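(* Suppose $M=S=\mathbb R/\mathbb Z$. Then for each $c\in H^1(S,\mathbb R)$, either $\tilde{\mathcal G}(c)$ contains an invariant torus which is a Lipschitz graph (that is, an invariant set of the Euler-Lagrange flow which is the image of a Lipschitz section of the projection $TS\times S\to S\times S$), or $R(c)=H^1(S,\mathbb R)$.
   Context: Setting (with $M=S$). $M$ carries a fixed Riemannian metric; $\pi:TM\to M$ is the tangent bundle; $S=\mathbb R/\mathbb Z$. For a curve $\gamma$ in $M$, $d\gamma(t)\in TM$ is its velocity vector. $L:TM\times\mathbb R\to\mathbb R$ is a $C^2$ function such that: (Periodicity) $L(z,t+1)=L(z,t)$; (Positive definiteness) for each $x\in M$, $t\in\mathbb R$ the restriction of $L$ to $T_xM\times\{t\}$ is strictly convex with nondegenerate Hessian; (Superlinear growth) for each $t$, $L(z,t)/\|z\|\to\infty$ as $\|z\|\to\infty$; (Completeness) the Euler-Lagrange flow $\phi_t$ on $TM\times S$ is complete. Here the action of $\gamma:I\to M$ is $A(\gamma)=\int_I L(d\gamma(t),t)\,dt$, extremals are critical points of $A$ with fixed endpoints, and $\phi_t$ is the flow such that a $C^1$ curve $\gamma$ is an extremal of $L$ if and only if $(d\gamma(t),t \bmod 1)$ is a trajectory of $\phi_t$. A curve $\gamma:\mathbb R\to M$ is a minimizer of a Lagrangian if on every compact interval $[a,b]$ it minimizes the action among curves on $[a,b]$ with the same endpoints. A closed 1-form $\eta$ on $M\times S$ defines the function $\eta(z,t)=\langle \eta,(z,1)\rangle_{(\pi(z),t\bmod 1)}$ on $TM\times\mathbb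 R$; its class is $[\eta]=[i_s^*\eta]\in H^1(M,\mathbb R)$ with $i_s(x)=(x,s)$ (independent of $s$). $L-\eta$ has the same Euler-Lagrange flow as $L$ and its minimizers depend only on $[\eta]$. For $c\in H^1(M,\mathbb R)$, $\tilde{\mathcal G}(c)\subset TM\times S$ is the set of points whose orbit under $\phi_t$ has the form $(d\gamma(t),t\bmod 1)$, up to translation of the time parameter, with $\gamma:\mathbb R\to M$ a minimizer of $L-\eta$, where $[\eta]=c$; $\mathcal G(c)$ is its projection to $M\times S$. For an open set $U\subset M\times S$, denote also by $U$ the open set of $(x,t)\in M\times\mathbb R$ with $(x,t\bmod 1)\in U$. A 1-form $\mu$ on $M\times\mathbb R$ is a $U$-step form if there is a closed 1-form $\bar\mu$ on $M\times S$ (also viewed as a 1-periodic 1-form on $M\times\mathbb R$) such that $\mu=0$ on $\{t\le 0\}$, $\mu=\bar\mu$ on $\{t\ge1\}$, and the restriction of $\mu$ to $U\cup\{t\le0\}\cup\{t\ge1\}$ is closed. $R(c)\subset H^1(M,\mathbb R)$ is the set of classes $d$ for which there exist an open neighborhood $U$ of $\mathcal G(c)$ and a $U$-step form $\mu$ with $[\bar\mu]=d$. *)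

theory Defs
  imports "HOL-Analysis.Analysis"
begin

section \<open>The circle \<open>S = \<real>/\<int>\<close>\<close>

quotient_type circle = real / "\<lambda>x y::real. x - y \<in> \<int>"
  morphisms rep_circle proj
proof (intro equivpI reflpI sympI transpI)
  show "x - x \<in> \<int>" for x :: real by simp
  show "y - x \<in> \<int>" if "x - y \<in> \<int>" for x y :: real
    using Ints_minus[OF that] by simp
  show "x - z \<in> \<int>" if "x - y \<in> \<int>" "y - z \<in> \<int>" for x y z :: real
    using Ints_add[OF that] by simp
qed

lemma proj_eq_iff: "proj x = proj y \<longleftrightarrow> x - y \<in> \<int>"
  by (rule circle.abs_eq_iff)

lemma proj_cases: obtains x where "p = proj x"
  by (induction p rule: circle.abs_induct) blast

lemma Ints_nonempty: "(\<int> :: real set) \<noteq> {}"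
  using Ints_0 by blast

lemma infdist_Ints_attained: "\<exists>n\<in>\<int>. infdist (x::real) \<int> = \<bar>x - n\<bar>"
proof -
  obtain n where "n \<in> \<int>" "infdist x \<int> = dist x n"
    by (rule infdist_attains_inf[OF closed_Ints Ints_nonempty])
  then show ?thesis unfolding dist_real_def by (rule bexI[rotated])
qed

lemma infdist_Ints_le: "n \<in> \<int> \<Longrightarrow> infdist (x::real) \<int> \<le> \<bar>x - n\<bar>"
  using infdist_le[of n \<int> x] by (simp add: dist_real_def)

lemma infdist_Ints_add_int_le:
  assumes "k \<in> \<int>" shows "infdist (x + k :: real) \<int> \<le> infdist x \<int>"
proof -
  obtain n where n: "n \<in> \<int>" "infdist x \<int> = \<bar>x - n\<bar>"
    using infdist_Ints_attained by blast
  have "infdist (x + k) \<int> \<le> \<bar>x + k - (n + k)\<bar>"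
    by (intro infdist_Ints_le Ints_add n assms)
  also have "\<dots> = infdist x \<int>" by (simp add: n(2))
  finally show ?thesis .
qed

lemma infdist_Ints_add_int:
  assumes "k \<in> \<int>" shows "infdist (x + k :: real) \<int> = infdist x \<int>"
proof (rule antisym)
  show "infdist (x + k) \<int> \<le> infdist x \<int>" by (rule infdist_Ints_add_int_le[OF assms])
  have "infdist (x + k + - k) \<int> \<le> infdist (x + k) \<int>"
    by (rule infdist_Ints_add_int_le[OF Ints_minus[OF assms]])
  then show "infdist x \<int> \<le> infdist (x + k) \<int>" by (simp only: add.assoc add.right_inverse add_0_right)
qed

lemma infdist_Ints_minus_le: "infdist (- x :: real) \<int> \<le> infdist x \<int>"
proof -
  obtain n where n: "n \<in> \<int>" "infdist x \<int> = \<bar>x - n\<bar>"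
    using infdist_Ints_attained by blast
  have "infdist (- x) \<int> \<le> \<bar>- x - (- n)\<bar>"
    by (intro infdist_Ints_le Ints_minus n)
  also have "\<dots> = infdist x \<int>" using n(2) by linarith
  finally show ?thesis .
qed

lemma infdist_Ints_triangle: "infdist (x + y :: real) \<int> \<le> infdist x \<int> + infdist y \<int>"
proof -
  obtain m where m: "m \<in> \<int>" "infdist x \<int> = \<bar>x - m\<bar>"
    using infdist_Ints_attained by blast
  obtain n where n: "n \<in> \<int>" "infdist y \<int> = \<bar>y - n\<bar>"
    using infdist_Ints_attained by blast
  have "infdist (x + y) \<int> \<le> \<bar>x + y - (m + n)\<bar>"
    by (intro infdist_Ints_le Ints_add m n)
  also have "\<dots> \<le> infdist x \<int> + infdist y \<int>" using m(2) n(2) by linarith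
  finally show ?thesis .
qed

instantiation circle :: metric_space
begin

lift_definition dist_circle :: "circle \<Rightarrow> circle \<Rightarrow> real" is "\<lambda>x y. infdist (x - y) \<int>"
proof -
  fix x x' y y' :: real
  assume "x - x' \<in> \<int>" "y - y' \<in> \<int>"
  then have "(x - x') - (y - y') \<in> \<int>" by (rule Ints_diff)
  then have "infdist (x' - y' + ((x - x') - (y - y'))) \<int> = infdist (x' - y') \<int>"
    by (rule infdist_Ints_add_int)
  moreover have "x' - y' + ((x - x') - (y - y')) = x - y" by simp
  ultimately show "infdist (x - y) \<int> = infdist (x' - y') \<int>" by simp
qed

definition uniformity_circle :: "(circle \<times> circle) filter" where
  "uniformity_circle = (INF e\<in>{0<..}. principal {(x, y). dist x y < e})"

definition open_circle :: "circle set \<Rightarrow> bool" where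
  "open_circle U \<longleftrightarrow> (\<forall>x\<in>U. \<forall>\<^sub>F (x', y) in uniformity. x' = x \<longrightarrow> y \<in> U)"

instance
proof
  fix x y z :: circle
  show "(dist x y = 0) = (x = y)"
    by transfer (rule in_closed_iff_infdist_zero[OF closed_Ints Ints_nonempty, symmetric])
  show "dist x y \<le> dist x z + dist y z"
  proof transfer
    fix x y z :: real
    show "infdist (x - y) \<int> \<le> infdist (x - z) \<int> + infdist (y - z) \<int>"
      using infdist_Ints_triangle[of "x - z" "z - y"] infdist_Ints_minus_le[of "y - z"]
      unfolding diff_add_cancel add_diff_eq minus_diff_eq by linarith
  qed
qed (simp_all add: uniformity_circle_def open_circle_def)

end

lemma dist_proj: "dist (proj x) (proj y) = infdist (x - y) \<int>"
  by (rule dist_circle.abs_eq)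

lemma open_circle_iff_open_vimage_proj: "open U \<longleftrightarrow> open (proj -` U)"
proof
  have "continuous_on UNIV proj"
    unfolding continuous_on_iff
  proof (intro ballI allI impI)
    fix x e :: real assume "e > 0"
    have "dist (proj y) (proj x) < e" if "dist y x < e" for y
      using infdist_Ints_le[OF Ints_0, of "y - x"] that
      unfolding dist_proj dist_real_def by linarith
    then show "\<exists>d>0. \<forall>y\<in>UNIV. dist y x < d \<longrightarrow> dist (proj y) (proj x) < e"
      using \<open>e > 0\<close> by blast
  qed
  then show "open (proj -` U)" if "open U"
    using that by (rule open_vimage[rotated])
next
  assume op: "open (proj -` U)"
  show "open U"
    unfolding open_dist
  proof
    fix p assume "p \<in> U"
    obtain x where p: "p = proj x" by (rule proj_cases)
    then obtain e where e: "e > 0" "\<And>y. dist y x < e \<Longrightarrow> proj y \<in> U"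
      using op \<open>p \<in> U\<close> unfolding open_dist vimage_eq by (metis vimage_eq)
    have "q \<in> U" if "dist q p < e" for q
    proof -
      obtain y where q: "q = proj y" by (rule proj_cases)
      obtain n where n: "n \<in> \<int>" "infdist (y - x) \<int> = \<bar>y - x - n\<bar>"
        using infdist_Ints_attained by blast
      have "dist (y - n) x < e"
        using that n(2) unfolding p q dist_proj dist_real_def by linarith
      then have "proj (y - n) \<in> U" by (rule e(2))
      moreover have "proj (y - n) = q" using n by (simp add: q proj_eq_iff)
      ultimately show ?thesis by simp
    qed
    then show "\<exists>e>0. \<forall>y. dist y p < e \<longrightarrow> y \<in> U" using e(1) by blast
  qed
qed

section \<open>Differentiability classes\<close>

primrec C_diff :: "nat \<Rightarrow> ('a::euclidean_space \<Rightarrow> 'b::real_normed_vector) \<Rightarrow> bool" where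
  "C_diff 0 f \<longleftrightarrow> continuous_on UNIV f"
| "C_diff (Suc k) f \<longleftrightarrow>
     (\<forall>x. f differentiable (at x)) \<and> (\<forall>v. C_diff k (\<lambda>x. frechet_derivative f (at x) v))"

definition smooth :: "('a::euclidean_space \<Rightarrow> 'b::real_normed_vector) \<Rightarrow> bool" where
  "smooth f \<longleftrightarrow> (\<forall>k. C_diff k f)"

text \<open>Functions on products involving the circle are differentiated after pulling back
  along \<^const>\<open>proj\<close>, which is a local diffeomorphism.\<close>

section \<open>Lagrangians\<close>

text \<open>\<open>TS\<close> is trivialised by the coordinate field: \<open>((x, v), \<theta>)\<close> is the vector
  \<open>v \<partial>\<^sub>x\<close> at \<open>x\<close>, at the time \<open>\<theta>\<close>.\<close>

type_synonym tangent = "circle \<times> real"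
type_synonym phase = "tangent \<times> circle"
type_synonym lagrangian = "tangent \<Rightarrow> real \<Rightarrow> real"

text \<open>A Riemannian metric on \<open>S\<close> is \<open>g(x) dx\<^sup>2\<close> with \<open>g > 0\<close>.\<close>

definition riemannian_metric :: "(circle \<Rightarrow> real) \<Rightarrow> bool" where
  "riemannian_metric g \<longleftrightarrow> smooth (\<lambda>s. g (proj s)) \<and> (\<forall>x. g x > 0)"

definition tangent_norm :: "(circle \<Rightarrow> real) \<Rightarrow> tangent \<Rightarrow> real" where
  "tangent_norm g = (\<lambda>(x, v). sqrt (g x * v\<^sup>2))"

text \<open>All hypotheses on \<open>L\<close> except completeness, which is expressed by the totality of the
  flow in \<open>euler_lagrange_flow\<close> below.\<close>

definition admissible_lagrangian :: "(circle \<Rightarrow> real) \<Rightarrow> lagrangian \<Rightarrow> bool" where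
  "admissible_lagrangian g L \<longleftrightarrow>
     C_diff 2 (\<lambda>(s, v, t). L (proj s, v) t) \<and>
     (\<forall>z t. L z (t + 1) = L z t) \<and>
     (\<forall>x t v w. \<forall>u\<in>{0<..<1}. v \<noteq> w \<longrightarrow>
        L (x, (1 - u) * v + u * w) t < (1 - u) * L (x, v) t + u * L (x, w) t) \<and>
     (\<forall>x t v. deriv (deriv (\<lambda>w. L (x, w) t)) v \<noteq> 0) \<and>
     (\<forall>t. filterlim (\<lambda>z. L z t / tangent_norm g z) at_top (filtercomap (tangent_norm g) at_top))"

text \<open>A \<open>C\<^sup>1\<close> curve \<open>\<gamma>\<close> in \<open>S\<close> is given by a \<open>C\<^sup>1\<close> lift \<open>x\<close> to \<open>\<real>\<close>, \<open>\<gamma> = proj \<circ> x\<close>; each curve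
  on an interval has one, unique up to an integer constant.\<close>

definition velocity :: "(real \<Rightarrow> real) \<Rightarrow> real \<Rightarrow> tangent" where
  "velocity x t = (proj (x t), deriv x t)"

definition action :: "lagrangian \<Rightarrow> (real \<Rightarrow> real) \<Rightarrow> real \<Rightarrow> real \<Rightarrow> real" where
  "action L x a b = integral {a..b} (\<lambda>t. L (velocity x t) t)"

definition extremal_on :: "lagrangian \<Rightarrow> (real \<Rightarrow> real) \<Rightarrow> real \<Rightarrow> real \<Rightarrow> bool" where
  "extremal_on L x a b \<longleftrightarrow> x C1_differentiable_on {a..b} \<and>
     (\<forall>h. h C1_differentiable_on {a..b} \<and> h a = 0 \<and> h b = 0 \<longrightarrow>
        ((\<lambda>\<epsilon>. action L (\<lambda>t. x t + \<epsilon> * h t) a b) has_real_derivative 0) (at 0))"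

text \<open>The endpoints are compared in \<open>S\<close>, not in \<open>\<real>\<close>: competitors in all homotopy classes are
  allowed.\<close>

definition minimizer :: "lagrangian \<Rightarrow> (real \<Rightarrow> real) \<Rightarrow> bool" where
  "minimizer L x \<longleftrightarrow> x C1_differentiable_on UNIV \<and>
     (\<forall>a b y. a < b \<and> y C1_differentiable_on {a..b} \<and>
        proj (y a) = proj (x a) \<and> proj (y b) = proj (x b) \<longrightarrow> action L x a b \<le> action L y a b)"

text \<open>The last clause is stated on all compact intervals, because this determines \<open>\<phi>\<close>: there are
  extremals through every point of phase space, but a priori only on short intervals.\<close>

definition euler_lagrange_flow :: "lagrangian \<Rightarrow> (real \<Rightarrow> phase \<Rightarrow> phase) \<Rightarrow> bool" where
  "euler_lagrange_flow L \<phi> \<longleftrightarrow>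
     continuous_on UNIV (\<lambda>(t, p). \<phi> t p) \<and>
     (\<forall>p. \<phi> 0 p = p) \<and> (\<forall>s t p. \<phi> (s + t) p = \<phi> s (\<phi> t p)) \<and>
     (\<forall>x a b. a < b \<and> x C1_differentiable_on {a..b} \<longrightarrow>
        (extremal_on L x a b \<longleftrightarrow>
         (\<forall>s\<in>{a..b}. \<forall>t\<in>{a..b}. \<phi> (t - s) (velocity x s, proj s) = (velocity x t, proj t))))"

section \<open>Forms and cohomology\<close>

text \<open>A 1-form \<open>\<mu>\<^sub>1 dx + \<mu>\<^sub>2 dt\<close> is the pair of its coefficient functions. \<open>d_form \<mu> s t\<close> is the
  coefficient of \<open>dx \<and> dt\<close> in \<open>d\<mu>\<close> at \<open>(proj s, t)\<close>. On a set that need not be open, such as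
  \<open>U \<union> {t \<le> 0} \<union> {t \<ge> 1}\<close>, closed means \<open>d\<mu> = 0\<close> at each of its points. All forms are
  \<open>C\<^sup>\<infinity>\<close>.\<close>

type_synonym form_SR = "circle \<times> real \<Rightarrow> real \<times> real"
type_synonym form_SS = "circle \<times> circle \<Rightarrow> real \<times> real"

definition smooth_form :: "form_SR \<Rightarrow> bool" where
  "smooth_form \<mu> \<longleftrightarrow> smooth (\<lambda>(s, t). \<mu> (proj s, t))"

definition d_form :: "form_SR \<Rightarrow> real \<Rightarrow> real \<Rightarrow> real" where
  "d_form \<mu> s t =
     deriv (\<lambda>s'. snd (\<mu> (proj s', t))) s - deriv (\<lambda>t'. fst (\<mu> (proj s, t'))) t"

definition closed_form_on :: "(circle \<times> real) set \<Rightarrow> form_SR \<Rightarrow> bool" where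
  "closed_form_on A \<mu> \<longleftrightarrow> (\<forall>s t. (proj s, t) \<in> A \<longrightarrow> d_form \<mu> s t = 0)"

definition periodic_form :: "form_SS \<Rightarrow> form_SR" where
  "periodic_form \<eta> = (\<lambda>(x, t). \<eta> (x, proj t))"

definition closed_form_SS :: "form_SS \<Rightarrow> bool" where
  "closed_form_SS \<eta> \<longleftrightarrow> smooth_form (periodic_form \<eta>) \<and> closed_form_on UNIV (periodic_form \<eta>)"

text \<open>\<open>H\<^sup>1(S, \<real>)\<close> is de Rham cohomology: 1-forms \<open>f dx\<close> on \<open>S\<close>, all of which are closed, modulo
  exact forms.\<close>

definition forms_S :: "(circle \<Rightarrow> real) set" where
  "forms_S = {f. smooth (\<lambda>s. f (proj s))}"

definition exact_form_S :: "(circle \<Rightarrow> real) \<Rightarrow> bool" where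
  "exact_form_S f \<longleftrightarrow> (\<exists>F. smooth (\<lambda>s. F (proj s)) \<and>
     (\<forall>s. ((\<lambda>s. F (proj s)) has_real_derivative f (proj s)) (at s)))"

definition cohomologous :: "((circle \<Rightarrow> real) \<times> (circle \<Rightarrow> real)) set" where
  "cohomologous = {(f, h). f \<in> forms_S \<and> h \<in> forms_S \<and> exact_form_S (\<lambda>x. f x - h x)}"

definition H1 :: "(circle \<Rightarrow> real) set set" where
  "H1 = forms_S // cohomologous"

text \<open>The class of \<open>i\<^sub>s\<^sup>* \<eta>\<close> does not depend on \<open>s\<close> for closed \<open>\<eta>\<close>; we take \<open>s = 0\<close>.\<close>

definition form_class :: "form_SS \<Rightarrow> (circle \<Rightarrow> real) set" where
  "form_class \<eta> = cohomologous `` {\<lambda>x. fst (\<eta> (x, proj 0))}"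

text \<open>\<open>L - \<eta>\<close>, where \<open>\<eta>\<close> is the function \<open>\<langle>\<eta>, (z, 1)\<rangle>\<close> on \<open>TS \<times> \<real>\<close>.\<close>

definition minus_form :: "lagrangian \<Rightarrow> form_SS \<Rightarrow> lagrangian" where
  "minus_form L \<eta> = (\<lambda>(x, v) t. L (x, v) t - (fst (\<eta> (x, proj t)) * v + snd (\<eta> (x, proj t))))"

section \<open>The sets \<open>G(c)\<close> and \<open>R(c)\<close>\<close>

definition G_tilde ::
  "lagrangian \<Rightarrow> (real \<Rightarrow> phase \<Rightarrow> phase) \<Rightarrow> (circle \<Rightarrow> real) set \<Rightarrow> phase set" where
  "G_tilde L \<phi> c = {p. \<exists>\<eta> x \<tau>. closed_form_SS \<eta> \<and> form_class \<eta> = c \<and>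
     minimizer (minus_form L \<eta>) x \<and> (\<forall>t. \<phi> t p = (velocity x (t + \<tau>), proj (t + \<tau>)))}"

definition base_point :: "phase \<Rightarrow> circle \<times> circle" where
  "base_point = (\<lambda>((x, v), \<theta>). (x, \<theta>))"

definition G_base ::
  "lagrangian \<Rightarrow> (real \<Rightarrow> phase \<Rightarrow> phase) \<Rightarrow> (circle \<Rightarrow> real) set \<Rightarrow> (circle \<times> circle) set" where
  "G_base L \<phi> c = base_point ` G_tilde L \<phi> c"

definition step_form :: "(circle \<times> circle) set \<Rightarrow> form_SR \<Rightarrow> form_SS \<Rightarrow> bool" where
  "step_form U \<mu> \<mu>' \<longleftrightarrow> smooth_form \<mu> \<and> closed_form_SS \<mu>' \<and>
     (\<forall>x. \<forall>t\<le>0. \<mu> (x, t) = 0) \<and>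
     (\<forall>x. \<forall>t\<ge>1. \<mu> (x, t) = periodic_form \<mu>' (x, t)) \<and>
     closed_form_on {(x, t). (x, proj t) \<in> U \<or> t \<le> 0 \<or> t \<ge> 1} \<mu>"

definition R_set ::
  "lagrangian \<Rightarrow> (real \<Rightarrow> phase \<Rightarrow> phase) \<Rightarrow> (circle \<Rightarrow> real) set \<Rightarrow> (circle \<Rightarrow> real) set set" where
  "R_set L \<phi> c = {d \<in> H1. \<exists>U \<mu> \<mu>'. open U \<and> G_base L \<phi> c \<subseteq> U \<and>
     step_form U \<mu> \<mu>' \<and> form_class \<mu>' = d}"

text \<open>The Lipschitz condition refers to the product metrics, with the flat metric on \<open>S\<close>. As
  \<open>S \<times> S\<close> is compact, any Riemannian metrics on \<open>S \<times> S\<close> and \<open>TS \<times> S\<close> give the same notion.\<close>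

definition invariant_lipschitz_torus :: "(real \<Rightarrow> phase \<Rightarrow> phase) \<Rightarrow> phase set \<Rightarrow> bool" where
  "invariant_lipschitz_torus \<phi> T \<longleftrightarrow> (\<forall>t. \<phi> t ` T = T) \<and>
     (\<exists>\<sigma> K. (\<forall>q. base_point (\<sigma> q) = q) \<and> K-lipschitz_on UNIV \<sigma> \<and> T = range \<sigma>)"

end

theory Submission
  imports Defs
begin

text \<open>Everything depends on whether the minimizers of class \<open>c\<close> come close to every point of the
torus \<open>S \<times> S\<close>.

Suppose first that the closure of \<open>G(c)\<close> misses a point. Then it misses a small closed
rectangle \<open>K\<close>, an arc times a time interval inside \<open>(0, 1)\<close>. Take \<open>\<mu> = \<theta>(t) f(x) dx\<close>, where \<open>f\<close> is
supported in the arc and \<open>\<theta>\<close> steps from \<open>0\<close> to \<open>1\<close> during the time interval. The differential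
\<open>d\<mu>\<close> lives in \<open>K\<close>, so \<open>\<mu>\<close> is a step form for the complement of \<open>K\<close>, and scaling \<open>f\<close> gives every
class: \<open>R(c) = H\<^sup>1\<close> (lemma \<open>R_set_eq_H1\<close>).

Suppose now that \<open>G(c)\<close> is dense. The class \<open>c\<close> is represented by a constant form \<open>r dx\<close>, and
replacing a form by a cohomologous one changes the action only by boundary terms
(\<open>minimizer_depends_on_class\<close>). So all curves in question are minimizers of the one function
\<open>G = L - r v\<close>, lifted to the universal cover. They have a common bound for their velocities
(\<open>velocity_bound\<close>), hence form a compact family, and density gives a minimizer through every
point \<open>(t, x)\<close> of the plane (\<open>dense_cover\<close>).

Minimizers through every point are not yet a torus, since two of them may cross. Aubry-Mather theory
in one degree of freedom controls the crossings; it rests on the fact that replacing part of a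
minimizer by part of another one, or by a translate, creates a corner, and that cutting the corner
saves action. Two minimizers that are not translates of each other in space meet at most once, even
modulo integers (\<open>touch_at_most_once\<close>); a minimizer never crosses its own translates
(\<open>shift_no_crossing\<close>); hence all minimizers have one common rotation number. If it is irrational,
no two minimizers cross at all (\<open>irrational_no_crossing\<close>), and the family of all of them is a
foliation of the plane. If it is rational, the minimizers are periodic or lie in the gaps
between periodic ones and move monotonically, up or down, from one translate to the next; those
moving up do not cross each other, nor do those moving down, and every gap is filled by one of the
two families (\<open>gap_covered\<close>). Choosing one of them in each gap again yields a foliation that is
invariant under integer translations (theorem \<open>foliation\<close>).

The slopes of such a foliation are Lipschitz: for two ordered minimizers the quotient of the
difference of momenta by the difference of positions satisfies a Riccati inequality for all times,
which bounds it (\<open>riccati_bound\<close>, \<open>graph_lipschitz_space\<close>). Sending each point of the torus to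
the velocity of the leaf through it gives the invariant Lipschitz graph (theorem
\<open>invariant_torus\<close>).\<close>

section \<open>Curves in the plane and their integer translates\<close>

lemma int_periodic:
  fixes f :: "real \<Rightarrow> 'a"
  assumes "\<And>s. f (s + 1) = f s" shows "f (s + of_int n) = f s"
proof (induction n rule: int_induct[of _ 0])
  case (step1 i)
  then show ?case using assms[of "s + of_int i"] by (simp add: algebra_simps)
next
  case (step2 i)
  then show ?case using assms[of "s + of_int (i - 1)"] by (simp add: algebra_simps)
qed simp

text \<open>The graph of \<open>\<gamma>\<close> in the \<open>(t, x)\<close>-plane translated by the integer vector \<open>(- n, m)\<close>. Curves on the
torus \<open>S \<times> S\<close> are studied through all their lifts, and these translations permute the lifts.\<close>

definition shift :: "int \<Rightarrow> int \<Rightarrow> (real \<Rightarrow> real) \<Rightarrow> real \<Rightarrow> real" where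
  "shift m n \<gamma> t = \<gamma> (t + of_int n) + of_int m"

lemma shift_zero [simp]: "shift 0 0 \<gamma> = \<gamma>"
  by (simp add: shift_def fun_eq_iff)

lemma shift_shift: "shift m n (shift m' n' \<gamma>) = shift (m + m') (n + n') \<gamma>"
  by (simp add: shift_def fun_eq_iff algebra_simps)

lemma continuous_constant_sign:
  fixes f :: "real \<Rightarrow> real"
  assumes "continuous_on S f" "connected S" "\<forall>t\<in>S. f t \<noteq> 0" "s \<in> S" "t \<in> S" "f s > 0"
  shows "f t > 0"
proof (rule ccontr)
  assume "\<not> f t > 0"
  then have "f t \<le> 0" by simp
  have "connected (f ` S)" using assms(1,2) by (rule connected_continuous_image)
  then have "0 \<in> f ` S"
    using connectedD_interval[of "f ` S" "f t" "f s" 0] assms \<open>f t \<le> 0\<close> by auto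
  then show False using assms(3) by auto
qed

text \<open>The argument for the existence of rotation numbers. The upper bounds \<open>(a k + 2) / k\<close> of the
slope all lie above the lower bounds \<open>(a n - 2) / n\<close>: compare \<open>a (k n)\<close> with \<open>k\<close> times \<open>a n\<close> and
with \<open>n\<close> times \<open>a k\<close>. So a number lies between them.\<close>

lemma additive_up_to_bounded_error:
  fixes a :: "int \<Rightarrow> real"
  assumes a: "\<And>m n. \<bar>a (m + n) - a m - a n\<bar> \<le> 2"
  shows "\<exists>\<rho>. \<forall>n. \<bar>a n - of_int n * \<rho>\<bar> \<le> 6"
proof -
  have mult: "\<bar>a (int k * n) - real k * a n\<bar> \<le> 2 * real k" if "k \<ge> 1" for k n
    using that
  proof (induction k rule: dec_induct)
    case base
    then show ?case by simp
  next
    case (step k)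
    have "int (Suc k) * n = int k * n + n" by (simp add: algebra_simps)
    then have "\<bar>a (int (Suc k) * n) - a (int k * n) - a n\<bar> \<le> 2" using a[of "int k * n" n] by simp
    then show ?case using step.IH by (simp add: algebra_simps abs_le_iff)
  qed
  have le: "(a (int n) - 2) / n \<le> (a (int k) + 2) / k" if "n \<ge> 1" "k \<ge> 1" for n k :: nat
  proof -
    have "\<bar>a (int k * int n) - real k * a (int n)\<bar> \<le> 2 * real k"
      "\<bar>a (int n * int k) - real n * a (int k)\<bar> \<le> 2 * real n"
      using mult that by blast+
    then have "real k * a (int n) - 2 * real k \<le> real n * a (int k) + 2 * real n"
      by (simp add: mult.commute)
    then show ?thesis using that by (simp add: field_simps)
  qed
  define \<rho> where "\<rho> = (SUP n\<in>{1..}. (a (int n) - 2) / n)"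
  have bdd: "bdd_above ((\<lambda>n::nat. (a (int n) - 2) / n) ` {1..})"
    using le[of _ 1] by (intro bdd_aboveI2[where M = "(a 1 + 2) / 1"]) auto
  have pos: "\<bar>a (int n) - int n * \<rho>\<bar> \<le> 2" if "n \<ge> 1" for n :: nat
  proof -
    have "(a (int n) - 2) / n \<le> \<rho>" unfolding \<rho>_def
      by (rule cSUP_upper[OF _ bdd]) (use that in simp)
    moreover have "\<rho> \<le> (a (int n) + 2) / n" unfolding \<rho>_def
      by (rule cSUP_least) (use le that in auto)
    ultimately show ?thesis using that by (simp add: field_simps abs_le_iff)
  qed
  have zero: "\<bar>a 0\<bar> \<le> 2" using a[of 0 0] by simp
  have "\<bar>a n - of_int n * \<rho>\<bar> \<le> 6" for n
  proof (cases "n \<ge> 0")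
    case True
    then have "n = 0 \<or> 1 \<le> nat n" by linarith
    then show ?thesis using pos[of "nat n"] zero True by auto
  next
    case False
    then have "\<bar>a (- n) - (- n) * \<rho>\<bar> \<le> 2" using pos[of "nat (- n)"] by simp
    moreover have "\<bar>a 0 - a n - a (- n)\<bar> \<le> 2" using a[of n "- n"] by simp
    ultimately show ?thesis using zero by (simp add: abs_le_iff)
  qed
  then show ?thesis by blast
qed

text \<open>Kronecker's theorem for \<open>- N \<rho>\<close> in place of \<open>\<rho>\<close>; this forces \<open>n\<close> to be a negative multiple of
\<open>N\<close>, which lets a translation go arbitrarily far in time while moving curves very little.\<close>

lemma irrational_small_combination:
  fixes \<rho> e :: real
  assumes irr: "\<rho> \<notin> \<rat>" and e: "e > 0"
  shows "\<exists>m n. 0 < of_int m + of_int n * \<rho> \<and> of_int m + of_int n * \<rho> < e \<and> n \<le> - int N"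
proof -
  define N' where "N' = max 1 N"
  define \<theta> where "\<theta> = - (real N' * \<rho>)"
  have "\<theta> \<notin> \<rat>"
  proof
    assume "\<theta> \<in> \<rat>"
    then have "- \<theta> / real N' \<in> \<rat>" by simp
    then show False using irr by (simp add: \<theta>_def N'_def split: if_splits)
  qed
  define \<alpha> where "\<alpha> = min e 1 / 2"
  have \<alpha>: "0 < \<alpha>" "\<alpha> \<le> 1" "2 * \<alpha> \<le> e" using e by (auto simp: \<alpha>_def min_def)
  obtain k where k: "k > 0" "\<bar>frac (real k * \<theta>) - \<alpha>\<bar> < \<alpha>"
    using Kronecker_approx_1_explicit[OF \<open>\<theta> \<notin> \<rat>\<close> less_imp_le[OF \<alpha>(1)] \<alpha>(2) \<alpha>(1)] by blast
  define m where "m = - \<lfloor>real k * \<theta>\<rfloor>"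
  define n where "n = - (int k * int N')"
  have "of_int m + of_int n * \<rho> = frac (real k * \<theta>)"
    by (simp add: m_def n_def \<theta>_def frac_def)
  moreover have "n \<le> - int N"
  proof -
    have "N \<le> k * N'" using k(1) by (metis N'_def dual_order.trans max.cobounded2 mult_le_mono1 Suc_leI mult_1 One_nat_def)
    then show ?thesis unfolding n_def by (simp flip: of_nat_mult)
  qed
  ultimately have "0 < of_int m + of_int n * \<rho> \<and> of_int m + of_int n * \<rho> < e \<and> n \<le> - int N"
    using k(2) \<alpha>(3) by linarith
  then show ?thesis by blast
qed


section \<open>Foliations by minimizing curves\<close>

text \<open>What the combinatorial part of Aubry-Mather theory uses of the minimizers \<open>M\<close>. The number
\<open>C a x b y\<close> stands for the least action of a curve from \<open>x\<close> at time \<open>a\<close> to \<open>y\<close> at time \<open>b\<close>, where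
both points are taken modulo \<open>1\<close>. The assumption \<open>cost_additive\<close> says that members of \<open>M\<close> are
minimizers, \<open>cost_corner\<close> that a curve with a corner never is one, and \<open>cost_end\<close> that moving
an endpoint costs little, uniformly in the length of the time interval.\<close>

locale minimizing_curves =
  fixes M :: "(real \<Rightarrow> real) set" and C :: "real \<Rightarrow> real \<Rightarrow> real \<Rightarrow> real \<Rightarrow> real"
  assumes has_velocity: "\<gamma> \<in> M \<Longrightarrow> (\<gamma> has_real_derivative deriv \<gamma> t) (at t)"
    and unique: "\<lbrakk>\<gamma> \<in> M; \<beta> \<in> M; \<gamma> s = \<beta> s; deriv \<gamma> s = deriv \<beta> s\<rbrakk> \<Longrightarrow> \<gamma> = \<beta>"
    and shift_mem: "\<gamma> \<in> M \<Longrightarrow> shift m n \<gamma> \<in> M"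
    and compactness: "\<lbrakk>\<And>k. u k \<in> M; bounded (range (\<lambda>k. u k t))\<rbrakk>
      \<Longrightarrow> \<exists>r \<beta>. strict_mono (r :: nat \<Rightarrow> nat) \<and> \<beta> \<in> M \<and> (\<forall>s. (\<lambda>k. u (r k) s) \<longlonglongrightarrow> \<beta> s)"
    and cover: "\<exists>\<gamma>\<in>M. \<gamma> t = x"
    and cost_triangle: "\<lbrakk>a < b; b < c\<rbrakk> \<Longrightarrow> C a x c z \<le> C a x b y + C b y c z"
    and cost_additive: "\<lbrakk>\<gamma> \<in> M; a < b; b < c\<rbrakk>
      \<Longrightarrow> C a (\<gamma> a) c (\<gamma> c) = C a (\<gamma> a) b (\<gamma> b) + C b (\<gamma> b) c (\<gamma> c)"
    and cost_space_shift: "C a (x + of_int i) b (y + of_int j) = C a x b y"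
    and cost_time_shift: "C (a + of_int n) x (b + of_int n) y = C a x b y"
    and cost_corner: "\<lbrakk>\<gamma> \<in> M; \<beta> \<in> M; \<gamma> s = \<beta> s; \<gamma> \<noteq> \<beta>; a < s; s < b\<rbrakk>
      \<Longrightarrow> C a (\<gamma> a) b (\<beta> b) < C a (\<gamma> a) s (\<gamma> s) + C s (\<beta> s) b (\<beta> b)"
    and cost_end: "e > 0 \<Longrightarrow> \<exists>\<delta>>0. \<forall>\<gamma>\<in>M. \<forall>a b x. a + 1 \<le> b \<and> \<bar>x - \<gamma> b\<bar> < \<delta>
      \<longrightarrow> C a (\<gamma> a) b x \<le> C a (\<gamma> a) b (\<gamma> b) + e"
    and cost_bounded: "l > 0 \<Longrightarrow> \<exists>K. \<forall>a x y. C a x (a + l) y \<le> K"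
begin

lemma cont: "\<gamma> \<in> M \<Longrightarrow> continuous_on S \<gamma>"
  using has_velocity by (metis DERIV_isCont continuous_at_imp_continuous_on)

lemma cost_cong_Ints:
  assumes "x - x' \<in> \<int>" "y - y' \<in> \<int>"
  shows "C a x b y = C a x' b y'"
proof -
  obtain i j where "x - x' = of_int i" "y - y' = of_int j" using assms by (elim Ints_cases)
  then show ?thesis using cost_space_shift[of a x' i b y' j] by (simp add: algebra_simps)
qed

text \<open>If \<open>\<gamma>\<close> and a translate of \<open>\<beta>\<close> meet at time \<open>s\<close>, follow \<open>\<gamma>\<close> up to \<open>s\<close> and then the translate up to
\<open>t\<close>. If the end is again congruent to that of \<open>\<gamma>\<close>, this is a competitor of \<open>\<gamma>\<close> of the same
cost but with a corner.\<close>

lemma touch_at_most_once: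
  assumes M: "\<gamma> \<in> M" "\<beta> \<in> M" and st: "s < t"
    and s: "\<gamma> s - \<beta> s \<in> \<int>" and t: "\<gamma> t - \<beta> t \<in> \<int>"
  shows "\<exists>k. \<gamma> = shift k 0 \<beta>"
proof -
  obtain k where k: "\<gamma> s - \<beta> s = of_int k" using s by (rule Ints_cases)
  define \<beta>' where "\<beta>' = shift k 0 \<beta>"
  have M': "\<beta>' \<in> M" unfolding \<beta>'_def by (rule shift_mem[OF M(2)])
  have eq: "\<gamma> s = \<beta>' s" using k by (simp add: \<beta>'_def shift_def)
  have "\<beta>' t - \<gamma> t = of_int k - (\<gamma> t - \<beta> t)" by (simp add: \<beta>'_def shift_def)
  then have int: "\<beta>' t - \<gamma> t \<in> \<int>" using Ints_diff[OF Ints_of_int t] by metis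
  have "\<gamma> = \<beta>'"
  proof (rule ccontr)
    assume "\<gamma> \<noteq> \<beta>'"
    then have "C (s - 1) (\<gamma> (s - 1)) t (\<beta>' t) < C (s - 1) (\<gamma> (s - 1)) s (\<gamma> s) + C s (\<beta>' s) t (\<beta>' t)"
      using M(1) M' eq st by (intro cost_corner) auto
    moreover have "C (s - 1) (\<gamma> (s - 1)) t (\<beta>' t) = C (s - 1) (\<gamma> (s - 1)) t (\<gamma> t)"
      by (rule cost_cong_Ints) (use int in auto)
    moreover have "C s (\<beta>' s) t (\<beta>' t) = C s (\<gamma> s) t (\<gamma> t)"
      by (rule cost_cong_Ints) (use int eq in auto)
    ultimately show False using cost_additive[OF M(1), of "s - 1" s t] st by simp
  qed
  then show ?thesis by (auto simp: \<beta>'_def)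
qed

definition crosses_up :: "(real \<Rightarrow> real) \<Rightarrow> (real \<Rightarrow> real) \<Rightarrow> real \<Rightarrow> bool" where
  "crosses_up \<beta> \<gamma> s \<longleftrightarrow> \<gamma> s = \<beta> s \<and> (\<forall>t>s. \<gamma> t < \<beta> t) \<and> (\<forall>t<s. \<beta> t < \<gamma> t)"

text \<open>Two curves that meet only at \<open>s\<close>, and there with different slopes, change sides.\<close>

lemma crossing:
  assumes M: "\<gamma> \<in> M" "\<beta> \<in> M" and s: "\<gamma> s = \<beta> s" and ne: "\<gamma> \<noteq> \<beta>"
  shows "crosses_up \<beta> \<gamma> s \<or> crosses_up \<gamma> \<beta> s"
proof -
  have nz: "\<gamma> t \<noteq> \<beta> t" if "t \<noteq> s" for t
  proof
    assume "\<gamma> t = \<beta> t"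
    then have "\<exists>k. \<gamma> = shift k 0 \<beta>"
      using touch_at_most_once[OF M, of s t] touch_at_most_once[OF M, of t s] s that
      by (cases "s < t") auto
    then show False using s ne by (auto simp: shift_def fun_eq_iff)
  qed
  have *: "crosses_up \<beta> \<gamma> s"
    if M: "\<gamma> \<in> M" "\<beta> \<in> M" and lt: "deriv \<gamma> s < deriv \<beta> s" and s: "\<gamma> s = \<beta> s"
      and nz: "\<And>t. t \<noteq> s \<Longrightarrow> \<gamma> t \<noteq> \<beta> t" for \<gamma> \<beta>
  proof -
    let ?f = "\<lambda>t. \<beta> t - \<gamma> t"
    have D: "(?f has_real_derivative deriv \<beta> s - deriv \<gamma> s) (at s)"
      by (intro DERIV_diff has_velocity M)
    obtain d where d: "d > 0" "\<And>h. 0 < h \<Longrightarrow> h < d \<Longrightarrow> ?f s < ?f (s + h)"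
      using DERIV_pos_inc_right[OF D] lt by auto
    obtain d' where d': "d' > 0" "\<And>h. 0 < h \<Longrightarrow> h < d' \<Longrightarrow> ?f (s - h) < ?f s"
      using DERIV_pos_inc_left[OF D] lt by auto
    have nz': "\<beta> t - \<gamma> t \<noteq> 0" "\<gamma> t - \<beta> t \<noteq> 0" if "t \<noteq> s" for t
      using nz[OF that] by simp_all
    have c: "continuous_on S ?f" "continuous_on S (\<lambda>t. \<gamma> t - \<beta> t)" for S
      by (intro continuous_intros cont M)+
    have "?f t > 0" if "t > s" for t
      by (rule continuous_constant_sign[of "{s<..}" ?f "s + d / 2"])
        (use c nz' d(2)[of "d/2"] d(1) s that in \<open>auto simp: connected_Ioi\<close>)
    moreover have "\<gamma> t - \<beta> t > 0" if "t < s" for t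
      by (rule continuous_constant_sign[of "{..<s}" "\<lambda>t. \<gamma> t - \<beta> t" "s - d' / 2"])
        (use c nz' d'(2)[of "d'/2"] d'(1) s that in \<open>auto simp: connected_Iio\<close>)
    ultimately show ?thesis using s by (auto simp: crosses_up_def)
  qed
  have "deriv \<gamma> s \<noteq> deriv \<beta> s" using unique[OF M s] ne by blast
  then show ?thesis
    using *[OF M] *[of \<beta> \<gamma>] M s nz by (metis linorder_neqE_linordered_idom)
qed

lemma crosses_up_ne: "crosses_up \<beta> \<gamma> s \<Longrightarrow> \<gamma> \<noteq> \<beta>"
  unfolding crosses_up_def using lt_ex by (metis less_irrefl)

text \<open>Two minimizers that cross at \<open>s\<close> and come arbitrarily close later cannot both minimize: follow
one up to \<open>s - 1\<close>, cut the corner at \<open>s\<close> with a definite gain, follow the other one, and switch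
back where the two curves are so close that switching costs less than the gain. This shows that
each curve is strictly cheaper than the other one from \<open>s\<close> on.\<close>

lemma asymptotic_no_crossing:
  assumes M: "\<gamma> \<in> M" "\<beta> \<in> M" and s: "\<gamma> s = \<beta> s"
    and close: "\<And>e. e > 0 \<Longrightarrow> \<exists>t\<ge>s + 3. \<bar>\<gamma> t - \<beta> t\<bar> < e"
  shows "\<gamma> = \<beta>"
proof (rule ccontr)
  assume ne: "\<gamma> \<noteq> \<beta>"
  have *: "\<exists>\<epsilon>>0. \<forall>e>0. \<exists>\<delta>>0. \<forall>t\<ge>s + 3. \<bar>\<gamma> t - \<beta> t\<bar> < \<delta> \<longrightarrow>
      C s (\<gamma> s) t (\<gamma> t) \<le> C s (\<beta> s) t (\<beta> t) - \<epsilon> + e"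
    if M: "\<gamma> \<in> M" "\<beta> \<in> M" and s: "\<gamma> s = \<beta> s" and ne: "\<gamma> \<noteq> \<beta>" for \<gamma> \<beta>
  proof -
    define \<epsilon> where "\<epsilon> = C (s - 1) (\<gamma> (s - 1)) s (\<gamma> s) + C s (\<beta> s) (s + 1) (\<beta> (s + 1))
      - C (s - 1) (\<gamma> (s - 1)) (s + 1) (\<beta> (s + 1))"
    have "\<epsilon> > 0" using cost_corner[OF M s ne, of "s - 1" "s + 1"] by (simp add: \<epsilon>_def)
    moreover have "\<exists>\<delta>>0. \<forall>t\<ge>s + 3. \<bar>\<gamma> t - \<beta> t\<bar> < \<delta> \<longrightarrow>
      C s (\<gamma> s) t (\<gamma> t) \<le> C s (\<beta> s) t (\<beta> t) - \<epsilon> + e" if e: "e > 0" for e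
    proof -
      obtain \<delta> where \<delta>: "\<delta> > 0" "\<And>\<gamma> a b x. \<gamma> \<in> M \<Longrightarrow> a + 1 \<le> b \<Longrightarrow> \<bar>x - \<gamma> b\<bar> < \<delta> \<Longrightarrow>
        C a (\<gamma> a) b x \<le> C a (\<gamma> a) b (\<gamma> b) + e"
        using cost_end[OF e] by blast
      have "C s (\<gamma> s) t (\<gamma> t) \<le> C s (\<beta> s) t (\<beta> t) - \<epsilon> + e"
        if t: "t \<ge> s + 3" "\<bar>\<gamma> t - \<beta> t\<bar> < \<delta>" for t
      proof -
        have "C (s - 1) (\<gamma> (s - 1)) t (\<gamma> t) = C (s - 1) (\<gamma> (s - 1)) s (\<gamma> s) + C s (\<gamma> s) t (\<gamma> t)"
          using cost_additive[OF M(1)] t by simp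
        moreover have "C (s - 1) (\<gamma> (s - 1)) t (\<gamma> t)
          \<le> C (s - 1) (\<gamma> (s - 1)) (s + 1) (\<beta> (s + 1)) + C (s + 1) (\<beta> (s + 1)) t (\<gamma> t)"
          using cost_triangle t by simp
        moreover have "C (s + 1) (\<beta> (s + 1)) t (\<gamma> t) \<le> C (s + 1) (\<beta> (s + 1)) t (\<beta> t) + e"
          using \<delta>(2)[OF M(2)] t by simp
        moreover have "C s (\<beta> s) t (\<beta> t)
          = C s (\<beta> s) (s + 1) (\<beta> (s + 1)) + C (s + 1) (\<beta> (s + 1)) t (\<beta> t)"
          using cost_additive[OF M(2)] t by simp
        ultimately show ?thesis by (simp add: \<epsilon>_def)
      qed
      then show ?thesis using \<delta>(1) by blast
    qed
    ultimately show ?thesis by blast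
  qed
  obtain \<epsilon>1 where 1: "\<epsilon>1 > 0" "\<And>e. e > 0 \<Longrightarrow> \<exists>\<delta>>0. \<forall>t\<ge>s + 3. \<bar>\<gamma> t - \<beta> t\<bar> < \<delta> \<longrightarrow>
      C s (\<gamma> s) t (\<gamma> t) \<le> C s (\<beta> s) t (\<beta> t) - \<epsilon>1 + e"
    using *[OF M s ne] by blast
  obtain \<epsilon>2 where 2: "\<epsilon>2 > 0" "\<And>e. e > 0 \<Longrightarrow> \<exists>\<delta>>0. \<forall>t\<ge>s + 3. \<bar>\<beta> t - \<gamma> t\<bar> < \<delta> \<longrightarrow>
      C s (\<beta> s) t (\<beta> t) \<le> C s (\<gamma> s) t (\<gamma> t) - \<epsilon>2 + e"
    using *[OF M(2,1) s[symmetric] ne[symmetric]] by blast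
  obtain \<delta>1 where \<delta>1: "\<delta>1 > 0" "\<And>t. t \<ge> s + 3 \<Longrightarrow> \<bar>\<gamma> t - \<beta> t\<bar> < \<delta>1 \<Longrightarrow>
      C s (\<gamma> s) t (\<gamma> t) \<le> C s (\<beta> s) t (\<beta> t) - \<epsilon>1 + \<epsilon>1"
    using 1(2)[OF 1(1)] by blast
  obtain \<delta>2 where \<delta>2: "\<delta>2 > 0" "\<And>t. t \<ge> s + 3 \<Longrightarrow> \<bar>\<beta> t - \<gamma> t\<bar> < \<delta>2 \<Longrightarrow>
      C s (\<beta> s) t (\<beta> t) \<le> C s (\<gamma> s) t (\<gamma> t) - \<epsilon>2 + \<epsilon>2 / 2"
    using 2(2)[of "\<epsilon>2 / 2"] 2(1) by auto
  obtain t where t: "t \<ge> s + 3" "\<bar>\<gamma> t - \<beta> t\<bar> < min \<delta>1 \<delta>2"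
    using close[of "min \<delta>1 \<delta>2"] \<delta>1(1) \<delta>2(1) by auto
  show False using \<delta>1(2)[OF t(1)] \<delta>2(2)[OF t(1)] t(2) 2(1) by (simp add: abs_minus_commute)
qed

text \<open>The difference \<open>\<gamma> - \<beta>\<close> takes integer values at most once unless it is constant, whereas a
continuous function that varies by more than \<open>2\<close> takes two integer values.\<close>

lemma bounded_oscillation:
  assumes M: "\<gamma> \<in> M" "\<beta> \<in> M"
  shows "\<bar>(\<gamma> t - \<beta> t) - (\<gamma> s - \<beta> s)\<bar> \<le> 2"
proof -
  have *: "(\<gamma> t - \<beta> t) - (\<gamma> s - \<beta> s) \<le> 2" for s t
  proof (rule ccontr)
    let ?D = "\<lambda>t. \<gamma> t - \<beta> t"
    assume "\<not> ?D t - ?D s \<le> 2"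
    then have gt: "?D t > ?D s + 2" by simp
    have "is_interval (range ?D)"
      by (intro is_interval_connected_1[THEN iffD2] connected_continuous_image continuous_intros cont M) simp
    then have mem: "y \<in> range ?D" if "?D s \<le> y" "y \<le> ?D t" for y
      using that unfolding is_interval_1 by blast
    define k where "k = \<lceil>?D s\<rceil>"
    have k: "?D s \<le> of_int k" "of_int k + 1 \<le> ?D t" using gt by (simp_all add: k_def) linarith+
    obtain u where u: "?D u = of_int k" using mem[of "of_int k"] k by auto
    obtain w where w: "?D w = of_int k + 1" using mem[of "of_int k + 1"] k by auto
    have "u \<noteq> w" using u w by auto
    moreover have "?D u \<in> \<int>" "?D w \<in> \<int>" using u w by simp_all
    ultimately have "\<exists>k. \<gamma> = shift k 0 \<beta>"
      using touch_at_most_once[OF M, of u w] touch_at_most_once[OF M, of w u] by (metis linorder_neqE_linordered_idom)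
    then show False using gt by (auto simp: shift_def)
  qed
  show ?thesis using *[of t s] *[of s t] by (simp add: abs_le_iff)
qed


lemma no_touch_ordered:
  assumes M: "\<gamma> \<in> M" "\<beta> \<in> M" and ne: "\<And>s. \<gamma> s \<noteq> \<beta> s" and lt: "\<gamma> s < \<beta> s"
  shows "\<gamma> t < \<beta> t"
proof -
  have "continuous_on UNIV (\<lambda>t. \<beta> t - \<gamma> t)" by (intro continuous_intros cont M)
  then have "0 < \<beta> t - \<gamma> t"
    by (rule continuous_constant_sign[of UNIV "\<lambda>t. \<beta> t - \<gamma> t" s])
      (use lt ne ne[symmetric] in auto)
  then show ?thesis by simp
qed

text \<open>Suppose \<open>\<gamma>\<close> crosses its translate \<open>\<beta>\<close> at \<open>s\<close>. Iterating the translation, the values \<open>y k\<close> of the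
iterates over \<open>s\<close> are monotone, because the sign of \<open>\<beta> - \<gamma>\<close> is known after \<open>s\<close>; the values
\<open>w k\<close> of the backward iterates move the other way. Bounded oscillation then makes \<open>y\<close> bounded,
hence convergent. So \<open>\<gamma>\<close> and \<open>\<beta>\<close> are asymptotic and cannot have crossed.\<close>

lemma shift_no_crossing:
  assumes M: "\<gamma> \<in> M" and s: "shift m n \<gamma> s = \<gamma> s"
  shows "shift m n \<gamma> = \<gamma>"
proof -
  have pos: "shift m n \<gamma> = \<gamma>" if n: "n > 0" and s: "shift m n \<gamma> s = \<gamma> s" for m n s
  proof (rule ccontr)
    define \<beta> where "\<beta> = shift m n \<gamma>"
    assume "shift m n \<gamma> \<noteq> \<gamma>"
    then have ne: "\<gamma> \<noteq> \<beta>" by (simp add: \<beta>_def)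
    have \<beta>: "\<beta> \<in> M" "\<gamma> s = \<beta> s" using shift_mem[OF M] s by (simp_all add: \<beta>_def)
    obtain e :: real where e: "e = 1 \<or> e = -1"
      and after: "\<And>t. t > s \<Longrightarrow> e * (\<beta> t - \<gamma> t) > 0" and before: "\<And>t. t < s \<Longrightarrow> e * (\<beta> t - \<gamma> t) < 0"
    proof -
      from crossing[OF M \<beta> ne] show ?thesis
      proof
        assume "crosses_up \<beta> \<gamma> s"
        then show ?thesis by (intro that[of 1]) (auto simp: crosses_up_def)
      next
        assume "crosses_up \<gamma> \<beta> s"
        then show ?thesis by (intro that[of "-1"]) (auto simp: crosses_up_def)
      qed
    qed
    define y where "y k = e * (\<gamma> (s + real k * of_int n) + real k * of_int m)" for k
    define w where "w k = e * (\<gamma> (s - real k * of_int n) - real k * of_int m)" for k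
    have step: "y (Suc k) - y k = e * (\<beta> (s + real k * of_int n) - \<gamma> (s + real k * of_int n))" for k
      by (simp add: y_def \<beta>_def shift_def algebra_simps)
    have "y k \<le> y (Suc k)" for k
    proof (cases "k = 0")
      case True
      then show ?thesis using step[of k] \<beta>(2) by simp
    next
      case False
      then have "s + real k * of_int n > s" using n by simp
      then show ?thesis using step[of k] after by (smt (verit))
    qed
    then have inc: "incseq y" by (rule incseq_SucI)
    have w: "w 0 \<le> w k" for k
    proof (induction k)
      case (Suc k)
      have "w k - w (Suc k) = e * (\<beta> (s - real (Suc k) * of_int n) - \<gamma> (s - real (Suc k) * of_int n))"
        by (simp add: w_def \<beta>_def shift_def algebra_simps)
      also have "\<dots> < 0" by (rule before) (use n in simp)
      finally show ?case using Suc by simp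
    qed simp
    have "y k - y 0 \<le> 2" for k
    proof -
      have "\<bar>shift (int k * m) (int k * n) \<gamma> s - \<gamma> s -
        (shift (int k * m) (int k * n) \<gamma> (s - real k * of_int n) - \<gamma> (s - real k * of_int n))\<bar> \<le> 2"
        by (intro bounded_oscillation shift_mem M)
      then have "\<bar>(y k - y 0) - (w 0 - w k)\<bar> \<le> 2"
        using e by (auto simp: shift_def y_def w_def algebra_simps)
      then show ?thesis using w[of k] by (simp add: abs_le_iff)
    qed
    then have "\<forall>k. y k \<le> y 0 + 2" by (simp add: algebra_simps)
    then obtain l where l: "y \<longlonglongrightarrow> l" using incseq_convergent[OF inc] by metis
    have lim: "(\<lambda>k. y (Suc k) - y k) \<longlonglongrightarrow> l - l" by (intro tendsto_diff l LIMSEQ_Suc)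
    have "\<gamma> = \<beta>"
    proof (rule asymptotic_no_crossing[OF M \<beta>])
      fix \<epsilon> :: real assume "\<epsilon> > 0"
      then obtain k0 where k0: "\<And>k. k \<ge> k0 \<Longrightarrow> \<bar>y (Suc k) - y k\<bar> < \<epsilon>"
        using lim by (fastforce simp: LIMSEQ_iff)
      define k where "k = max k0 3"
      have "\<bar>y (Suc k) - y k\<bar> = \<bar>\<gamma> (s + real k * of_int n) - \<beta> (s + real k * of_int n)\<bar>"
        unfolding step using e by auto
      then have "\<bar>\<gamma> (s + real k * of_int n) - \<beta> (s + real k * of_int n)\<bar> < \<epsilon>"
        using k0[of k] by (simp add: k_def)
      moreover have "real k * of_int n \<ge> 3 * 1"
        by (intro mult_mono) (use n in \<open>auto simp: k_def\<close>)
      ultimately show "\<exists>t\<ge>s + 3. \<bar>\<gamma> t - \<beta> t\<bar> < \<epsilon>"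
        by (intro exI[of _ "s + real k * of_int n"]) auto
    qed
    then show False using ne by blast
  qed
  consider "n > 0" | "n = 0" | "n < 0" by linarith
  then show ?thesis
  proof cases
    case 1
    then show ?thesis using pos s by blast
  next
    case 2
    then show ?thesis using s by (simp add: shift_def fun_eq_iff)
  next
    case 3
    have "shift (- m) (- n) \<gamma> (s + of_int n) = \<gamma> (s + of_int n)"
      using s by (simp add: shift_def)
    then have "shift (- m) (- n) \<gamma> = \<gamma>" using 3 by (intro pos) auto
    then have "shift m n \<gamma> = shift m n (shift (- m) (- n) \<gamma>)" by simp
    also have "\<dots> = \<gamma>" by (simp only: shift_shift) simp
    finally show ?thesis .
  qed
qed

lemma shift_cases:
  assumes M: "\<gamma> \<in> M"
  obtains "shift m n \<gamma> = \<gamma>" | "\<And>t. \<gamma> t < shift m n \<gamma> t" | "\<And>t. shift m n \<gamma> t < \<gamma> t"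
proof (cases "shift m n \<gamma> = \<gamma>")
  case False
  then have ne: "shift m n \<gamma> s \<noteq> \<gamma> s" for s using shift_no_crossing[OF M] by blast
  then have "\<gamma> 0 < shift m n \<gamma> 0 \<or> shift m n \<gamma> 0 < \<gamma> 0" by (metis linorder_neqE_linordered_idom)
  then show ?thesis
    using that(2,3) no_touch_ordered[OF M shift_mem[OF M]] no_touch_ordered[OF shift_mem[OF M] M] ne
    by metis
qed

text \<open>The same \<open>\<rho>\<close> serves all minimizers, because any two of them stay within bounded distance of each
other up to an additive constant.\<close>

lemma rotation_number:
  "\<exists>\<rho>. \<forall>\<gamma>\<in>M. \<forall>t n. \<bar>\<gamma> (t + of_int n) - \<gamma> t - of_int n * \<rho>\<bar> \<le> 10"
proof -
  obtain \<alpha> where \<alpha>: "\<alpha> \<in> M" using cover by blast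
  have "\<bar>(\<alpha> (of_int (m + n)) - \<alpha> 0) - (\<alpha> (of_int m) - \<alpha> 0) - (\<alpha> (of_int n) - \<alpha> 0)\<bar> \<le> 2" for m n
    using bounded_oscillation[OF shift_mem[OF \<alpha>, of 0 n] \<alpha>, of "of_int m" 0]
    by (simp add: shift_def algebra_simps)
  then obtain \<rho> where \<rho>: "\<And>n. \<bar>(\<alpha> (of_int n) - \<alpha> 0) - of_int n * \<rho>\<bar> \<le> 6"
    using additive_up_to_bounded_error[of "\<lambda>n. \<alpha> (of_int n) - \<alpha> 0"] by blast
  have "\<bar>\<gamma> (t + of_int n) - \<gamma> t - of_int n * \<rho>\<bar> \<le> 10" if \<gamma>: "\<gamma> \<in> M" for \<gamma> t n
    using bounded_oscillation[OF \<gamma> \<alpha>, of "t + of_int n" t]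
      bounded_oscillation[OF shift_mem[OF \<alpha>, of 0 n] \<alpha>, of t 0] \<rho>[of n]
    by (simp add: shift_def abs_le_iff)
  then show ?thesis by blast
qed

text \<open>For irrational \<open>\<rho>\<close> the translates of a minimizer are ordered like the numbers \<open>m + n \<rho>\<close>. If \<open>\<alpha>\<close>
crosses \<open>\<gamma>\<close>, then \<open>\<gamma>\<close> is above \<open>\<alpha>\<close> on one side of the crossing and below it on the other, and
translating far in time by a vector with small \<open>m + n \<rho>\<close> compares them everywhere: \<open>\<gamma>\<close> is squeezed
between the translates of \<open>\<alpha>\<close> by \<open>(m, n)\<close> and \<open>(- m, - n)\<close> for every positive \<open>m + n \<rho>\<close>. The widths
of this strip at \<open>N\<close> successive times are telescoping and sum to at most \<open>4\<close> if
\<open>N (m + n \<rho>) < 1\<close>, so one of them is at most \<open>4 / N\<close>. Hence \<open>\<alpha>\<close> and \<open>\<gamma>\<close> come arbitrarily close.\<close>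

lemma irrational_no_crossing:
  assumes \<rho>: "\<And>\<gamma> t n. \<gamma> \<in> M \<Longrightarrow> \<bar>\<gamma> (t + of_int n) - \<gamma> t - of_int n * \<rho>\<bar> \<le> 10"
    and irr: "\<rho> \<notin> \<rat>" and M: "\<gamma> \<in> M" "\<alpha> \<in> M" and s: "\<gamma> s = \<alpha> s"
  shows "\<gamma> = \<alpha>"
proof -
  have pos: "\<gamma> t < shift m n \<gamma> t" if \<gamma>: "\<gamma> \<in> M" and lam: "0 < of_int m + of_int n * \<rho>" for \<gamma> m n t
  proof (rule ccontr)
    assume "\<not> \<gamma> t < shift m n \<gamma> t"
    then have le: "shift m n \<gamma> t \<le> \<gamma> t" for t
      using shift_cases[OF \<gamma>, of m n "shift m n \<gamma> t \<le> \<gamma> t"] by (metis less_imp_le order_refl)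
    have "\<gamma> (t + of_int (int k * n)) + real k * of_int m \<le> \<gamma> t" for k
    proof (induction k)
      case (Suc k)
      then show ?case using le[of "t + of_int (int k * n)"] by (simp add: shift_def algebra_simps)
    qed simp
    then have "real k * (of_int m + of_int n * \<rho>) \<le> 10" for k
      using \<rho>[OF \<gamma>, of t "int k * n"] by (simp add: abs_le_iff algebra_simps) (smt (verit))
    then show False using ex_less_of_nat_mult[OF lam, of 10] by (metis linorder_not_le)
  qed
  have main: "\<not> crosses_up \<gamma> \<alpha> s" if M: "\<gamma> \<in> M" "\<alpha> \<in> M" for \<gamma> \<alpha>
  proof
    assume up: "crosses_up \<gamma> \<alpha> s"
    have s: "\<gamma> s = \<alpha> s" using up by (simp add: crosses_up_def)
    have after: "\<alpha> t \<le> \<gamma> t" if "t \<ge> s" for t using up that by (auto simp: crosses_up_def less_eq_real_def)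
    have before: "\<gamma> t \<le> \<alpha> t" if "t \<le> s" for t using up that by (auto simp: crosses_up_def less_eq_real_def)
    have mono: "shift m' n' \<alpha> t \<le> shift m n \<alpha> t"
      if "of_int m' + of_int n' * \<rho> < of_int m + of_int n * \<rho>" for m n m' n' t
      using pos[OF shift_mem[OF M(2), of m' n'], of "m - m'" "n - n'" t] that
      by (simp add: shift_shift algebra_simps)
    have sandwich: "\<gamma> t \<le> shift m n \<alpha> t" "shift (- m) (- n) \<alpha> t \<le> \<gamma> t"
      if lam: "0 < of_int m + of_int n * \<rho>" for m n t
    proof -
      obtain N :: nat where N: "\<bar>t - s\<bar> \<le> N" using real_arch_simple by blast
      obtain m' n' where 1: "0 < of_int m' + of_int n' * \<rho>"
        "of_int m' + of_int n' * \<rho> < of_int m + of_int n * \<rho>" "n' \<le> - int N"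
        using irrational_small_combination[OF irr lam] by blast
      have "of_int n' \<le> - real N" using 1(3) by (metis of_int_le_iff of_int_minus of_int_of_nat_eq)
      then have t: "t + of_int n' \<le> s" "s \<le> t - of_int n'" using N by (simp_all add: abs_le_iff)
      have "\<gamma> t < shift m' n' \<gamma> t" using pos[OF M(1)] 1 by blast
      also have "\<dots> \<le> shift m' n' \<alpha> t" using before[OF t(1)] by (simp add: shift_def)
      also have "\<dots> \<le> shift m n \<alpha> t" using mono 1(2) by blast
      finally show "\<gamma> t \<le> shift m n \<alpha> t" by simp
      have "shift (- m) (- n) \<alpha> t \<le> shift (- m') (- n') \<alpha> t" using mono 1(2) by (simp add: algebra_simps)
      also have "\<dots> \<le> shift (- m') (- n') \<gamma> t" using after[OF t(2)] by (simp add: shift_def)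
      also have "\<dots> \<le> \<gamma> t"
        using pos[OF shift_mem[OF M(1)], of m' n' "- m'" "- n'" t] 1(1) by (simp add: shift_shift)
      finally show "shift (- m) (- n) \<alpha> t \<le> \<gamma> t" .
    qed
    have "\<alpha> = \<gamma>"
    proof (rule asymptotic_no_crossing[OF M(2,1) s[symmetric]])
      fix e :: real assume e: "e > 0"
      obtain N :: nat where N: "N > 0" "4 < e * N"
        using ex_less_of_nat_mult[OF e, of 4] by (metis less_nat_zero_code mult.commute mult_zero_right neq0_conv not_numeral_less_zero of_nat_0)
      obtain m n where mn: "0 < of_int m + of_int n * \<rho>" "of_int m + of_int n * \<rho> < 1 / N" "n \<le> - int 1"
        using irrational_small_combination[OF irr, of "1 / N" 1] N(1) by auto
      define \<tau> where "\<tau> = s + 3"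
      define b where "b j = \<alpha> (\<tau> - j * of_int n) - j * of_int m" for j :: real
      have W: "\<bar>\<alpha> t - \<gamma> t\<bar> \<le> b (real j - 1) - b (real j + 1)"
        if "t = \<tau> - real j * of_int n" for j t
      proof -
        have "shift m n \<alpha> t - shift (- m) (- n) \<alpha> t = b (real j - 1) - b (real j + 1)"
          unfolding that by (simp add: shift_def b_def algebra_simps)
        moreover have "shift (- m) (- n) \<alpha> t < \<alpha> t" "\<alpha> t < shift m n \<alpha> t"
          using pos[OF M(2) mn(1)] pos[OF shift_mem[OF M(2)], of m n "- m" "- n" t] mn(1)
          by (simp_all add: shift_shift)
        ultimately show ?thesis using sandwich[OF mn(1), of t] by linarith
      qed
      have tele: "(\<Sum>j<k. b (real j - 1) - b (real j + 1)) = b (-1) + b 0 - b (real k - 1) - b (real k)" for k :: nat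
        by (induction k) (simp_all add: algebra_simps)
      have "b (-1) \<le> \<alpha> \<tau> + 1"
        using mono[of m n 1 0 \<tau>] mn(2) N(1) by (simp add: b_def shift_def algebra_simps divide_le_eq_1 order.strict_trans2)
      have "b 0 = \<alpha> \<tau>" by (simp add: b_def)
      have low: "\<alpha> \<tau> - 1 \<le> b (real k)" if "k \<le> N" for k :: nat
      proof -
        have "real k * (of_int m + of_int n * \<rho>) \<le> real N * (of_int m + of_int n * \<rho>)"
          using that mn(1) by (intro mult_right_mono) auto
        also have "\<dots> < 1" using mn(2) N(1) by (simp add: field_simps)
        finally show ?thesis
          using mono[of "-1" 0 "- int k * m" "- int k * n" \<tau>] by (simp add: b_def shift_def algebra_simps)
      qed
      have "b (-1) + b 0 - b (real N - 1) - b (real N) \<le> 4"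
      proof -
        have "\<alpha> \<tau> - 1 \<le> b (real N)" "\<alpha> \<tau> - 1 \<le> b (real N - 1)"
          using low[of N] low[of "N - 1"] N(1) by (simp_all add: of_nat_diff Suc_leI)
        then show ?thesis using \<open>b (-1) \<le> \<alpha> \<tau> + 1\<close> \<open>b 0 = \<alpha> \<tau>\<close> by linarith
      qed
      then have sum: "(\<Sum>j<N. b (real j - 1) - b (real j + 1)) \<le> 4" using tele[of N] by simp
      have "\<exists>j<N. b (real j - 1) - b (real j + 1) < e"
      proof (rule ccontr)
        assume "\<not> ?thesis"
        then have "(\<Sum>j<N. e) \<le> (\<Sum>j<N. b (real j - 1) - b (real j + 1))"
          by (intro sum_mono) (metis lessThan_iff not_less)
        then show False using sum N by (simp add: mult.commute)
      qed
      then obtain j where j: "b (real j - 1) - b (real j + 1) < e" by blast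
      have "real j * of_int n \<le> 0" using mn(3) by (simp add: mult_nonneg_nonpos)
      then show "\<exists>t\<ge>s + 3. \<bar>\<alpha> t - \<gamma> t\<bar> < e"
        using W[OF refl, of j] j by (intro exI[of _ "\<tau> - real j * of_int n"]) (auto simp: \<tau>_def)
    qed
    then show False using crosses_up_ne[OF up] by blast
  qed
  show ?thesis using crossing[OF M s] main M by blast
qed


end

section \<open>Rational rotation numbers\<close>

text \<open>The case of rotation number \<open>- p / q\<close>: translation by \<open>(p, q)\<close> moves every minimizer by a bounded
amount, no matter how often it is repeated. By \<open>shift_no_crossing\<close>, each minimizer is fixed,
raised or lowered by this translation.\<close>

locale resonant_curves = minimizing_curves +
  fixes p q :: int and B :: real
  assumes q_pos: "q > 0"
    and bounded_orbit: "\<gamma> \<in> M \<Longrightarrow> \<bar>shift (k * p) (k * q) \<gamma> t - \<gamma> t\<bar> \<le> B"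
begin

definition Per :: "(real \<Rightarrow> real) set" where "Per = {\<gamma> \<in> M. shift p q \<gamma> = \<gamma>}"
definition Up :: "(real \<Rightarrow> real) set" where "Up = {\<gamma> \<in> M. \<forall>t. \<gamma> t \<le> shift p q \<gamma> t}"
definition Down :: "(real \<Rightarrow> real) set" where "Down = {\<gamma> \<in> M. \<forall>t. shift p q \<gamma> t \<le> \<gamma> t}"

lemma Per_subset: "Per \<subseteq> Up" "Per \<subseteq> Down" "Per \<subseteq> M" "Up \<subseteq> M" "Down \<subseteq> M" "Up \<inter> Down \<subseteq> Per"
  by (auto simp: Per_def Up_def Down_def fun_eq_iff intro: antisym)

lemma Up_Down: "\<gamma> \<in> M \<Longrightarrow> \<gamma> \<in> Up \<or> \<gamma> \<in> Down"
  by (rule shift_cases[of \<gamma> p q]) (auto simp: Up_def Down_def intro: less_imp_le)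

lemma shift_Per: "\<gamma> \<in> Per \<Longrightarrow> shift m n \<gamma> \<in> Per"
  and shift_Up: "\<gamma> \<in> Up \<Longrightarrow> shift m n \<gamma> \<in> Up"
  and shift_Down: "\<gamma> \<in> Down \<Longrightarrow> shift m n \<gamma> \<in> Down"
proof -
  have comm: "shift p q (shift m n \<gamma>) = shift m n (shift p q \<gamma>)"
    by (simp add: shift_shift add.commute)
  show "\<gamma> \<in> Per \<Longrightarrow> shift m n \<gamma> \<in> Per" by (simp add: Per_def shift_mem comm)
  show "\<gamma> \<in> Up \<Longrightarrow> shift m n \<gamma> \<in> Up" unfolding Up_def mem_Collect_eq comm by (simp add: shift_mem) (simp add: shift_def)
  show "\<gamma> \<in> Down \<Longrightarrow> shift m n \<gamma> \<in> Down" unfolding Down_def mem_Collect_eq comm by (simp add: shift_mem) (simp add: shift_def)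
qed

lemma Per_shift_multiple: "\<gamma> \<in> Per \<Longrightarrow> shift (k * p) (k * q) \<gamma> = \<gamma>"
proof -
  assume \<gamma>: "\<gamma> \<in> Per"
  have pos: "shift (int k * p) (int k * q) \<gamma> = \<gamma>" for k
  proof (induction k)
    case (Suc k)
    have "shift (int (Suc k) * p) (int (Suc k) * q) \<gamma> = shift (int k * p) (int k * q) (shift p q \<gamma>)"
      by (simp add: shift_shift algebra_simps)
    then show ?case using Suc \<gamma> by (simp add: Per_def)
  qed simp
  show ?thesis
  proof (cases "k \<ge> 0")
    case True
    then show ?thesis using pos[of "nat k"] by simp
  next
    case False
    then have "shift (- k * p) (- k * q) \<gamma> = \<gamma>" using pos[of "nat (- k)"] by simp
    then have "shift (k * p) (k * q) \<gamma> = shift (k * p) (k * q) (shift (- k * p) (- k * q) \<gamma>)" by simp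
    then show ?thesis by (simp add: shift_shift)
  qed
qed

text \<open>The iterates of a minimizer are monotone and bounded, so they converge, and a limit of iterates
is fixed by the translation. The sign \<open>e\<close> selects forward or backward iteration.\<close>

lemma orbit_limit:
  assumes \<gamma>: "\<gamma> \<in> M" and e: "e = 1 \<or> e = -1"
  shows "\<exists>\<omega>\<in>Per. \<forall>t. (\<lambda>k. shift (int k * (e * p)) (int k * (e * q)) \<gamma> t) \<longlonglongrightarrow> \<omega> t"
proof -
  define u where "u k = shift (int k * (e * p)) (int k * (e * q)) \<gamma>" for k
  have u: "u k \<in> M" for k by (simp add: u_def shift_mem \<gamma>)
  have bd: "\<bar>u k t - \<gamma> t\<bar> \<le> B" for k t
    using bounded_orbit[OF \<gamma>, of "int k * e" t] by (simp add: u_def mult.assoc)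
  have Suc: "u (Suc k) t = u k (t + of_int (e * q)) + of_int (e * p)" for k t
    by (simp add: u_def shift_def algebra_simps)
  have Suc': "u (Suc k) t = shift (e * p) (e * q) \<gamma> (t + real k * of_int (e * q)) + real k * of_int (e * p)" for k t
    by (simp add: u_def shift_def algebra_simps)
  have u': "u k t = \<gamma> (t + real k * of_int (e * q)) + real k * of_int (e * p)" for k t
    by (simp add: u_def shift_def algebra_simps)
  have "\<exists>l. (\<lambda>k. u k t) \<longlonglongrightarrow> l" for t
  proof -
    have "monoseq (\<lambda>k. u k t)"
      by (rule shift_cases[OF \<gamma>, of "e * p" "e * q"])
        (use Suc' u' in \<open>auto simp: monoseq_Suc less_imp_le\<close>)
    moreover have "Bseq (\<lambda>k. u k t)"
    proof (rule BseqI'[of _ "\<bar>\<gamma> t\<bar> + B"])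
      show "norm (u k t) \<le> \<bar>\<gamma> t\<bar> + B" for k using bd[of k t] by simp
    qed
    ultimately show ?thesis using Bseq_monoseq_convergent by (auto simp: convergent_def)
  qed
  then obtain \<omega> where \<omega>: "\<And>t. (\<lambda>k. u k t) \<longlonglongrightarrow> \<omega> t" by metis
  have "bounded (range (\<lambda>k. u k 0))" using \<omega>[of 0] by (rule convergent_imp_bounded)
  then obtain r \<beta> where r: "strict_mono r" "\<beta> \<in> M" "\<And>t. (\<lambda>k. u (r k) t) \<longlonglongrightarrow> \<beta> t"
    using compactness[of u 0, OF u] by blast
  have "\<beta> t = \<omega> t" for t
    using LIMSEQ_unique[OF r(3)] LIMSEQ_subseq_LIMSEQ[OF \<omega> r(1)] by (auto simp: o_def)
  then have "\<beta> = \<omega>" by blast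
  have fix1: "\<omega> t = \<omega> (t + of_int (e * q)) + of_int (e * p)" for t
  proof -
    have "(\<lambda>k. u (Suc k) t) \<longlonglongrightarrow> \<omega> (t + of_int (e * q)) + of_int (e * p)"
      unfolding Suc by (intro tendsto_add \<omega> tendsto_const)
    then show ?thesis using LIMSEQ_unique LIMSEQ_Suc[OF \<omega>] by blast
  qed
  have "shift p q \<omega> t = \<omega> t" for t
    using e fix1[of t] fix1[of "t + of_int q"] by (auto simp: shift_def)
  then have "\<omega> \<in> Per" using r(2) \<open>\<beta> = \<omega>\<close> by (auto simp: Per_def)
  then show ?thesis using \<omega> unfolding u_def by blast
qed

text \<open>Repeat both loops \<open>k\<close> times. The periodic curve minimizes over all \<open>k + 2\<close> turns, and following
the loops at \<open>x\<close> instead needs only one transition at each end, of bounded cost. Let \<open>k\<close> tend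
to infinity.\<close>

lemma periodic_loop_minimal:
  assumes \<pi>: "\<pi> \<in> Per"
  shows "C s (\<pi> s) (s + of_int q) (\<pi> s) \<le> C s x (s + of_int q) x"
proof -
  define Q :: real where "Q = of_int q"
  have Q: "Q \<ge> 1" using q_pos by (simp add: Q_def)
  have M: "\<pi> \<in> M" using \<pi> Per_subset by blast
  define \<beta> where "\<beta> = C s (\<pi> s) (s + Q) (\<pi> s)"
  define c where "c = C s x (s + Q) x"
  have tshift: "C (a + real k * Q) y (b + real k * Q) z = C a y b z" for a b y z k
    using cost_time_shift[of a "int k * q" y b z] by (simp add: Q_def)
  have \<pi>k: "\<pi> (s + real k * Q) - \<pi> s \<in> \<int>" for k
  proof -
    have "\<pi> (s + real k * Q) + of_int (int k * p) = \<pi> s"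
      using Per_shift_multiple[OF \<pi>, of "int k"] by (auto simp: shift_def fun_eq_iff Q_def)
    then have "\<pi> (s + real k * Q) - \<pi> s = - of_int (int k * p)" by linarith
    then show ?thesis by simp
  qed
  have loops: "C s x (s + real k * Q) x \<le> real k * c" if "k \<ge> 1" for k
    using that
  proof (induction k rule: dec_induct)
    case (step k)
    have "C s x (s + real (Suc k) * Q) x \<le> C s x (s + real k * Q) x + C (s + real k * Q) x (s + real (Suc k) * Q) x"
      using step.hyps Q by (intro cost_triangle) auto
    also have "C (s + real k * Q) x (s + real (Suc k) * Q) x = c"
      using tshift[of s k x "s + Q" x] by (simp add: c_def algebra_simps)
    finally show ?case using step.IH by (simp add: algebra_simps)
  qed (simp add: c_def)
  have per: "C s (\<pi> s) (s + real k * Q) (\<pi> (s + real k * Q)) = real k * \<beta>" if "k \<ge> 1" for k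
    using that
  proof (induction k rule: dec_induct)
    case base
    show ?case using cost_cong_Ints[of "\<pi> s" "\<pi> s" "\<pi> (s + 1 * Q)" "\<pi> s"] \<pi>k[of 1] by (simp add: \<beta>_def)
  next
    case (step k)
    have "C s (\<pi> s) (s + real (Suc k) * Q) (\<pi> (s + real (Suc k) * Q)) = C s (\<pi> s) (s + real k * Q) (\<pi> (s + real k * Q))
       + C (s + real k * Q) (\<pi> (s + real k * Q)) (s + real (Suc k) * Q) (\<pi> (s + real (Suc k) * Q))"
      using step.hyps Q by (intro cost_additive[OF M]) auto
    also have "C (s + real k * Q) (\<pi> (s + real k * Q)) (s + real (Suc k) * Q) (\<pi> (s + real (Suc k) * Q)) =
      C (s + real k * Q) (\<pi> s) (s + real (Suc k) * Q) (\<pi> s)"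
      by (intro cost_cong_Ints \<pi>k)
    also have "\<dots> = \<beta>" using tshift[of s k "\<pi> s" "s + Q" "\<pi> s"] by (simp add: \<beta>_def algebra_simps)
    finally show ?case using step.IH by (simp add: algebra_simps)
  qed
  obtain K where K: "\<And>a x y. C a x (a + Q) y \<le> K" using cost_bounded[of Q] Q by auto
  have "real k * (\<beta> - c) \<le> 2 * K - 2 * \<beta>" if k: "k \<ge> 1" for k
  proof -
    have "real (k + 2) * \<beta> = C s (\<pi> s) (s + real (k + 2) * Q) (\<pi> (s + real (k + 2) * Q))"
      using per[of "k + 2"] by simp
    also have "\<dots> \<le> C s (\<pi> s) (s + Q) x + C (s + Q) x (s + real (k + 2) * Q) (\<pi> (s + real (k + 2) * Q))"
      using Q by (intro cost_triangle) (auto simp: algebra_simps add_pos_nonneg)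
    also have "C (s + Q) x (s + real (k + 2) * Q) (\<pi> (s + real (k + 2) * Q)) \<le>
      C (s + Q) x (s + real (k + 1) * Q) x + C (s + real (k + 1) * Q) x (s + real (k + 2) * Q) (\<pi> (s + real (k + 2) * Q))"
      using Q k by (intro cost_triangle) (auto simp: algebra_simps)
    also have "C (s + Q) x (s + real (k + 1) * Q) x = C s x (s + real k * Q) x"
      using tshift[of s 1 x "s + real k * Q" x] by (simp add: algebra_simps)
    also have "C (s + real (k + 1) * Q) x (s + real (k + 2) * Q) (\<pi> (s + real (k + 2) * Q)) \<le> K"
      using K[of "s + real (k + 1) * Q" x "\<pi> (s + real (k + 2) * Q)"] by (simp add: algebra_simps)
    finally have "real (k + 2) * \<beta> \<le> C s (\<pi> s) (s + Q) x + (C s x (s + real k * Q) x + K)" by simp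
    then show ?thesis using K[of s "\<pi> s" x] loops[OF k] by (simp add: algebra_simps)
  qed
  note multiples = this
  have "\<beta> \<le> c"
  proof (rule ccontr)
    assume "\<not> \<beta> \<le> c"
    then have pos: "\<beta> - c > 0" by simp
    obtain k where k: "2 * K - 2 * \<beta> < real k * (\<beta> - c)" using ex_less_of_nat_mult[OF pos] by blast
    have "real k * (\<beta> - c) \<le> real (Suc k) * (\<beta> - c)" using pos by (intro mult_right_mono) auto
    then show False using k multiples[of "Suc k"] by simp
  qed
  then show ?thesis by (simp add: \<beta>_def c_def Q_def)
qed

text \<open>Let \<open>\<gamma>\<close> meet the periodic curve \<open>\<pi>\<close> at \<open>s\<close>. Inserting one turn of \<open>\<pi>\<close> there creates a corner with a
definite gain \<open>\<epsilon>\<close>. Since the translates of \<open>\<gamma>\<close> converge, a late turn of \<open>\<gamma>\<close> nearly closes up and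
may be omitted in exchange, so that the end is reached in time; it costs at least as much as the
turn of \<open>\<pi>\<close>.\<close>

lemma periodic_no_crossing:
  assumes \<pi>: "\<pi> \<in> Per" and M: "\<gamma> \<in> M" and s: "\<gamma> s = \<pi> s"
  shows "\<gamma> = \<pi>"
proof (rule ccontr)
  assume ne: "\<gamma> \<noteq> \<pi>"
  define Q :: real where "Q = of_int q"
  have Q: "Q \<ge> 1" using q_pos by (simp add: Q_def)
  have M': "\<pi> \<in> M" using \<pi> Per_subset by blast
  have tshift: "C (a + real k * Q) y (b + real k * Q) z = C a y b z" for a b y z k
    using cost_time_shift[of a "int k * q" y b z] by (simp add: Q_def)
  define \<beta> where "\<beta> = C s (\<pi> s) (s + Q) (\<pi> s)"
  have \<pi>Q: "\<pi> (s + Q) = \<pi> s - of_int p"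
  proof -
    have "shift p q \<pi> s = \<pi> s" using \<pi> by (simp add: Per_def)
    then show ?thesis unfolding shift_def Q_def by linarith
  qed
  have \<beta>: "C s (\<pi> s) (s + Q) (\<pi> (s + Q)) = \<beta>"
    unfolding \<beta>_def by (rule cost_cong_Ints) (auto simp: \<pi>Q)
  define \<epsilon> where "\<epsilon> = C (s - 1) (\<gamma> (s - 1)) s (\<gamma> s) + \<beta> - C (s - 1) (\<gamma> (s - 1)) (s + Q) (\<pi> (s + Q))"
  have \<epsilon>: "\<epsilon> > 0"
    using cost_corner[OF M M' s ne, of "s - 1" "s + Q"] Q by (simp add: \<epsilon>_def \<beta>)
  obtain \<delta> where \<delta>: "\<delta> > 0" "\<And>\<gamma> a b x. \<gamma> \<in> M \<Longrightarrow> a + 1 \<le> b \<Longrightarrow> \<bar>x - \<gamma> b\<bar> < \<delta> \<Longrightarrow>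
      C a (\<gamma> a) b x \<le> C a (\<gamma> a) b (\<gamma> b) + \<epsilon> / 3"
    using cost_end[of "\<epsilon> / 3"] \<epsilon> by (metis divide_pos_pos zero_less_numeral)
  define u where "u k = \<gamma> (s + real k * Q) + real k * of_int p" for k
  obtain l where "u \<longlonglongrightarrow> l"
    using orbit_limit[OF M, of 1] by (auto simp: shift_def u_def[abs_def] Q_def algebra_simps)
  then have "(\<lambda>k. u (Suc k) - u k) \<longlonglongrightarrow> l - l" by (intro tendsto_diff LIMSEQ_Suc)
  then obtain k0 where k0: "\<And>k. k \<ge> k0 \<Longrightarrow> \<bar>u (Suc k) - u k\<bar> < \<delta>"
    using \<delta>(1) by (fastforce simp: LIMSEQ_iff)
  define k where "k = max k0 1"
  have k: "real k \<ge> 1" and uk: "\<bar>u (Suc k) - u k\<bar> < \<delta>" using k0[of k] by (auto simp: k_def)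
  have kQ: "real k * Q \<ge> 1" using k Q mult_mono[of 1 "real k" 1 Q] by simp
  define S where "S = s + real (Suc k) * Q"
  have S: "S = s + real k * Q + Q" by (simp add: S_def algebra_simps)
  define \<gamma>' where "\<gamma>' = shift (- p) (- q) \<gamma>"
  have \<gamma>': "\<gamma>' \<in> M" "\<gamma>' (s + Q) = \<pi> (s + Q)" "\<gamma>' S = \<gamma> (s + real k * Q) - of_int p"
  proof -
    show "\<gamma>' \<in> M" by (simp add: \<gamma>'_def shift_mem M)
    have "\<gamma>' (s + Q) = \<gamma> s - of_int p" by (simp add: \<gamma>'_def shift_def Q_def)
    then show "\<gamma>' (s + Q) = \<pi> (s + Q)" by (simp only: \<pi>Q s)
    show "\<gamma>' S = \<gamma> (s + real k * Q) - of_int p" by (simp add: \<gamma>'_def shift_def S Q_def)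
  qed
  have close: "\<bar>\<gamma> S - \<gamma>' S\<bar> < \<delta>" using uk unfolding \<gamma>'(3) by (simp add: u_def S_def algebra_simps)
  \<comment> \<open>Splice one turn of the periodic curve into \<open>\<gamma>\<close> and delay the rest accordingly.\<close>
  have "C (s + Q) (\<pi> (s + Q)) S (\<gamma> S) \<le> C (s + Q) (\<gamma>' (s + Q)) S (\<gamma>' S) + \<epsilon> / 3"
    using \<delta>(2)[OF \<gamma>'(1) _ close, of "s + Q"] kQ unfolding \<gamma>'(2) S by simp
  also have "C (s + Q) (\<gamma>' (s + Q)) S (\<gamma>' S) = C (s + Q) (\<gamma> s) S (\<gamma> (s + real k * Q))"
    by (rule cost_cong_Ints) (simp_all add: \<gamma>' \<pi>Q s)
  also have "\<dots> = C s (\<gamma> s) (s + real k * Q) (\<gamma> (s + real k * Q))"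
    using tshift[of s 1 "\<gamma> s" "s + real k * Q"] by (simp add: S)
  finally have 1: "C (s + Q) (\<pi> (s + Q)) S (\<gamma> S) \<le> C s (\<gamma> s) (s + real k * Q) (\<gamma> (s + real k * Q)) + \<epsilon> / 3" .
  have 2: "C (s - 1) (\<gamma> (s - 1)) S (\<gamma> S) \<le> C (s - 1) (\<gamma> (s - 1)) (s + Q) (\<pi> (s + Q)) + C (s + Q) (\<pi> (s + Q)) S (\<gamma> S)"
    using Q kQ by (intro cost_triangle) (auto simp: S)
  have 3: "C (s - 1) (\<gamma> (s - 1)) S (\<gamma> S) = C (s - 1) (\<gamma> (s - 1)) s (\<gamma> s) + C s (\<gamma> s) S (\<gamma> S)"
    "C s (\<gamma> s) S (\<gamma> S) = C s (\<gamma> s) (s + real k * Q) (\<gamma> (s + real k * Q)) + C (s + real k * Q) (\<gamma> (s + real k * Q)) S (\<gamma> S)"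
    using Q kQ by (intro cost_additive[OF M]; simp add: S)+
  \<comment> \<open>The last turn of \<open>\<gamma>\<close> is nearly a loop, so it cannot cost less than the periodic one.\<close>
  have "\<beta> \<le> C s (\<gamma> (s + real k * Q)) (s + Q) (\<gamma> (s + real k * Q))"
    unfolding \<beta>_def Q_def by (rule periodic_loop_minimal[OF \<pi>])
  also have "\<dots> = C (s + real k * Q) (\<gamma> (s + real k * Q)) S (\<gamma> (s + real k * Q))"
    using tshift[of s k "\<gamma> (s + real k * Q)" "s + Q" "\<gamma> (s + real k * Q)"] by (simp add: S algebra_simps)
  also have "\<dots> = C (s + real k * Q) (\<gamma> (s + real k * Q)) S (\<gamma>' S)"
    by (rule cost_cong_Ints) (simp_all add: \<gamma>')
  also have "\<dots> \<le> C (s + real k * Q) (\<gamma> (s + real k * Q)) S (\<gamma> S) + \<epsilon> / 3"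
    using close Q by (intro \<delta>(2)[OF M]) (auto simp: S abs_minus_commute)
  finally show False using 1 2 3 \<epsilon> \<epsilon>_def by linarith
qed


lemma ordered:
  assumes "\<gamma> \<in> M" "\<beta> \<in> M" "\<And>s. \<gamma> s = \<beta> s \<Longrightarrow> \<gamma> = \<beta>" "\<gamma> s < \<beta> s"
  shows "\<gamma> t < \<beta> t"
  using no_touch_ordered[OF assms(1,2) _ assms(4)] assms(3,4) by (metis less_irrefl)

lemma ordered_Per:
  assumes "\<gamma> \<in> M" "\<pi> \<in> Per"
  shows "\<gamma> s < \<pi> s \<Longrightarrow> \<gamma> t < \<pi> t" "\<pi> s < \<gamma> s \<Longrightarrow> \<pi> t < \<gamma> t"
  using ordered[of \<gamma> \<pi>] ordered[of \<pi> \<gamma>] periodic_no_crossing[OF assms(2,1)] assms Per_subset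
  by (metis subsetD)+

text \<open>Suppose \<open>\<gamma>\<close> runs below \<open>\<beta>\<close> after the crossing. The upper limit \<open>\<omega>1\<close> of the iterates of \<open>\<gamma>\<close> is
periodic, so it is crossed neither by \<open>\<gamma>\<close> nor by \<open>\<beta>\<close>; as it lies above \<open>\<gamma>\<close> before the crossing,
it lies above \<open>\<beta>\<close> throughout. Thus the iterates of \<open>\<beta>\<close> are caught between those of \<open>\<gamma>\<close> and \<open>\<omega>1\<close>
and have the same limit, so that \<open>\<gamma>\<close> and \<open>\<beta>\<close> are asymptotic.\<close>

lemma Up_no_crossing:
  assumes U: "\<gamma> \<in> Up" "\<beta> \<in> Up" and s: "\<gamma> s = \<beta> s"
  shows "\<gamma> = \<beta>"
proof -
  have main: "\<not> crosses_up \<beta> \<gamma> s" if U: "\<gamma> \<in> Up" "\<beta> \<in> Up" for \<gamma> \<beta>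
  proof
    assume up: "crosses_up \<beta> \<gamma> s"
    have s: "\<gamma> s = \<beta> s" and after: "\<And>t. t > s \<Longrightarrow> \<gamma> t < \<beta> t" and before: "\<And>t. t < s \<Longrightarrow> \<beta> t < \<gamma> t"
      using up by (auto simp: crosses_up_def)
    have M: "\<gamma> \<in> M" "\<beta> \<in> M" using U Per_subset by blast+
    have ne: "\<gamma> \<noteq> \<beta>" using crosses_up_ne[OF up] .
    define T where "T k = shift (int k * p) (int k * q)" for k
    have Tval: "T k \<gamma> t = \<gamma> (t + real k * of_int q) + real k * of_int p" for k \<gamma> t
      by (simp add: T_def shift_def)
    obtain \<omega>1 where \<omega>1: "\<omega>1 \<in> Per" "\<And>t. (\<lambda>k. T k \<gamma> t) \<longlonglongrightarrow> \<omega>1 t"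
      using orbit_limit[OF M(1), of 1] by (auto simp: T_def)
    obtain \<omega>2 where \<omega>2: "\<omega>2 \<in> Per" "\<And>t. (\<lambda>k. T k \<beta> t) \<longlonglongrightarrow> \<omega>2 t"
      using orbit_limit[OF M(2), of 1] by (auto simp: T_def)
    have le: "\<gamma> t \<le> \<omega>1 t" for t
    proof (rule Lim_bounded2[OF \<omega>1(2)])
      have "\<gamma> t \<le> T k \<gamma> t" for k
      proof (induction k)
        case (Suc k)
        have "T (Suc k) \<gamma> t = shift p q \<gamma> (t + real k * of_int q) + real k * of_int p"
          by (simp add: Tval shift_def algebra_simps)
        also have "\<dots> \<ge> \<gamma> (t + real k * of_int q) + real k * of_int p" using U(1) by (simp add: Up_def)
        finally show ?case using Suc by (simp add: Tval)
      qed (simp add: Tval)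
      then show "\<forall>n\<ge>0. \<gamma> t \<le> T n \<gamma> t" by simp
    qed
    have "\<gamma> t \<noteq> \<omega>1 t" for t
    proof
      assume "\<gamma> t = \<omega>1 t"
      then have "\<gamma> = \<omega>1" by (rule periodic_no_crossing[OF \<omega>1(1) M(1)])
      then show False using periodic_no_crossing[OF \<omega>1(1) M(2), of s] s ne by simp
    qed
    then have "\<beta> (s - 1) < \<omega>1 (s - 1)"
      using le[of "s - 1"] before[of "s - 1"] by (simp add: less_eq_real_def)
    then have lt: "\<beta> t < \<omega>1 t" for t by (rule ordered_Per(1)[OF M(2) \<omega>1(1)])
    define t0 where "t0 = s + 3"
    have "\<omega>2 t0 \<le> \<omega>1 t0"
    proof (rule Lim_bounded[OF \<omega>2(2)])
      have "T k \<beta> t0 \<le> T k \<omega>1 t0" for k using lt[of "t0 + real k * of_int q"] by (simp add: Tval)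
      then show "\<forall>n\<ge>0. T n \<beta> t0 \<le> \<omega>1 t0"
        using Per_shift_multiple[OF \<omega>1(1)] by (simp add: T_def)
    qed
    moreover have "\<omega>1 t0 \<le> \<omega>2 t0"
    proof (rule LIMSEQ_le[OF \<omega>1(2) \<omega>2(2)])
      have "T k \<gamma> t0 \<le> T k \<beta> t0" for k
        using after[of "t0 + real k * of_int q"] q_pos by (simp add: Tval t0_def add_pos_nonneg)
      then show "\<exists>N. \<forall>n\<ge>N. T n \<gamma> t0 \<le> T n \<beta> t0" by blast
    qed
    ultimately have "(\<lambda>k. T k \<gamma> t0 - T k \<beta> t0) \<longlonglongrightarrow> 0"
      using tendsto_diff[OF \<omega>1(2)[of t0] \<omega>2(2)[of t0]] by simp
    then have lim: "(\<lambda>k. \<gamma> (t0 + real k * of_int q) - \<beta> (t0 + real k * of_int q)) \<longlonglongrightarrow> 0"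
      by (simp add: Tval)
    have "\<gamma> = \<beta>"
    proof (rule asymptotic_no_crossing[OF M s])
      fix e :: real assume "e > 0"
      then obtain k where "\<bar>\<gamma> (t0 + real k * of_int q) - \<beta> (t0 + real k * of_int q)\<bar> < e"
        using lim by (fastforce simp: LIMSEQ_iff)
      then show "\<exists>t\<ge>s + 3. \<bar>\<gamma> t - \<beta> t\<bar> < e"
        using q_pos by (intro exI[of _ "t0 + real k * of_int q"]) (auto simp: t0_def)
    qed
    then show False using ne by blast
  qed
  have "\<gamma> \<in> M" "\<beta> \<in> M" using U Per_subset by blast+
  then show ?thesis using crossing[of \<gamma> \<beta> s] s main U by blast
qed

lemma ordered_Up:
  assumes "\<gamma> \<in> Up" "\<beta> \<in> Up" shows "\<gamma> s < \<beta> s \<Longrightarrow> \<gamma> t < \<beta> t"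
  using ordered[of \<gamma> \<beta>] Up_no_crossing[OF assms] assms Per_subset by (metis subsetD)

lemma closed_Up_values: "closed ((\<lambda>\<gamma>. \<gamma> t) ` Up)"
  unfolding closed_sequential_limits
proof (intro allI impI, elim conjE)
  fix x l assume x: "\<forall>n::nat. x n \<in> (\<lambda>\<gamma>. \<gamma> t) ` Up" and l: "x \<longlonglongrightarrow> l"
  then obtain u where u: "\<And>n. u n \<in> Up" "\<And>n. x n = u n t" by (auto simp: image_iff) metis
  have "bounded (range (\<lambda>n. u n t))" using l u(2) by (metis (mono_tags) convergent_imp_bounded range_composition image_cong)
  then obtain r \<beta> where r: "strict_mono r" "\<beta> \<in> M" "\<And>s. (\<lambda>k. u (r k) s) \<longlonglongrightarrow> \<beta> s"
    using compactness[of u t] u(1) Per_subset by blast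
  have "\<beta> s \<le> shift p q \<beta> s" for s
  proof (rule LIMSEQ_le[OF r(3)])
    show "(\<lambda>k. shift p q (u (r k)) s) \<longlonglongrightarrow> shift p q \<beta> s"
      unfolding shift_def by (intro tendsto_add r(3) tendsto_const)
    show "\<exists>N. \<forall>n\<ge>N. u (r n) s \<le> shift p q (u (r n)) s" using u(1) by (auto simp: Up_def)
  qed
  then have "\<beta> \<in> Up" using r(2) by (simp add: Up_def)
  moreover have "l = \<beta> t"
    using LIMSEQ_unique[OF r(3)[of t]] LIMSEQ_subseq_LIMSEQ[OF l r(1)] by (simp add: o_def u(2))
  ultimately show "l \<in> (\<lambda>\<gamma>. \<gamma> t) ` Up" by blast
qed

definition connects :: "(real \<Rightarrow> real) \<Rightarrow> (real \<Rightarrow> real) \<Rightarrow> (real \<Rightarrow> real) \<Rightarrow> bool" where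
  "connects \<alpha> \<omega> \<gamma> \<longleftrightarrow> (\<forall>t. (\<lambda>k. shift (int k * - p) (int k * - q) \<gamma> t) \<longlonglongrightarrow> \<alpha> t) \<and>
     (\<forall>t. (\<lambda>k. shift (int k * p) (int k * q) \<gamma> t) \<longlonglongrightarrow> \<omega> t)"

text \<open>The values of rising minimizers at a time form a closed set, so a missed point \<open>x0\<close> lies between
two adjacent ones, \<open>y < z\<close>. If they are not both periodic, adjacency forces \<open>y\<close> and \<open>z\<close> to
interleave with their translates: the translate of \<open>y\<close> by \<open>(p, q)\<close> does not lie below \<open>z\<close>. So the iterates of \<open>y\<close> and
\<open>z\<close> have the same limits \<open>\<alpha>\<close> in the past and \<open>\<omega>\<close> in the future.\<close>

lemma adjacent_Up:
  assumes nc: "\<forall>\<gamma>\<in>Up. \<gamma> t0 \<noteq> x0"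
  shows "\<exists>y\<in>Up. \<exists>z\<in>Up. y t0 < x0 \<and> x0 < z t0 \<and> (\<forall>\<gamma>\<in>Up. \<forall>t. \<not> (y t < \<gamma> t \<and> \<gamma> t < z t)) \<and>
    (y \<in> Per \<and> z \<in> Per \<or>
      (\<exists>\<alpha>\<in>Per. \<exists>\<omega>\<in>Per. (\<forall>t. \<alpha> t \<le> y t \<and> z t \<le> \<omega> t) \<and> connects \<alpha> \<omega> y \<and> connects \<alpha> \<omega> z))"
proof -
  let ?V = "(\<lambda>\<gamma>. \<gamma> t0) ` Up"
  obtain \<gamma>0 where "\<gamma>0 \<in> M" using cover by blast
  then obtain \<pi> where "\<pi> \<in> Per" using orbit_limit[of \<gamma>0 1] by blast
  then have \<pi>: "\<pi> \<in> Up" using Per_subset by blast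
  have sh: "shift m 0 \<pi> t0 \<in> ?V" "shift m 0 \<pi> t0 = \<pi> t0 + of_int m" for m
    by (rule imageI, rule shift_Up[OF \<pi>]) (simp add: shift_def)
  have "\<pi> t0 + of_int (\<lfloor>x0 - \<pi> t0\<rfloor>) \<le> x0" "x0 \<le> \<pi> t0 + of_int \<lceil>x0 - \<pi> t0\<rceil>" by linarith+
  then have ne: "?V \<inter> {..x0} \<noteq> {}" "?V \<inter> {x0..} \<noteq> {}" using sh by (metis IntI atMost_iff atLeast_iff empty_iff)+
  have cl: "closed (?V \<inter> {..x0})" "closed (?V \<inter> {x0..})"
    by (intro closed_Int closed_Up_values; simp)+
  have "Sup (?V \<inter> {..x0}) \<in> ?V \<inter> {..x0}"
    by (rule closed_contains_Sup[OF ne(1) _ cl(1)]) (auto intro: bdd_aboveI[of _ x0])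
  then obtain y where y: "y \<in> Up" "y t0 = Sup (?V \<inter> {..x0})" "y t0 \<le> x0" by auto
  have "Inf (?V \<inter> {x0..}) \<in> ?V \<inter> {x0..}"
    by (rule closed_contains_Inf[OF ne(2) _ cl(2)]) (auto intro: bdd_belowI[of _ x0])
  then obtain z where z: "z \<in> Up" "z t0 = Inf (?V \<inter> {x0..})" "x0 \<le> z t0" by auto
  have lt: "y t0 < x0" "x0 < z t0" using y z nc by (auto simp: less_eq_real_def)
  have yz: "y t < z t" for t using ordered_Up[OF y(1) z(1), of t0] lt by simp
  have M: "y \<in> M" "z \<in> M" using y z Per_subset by blast+
  have adj0: "\<gamma> t0 \<le> y t0 \<or> z t0 \<le> \<gamma> t0" if \<gamma>: "\<gamma> \<in> Up" for \<gamma>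
  proof (cases "\<gamma> t0 \<le> x0")
    case True
    then have "\<gamma> t0 \<le> y t0" unfolding y(2) using \<gamma> by (intro cSup_upper) (auto intro: bdd_aboveI[of _ x0])
    then show ?thesis by simp
  next
    case False
    then have "z t0 \<le> \<gamma> t0" unfolding z(2) using \<gamma> by (intro cInf_lower) (auto intro: bdd_belowI[of _ x0])
    then show ?thesis by simp
  qed
  have adj: "(\<forall>t. \<gamma> t \<le> y t) \<or> (\<forall>t. z t \<le> \<gamma> t)" if \<gamma>: "\<gamma> \<in> Up" for \<gamma>
    using adj0[OF \<gamma>] ordered_Up[OF y(1) \<gamma>] ordered_Up[OF \<gamma> z(1)] by (meson linorder_not_le)
  have adj': "False" if "\<gamma> \<in> Up" "y t < \<gamma> t" "\<gamma> t < z t" for \<gamma> t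
    using adj[OF that(1)] that by (meson linorder_not_le)
  have ends: "(y \<in> Per \<and> z \<in> Per) \<or> (\<forall>t. shift (- p) (- q) z t \<le> y t)"
  proof (cases "z \<in> Per")
    case True
    have "y \<in> Per"
    proof (rule ccontr)
      assume "y \<notin> Per"
      then have lt: "y t < shift p q y t" for t
        using y(1) shift_cases[OF M(1), of p q "y t < shift p q y t"] M(1)
        by (auto simp: Per_def Up_def not_le[symmetric])
      have "shift p q y t < z t" for t
      proof -
        have "shift p q y t < shift p q z t" using yz by (simp add: shift_def)
        then show ?thesis using True by (simp add: Per_def)
      qed
      then show False using adj'[OF shift_Up[OF y(1)]] lt by blast
    qed
    then show ?thesis using True by blast
  next
    case False
    have lt: "z t < shift p q z t" for t
      using False z(1) shift_cases[OF M(2), of p q "z t < shift p q z t"] M(2)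
      by (auto simp: Per_def Up_def not_le[symmetric])
    have "shift (- p) (- q) z t < z t" for t using lt[of "t - of_int q"] by (simp add: shift_def)
    then show ?thesis using adj[OF shift_Up[OF z(1)], of "-p" "-q"] by (meson linorder_not_le)
  qed
  show ?thesis
  proof (rule bexI[OF _ y(1)], rule bexI[OF _ z(1)], intro conjI lt)
    show "\<forall>\<gamma>\<in>Up. \<forall>t. \<not> (y t < \<gamma> t \<and> \<gamma> t < z t)" using adj' by blast
    show "y \<in> Per \<and> z \<in> Per \<or>
      (\<exists>\<alpha>\<in>Per. \<exists>\<omega>\<in>Per. (\<forall>t. \<alpha> t \<le> y t \<and> z t \<le> \<omega> t) \<and> connects \<alpha> \<omega> y \<and> connects \<alpha> \<omega> z)"
    proof (cases "y \<in> Per \<and> z \<in> Per")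
      case False
      then have zy: "shift (- p) (- q) z t \<le> y t" for t using ends by blast
      define T where "T e k = shift (int k * (e * p)) (int k * (e * q))" for e k
      have Tmono: "T e k \<gamma> t \<le> T e k \<beta> t" if "\<And>t. \<gamma> t \<le> \<beta> t" for \<gamma> \<beta> e k t
        using that by (simp add: T_def shift_def)
      obtain \<alpha> where \<alpha>: "\<alpha> \<in> Per" "\<And>t. (\<lambda>k. T (-1) k y t) \<longlonglongrightarrow> \<alpha> t"
        using orbit_limit[OF M(1), of "-1"] unfolding T_def by blast
      obtain \<omega> where \<omega>: "\<omega> \<in> Per" "\<And>t. (\<lambda>k. T 1 k y t) \<longlonglongrightarrow> \<omega> t"
        using orbit_limit[OF M(1), of 1] unfolding T_def by blast
      have yle: "y t \<le> shift p q y t" for t using y(1) by (simp add: Up_def)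
      have zle: "z t \<le> shift p q y t" for t using zy[of "t + of_int q"] by (simp add: shift_def)
      have Sm: "T (-1) (Suc k) \<gamma> = T (-1) k (shift (- p) (- q) \<gamma>)"
        "T 1 (Suc k) \<gamma> = T 1 k (shift p q \<gamma>)"
        "T (-1) (Suc k) (shift p q \<gamma>) = T (-1) k \<gamma>" for k \<gamma>
        by (simp_all add: T_def shift_shift algebra_simps)
      have \<alpha>z: "(\<lambda>k. T (-1) k z t) \<longlonglongrightarrow> \<alpha> t" for t
      proof -
        have "(\<lambda>k. T (-1) (Suc k) z t) \<longlonglongrightarrow> \<alpha> t"
        proof (rule tendsto_sandwich[OF _ _ LIMSEQ_Suc[OF \<alpha>(2)] \<alpha>(2)])
          show "\<forall>\<^sub>F k in sequentially. T (-1) (Suc k) y t \<le> T (-1) (Suc k) z t"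
            using Tmono[of y z] yz by (auto intro!: always_eventually simp: less_imp_le)
          show "\<forall>\<^sub>F k in sequentially. T (-1) (Suc k) z t \<le> T (-1) k y t"
            unfolding Sm using Tmono zy by (auto intro!: always_eventually)
        qed
        then show ?thesis by (rule LIMSEQ_imp_Suc)
      qed
      have \<omega>z: "(\<lambda>k. T 1 k z t) \<longlonglongrightarrow> \<omega> t" for t
      proof (rule tendsto_sandwich[OF _ _ \<omega>(2) LIMSEQ_Suc[OF \<omega>(2)]])
        show "\<forall>\<^sub>F k in sequentially. T 1 k y t \<le> T 1 k z t"
          using Tmono[of y z] yz by (auto intro!: always_eventually simp: less_imp_le)
        show "\<forall>\<^sub>F k in sequentially. T 1 k z t \<le> T 1 (Suc k) y t"
          unfolding Sm using Tmono zle by (auto intro!: always_eventually)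
      qed
      have dec: "T (-1) k y t \<le> y t" for k t
      proof (induction k arbitrary: t)
        case (Suc k)
        have "T (-1) (Suc k) y t \<le> T (-1) (Suc k) (shift p q y) t" by (rule Tmono[OF yle])
        then show ?case using Suc[of t] by (simp add: Sm(3))
      qed (simp add: T_def)
      have "\<alpha> t \<le> y t" for t using dec by (intro Lim_bounded[OF \<alpha>(2)]) auto
      moreover have "z t \<le> \<omega> t" for t
      proof (rule Lim_bounded2[OF LIMSEQ_Suc[OF \<omega>(2)]])
        have "z t \<le> T 1 (Suc k) y t" for k t
        proof (induction k arbitrary: t)
          case (Suc k)
          have "T 1 (Suc k) y t \<le> T 1 (Suc k) (shift p q y) t" by (rule Tmono[OF yle])
          then show ?case using Suc[of t] unfolding Sm(2)[of "Suc k"] by simp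
        qed (use zle in \<open>simp add: T_def\<close>)
        then show "\<forall>n\<ge>0. z t \<le> T 1 (Suc n) y t" by simp
      qed
      moreover have "connects \<alpha> \<omega> y" "connects \<alpha> \<omega> z"
        using \<alpha>(2) \<omega>(2) \<alpha>z \<omega>z unfolding T_def connects_def by simp_all
      ultimately show ?thesis using \<alpha>(1) \<omega>(1) by blast
    qed simp
  qed
qed


text \<open>Reflecting space exchanges rising and falling minimizers, so the results on \<open>Up\<close> carry over
to \<open>Down\<close>.\<close>

lemma reflection:
  "resonant_curves {\<gamma>. (\<lambda>t. - \<gamma> t) \<in> M} (\<lambda>a x b y. C a (- x) b (- y)) (- p) q B"
proof -
  have sh: "(\<lambda>t. - shift m n \<gamma> t) = shift (- m) n (\<lambda>t. - \<gamma> t)" for m n \<gamma>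
    by (simp add: shift_def fun_eq_iff)
  have der: "deriv \<gamma> s = - deriv (\<lambda>t. - \<gamma> t) s" if "(\<lambda>t. - \<gamma> t) \<in> M" for \<gamma> s
    using DERIV_minus[OF has_velocity[OF that, of s]] by (auto intro: DERIV_imp_deriv)
  show ?thesis
  proof (intro resonant_curves.intro minimizing_curves.intro resonant_curves_axioms.intro)
    fix \<gamma> :: "real \<Rightarrow> real" and t assume "\<gamma> \<in> {\<gamma>. (\<lambda>t. - \<gamma> t) \<in> M}"
    then have \<gamma>: "(\<lambda>t. - \<gamma> t) \<in> M" by simp
    show "(\<gamma> has_real_derivative deriv \<gamma> t) (at t)"
      using DERIV_minus[OF has_velocity[OF \<gamma>, of t]] der[OF \<gamma>] by simp
  next
    fix \<gamma> \<beta> :: "real \<Rightarrow> real" and s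
    assume "\<gamma> \<in> {\<gamma>. (\<lambda>t. - \<gamma> t) \<in> M}" "\<beta> \<in> {\<gamma>. (\<lambda>t. - \<gamma> t) \<in> M}"
      and eq: "\<gamma> s = \<beta> s" "deriv \<gamma> s = deriv \<beta> s"
    then have *: "(\<lambda>t. - \<gamma> t) \<in> M" "(\<lambda>t. - \<beta> t) \<in> M" by simp_all
    have "(\<lambda>t. - \<gamma> t) = (\<lambda>t. - \<beta> t)"
      by (rule unique[OF *, of s]) (use eq der[OF *(1), of s] der[OF *(2), of s] in auto)
    then show "\<gamma> = \<beta>" by (simp add: fun_eq_iff)
  next
    fix \<gamma> m n assume "\<gamma> \<in> {\<gamma>. (\<lambda>t. - \<gamma> t) \<in> M}"
    then show "shift m n \<gamma> \<in> {\<gamma>. (\<lambda>t. - \<gamma> t) \<in> M}" unfolding mem_Collect_eq sh by (rule shift_mem)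
  next
    fix u :: "nat \<Rightarrow> real \<Rightarrow> real" and t
    assume u: "\<And>k. u k \<in> {\<gamma>. (\<lambda>t. - \<gamma> t) \<in> M}" and bd: "bounded (range (\<lambda>k. u k t))"
    have "bounded (range (\<lambda>k. - u k t))" using bounded_uminus[THEN iffD2, OF bd] by (simp add: image_image)
    then obtain r \<beta> where r: "strict_mono r" "\<beta> \<in> M" "\<forall>s. (\<lambda>k. - u (r k) s) \<longlonglongrightarrow> \<beta> s"
      using compactness[of "\<lambda>k t. - u k t" t] u by auto
    then have "\<forall>s. (\<lambda>k. u (r k) s) \<longlonglongrightarrow> - \<beta> s"
      using tendsto_minus[of "\<lambda>k. - u (r k) _" "\<beta> _"] by simp
    then show "\<exists>r \<beta>. strict_mono r \<and> \<beta> \<in> {\<gamma>. (\<lambda>t. - \<gamma> t) \<in> M} \<and> (\<forall>s. (\<lambda>k. u (r k) s) \<longlonglongrightarrow> \<beta> s)"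
      using r by (intro exI[of _ r] exI[of _ "\<lambda>t. - \<beta> t"]) simp
  next
    fix t x
    obtain \<gamma> where "\<gamma> \<in> M" "\<gamma> t = - x" using cover by blast
    then show "\<exists>\<gamma>\<in>{\<gamma>. (\<lambda>t. - \<gamma> t) \<in> M}. \<gamma> t = x" by (intro bexI[of _ "\<lambda>t. - \<gamma> t"]) auto
  next
    fix a b c x y z :: real assume "a < b" "b < c"
    then show "C a (- x) c (- z) \<le> C a (- x) b (- y) + C b (- y) c (- z)" by (rule cost_triangle)
  next
    fix \<gamma> :: "real \<Rightarrow> real" and a b c :: real
    assume "\<gamma> \<in> {\<gamma>. (\<lambda>t. - \<gamma> t) \<in> M}" "a < b" "b < c"
    then show "C a (- \<gamma> a) c (- \<gamma> c) = C a (- \<gamma> a) b (- \<gamma> b) + C b (- \<gamma> b) c (- \<gamma> c)"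
      using cost_additive[of "\<lambda>t. - \<gamma> t" a b c] by simp
  next
    fix a x b y :: real and i j
    show "C a (- (x + of_int i)) b (- (y + of_int j)) = C a (- x) b (- y)"
      by (rule cost_cong_Ints) auto
  next
    fix a x b y :: real and n
    show "C (a + of_int n) (- x) (b + of_int n) (- y) = C a (- x) b (- y)" by (rule cost_time_shift)
  next
    fix \<gamma> \<beta> :: "real \<Rightarrow> real" and s a b
    assume *: "\<gamma> \<in> {\<gamma>. (\<lambda>t. - \<gamma> t) \<in> M}" "\<beta> \<in> {\<gamma>. (\<lambda>t. - \<gamma> t) \<in> M}" "\<gamma> s = \<beta> s" "\<gamma> \<noteq> \<beta>" "a < s" "s < b"
    have "(\<lambda>t. - \<gamma> t) \<noteq> (\<lambda>t. - \<beta> t)" using *(4) by (auto simp: fun_eq_iff)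
    then show "C a (- \<gamma> a) b (- \<beta> b) < C a (- \<gamma> a) s (- \<gamma> s) + C s (- \<beta> s) b (- \<beta> b)"
      using cost_corner[of "\<lambda>t. - \<gamma> t" "\<lambda>t. - \<beta> t" s a b] * by simp
  next
    fix e :: real assume "e > 0"
    then obtain \<delta> where \<delta>: "\<delta> > 0" "\<forall>\<gamma>\<in>M. \<forall>a b x. a + 1 \<le> b \<and> \<bar>x - \<gamma> b\<bar> < \<delta>
      \<longrightarrow> C a (\<gamma> a) b x \<le> C a (\<gamma> a) b (\<gamma> b) + e" using cost_end by blast
    have "C a (- \<gamma> a) b (- x) \<le> C a (- \<gamma> a) b (- \<gamma> b) + e"
      if "(\<lambda>t. - \<gamma> t) \<in> M" "a + 1 \<le> b" "\<bar>x - \<gamma> b\<bar> < \<delta>" for \<gamma> a b x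
    proof -
      have "\<bar>- x - - \<gamma> b\<bar> < \<delta>" using that(3) by linarith
      then show ?thesis using \<delta>(2)[rule_format, OF that(1), of a b "- x"] that(2) by simp
    qed
    then show "\<exists>\<delta>>0. \<forall>\<gamma>\<in>{\<gamma>. (\<lambda>t. - \<gamma> t) \<in> M}. \<forall>a b x. a + 1 \<le> b \<and> \<bar>x - \<gamma> b\<bar> < \<delta>
      \<longrightarrow> C a (- \<gamma> a) b (- x) \<le> C a (- \<gamma> a) b (- \<gamma> b) + e"
      using \<delta>(1) by blast
  next
    fix l :: real assume "l > 0"
    then show "\<exists>K. \<forall>a x y. C a (- x) (a + l) (- y) \<le> K" using cost_bounded by blast
  next
    show "q > 0" by (rule q_pos)
  next
    fix \<gamma> :: "real \<Rightarrow> real" and k t assume "\<gamma> \<in> {\<gamma>. (\<lambda>t. - \<gamma> t) \<in> M}"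
    then show "\<bar>shift (k * - p) (k * q) \<gamma> t - \<gamma> t\<bar> \<le> B"
      using bounded_orbit[of "\<lambda>t. - \<gamma> t" k t] by (simp add: shift_def abs_le_iff)
  qed
qed

lemma Down_no_crossing:
  assumes "\<gamma> \<in> Down" "\<beta> \<in> Down" "\<gamma> s = \<beta> s"
  shows "\<gamma> = \<beta>"
proof -
  interpret R: resonant_curves "{\<gamma>. (\<lambda>t. - \<gamma> t) \<in> M}" "\<lambda>a x b y. C a (- x) b (- y)" "- p" q B
    by (rule reflection)
  have neg: "(\<lambda>t. - \<gamma> t) \<in> R.Up" if "\<gamma> \<in> Down" for \<gamma>
  proof -
    have "- \<gamma> t \<le> shift (- p) q (\<lambda>t. - \<gamma> t) t" for t
    proof -
      have "shift p q \<gamma> t \<le> \<gamma> t" using that by (simp add: Down_def)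
      then show ?thesis by (simp add: shift_def)
    qed
    then show ?thesis using that by (simp add: R.Up_def Down_def)
  qed
  have "(\<lambda>t. - \<gamma> t) = (\<lambda>t. - \<beta> t)"
    by (rule R.Up_no_crossing[OF neg[OF assms(1)] neg[OF assms(2)], where s = s]) (simp add: assms(3))
  then show ?thesis by (simp add: fun_eq_iff)
qed

lemma adjacent_Down:
  assumes nc: "\<forall>\<gamma>\<in>Down. \<gamma> t0 \<noteq> x0"
  shows "\<exists>y\<in>Down. \<exists>z\<in>Down. y t0 < x0 \<and> x0 < z t0 \<and> (\<forall>\<gamma>\<in>Down. \<forall>t. \<not> (y t < \<gamma> t \<and> \<gamma> t < z t)) \<and>
    (y \<in> Per \<and> z \<in> Per \<or>
      (\<exists>\<alpha>\<in>Per. \<exists>\<omega>\<in>Per. (\<forall>t. \<omega> t \<le> y t \<and> z t \<le> \<alpha> t) \<and> connects \<alpha> \<omega> y \<and> connects \<alpha> \<omega> z))"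
proof -
  interpret R: resonant_curves "{\<gamma>. (\<lambda>t. - \<gamma> t) \<in> M}" "\<lambda>a x b y. C a (- x) b (- y)" "- p" q B
    by (rule reflection)
  have neg: "(\<lambda>t. - \<gamma> t) \<in> Down" if "\<gamma> \<in> R.Up" for \<gamma>
  proof -
    have "shift p q (\<lambda>t. - \<gamma> t) t \<le> - \<gamma> t" for t
    proof -
      have "\<gamma> t \<le> shift (- p) q \<gamma> t" using that by (simp add: R.Up_def)
      then show ?thesis by (simp add: shift_def)
    qed
    then show ?thesis using that by (simp add: R.Up_def Down_def)
  qed
  have neg': "(\<lambda>t. - \<gamma> t) \<in> R.Up" if "\<gamma> \<in> Down" for \<gamma>
  proof -
    have "- \<gamma> t \<le> shift (- p) q (\<lambda>t. - \<gamma> t) t" for t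
    proof -
      have "shift p q \<gamma> t \<le> \<gamma> t" using that by (simp add: Down_def)
      then show ?thesis by (simp add: shift_def)
    qed
    then show ?thesis using that by (simp add: R.Up_def Down_def)
  qed
  have negP: "(\<lambda>t. - \<gamma> t) \<in> Per" if "\<gamma> \<in> R.Per" for \<gamma>
  proof -
    have M: "(\<lambda>t. - \<gamma> t) \<in> M" and eq: "shift (- p) q \<gamma> = \<gamma>" using that by (auto simp: R.Per_def)
    have "shift p q (\<lambda>t. - \<gamma> t) t = - \<gamma> t" for t using fun_cong[OF eq, of t] by (simp add: shift_def)
    then have "shift p q (\<lambda>t. - \<gamma> t) = (\<lambda>t. - \<gamma> t)" by (rule ext)
    then show ?thesis using M by (simp add: Per_def)
  qed
  have conn: "connects (\<lambda>t. - \<alpha> t) (\<lambda>t. - \<omega> t) (\<lambda>t. - \<gamma> t)" if "R.connects \<alpha> \<omega> \<gamma>" for \<alpha> \<omega> \<gamma>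
  proof -
    have sh: "shift m n (\<lambda>t. - \<gamma> t) t = - shift (- m) n \<gamma> t" for m n t by (simp add: shift_def)
    show ?thesis using that unfolding connects_def R.connects_def sh by (auto intro!: tendsto_minus)
  qed
  have "\<forall>\<gamma>\<in>R.Up. \<gamma> t0 \<noteq> - x0"
  proof
    fix \<gamma> assume "\<gamma> \<in> R.Up"
    then have "- \<gamma> t0 \<noteq> x0" using nc neg[of \<gamma>] by (auto dest: bspec)
    then show "\<gamma> t0 \<noteq> - x0" by auto
  qed
  from R.adjacent_Up[OF this] obtain y z where yz: "y \<in> R.Up" "z \<in> R.Up" "y t0 < - x0" "- x0 < z t0"
    "\<forall>\<gamma>\<in>R.Up. \<forall>t. \<not> (y t < \<gamma> t \<and> \<gamma> t < z t)"
    and lims: "y \<in> R.Per \<and> z \<in> R.Per \<or>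
      (\<exists>\<alpha>\<in>R.Per. \<exists>\<omega>\<in>R.Per. (\<forall>t. \<alpha> t \<le> y t \<and> z t \<le> \<omega> t) \<and> R.connects \<alpha> \<omega> y \<and> R.connects \<alpha> \<omega> z)"
    by (elim bexE conjE)
  show ?thesis
  proof (rule bexI[OF _ neg[OF yz(2)]], rule bexI[OF _ neg[OF yz(1)]], intro conjI)
    show "- z t0 < x0" "x0 < - y t0" using yz(3,4) by auto
    show "\<forall>\<gamma>\<in>Down. \<forall>t. \<not> (- z t < \<gamma> t \<and> \<gamma> t < - y t)"
    proof (intro ballI allI)
      fix \<gamma> t assume "\<gamma> \<in> Down"
      from yz(5)[rule_format, OF neg'[OF this], of t] show "\<not> (- z t < \<gamma> t \<and> \<gamma> t < - y t)" by auto
    qed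
    show "(\<lambda>t. - z t) \<in> Per \<and> (\<lambda>t. - y t) \<in> Per \<or> (\<exists>\<alpha>\<in>Per. \<exists>\<omega>\<in>Per. (\<forall>t. \<omega> t \<le> - z t \<and> - y t \<le> \<alpha> t) \<and>
      connects \<alpha> \<omega> (\<lambda>t. - z t) \<and> connects \<alpha> \<omega> (\<lambda>t. - y t))"
      using lims
    proof (elim disjE bexE conjE)
      assume "y \<in> R.Per" "z \<in> R.Per"
      then show ?thesis by (intro disjI1 conjI negP)
    next
      fix \<alpha> \<omega> assume *: "\<alpha> \<in> R.Per" "\<omega> \<in> R.Per" "\<forall>t. \<alpha> t \<le> y t \<and> z t \<le> \<omega> t" "R.connects \<alpha> \<omega> y" "R.connects \<alpha> \<omega> z"
      show ?thesis
        by (rule disjI2, rule bexI[OF _ negP[OF *(1)]], rule bexI[OF _ negP[OF *(2)]])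
          (use *(3) conn[OF *(4)] conn[OF *(5)] in simp)
    qed
  qed
qed

text \<open>If a gap between periodic minimizers contains a point missed by \<open>Up\<close> and a point missed by
\<open>Down\<close>, then it contains a strip between adjacent rising curves, from \<open>\<alpha>\<close> up to \<open>\<omega>\<close>, and a strip
between adjacent falling curves, from \<open>\<alpha>'\<close> down to \<open>\<omega>'\<close>. The strips must cross, and a minimizer
through a common interior point is rising or falling, which contradicts adjacency.\<close>

lemma gap_covered:
  assumes nU: "\<forall>\<gamma>\<in>Up. \<gamma> t0 \<noteq> x0" and nD: "\<forall>\<gamma>\<in>Down. \<gamma> t1 \<noteq> x1"
    and gap: "\<And>\<pi>. \<pi> \<in> Per \<Longrightarrow> (\<pi> t0 < x0 \<and> \<pi> t1 < x1) \<or> (x0 < \<pi> t0 \<and> x1 < \<pi> t1)"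
  shows False
proof -
  from adjacent_Up[OF nU] obtain y z where yz: "y \<in> Up" "z \<in> Up" "y t0 < x0" "x0 < z t0"
    and adj: "\<forall>\<gamma>\<in>Up. \<forall>t. \<not> (y t < \<gamma> t \<and> \<gamma> t < z t)"
    and lims: "y \<in> Per \<and> z \<in> Per \<or>
      (\<exists>\<alpha>\<in>Per. \<exists>\<omega>\<in>Per. (\<forall>t. \<alpha> t \<le> y t \<and> z t \<le> \<omega> t) \<and> connects \<alpha> \<omega> y \<and> connects \<alpha> \<omega> z)"
    by (elim bexE conjE)
  from adjacent_Down[OF nD] obtain y' z' where yz': "y' \<in> Down" "z' \<in> Down" "y' t1 < x1" "x1 < z' t1"
    and adj': "\<forall>\<gamma>\<in>Down. \<forall>t. \<not> (y' t < \<gamma> t \<and> \<gamma> t < z' t)"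
    and lims': "y' \<in> Per \<and> z' \<in> Per \<or>
      (\<exists>\<alpha>\<in>Per. \<exists>\<omega>\<in>Per. (\<forall>t. \<omega> t \<le> y' t \<and> z' t \<le> \<alpha> t) \<and> connects \<alpha> \<omega> y' \<and> connects \<alpha> \<omega> z')"
    by (elim bexE conjE)
  have nper: "\<not> (y \<in> Per \<and> z \<in> Per)"
  proof
    assume P: "y \<in> Per \<and> z \<in> Per"
    then have "y t1 < x1" "x1 < z t1" using gap[of y] gap[of z] yz by auto
    then show False using cover[of t1 x1] Up_Down nD adj by metis
  qed
  have nper': "\<not> (y' \<in> Per \<and> z' \<in> Per)"
  proof
    assume P: "y' \<in> Per \<and> z' \<in> Per"
    then have "y' t0 < x0" "x0 < z' t0" using gap[of y'] gap[of z'] yz' by auto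
    then show False using cover[of t0 x0] Up_Down nU adj' by metis
  qed
  obtain \<alpha> \<omega> where \<alpha>\<omega>: "\<alpha> \<in> Per" "\<omega> \<in> Per" "\<And>t. \<alpha> t \<le> y t" "\<And>t. z t \<le> \<omega> t"
      "connects \<alpha> \<omega> y" "connects \<alpha> \<omega> z"
    using lims nper by blast
  obtain \<alpha>' \<omega>' where \<alpha>\<omega>': "\<alpha>' \<in> Per" "\<omega>' \<in> Per" "\<And>t. \<omega>' t \<le> y' t" "\<And>t. z' t \<le> \<alpha>' t"
      "connects \<alpha>' \<omega>' y'" "connects \<alpha>' \<omega>' z'"
    using lims' nper' by blast
  \<comment> \<open>The middle curves of the two strips swap their order between \<open>t = - \<infinity>\<close> and \<open>t = \<infinity>\<close>.\<close>
  define f where "f t = (y t + z t) / 2 - (y' t + z' t) / 2" for t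
  have M: "y \<in> M" "z \<in> M" "y' \<in> M" "z' \<in> M" using yz yz' Per_subset by blast+
  have cont: "continuous_on S f" for S unfolding f_def by (intro continuous_intros cont M) auto
  have "x0 < \<alpha>' t0" using gap[OF \<alpha>\<omega>'(1)] \<alpha>\<omega>'(4)[of t1] yz'(4) by linarith
  then have neg: "\<alpha> t0 < \<alpha>' t0" using \<alpha>\<omega>(3)[of t0] yz(3) by linarith
  have "\<omega>' t0 < x0" using gap[OF \<alpha>\<omega>'(2)] \<alpha>\<omega>'(3)[of t1] yz'(3) by linarith
  then have pos: "\<omega>' t0 < \<omega> t0" using \<alpha>\<omega>(4)[of t0] yz(4) by linarith
  have "(\<lambda>k. f (t0 + of_int (int k * - q))) \<longlonglongrightarrow> (\<alpha> t0 + \<alpha> t0) / 2 - (\<alpha>' t0 + \<alpha>' t0) / 2"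
  proof -
    have "(\<lambda>k. (shift (int k * - p) (int k * - q) y t0 + shift (int k * - p) (int k * - q) z t0) / 2
      - (shift (int k * - p) (int k * - q) y' t0 + shift (int k * - p) (int k * - q) z' t0) / 2)
      \<longlonglongrightarrow> (\<alpha> t0 + \<alpha> t0) / 2 - (\<alpha>' t0 + \<alpha>' t0) / 2"
      using \<alpha>\<omega>(5,6) \<alpha>\<omega>'(5,6) unfolding connects_def by (intro tendsto_intros) simp_all
    then show ?thesis by (simp add: f_def shift_def field_simps)
  qed
  then have "\<forall>\<^sub>F k in sequentially. f (t0 + of_int (int k * - q)) < 0"
    by (rule order_tendstoD(2)) (use neg in simp)
  then obtain k1 where k1: "f (t0 + of_int (int k1 * - q)) < 0" by (auto simp: eventually_sequentially)
  have "(\<lambda>k. f (t0 + of_int (int k * q))) \<longlonglongrightarrow> (\<omega> t0 + \<omega> t0) / 2 - (\<omega>' t0 + \<omega>' t0) / 2"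
  proof -
    have "(\<lambda>k. (shift (int k * p) (int k * q) y t0 + shift (int k * p) (int k * q) z t0) / 2
      - (shift (int k * p) (int k * q) y' t0 + shift (int k * p) (int k * q) z' t0) / 2)
      \<longlonglongrightarrow> (\<omega> t0 + \<omega> t0) / 2 - (\<omega>' t0 + \<omega>' t0) / 2"
      using \<alpha>\<omega>(5,6) \<alpha>\<omega>'(5,6) unfolding connects_def by (intro tendsto_intros) simp_all
    then show ?thesis by (simp add: f_def shift_def field_simps)
  qed
  then have "\<forall>\<^sub>F k in sequentially. f (t0 + of_int (int k * q)) > 0"
    by (rule order_tendstoD(1)) (use pos in simp)
  then obtain k2 where k2: "f (t0 + of_int (int k2 * q)) > 0" by (auto simp: eventually_sequentially)
  have "\<exists>t. f t = 0"
  proof (rule ccontr)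
    assume "\<nexists>t. f t = 0"
    then have "f (t0 + of_int (int k1 * - q)) > 0"
      by (intro continuous_constant_sign[OF cont[of UNIV] _ _ _ _ k2]) auto
    then show False using k1 by simp
  qed
  then obtain t where t: "(y t + z t) / 2 = (y' t + z' t) / 2" by (auto simp: f_def)
  obtain \<gamma> where \<gamma>: "\<gamma> \<in> M" "\<gamma> t = (y t + z t) / 2" using cover by blast
  have "y t < z t" using ordered_Up[OF yz(1,2), of t0] yz by simp
  then have "y t < \<gamma> t" "\<gamma> t < z t" using \<gamma>(2) by auto
  have "y' t < z' t"
    using ordered[of y' z' t1 t] M(3,4) Down_no_crossing[OF yz'(1,2)] yz' by simp
  then have "y' t < \<gamma> t" "\<gamma> t < z' t" using \<gamma>(2) t by auto
  then show False
    using Up_Down[OF \<gamma>(1)] adj adj' \<open>y t < \<gamma> t\<close> \<open>\<gamma> t < z t\<close> by blast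
qed

text \<open>No periodic minimizer separates the curve \<open>\<gamma>\<close> from the point \<open>(t, x)\<close>, or meets either of
them.\<close>

definition same_gap :: "(real \<Rightarrow> real) \<Rightarrow> real \<Rightarrow> real \<Rightarrow> bool" where
  "same_gap \<gamma> t x \<longleftrightarrow> (\<forall>\<pi>\<in>Per. (\<forall>s. \<gamma> s < \<pi> s) \<and> x < \<pi> t \<or> (\<forall>s. \<pi> s < \<gamma> s) \<and> \<pi> t < x)"

definition gap_not_covered_by_Up :: "(real \<Rightarrow> real) \<Rightarrow> bool" where
  "gap_not_covered_by_Up \<gamma> \<longleftrightarrow> (\<exists>t x. same_gap \<gamma> t x \<and> (\<forall>\<beta>\<in>Up. \<beta> t \<noteq> x))"

lemma same_gap_point:
  assumes "\<gamma> \<in> M" "\<beta> \<in> M" "\<gamma> s = \<beta> s" "same_gap \<gamma> t x"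
  shows "same_gap \<beta> t x"
  unfolding same_gap_def
proof
  fix \<pi> assume \<pi>: "\<pi> \<in> Per"
  then show "(\<forall>s. \<beta> s < \<pi> s) \<and> x < \<pi> t \<or> (\<forall>s. \<pi> s < \<beta> s) \<and> \<pi> t < x"
    using assms(3,4) ordered_Per[OF assms(2) \<pi>, of s] unfolding same_gap_def by metis
qed

lemma same_gap_shift:
  assumes "same_gap \<gamma> t x"
  shows "same_gap (shift m n \<gamma>) (t - of_int n) (x + of_int m)"
  unfolding same_gap_def
proof
  fix \<pi> assume "\<pi> \<in> Per"
  then have "shift (- m) (- n) \<pi> \<in> Per" by (rule shift_Per)
  with assms consider "\<forall>s. \<gamma> s < shift (- m) (- n) \<pi> s" "x < shift (- m) (- n) \<pi> t"
    | "\<forall>s. shift (- m) (- n) \<pi> s < \<gamma> s" "shift (- m) (- n) \<pi> t < x"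
    unfolding same_gap_def by blast
  then show "(\<forall>s. shift m n \<gamma> s < \<pi> s) \<and> x + of_int m < \<pi> (t - of_int n)
    \<or> (\<forall>s. \<pi> s < shift m n \<gamma> s) \<and> \<pi> (t - of_int n) < x + of_int m"
  proof cases
    case 1
    have "shift m n \<gamma> s < \<pi> s" for s using 1(1)[rule_format, of "s + of_int n"] by (simp add: shift_def)
    then show ?thesis using 1(2) by (simp add: shift_def)
  next
    case 2
    have "\<pi> s < shift m n \<gamma> s" for s using 2(1)[rule_format, of "s + of_int n"] by (simp add: shift_def)
    then show ?thesis using 2(2) by (simp add: shift_def)
  qed
qed

lemma gap_not_covered_by_Up_shift:
  "gap_not_covered_by_Up (shift m n \<gamma>) \<longleftrightarrow> gap_not_covered_by_Up \<gamma>"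
proof -
  have *: "gap_not_covered_by_Up (shift m n \<gamma>)" if bad: "gap_not_covered_by_Up \<gamma>" for m n \<gamma>
  proof -
    obtain t x where tx: "same_gap \<gamma> t x" "\<forall>\<beta>\<in>Up. \<beta> t \<noteq> x"
      using bad by (auto simp: gap_not_covered_by_Up_def)
    have "\<beta> (t - of_int n) \<noteq> x + of_int m" if "\<beta> \<in> Up" for \<beta>
      using tx(2) shift_Up[OF that, of "- m" "- n"] by (auto simp: shift_def)
    then show ?thesis using same_gap_shift[OF tx(1)] unfolding gap_not_covered_by_Up_def by blast
  qed
  show ?thesis using *[of \<gamma> m n] *[of "shift m n \<gamma>" "- m" "- n"] by (auto simp: shift_shift)
qed

lemma not_same_gap_Per: "\<gamma> \<in> Per \<Longrightarrow> \<not> same_gap \<gamma> t x"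
  unfolding same_gap_def by blast

text \<open>Take the rising minimizers in those gaps that they fill, the falling ones in the other gaps, and
all periodic ones. The choice depends only on the gap and is invariant under integer translations,
and curves from different gaps do not meet.\<close>

lemma resonant_foliation:
  "\<exists>F\<subseteq>M. (\<forall>\<gamma>\<in>F. \<forall>\<beta>\<in>F. \<forall>s. \<gamma> s = \<beta> s \<longrightarrow> \<gamma> = \<beta>) \<and> (\<forall>\<gamma>\<in>F. \<forall>m n. shift m n \<gamma> \<in> F)
    \<and> (\<forall>x t. \<exists>\<gamma>\<in>F. \<gamma> t = x)"
proof -
  define F where "F = {\<gamma> \<in> Up. \<not> gap_not_covered_by_Up \<gamma>} \<union> {\<gamma> \<in> Down. gap_not_covered_by_Up \<gamma>}"
  have FM: "F \<subseteq> M" using Per_subset by (auto simp: F_def)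
  have gap_eq: "gap_not_covered_by_Up \<gamma> \<longleftrightarrow> gap_not_covered_by_Up \<beta>"
    if "\<gamma> \<in> M" "\<beta> \<in> M" "\<gamma> s = \<beta> s" for \<gamma> \<beta> s
    using same_gap_point[OF that] same_gap_point[OF that(2,1) that(3)[symmetric]]
    unfolding gap_not_covered_by_Up_def by blast
  have "\<gamma> = \<beta>" if F: "\<gamma> \<in> F" "\<beta> \<in> F" and s: "\<gamma> s = \<beta> s" for \<gamma> \<beta> s
  proof -
    have "gap_not_covered_by_Up \<gamma> \<longleftrightarrow> gap_not_covered_by_Up \<beta>" using gap_eq F FM s by blast
    then show ?thesis using F Up_no_crossing[of \<gamma> \<beta> s] Down_no_crossing[of \<gamma> \<beta> s] s
      by (auto simp: F_def)
  qed
  moreover have "shift m n \<gamma> \<in> F" if "\<gamma> \<in> F" for \<gamma> m n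
    using that by (auto simp: F_def gap_not_covered_by_Up_shift shift_Up shift_Down)
  moreover have "\<exists>\<gamma>\<in>F. \<gamma> t = x" for x t
  proof -
    obtain \<gamma> where \<gamma>: "\<gamma> \<in> M" "\<gamma> t = x" using cover by blast
    show ?thesis
    proof (cases "\<gamma> \<in> Per")
      case True
      then have "\<gamma> \<in> F" using not_same_gap_Per Per_subset by (auto simp: F_def gap_not_covered_by_Up_def)
      then show ?thesis using \<gamma> by blast
    next
      case nP: False
      show ?thesis
      proof (cases "gap_not_covered_by_Up \<gamma>")
        case True
        then obtain t0 x0 where gap: "same_gap \<gamma> t0 x0" "\<And>\<beta>. \<beta> \<in> Up \<Longrightarrow> \<beta> t0 \<noteq> x0"
          by (auto simp: gap_not_covered_by_Up_def)
        have "\<exists>\<beta>\<in>Down. \<beta> t = x"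
        proof (rule ccontr)
          assume "\<not> (\<exists>\<beta>\<in>Down. \<beta> t = x)"
          then show False
            using gap \<gamma>(2) by (intro gap_covered[of t0 x0 t x]) (auto simp: same_gap_def)
        qed
        then obtain \<beta> where \<beta>: "\<beta> \<in> Down" "\<beta> t = x" by blast
        then have "gap_not_covered_by_Up \<beta>" using gap_eq[OF \<gamma>(1), of \<beta> t] \<gamma>(2) True Per_subset by auto
        then show ?thesis using \<beta> by (auto simp: F_def)
      next
        case False
        have "same_gap \<gamma> t x" unfolding same_gap_def
        proof
          fix \<pi> assume \<pi>: "\<pi> \<in> Per"
          then have "\<gamma> t \<noteq> \<pi> t" using periodic_no_crossing[OF \<pi> \<gamma>(1)] nP by blast
          then show "(\<forall>s. \<gamma> s < \<pi> s) \<and> x < \<pi> t \<or> (\<forall>s. \<pi> s < \<gamma> s) \<and> \<pi> t < x"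
            using ordered_Per[OF \<gamma>(1) \<pi>, of t] \<gamma>(2) by (cases "\<gamma> t < \<pi> t") auto
        qed
        then obtain \<beta> where \<beta>: "\<beta> \<in> Up" "\<beta> t = x" using False by (auto simp: gap_not_covered_by_Up_def)
        then have "\<not> gap_not_covered_by_Up \<beta>" using gap_eq[OF \<gamma>(1), of \<beta> t] \<gamma>(2) False Per_subset by auto
        then show ?thesis using \<beta> by (auto simp: F_def)
      qed
    qed
  qed
  ultimately show ?thesis using FM by (intro exI[of _ F] conjI ballI allI impI) auto
qed

end

context minimizing_curves
begin

theorem foliation:
  "\<exists>F\<subseteq>M. (\<forall>\<gamma>\<in>F. \<forall>\<beta>\<in>F. \<forall>s. \<gamma> s = \<beta> s \<longrightarrow> \<gamma> = \<beta>) \<and> (\<forall>\<gamma>\<in>F. \<forall>m n. shift m n \<gamma> \<in> F)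
    \<and> (\<forall>x t. \<exists>\<gamma>\<in>F. \<gamma> t = x)"
proof -
  obtain \<rho> where \<rho>: "\<And>\<gamma> t n. \<gamma> \<in> M \<Longrightarrow> \<bar>\<gamma> (t + of_int n) - \<gamma> t - of_int n * \<rho>\<bar> \<le> 10"
    using rotation_number by blast
  show ?thesis
  proof (cases "\<rho> \<in> \<rat>")
    case False
    then show ?thesis
      using irrational_no_crossing[of \<rho>, OF \<rho> False] shift_mem cover
      by (intro exI[of _ M] conjI ballI allI impI) auto
  next
    case True
    then obtain a b :: int where ab: "b > 0" "\<rho> = of_int a / of_int b"
      by (elim Rats_cases')
    interpret resonant_curves M C "- a" b 10
    proof (intro resonant_curves.intro minimizing_curves_axioms resonant_curves_axioms.intro)
      fix \<gamma> k t assume "\<gamma> \<in> M"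
      then show "\<bar>shift (k * - a) (k * b) \<gamma> t - \<gamma> t\<bar> \<le> 10"
        using \<rho>[of \<gamma> t "k * b"] ab by (simp add: shift_def algebra_simps)
    qed (rule ab(1))
    show ?thesis by (rule resonant_foliation)
  qed
qed

end

section \<open>Continuously differentiable curves\<close>

lemma C1_differentiable_on_iff_deriv:
  fixes x :: "real \<Rightarrow> real"
  shows "x C1_differentiable_on S \<longleftrightarrow>
    (\<forall>t\<in>S. (x has_real_derivative deriv x t) (at t)) \<and> continuous_on S (deriv x)"
proof
  assume "x C1_differentiable_on S"
  then obtain D where D: "\<And>t. t \<in> S \<Longrightarrow> (x has_real_derivative D t) (at t)" "continuous_on S D"
    by (auto simp: C1_differentiable_on_def has_real_derivative_iff_has_vector_derivative)
  then have eq: "deriv x t = D t" if "t \<in> S" for t using that DERIV_imp_deriv by blast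
  show "(\<forall>t\<in>S. (x has_real_derivative deriv x t) (at t)) \<and> continuous_on S (deriv x)"
    using D eq by (simp cong: continuous_on_cong)
qed (auto simp: C1_differentiable_on_def has_real_derivative_iff_has_vector_derivative)

lemma C1_I:
  fixes x :: "real \<Rightarrow> real"
  assumes "\<And>t. t \<in> S \<Longrightarrow> (x has_real_derivative D t) (at t)" "continuous_on S D"
  shows "x C1_differentiable_on S" "\<And>t. t \<in> S \<Longrightarrow> deriv x t = D t"
  using assms by (auto simp: C1_differentiable_on_def has_real_derivative_iff_has_vector_derivative
      intro!: DERIV_imp_deriv)

lemma C1_has_deriv:
  fixes x :: "real \<Rightarrow> real"
  assumes "x C1_differentiable_on S"
  shows "t \<in> S \<Longrightarrow> (x has_real_derivative deriv x t) (at t)" "continuous_on S (deriv x)" "continuous_on S x"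
  using assms unfolding C1_differentiable_on_iff_deriv
  by (auto intro: DERIV_isCont continuous_at_imp_continuous_on)

lemma C1_affine_perturbation:
  fixes x :: "real \<Rightarrow> real"
  assumes "x C1_differentiable_on S"
  shows "(\<lambda>t. x t + (p + q * (t - r))) C1_differentiable_on S"
    "\<And>t. t \<in> S \<Longrightarrow> deriv (\<lambda>t. x t + (p + q * (t - r))) t = deriv x t + q"
proof -
  have D: "((\<lambda>t. x t + (p + q * (t - r))) has_real_derivative deriv x t + q) (at t)" if "t \<in> S" for t
    by (auto intro!: derivative_eq_intros C1_has_deriv(1)[OF assms that])
  have c: "continuous_on S (\<lambda>t. deriv x t + q)" by (intro continuous_intros C1_has_deriv(2)[OF assms])
  show "(\<lambda>t. x t + (p + q * (t - r))) C1_differentiable_on S"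
    "\<And>t. t \<in> S \<Longrightarrow> deriv (\<lambda>t. x t + (p + q * (t - r))) t = deriv x t + q"
    using C1_I[OF D c] by auto
qed

lemma C1_glue:
  fixes x y :: "real \<Rightarrow> real"
  assumes x: "x C1_differentiable_on {a..b}" and y: "y C1_differentiable_on {b..c}"
    and eq: "x b = y b" and deq: "deriv x b = deriv y b"
  defines "z \<equiv> (\<lambda>t. if t \<le> b then x t else y t)"
  shows "z C1_differentiable_on {a..c}"
    "\<And>t. t \<in> {a..c} \<Longrightarrow> deriv z t = (if t \<le> b then deriv x t else deriv y t)"
proof -
  define D where "D t = (if t \<le> b then deriv x t else deriv y t)" for t
  have der: "(z has_real_derivative D t) (at t)" if t: "t \<in> {a..c}" for t
  proof -
    consider "t < b" | "t > b" | "t = b" by linarith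
    then show ?thesis
    proof cases
      case 1
      have "(x has_real_derivative D t) (at t)" using C1_has_deriv(1)[OF x, of t] 1 t by (simp add: D_def)
      then show ?thesis
        by (rule has_field_derivative_transform_within_open[of _ _ _ "{..<b}"]) (use 1 in \<open>auto simp: z_def\<close>)
    next
      case 2
      have "(y has_real_derivative D t) (at t)" using C1_has_deriv(1)[OF y, of t] 2 t by (simp add: D_def)
      then show ?thesis
        by (rule has_field_derivative_transform_within_open[of _ _ _ "{b<..}"]) (use 2 in \<open>auto simp: z_def\<close>)
    next
      case 3
      then have bc: "b \<in> {a..b}" "b \<in> {b..c}" using t by auto
      have "((\<lambda>u. (z u - z b) / (u - b)) \<longlongrightarrow> deriv x b) (at_left b)"
      proof (rule Lim_transform_eventually)
        show "((\<lambda>u. (x u - x b) / (u - b)) \<longlongrightarrow> deriv x b) (at_left b)"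
          using DERIV_subset[OF C1_has_deriv(1)[OF x bc(1)], of "{..<b}"] by (simp add: has_field_derivative_iff)
        show "\<forall>\<^sub>F u in at_left b. (x u - x b) / (u - b) = (z u - z b) / (u - b)"
          unfolding eventually_at_filter by (rule always_eventually) (auto simp: z_def)
      qed
      moreover have "((\<lambda>u. (z u - z b) / (u - b)) \<longlongrightarrow> deriv x b) (at_right b)"
      proof (rule Lim_transform_eventually)
        show "((\<lambda>u. (y u - y b) / (u - b)) \<longlongrightarrow> deriv x b) (at_right b)"
          using DERIV_subset[OF C1_has_deriv(1)[OF y bc(2)], of "{b<..}"] deq by (simp add: has_field_derivative_iff)
        show "\<forall>\<^sub>F u in at_right b. (y u - y b) / (u - b) = (z u - z b) / (u - b)"
          unfolding eventually_at_filter by (rule always_eventually) (auto simp: z_def eq)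
      qed
      ultimately have "(z has_real_derivative deriv x b) (at b)"
        unfolding has_field_derivative_iff by (rule filterlim_split_at)
      then show ?thesis using 3 by (simp add: D_def)
    qed
  qed
  have cont: "continuous_on {a..c} D"
  proof (cases "a \<le> b \<and> b \<le> c")
    case True
    then have "{a..c} = {a..b} \<union> {b..c}" by auto
    moreover have "continuous_on ({a..b} \<union> {b..c}) D" unfolding D_def
      by (rule continuous_on_If) (use C1_has_deriv(2)[OF x] C1_has_deriv(2)[OF y] deq in auto)
    ultimately show ?thesis by simp
  next
    case False
    then consider "b < a" | "c < b" by linarith
    then show ?thesis
    proof cases
      case 1
      then have "continuous_on {a..c} (deriv y)" using continuous_on_subset[OF C1_has_deriv(2)[OF y], of "{a..c}"] by auto
      moreover have "continuous_on {a..c} D \<longleftrightarrow> continuous_on {a..c} (deriv y)"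
        by (rule continuous_on_cong) (use 1 in \<open>auto simp: D_def\<close>)
      ultimately show ?thesis by simp
    next
      case 2
      then have "continuous_on {a..c} (deriv x)" using continuous_on_subset[OF C1_has_deriv(2)[OF x], of "{a..c}"] by auto
      moreover have "continuous_on {a..c} D \<longleftrightarrow> continuous_on {a..c} (deriv x)"
        by (rule continuous_on_cong) (use 2 in \<open>auto simp: D_def\<close>)
      ultimately show ?thesis by simp
    qed
  qed
  show "z C1_differentiable_on {a..c}"
    "\<And>t. t \<in> {a..c} \<Longrightarrow> deriv z t = (if t \<le> b then deriv x t else deriv y t)"
    using C1_I[OF der cont] by (auto simp: D_def)
qed

lemma antiderivative_exists:
  fixes f :: "real \<Rightarrow> real"
  assumes "continuous_on UNIV f"
  shows "\<exists>F. \<forall>t. (F has_real_derivative f t) (at t)"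
proof -
  have "\<exists>F. \<forall>x::real. -\<infinity> < ereal x \<longrightarrow> ereal x < \<infinity> \<longrightarrow> (F has_vector_derivative f x) (at x)"
    using assms by (intro einterval_antiderivative) (auto simp: continuous_on_eq_continuous_at)
  then show ?thesis by (simp add: has_real_derivative_iff_has_vector_derivative)
qed

lemma integral_deriv:
  fixes f f' :: "real \<Rightarrow> real"
  assumes "a \<le> b" "\<And>t. t \<in> {a..b} \<Longrightarrow> (f has_real_derivative f' t) (at t)"
  shows "integral {a..b} f' = f b - f a" "f' integrable_on {a..b}"
proof -
  have "(f' has_integral (f b - f a)) {a..b}"
    using assms by (intro fundamental_theorem_of_calculus)
      (auto simp: has_real_derivative_iff_has_vector_derivative intro: has_vector_derivative_at_within)
  then show "integral {a..b} f' = f b - f a" "f' integrable_on {a..b}" by (auto simp: has_integral_iff)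
qed

section \<open>Periodic variational problems in one dimension\<close>

text \<open>A Lagrangian \<open>G s v t\<close> on the universal cover, periodic in the position \<open>s\<close> and the time \<open>t\<close>, with
its partial derivatives \<open>Gs\<close> and \<open>Gv\<close>. The flow enters through \<open>W u s v t\<close>, the velocity at time
\<open>t\<close> of the extremal that has position \<open>s\<close> and velocity \<open>v\<close> at time \<open>u\<close>. By \<open>W_extremal\<close>,
extremals are determined by their initial values; \<open>W_cont\<close> reflects completeness and
continuity of the flow.\<close>

locale tonelli =
  fixes G Gs Gv :: "real \<Rightarrow> real \<Rightarrow> real \<Rightarrow> real" and W :: "real \<Rightarrow> real \<Rightarrow> real \<Rightarrow> real \<Rightarrow> real"
  assumes G_periodic: "G (s + 1) v t = G s v t" "G s v (t + 1) = G s v t"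
    and G_cont: "continuous_on UNIV (\<lambda>(s, v, t). G s v t)"
    and Gs_cont: "continuous_on UNIV (\<lambda>(s, v, t). Gs s v t)"
    and Gv_cont: "continuous_on UNIV (\<lambda>(s, v, t). Gv s v t)"
    and G_deriv: "((\<lambda>e. G (s + e * a) (v + e * b) t) has_real_derivative
      Gs (s + e * a) (v + e * b) t * a + Gv (s + e * a) (v + e * b) t * b) (at e)"
    and G_bounded: "\<exists>B. \<forall>s v t. \<bar>v\<bar> \<le> V \<longrightarrow> \<bar>G s v t\<bar> \<le> B"
    and Gs_bounded: "\<exists>B. \<forall>s v t. \<bar>v\<bar> \<le> V \<longrightarrow> \<bar>Gs s v t\<bar> \<le> B"
    and G_lipschitz: "\<exists>K. \<forall>s v t s' v' t'. \<bar>v\<bar> \<le> V \<and> \<bar>v'\<bar> \<le> V \<longrightarrow>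
      \<bar>G s v t - G s' v' t'\<bar> \<le> K * (\<bar>s - s'\<bar> + \<bar>v - v'\<bar> + \<bar>t - t'\<bar>)"
    and Gs_lipschitz: "\<exists>K. \<forall>s v t s' v' t'. \<bar>v\<bar> \<le> V \<and> \<bar>v'\<bar> \<le> V \<longrightarrow>
      \<bar>Gs s v t - Gs s' v' t'\<bar> \<le> K * (\<bar>s - s'\<bar> + \<bar>v - v'\<bar> + \<bar>t - t'\<bar>)"
    and Gv_lipschitz: "\<exists>K. \<forall>s v t s' v' t'. \<bar>v\<bar> \<le> V \<and> \<bar>v'\<bar> \<le> V \<longrightarrow>
      \<bar>Gv s v t - Gv s' v' t'\<bar> \<le> K * (\<bar>s - s'\<bar> + \<bar>v - v'\<bar> + \<bar>t - t'\<bar>)"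
    and Gv_monotone: "\<exists>m>0. \<forall>s v v' t. \<bar>v\<bar> \<le> V \<and> \<bar>v'\<bar> \<le> V \<longrightarrow>
      m * (v - v')\<^sup>2 \<le> (Gv s v t - Gv s v' t) * (v - v')"
    and G_convex: "v \<noteq> w \<Longrightarrow> G s ((v + w) / 2) t < (G s v t + G s w t) / 2"
    and G_superlinear: "\<exists>C. \<forall>s v t. \<bar>v\<bar> - C \<le> G s v t"
    and W_cont: "continuous_on UNIV (\<lambda>(u, s, v, t). W u s v t)"
    and W_periodic: "W (u + 1) s v (t + 1) = W u s v t" "W u (s + 1) v t = W u s v t"
    and W_extremal: "\<lbrakk>a < b; x C1_differentiable_on {a..b};
      \<And>h. \<lbrakk>h C1_differentiable_on {a..b}; h a = 0; h b = 0\<rbrakk> \<Longrightarrow>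
        ((\<lambda>e. integral {a..b} (\<lambda>t. G (x t + e * h t) (deriv (\<lambda>t. x t + e * h t) t) t))
          has_real_derivative 0) (at 0);
      u \<in> {a..b}; t \<in> {a..b}\<rbrakk> \<Longrightarrow> deriv x t = W u (x u) (deriv x u) t"
begin

definition act :: "(real \<Rightarrow> real) \<Rightarrow> real \<Rightarrow> real \<Rightarrow> real" where
  "act x a b = integral {a..b} (\<lambda>t. G (x t) (deriv x t) t)"

definition M :: "(real \<Rightarrow> real) set" where
  "M = {x. x C1_differentiable_on UNIV \<and> (\<forall>a b y. a < b \<and> y C1_differentiable_on {a..b} \<and>
     y a - x a \<in> \<int> \<and> y b - x b \<in> \<int> \<longrightarrow> act x a b \<le> act y a b)}"

lemma G_comp_cont:
  assumes "continuous_on S f" "continuous_on S g" "continuous_on S h"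
  shows "continuous_on S (\<lambda>z. G (f z) (g z) (h z))" "continuous_on S (\<lambda>z. Gs (f z) (g z) (h z))"
    "continuous_on S (\<lambda>z. Gv (f z) (g z) (h z))"
proof -
  have c: "continuous_on S (\<lambda>z. (f z, g z, h z))" by (intro continuous_intros assms)
  show "continuous_on S (\<lambda>z. G (f z) (g z) (h z))" "continuous_on S (\<lambda>z. Gs (f z) (g z) (h z))"
    "continuous_on S (\<lambda>z. Gv (f z) (g z) (h z))"
    using continuous_on_compose2[OF G_cont c] continuous_on_compose2[OF Gs_cont c]
      continuous_on_compose2[OF Gv_cont c] by simp_all
qed

lemma act_integrand:
  assumes "x C1_differentiable_on {a..b}"
  shows "continuous_on {a..b} (\<lambda>t. G (x t) (deriv x t) t)" "(\<lambda>t. G (x t) (deriv x t) t) integrable_on {a..b}"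
proof -
  show c: "continuous_on {a..b} (\<lambda>t. G (x t) (deriv x t) t)"
    by (intro G_comp_cont continuous_intros C1_has_deriv[OF assms])
  show "(\<lambda>t. G (x t) (deriv x t) t) integrable_on {a..b}"
    by (rule integrable_continuous_interval[OF c])
qed

lemma act_additive:
  assumes "x C1_differentiable_on {a..c}" "a \<le> b" "b \<le> c"
  shows "act x a c = act x a b + act x b c"
  unfolding act_def using Henstock_Kurzweil_Integration.integral_combine[OF assms(2,3) act_integrand(2)[OF assms(1)]] by simp

lemma act_lower: "\<exists>C. \<forall>x a b. a \<le> b \<longrightarrow> x C1_differentiable_on {a..b} \<longrightarrow> - C * (b - a) \<le> act x a b"
proof -
  obtain C where C: "\<And>s v t. \<bar>v\<bar> - C \<le> G s v t" using G_superlinear by blast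
  have "- C * (b - a) \<le> act x a b" if "a \<le> b" "x C1_differentiable_on {a..b}" for x a b
  proof -
    have "integral {a..b} (\<lambda>t. - C) \<le> act x a b" unfolding act_def
    proof (rule integral_le[OF integrable_const_ivl act_integrand(2)[OF that(2)]])
      show "- C \<le> G (x t) (deriv x t) t" for t using C[of "deriv x t" "x t" t] by simp
    qed
    then show ?thesis using that(1) by (simp add: mult.commute)
  qed
  then show ?thesis by blast
qed

text \<open>Pointwise limits of velocities suffice, since the velocities are bounded. The limit \<open>w\<close> of the
velocities may be discontinuous.\<close>

lemma act_tendsto:
  fixes y :: "nat \<Rightarrow> real \<Rightarrow> real"
  assumes y: "\<And>k. y k C1_differentiable_on {a..b}" and V: "\<And>k t. t \<in> {a..b} \<Longrightarrow> \<bar>deriv (y k) t\<bar> \<le> V"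
    and z: "\<And>t. t \<in> {a..b} \<Longrightarrow> (\<lambda>k. y k t) \<longlonglongrightarrow> z t"
    and w: "\<And>t. t \<in> {a..b} \<Longrightarrow> (\<lambda>k. deriv (y k) t) \<longlonglongrightarrow> w t"
  shows "(\<lambda>t. G (z t) (w t) t) integrable_on {a..b}"
    "(\<lambda>k. act (y k) a b) \<longlonglongrightarrow> integral {a..b} (\<lambda>t. G (z t) (w t) t)"
proof -
  obtain B where B: "\<And>s v t. \<bar>v\<bar> \<le> V \<Longrightarrow> \<bar>G s v t\<bar> \<le> B" using G_bounded[of V] by blast
  have lim: "(\<lambda>k. G (y k t) (deriv (y k) t) t) \<longlonglongrightarrow> G (z t) (w t) t" if "t \<in> {a..b}" for t
  proof -
    have "(\<lambda>k. (y k t, deriv (y k) t, t)) \<longlonglongrightarrow> (z t, w t, t)"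
      by (intro tendsto_Pair z w that tendsto_const)
    from continuous_on_tendsto_compose[OF G_cont this] show ?thesis by simp
  qed
  have *: "norm (G (y k t) (deriv (y k) t) t) \<le> B" if "t \<in> {a..b}" for k t
    using B[OF V[OF that]] by simp
  show "(\<lambda>t. G (z t) (w t) t) integrable_on {a..b}"
    by (rule dominated_convergence(1)[OF act_integrand(2)[OF y] integrable_const_ivl * lim])
  show "(\<lambda>k. act (y k) a b) \<longlonglongrightarrow> integral {a..b} (\<lambda>t. G (z t) (w t) t)"
    unfolding act_def
    by (rule dominated_convergence(2)[OF act_integrand(2)[OF y] integrable_const_ivl * lim])
qed

text \<open>Tilt \<open>y\<close> by a linear function so that its slope at \<open>b\<close> matches that of \<open>x\<close>. This makes the glued
curve \<open>f\<close> continuously differentiable, and the original broken curve is \<open>f\<close> plus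
\<open>j * max 0 (t - b)\<close>, where \<open>j\<close> is the jump of the slopes. Replace \<open>max 0 (t - b)\<close> by the smooth
functions \<open>\<sigma> n t = (sqrt ((t - b)\<^sup>2 + (r n)\<^sup>2) + (t - b)) / 2\<close> with \<open>r n\<close> tending to \<open>0\<close>, corrected
by affine functions to keep the endpoints. The velocities stay bounded and converge pointwise.\<close>

lemma round_corner:
  assumes ab: "a < b" "b < c" and x: "x C1_differentiable_on {a..b}" and y: "y C1_differentiable_on {b..c}"
    and eq: "x b = y b" and e: "e > 0"
  shows "\<exists>z. z C1_differentiable_on {a..c} \<and> z a = x a \<and> z c = y c \<and> act z a c \<le> act x a b + act y b c + e"
proof -
  define j where "j = deriv y b - deriv x b"
  define y' where "y' t = y t + (0 + (- j) * (t - b))" for t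
  have y': "y' C1_differentiable_on {b..c}" "\<And>t. t \<in> {b..c} \<Longrightarrow> deriv y' t = deriv y t + - j"
    unfolding y'_def by (rule C1_affine_perturbation[OF y], assumption?)+
  define f where "f t = (if t \<le> b then x t else y' t)" for t
  have f: "f C1_differentiable_on {a..c}"
    "\<And>t. t \<in> {a..c} \<Longrightarrow> deriv f t = (if t \<le> b then deriv x t else deriv y' t)"
    unfolding f_def
    by (rule C1_glue[OF x y'(1)]; use ab eq y'(2)[of b] in \<open>simp add: y'_def j_def\<close>)+
  define r :: "nat \<Rightarrow> real" where "r = (\<lambda>n. inverse (real (Suc n)))"
  have r: "r n > 0" "r n \<le> 1" "r \<longlonglongrightarrow> 0" for n
  proof -
    show "r n > 0" by (simp add: r_def)
    show "r n \<le> 1" unfolding r_def by (simp only: inverse_le_1_iff) simp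
    show "r \<longlonglongrightarrow> 0" unfolding r_def by (rule LIMSEQ_inverse_real_of_nat)
  qed
  define q where "q n t = sqrt ((t - b)\<^sup>2 + (r n)\<^sup>2)" for n t
  have q_pos: "(t - b)\<^sup>2 + (r n)\<^sup>2 > 0" for n t using r(1)[of n] by (simp add: add_nonneg_pos)
  then have q0: "q n t > 0" for n t by (simp add: q_def)
  define \<sigma> where "\<sigma> n t = (q n t + (t - b)) / 2" for n t
  define \<sigma>' where "\<sigma>' n t = ((t - b) / q n t + 1) / 2" for n t
  have \<sigma>_der: "(\<sigma> n has_real_derivative \<sigma>' n t) (at t)" for n t
  proof -
    have "((\<lambda>t. (t - b)\<^sup>2 + (r n)\<^sup>2) has_real_derivative 2 * (t - b)) (at t)"
      by (auto intro!: derivative_eq_intros)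
    from DERIV_chain2[OF DERIV_real_sqrt[OF q_pos] this]
    have "(q n has_real_derivative inverse (q n t) / 2 * (2 * (t - b))) (at t)" by (simp add: q_def[abs_def])
    moreover have "((\<lambda>t. t - b) has_real_derivative 1) (at t)" by (auto intro!: derivative_eq_intros)
    ultimately have "((\<lambda>t. (q n t + (t - b)) / 2) has_real_derivative
      (inverse (q n t) / 2 * (2 * (t - b)) + 1) / 2) (at t)" by (intro DERIV_cdivide DERIV_add)
    moreover have "(inverse (q n t) / 2 * (2 * (t - b)) + 1) / 2 = \<sigma>' n t"
    proof -
      have "inverse u / 2 * (2 * w) = w / u" for u w :: real by (simp add: inverse_eq_divide)
      then show ?thesis by (simp only: \<sigma>'_def)
    qed
    moreover have "\<sigma> n = (\<lambda>t. (q n t + (t - b)) / 2)" by (simp add: \<sigma>_def fun_eq_iff)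
    ultimately show ?thesis by simp
  qed
  have q_abs: "\<bar>t - b\<bar> \<le> q n t" "q n t \<le> \<bar>t - b\<bar> + 1" for n t
  proof -
    have "sqrt ((t - b)\<^sup>2) \<le> q n t" unfolding q_def by (rule real_sqrt_le_mono) simp
    then show "\<bar>t - b\<bar> \<le> q n t" by simp
    have "q n t \<le> sqrt ((t - b)\<^sup>2) + sqrt ((r n)\<^sup>2)" unfolding q_def
      by (rule sqrt_add_le_add_sqrt) auto
    then show "q n t \<le> \<bar>t - b\<bar> + 1" using r(1,2)[of n] by simp
  qed
  have \<sigma>'01: "0 \<le> \<sigma>' n t" "\<sigma>' n t \<le> 1" for n t
  proof -
    have "\<bar>(t - b) / q n t\<bar> \<le> 1" using q_abs(1)[of t n] q0[of n t] by (simp add: abs_of_pos divide_le_eq_1)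
    then have "- 1 \<le> (t - b) / q n t" "(t - b) / q n t \<le> 1" unfolding abs_le_iff by linarith+
    then show "0 \<le> \<sigma>' n t" "\<sigma>' n t \<le> 1" by (simp_all add: \<sigma>'_def)
  qed
  have q_lim: "(\<lambda>n. q n t) \<longlonglongrightarrow> \<bar>t - b\<bar>" for t
  proof -
    have "(\<lambda>n. q n t) \<longlonglongrightarrow> sqrt ((t - b)\<^sup>2 + 0\<^sup>2)" unfolding q_def by (intro tendsto_intros r)
    then show ?thesis by simp
  qed
  have \<sigma>_lim: "(\<lambda>n. \<sigma> n t) \<longlonglongrightarrow> max 0 (t - b)" for t
  proof -
    have "(\<lambda>n. \<sigma> n t) \<longlonglongrightarrow> (\<bar>t - b\<bar> + (t - b)) / 2" unfolding \<sigma>_def by (intro tendsto_intros q_lim) simp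
    moreover have "(\<bar>t - b\<bar> + (t - b)) / 2 = max 0 (t - b)" by (simp add: max_def abs_if)
    ultimately show ?thesis by simp
  qed
  have \<sigma>'_lim: "(\<lambda>n. \<sigma>' n t) \<longlonglongrightarrow> (if t < b then 0 else if t = b then 1/2 else 1)" for t
  proof (cases "t = b")
    case False
    have "(\<lambda>n. \<sigma>' n t) \<longlonglongrightarrow> ((t - b) / \<bar>t - b\<bar> + 1) / 2"
      unfolding \<sigma>'_def by (intro tendsto_intros q_lim) (use False in auto)
    moreover have "((t - b) / \<bar>t - b\<bar> + 1) / 2 = (if t < b then 0 else if t = b then 1/2 else 1)"
      using False by (auto simp: abs_if field_simps)
    ultimately show ?thesis by simp
  qed (simp add: \<sigma>'_def)
  define \<epsilon>a where "\<epsilon>a n = \<sigma> n a" for n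
  define \<epsilon>c where "\<epsilon>c n = (\<sigma> n c - (c - b) - \<epsilon>a n) / (c - a)" for n
  have \<epsilon>_lim: "\<epsilon>a \<longlonglongrightarrow> 0" "\<epsilon>c \<longlonglongrightarrow> 0"
  proof -
    show 1: "\<epsilon>a \<longlonglongrightarrow> 0" using \<sigma>_lim[of a] ab by (simp add: \<epsilon>a_def[abs_def])
    have "\<epsilon>c \<longlonglongrightarrow> (max 0 (c - b) - (c - b) - 0) / (c - a)"
      unfolding \<epsilon>c_def[abs_def] by (intro tendsto_intros \<sigma>_lim 1) (use ab in simp)
    then show "\<epsilon>c \<longlonglongrightarrow> 0" using ab by simp
  qed
  define z where "z n t = f t + j * (\<sigma> n t - \<epsilon>a n - \<epsilon>c n * (t - a))" for n t
  have z: "z n C1_differentiable_on {a..c}"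
    "\<And>t. t \<in> {a..c} \<Longrightarrow> deriv (z n) t = deriv f t + j * (\<sigma>' n t - \<epsilon>c n)" for n
  proof -
    have D: "(z n has_real_derivative deriv f t + j * (\<sigma>' n t - \<epsilon>c n)) (at t)" if "t \<in> {a..c}" for t
      unfolding z_def
      by (auto intro!: derivative_eq_intros \<sigma>_der C1_has_deriv(1)[OF f(1) that])
    have "continuous_on {a..c} (\<lambda>t. deriv f t + j * (\<sigma>' n t - \<epsilon>c n))"
      unfolding \<sigma>'_def q_def
      by (intro continuous_intros C1_has_deriv(2)[OF f(1)]) (use q_pos in \<open>auto simp: less_le\<close>)
    from C1_I[OF D this] show "z n C1_differentiable_on {a..c}"
      "\<And>t. t \<in> {a..c} \<Longrightarrow> deriv (z n) t = deriv f t + j * (\<sigma>' n t - \<epsilon>c n)" by auto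
  qed
  obtain E where "\<forall>t\<in>{a..c}. \<bar>deriv f t\<bar> \<le> E"
    using compact_imp_bounded[OF compact_continuous_image[OF C1_has_deriv(2)[OF f(1)] compact_Icc]]
    by (auto simp: bounded_iff)
  then have E: "\<And>t. t \<in> {a..c} \<Longrightarrow> \<bar>deriv f t\<bar> \<le> E" by blast
  obtain E' where E': "\<And>n. \<bar>\<epsilon>c n\<bar> \<le> E'"
    using Bseq_def[of \<epsilon>c] convergent_imp_Bseq[OF convergentI[OF \<epsilon>_lim(2)]] by auto
  define V where "V = E + \<bar>j\<bar> * (1 + E')"
  have V: "\<bar>deriv (z n) t\<bar> \<le> V" if "t \<in> {a..c}" for n t
  proof -
    have "\<bar>j * (\<sigma>' n t - \<epsilon>c n)\<bar> \<le> \<bar>j\<bar> * (1 + E')"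
      unfolding abs_mult using \<sigma>'01[of n t] E'[of n] by (intro mult_left_mono) auto
    then show ?thesis using E[OF that] z(2)[OF that, of n] by (simp add: V_def)
  qed
  define zl where "zl t = (if t \<le> b then x t else y t)" for t
  define wl where "wl t = (if t < b then deriv x t else if t = b then deriv f b + j * (1/2) else deriv y t)" for t
  have lim1: "(\<lambda>n. z n t) \<longlonglongrightarrow> zl t" for t
  proof -
    have "(\<lambda>n. z n t) \<longlonglongrightarrow> f t + j * (max 0 (t - b) - 0 - 0 * (t - a))"
      unfolding z_def by (intro tendsto_intros \<sigma>_lim \<epsilon>_lim)
    also have "f t + j * (max 0 (t - b) - 0 - 0 * (t - a)) = zl t"
      by (simp add: f_def y'_def zl_def max_def)
    finally show ?thesis .
  qed
  have lim2: "(\<lambda>n. deriv (z n) t) \<longlonglongrightarrow> wl t" if t: "t \<in> {a..c}" for t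
  proof -
    have "(\<lambda>n. deriv (z n) t) \<longlonglongrightarrow> deriv f t + j * ((if t < b then 0 else if t = b then 1/2 else 1) - 0)"
      unfolding z(2)[OF t] by (intro tendsto_intros \<sigma>'_lim \<epsilon>_lim)
    also have "deriv f t + j * ((if t < b then 0 else if t = b then 1/2 else 1) - 0) = wl t"
      using f(2)[OF t] y'(2)[of t] t by (auto simp: wl_def)
    finally show ?thesis .
  qed
  note conv = act_tendsto[of z a c V zl wl, OF z(1) V lim1 lim2]
  have "integral {a..c} (\<lambda>t. G (zl t) (wl t) t) =
    integral {a..b} (\<lambda>t. G (zl t) (wl t) t) + integral {b..c} (\<lambda>t. G (zl t) (wl t) t)"
    using Henstock_Kurzweil_Integration.integral_combine[OF _ _ conv(1)] ab by simp
  also have "integral {a..b} (\<lambda>t. G (zl t) (wl t) t) = act x a b" unfolding act_def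
    by (rule integral_spike[of "{b}"]) (auto simp: zl_def wl_def)
  also have "integral {b..c} (\<lambda>t. G (zl t) (wl t) t) = act y b c" unfolding act_def
    by (rule integral_spike[of "{b}"]) (auto simp: zl_def wl_def eq)
  finally have "(\<lambda>n. act (z n) a c) \<longlonglongrightarrow> act x a b + act y b c" using conv(2) by simp
  then have "\<forall>\<^sub>F n in sequentially. act (z n) a c < act x a b + act y b c + e"
    using e by (intro order_tendstoD(2)) auto
  then obtain n where n: "act (z n) a c < act x a b + act y b c + e" by (auto simp: eventually_sequentially)
  have "z n a = x a" using ab by (simp add: z_def f_def \<epsilon>a_def)
  moreover have "z n c = y c"
  proof -
    have "\<epsilon>c n * (c - a) = \<sigma> n c - (c - b) - \<epsilon>a n" using ab by (simp add: \<epsilon>c_def)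
    then have "\<sigma> n c - \<epsilon>a n - \<epsilon>c n * (c - a) = c - b" by simp
    then have "z n c = f c + j * (c - b)" by (simp add: z_def)
    then show ?thesis using ab by (simp add: f_def y'_def)
  qed
  ultimately show ?thesis using z(1)[of n] n by (intro exI[of _ "z n"]) auto
qed


section \<open>Minimal action and velocity bounds\<close>

definition competitors :: "real \<Rightarrow> real \<Rightarrow> real \<Rightarrow> real \<Rightarrow> (real \<Rightarrow> real) set" where
  "competitors a x b y = {z. z C1_differentiable_on {a..b} \<and> z a - x \<in> \<int> \<and> z b - y \<in> \<int>}"

definition cost :: "real \<Rightarrow> real \<Rightarrow> real \<Rightarrow> real \<Rightarrow> real" where
  "cost a x b y = (INF z\<in>competitors a x b y. act z a b)"

lemma M_iff: "x \<in> M \<longleftrightarrow> x C1_differentiable_on UNIV \<and>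
    (\<forall>a b. a < b \<longrightarrow> (\<forall>y\<in>competitors a (x a) b (x b). act x a b \<le> act y a b))"
  by (auto simp: M_def competitors_def)

lemma M_C1: "x \<in> M \<Longrightarrow> x C1_differentiable_on S"
  unfolding M_iff using C1_differentiable_on_subset by blast

lemma affine_competitor:
  assumes "a < b"
  shows "(\<lambda>t. x + (y - x) / (b - a) * (t - a)) \<in> competitors a x b y"
    "deriv (\<lambda>t. x + (y - x) / (b - a) * (t - a)) t = (y - x) / (b - a)"
proof -
  have D: "((\<lambda>t. x + (y - x) / (b - a) * (t - a)) has_real_derivative (y - x) / (b - a)) (at t)" for t
    using assms by (auto intro!: derivative_eq_intros)
  show "deriv (\<lambda>t. x + (y - x) / (b - a) * (t - a)) t = (y - x) / (b - a)" by (rule DERIV_imp_deriv[OF D])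
  have "(\<lambda>t. x + (y - x) / (b - a) * (t - a)) C1_differentiable_on {a..b}"
    by (rule C1_I(1)[OF D]) simp
  then show "(\<lambda>t. x + (y - x) / (b - a) * (t - a)) \<in> competitors a x b y"
    using assms by (simp add: competitors_def)
qed

lemma act_upper:
  assumes "a \<le> b" "z C1_differentiable_on {a..b}" "\<And>t. t \<in> {a..b} \<Longrightarrow> G (z t) (deriv z t) t \<le> B"
  shows "act z a b \<le> B * (b - a)"
proof -
  have "act z a b \<le> integral {a..b} (\<lambda>t. B)" unfolding act_def
    by (rule integral_le[OF act_integrand(2)[OF assms(2)] integrable_const_ivl assms(3)])
  then show ?thesis using assms(1) by (simp add: mult.commute)
qed

lemma act_lower_bound:
  assumes "a \<le> b" "z C1_differentiable_on {a..b}" "\<And>t. t \<in> {a..b} \<Longrightarrow> B \<le> G (z t) (deriv z t) t"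
  shows "B * (b - a) \<le> act z a b"
proof -
  have "integral {a..b} (\<lambda>t. B) \<le> act z a b" unfolding act_def
    by (rule integral_le[OF integrable_const_ivl act_integrand(2)[OF assms(2)] assms(3)])
  then show ?thesis using assms(1) by (simp add: mult.commute)
qed

lemma bdd_below_act: "a < b \<Longrightarrow> bdd_below ((\<lambda>z. act z a b) ` competitors a x b y)"
proof -
  assume "a < b"
  obtain C where "\<forall>x a b. a \<le> b \<longrightarrow> x C1_differentiable_on {a..b} \<longrightarrow> - C * (b - a) \<le> act x a b"
    using act_lower by blast
  then show ?thesis using \<open>a < b\<close> by (intro bdd_belowI2[of _ "- C * (b - a)"]) (auto simp: competitors_def)
qed

lemma cost_le: "a < b \<Longrightarrow> z \<in> competitors a x b y \<Longrightarrow> cost a x b y \<le> act z a b"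
  unfolding cost_def by (rule cINF_lower[OF bdd_below_act])

lemma cost_approx:
  assumes "a < b" "e > 0" shows "\<exists>z\<in>competitors a x b y. act z a b < cost a x b y + e"
proof -
  have "Inf ((\<lambda>z. act z a b) ` competitors a x b y) < cost a x b y + e"
    using assms by (simp add: cost_def)
  then show ?thesis
    using cInf_lessD[of "(\<lambda>z. act z a b) ` competitors a x b y"] affine_competitor(1)[OF assms(1)] by blast
qed

lemma cost_minimizer:
  assumes "\<gamma> \<in> M" "a < b" shows "cost a (\<gamma> a) b (\<gamma> b) = act \<gamma> a b"
proof (rule antisym)
  show "cost a (\<gamma> a) b (\<gamma> b) \<le> act \<gamma> a b"
    using assms M_C1 by (intro cost_le) (auto simp: competitors_def)
  show "act \<gamma> a b \<le> cost a (\<gamma> a) b (\<gamma> b)" unfolding cost_def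
  proof (rule cINF_greatest)
    show "competitors a (\<gamma> a) b (\<gamma> b) \<noteq> {}" using affine_competitor(1)[OF assms(2)] by blast
  qed (use assms in \<open>auto simp: M_iff\<close>)
qed

lemma G_int_periodic: "G (s + of_int m) v (t + of_int n) = G s v t"
  using int_periodic[of "\<lambda>s. G s v (t + of_int n)" s m] int_periodic[of "\<lambda>t. G s v t" t n]
  by (simp add: G_periodic)

lemma shift_C1:
  assumes "z C1_differentiable_on {a + of_int n..b + of_int n}"
  shows "shift m n z C1_differentiable_on {a..b}"
    "\<And>t. t \<in> {a..b} \<Longrightarrow> deriv (shift m n z) t = deriv z (t + of_int n)"
    "act (shift m n z) a b = act z (a + of_int n) (b + of_int n)"
proof -
  have D: "(shift m n z has_real_derivative deriv z (t + of_int n)) (at t)" if "t \<in> {a..b}" for t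
  proof -
    have "(z has_real_derivative deriv z (t + of_int n)) (at (t + of_int n))"
      using C1_has_deriv(1)[OF assms] that by simp
    then have "((\<lambda>t. z (t + of_int n)) has_real_derivative deriv z (t + of_int n)) (at t)"
      by (simp add: DERIV_shift)
    from DERIV_add[OF this DERIV_const] show ?thesis unfolding shift_def[abs_def] by simp
  qed
  have c: "continuous_on {a..b} (\<lambda>t. deriv z (t + of_int n))"
    by (rule continuous_on_compose2[OF C1_has_deriv(2)[OF assms]]) (auto intro!: continuous_intros)
  show "shift m n z C1_differentiable_on {a..b}" by (rule C1_I(1)[OF D c])
  show d: "deriv (shift m n z) t = deriv z (t + of_int n)" if "t \<in> {a..b}" for t
    by (rule C1_I(2)[OF D c that])
  have "act (shift m n z) a b = integral {a..b} ((\<lambda>t. G (z t) (deriv z t) t) \<circ> (\<lambda>t. t + of_int n))"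
    unfolding act_def
    by (rule integral_cong)
      (use G_int_periodic[of _ m _ _ 0] G_int_periodic[of _ 0 _ _ n] in \<open>simp add: d shift_def\<close>)
  also have "\<dots> = act z (a + of_int n) (b + of_int n)" unfolding act_def
    using integral_shift_Icc_real[of a b "\<lambda>t. G (z t) (deriv z t) t" "of_int n"] by (simp add: o_def add.commute)
  finally show "act (shift m n z) a b = act z (a + of_int n) (b + of_int n)" .
qed

lemma shift_competitor:
  assumes "z \<in> competitors a x b y"
  shows "shift m (- n) z \<in> competitors (a + of_int n) x (b + of_int n) y"
    "act (shift m (- n) z) (a + of_int n) (b + of_int n) = act z a b"
proof -
  have z: "z C1_differentiable_on {(a + of_int n) + of_int (- n)..(b + of_int n) + of_int (- n)}"
    using assms by (simp add: competitors_def)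
  have "z a + of_int m - x \<in> \<int>" "z b + of_int m - y \<in> \<int>"
    using assms Ints_add[OF _ Ints_of_int[of m], of "z a - x"] Ints_add[OF _ Ints_of_int[of m], of "z b - y"]
    by (simp_all add: competitors_def algebra_simps)
  then show "shift m (- n) z \<in> competitors (a + of_int n) x (b + of_int n) y"
    using shift_C1(1)[OF z, of m] by (simp add: competitors_def shift_def)
  show "act (shift m (- n) z) (a + of_int n) (b + of_int n) = act z a b"
    using shift_C1(3)[OF z, of m] by simp
qed

lemma shift_mem_M: assumes "\<gamma> \<in> M" shows "shift m n \<gamma> \<in> M"
  unfolding M_iff
proof (intro conjI allI impI ballI)
  have D: "(shift m n \<gamma> has_real_derivative deriv \<gamma> (t + of_int n)) (at t)" for t
  proof -
    have "((\<lambda>t. \<gamma> (t + of_int n)) has_real_derivative deriv \<gamma> (t + of_int n)) (at t)"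
      using C1_has_deriv(1)[OF M_C1[OF assms, of UNIV], of "t + of_int n"] by (simp add: DERIV_shift)
    from DERIV_add[OF this DERIV_const] show ?thesis unfolding shift_def[abs_def] by simp
  qed
  show "shift m n \<gamma> C1_differentiable_on UNIV"
    by (rule C1_I(1)[OF D]) (rule continuous_on_compose2[OF C1_has_deriv(2)[OF M_C1[OF assms, of UNIV]]],
      auto intro!: continuous_intros)
  fix a b y assume ab: "a < b" and y: "y \<in> competitors a (shift m n \<gamma> a) b (shift m n \<gamma> b)"
  have "y a - \<gamma> (a + of_int n) \<in> \<int>" "y b - \<gamma> (b + of_int n) \<in> \<int>"
    using y Ints_add[OF _ Ints_of_int[of m], of "y a - shift m n \<gamma> a"]
      Ints_add[OF _ Ints_of_int[of m], of "y b - shift m n \<gamma> b"]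
    by (simp_all add: competitors_def shift_def)
  then have y': "y \<in> competitors a (\<gamma> (a + of_int n)) b (\<gamma> (b + of_int n))"
    using y by (simp add: competitors_def)
  have "act (shift m n \<gamma>) a b = act \<gamma> (a + of_int n) (b + of_int n)" by (rule shift_C1(3)[OF M_C1[OF assms]])
  also have "\<dots> \<le> act (shift 0 (- n) y) (a + of_int n) (b + of_int n)"
    using assms ab shift_competitor(1)[OF y', of 0 n] by (simp add: M_iff)
  also have "\<dots> = act y a b" by (rule shift_competitor(2)[OF y'])
  finally show "act (shift m n \<gamma>) a b \<le> act y a b" .
qed

lemma cost_space_shift: "cost a (x + of_int i) b (y + of_int j) = cost a x b y"
proof -
  have "z - (x + of_int i) \<in> \<int> \<longleftrightarrow> z - x \<in> \<int>" for z x i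
    using Ints_add[OF _ Ints_of_int[of i], of "z - (x + of_int i)"] Ints_diff[OF _ Ints_of_int[of i], of "z - x"]
    by (auto simp: algebra_simps)
  then have "competitors a (x + of_int i) b (y + of_int j) = competitors a x b y"
    unfolding competitors_def by blast
  then show ?thesis by (simp add: cost_def)
qed

lemma cost_time_shift: "cost (a + of_int n) x (b + of_int n) y = cost a x b y"
proof -
  have "(\<lambda>z. act z a b) ` competitors a x b y \<subseteq> (\<lambda>z. act z (a + of_int n) (b + of_int n)) ` competitors (a + of_int n) x (b + of_int n) y" for a b n
    using shift_competitor[of _ a x b y 0 n] by (force simp: image_iff)
  from this[of a b n] this[of "a + of_int n" "b + of_int n" "- n"]
  have "(\<lambda>z. act z a b) ` competitors a x b y = (\<lambda>z. act z (a + of_int n) (b + of_int n)) ` competitors (a + of_int n) x (b + of_int n) y"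
    by (intro subset_antisym) simp_all
  then show ?thesis by (simp add: cost_def)
qed

text \<open>Translate the second of two nearly optimal curves by an integer so that it starts where the first
one ends, and round the corner.\<close>

lemma cost_triangle:
  assumes "a < b" "b < c" shows "cost a x c z \<le> cost a x b y + cost b y c z"
proof (rule field_le_epsilon)
  fix e :: real assume e: "e > 0"
  obtain u where u: "u \<in> competitors a x b y" "act u a b < cost a x b y + e / 3"
    using cost_approx[OF assms(1), of "e / 3"] e by auto
  obtain w where w: "w \<in> competitors b y c z" "act w b c < cost b y c z + e / 3"
    using cost_approx[OF assms(2), of "e / 3"] e by auto
  have "(u b - y) - (w b - y) \<in> \<int>" using u w by (intro Ints_diff[of "u b - y"]) (auto simp: competitors_def)
  then obtain k where k: "u b - w b = of_int k" by (auto elim: Ints_cases)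
  define w' where "w' = shift k (- 0) w"
  have w': "w' \<in> competitors b y c z" "act w' b c = act w b c"
    using shift_competitor[OF w(1), of k 0] by (simp_all add: w'_def)
  have eq: "u b = w' b" using k by (simp add: w'_def shift_def)
  obtain v where v: "v C1_differentiable_on {a..c}" "v a = u a" "v c = w' c" "act v a c \<le> act u a b + act w' b c + e / 3"
  proof -
    have "u C1_differentiable_on {a..b}" "w' C1_differentiable_on {b..c}" "e / 3 > 0"
      using u(1) w'(1) e by (simp_all add: competitors_def)
    from round_corner[OF assms this(1,2) eq this(3)] show ?thesis using that by blast
  qed
  have "v \<in> competitors a x c z" using v(1-3) u(1) w'(1) by (simp add: competitors_def)
  then have "cost a x c z \<le> act v a c" using assms by (intro cost_le) auto
  then show "cost a x c z \<le> cost a x b y + cost b y c z + e" using v(4) u(2) w(2) w'(2) by linarith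
qed

lemma cost_bounded:
  assumes "l > 0" shows "\<exists>K. \<forall>a x y. cost a x (a + l) y \<le> K"
proof -
  obtain B where B: "\<And>s v t. \<bar>v\<bar> \<le> 1 / l \<Longrightarrow> \<bar>G s v t\<bar> \<le> B" using G_bounded by blast
  have "cost a x (a + l) y \<le> B * l" for a x y
  proof -
    define y' where "y' = y + of_int (- \<lfloor>y - x\<rfloor>)"
    have y': "0 \<le> y' - x" "y' - x \<le> 1" unfolding y'_def by linarith+
    define z where "z t = x + (y' - x) / ((a + l) - a) * (t - a)" for t
    have z: "z \<in> competitors a x (a + l) y'" "\<And>t. deriv z t = (y' - x) / ((a + l) - a)"
      using affine_competitor[of a "a + l" x y'] assms unfolding z_def[abs_def] by simp_all
    have "\<bar>deriv z t\<bar> \<le> 1 / l" for t using y' assms by (simp add: z(2) abs_of_pos divide_right_mono)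
    then have "G (z t) (deriv z t) t \<le> B" for t using B[of "deriv z t" "z t" t] by (simp add: abs_le_iff)
    then have "act z a (a + l) \<le> B * ((a + l) - a)"
      using z(1) assms by (intro act_upper) (auto simp: competitors_def)
    moreover have "cost a x (a + l) y' \<le> act z a (a + l)" using z(1) assms by (intro cost_le) auto
    moreover have "cost a x (a + l) y' = cost a x (a + l) y"
      using cost_space_shift[of a x 0 "a + l" y "- \<lfloor>y - x\<rfloor>"] by (simp add: y'_def)
    ultimately show ?thesis by simp
  qed
  then show ?thesis by blast
qed

lemma first_variation:
  assumes x: "x C1_differentiable_on {a..b}" and h: "h C1_differentiable_on {a..b}"
  shows "((\<lambda>e. act (\<lambda>t. x t + e * h t) a b) has_real_derivative
    integral {a..b} (\<lambda>t. Gs (x t) (deriv x t) t * h t + Gv (x t) (deriv x t) t * deriv h t)) (at 0)"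
proof -
  define f where "f e t = G (x t + e * h t) (deriv x t + e * deriv h t) t" for e t
  define f' where "f' e t = Gs (x t + e * h t) (deriv x t + e * deriv h t) t * h t
    + Gv (x t + e * h t) (deriv x t + e * deriv h t) t * deriv h t" for e t
  have c: "continuous_on (UNIV \<times> {a..b}) (\<lambda>z. x (snd z))" "continuous_on (UNIV \<times> {a..b}) (\<lambda>z. deriv x (snd z))"
    "continuous_on (UNIV \<times> {a..b}) (\<lambda>z. h (snd z))" "continuous_on (UNIV \<times> {a..b}) (\<lambda>z. deriv h (snd z))"
    by (auto intro!: continuous_on_compose2[OF C1_has_deriv(2)[OF x]] continuous_on_compose2[OF C1_has_deriv(2)[OF h]]
      continuous_on_compose2[OF C1_has_deriv(3)[OF x]] continuous_on_compose2[OF C1_has_deriv(3)[OF h]] continuous_intros)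
  have "((\<lambda>e. integral (cbox a b) (f e)) has_real_derivative integral (cbox a b) (f' 0)) (at 0 within UNIV)"
  proof (rule leibniz_rule_field_derivative)
    show "((\<lambda>e. f e t) has_real_derivative f' e t) (at e within UNIV)" for e t
      using G_deriv[of "x t" "h t" "deriv x t" "deriv h t" t e] by (simp add: f_def f'_def)
    show "f e integrable_on cbox a b" for e
      unfolding f_def box_real
      by (intro integrable_continuous_interval G_comp_cont continuous_intros C1_has_deriv[OF x] C1_has_deriv[OF h])
    show "continuous_on (UNIV \<times> cbox a b) (\<lambda>(e, t). f' e t)"
      unfolding f'_def split_beta box_real
      by (intro continuous_intros G_comp_cont c)
  qed auto
  moreover have "integral (cbox a b) (f e) = act (\<lambda>t. x t + e * h t) a b" for e
  proof -
    have d: "deriv (\<lambda>t. x t + e * h t) t = deriv x t + e * deriv h t" if "t \<in> {a..b}" for t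
      by (rule DERIV_imp_deriv) (rule derivative_eq_intros C1_has_deriv(1)[OF x that] C1_has_deriv(1)[OF h that] refl | simp)+
    show ?thesis unfolding act_def box_real by (rule integral_cong) (simp add: f_def d)
  qed
  ultimately show ?thesis by (simp add: f'_def[abs_def])
qed

text \<open>The variation \<open>x + e h\<close> competes with \<open>x\<close>, so its action is minimal at \<open>e = 0\<close>.\<close>

lemma first_variation_minimizer:
  assumes x: "x \<in> M" and ab: "a < b" and h: "h C1_differentiable_on {a..b}" "h a = 0" "h b = 0"
  shows "((\<lambda>e. act (\<lambda>t. x t + e * h t) a b) has_real_derivative 0) (at 0)"
    "integral {a..b} (\<lambda>t. Gs (x t) (deriv x t) t * h t + Gv (x t) (deriv x t) t * deriv h t) = 0"
proof -
  note D = first_variation[OF M_C1[OF x] h(1)]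
  have "act (\<lambda>t. x t + 0 * h t) a b \<le> act (\<lambda>t. x t + e * h t) a b" for e
  proof -
    have "(\<lambda>t. x t + e * h t) C1_differentiable_on {a..b}"
      using M_C1[OF x] h(1) by (intro C1_differentiable_on_add C1_differentiable_on_mult C1_differentiable_on_const)
    then have "(\<lambda>t. x t + e * h t) \<in> competitors a (x a) b (x b)" using h by (simp add: competitors_def)
    then show ?thesis using x ab by (simp add: M_iff)
  qed
  then show "integral {a..b} (\<lambda>t. Gs (x t) (deriv x t) t * h t + Gv (x t) (deriv x t) t * deriv h t) = 0"
    by (intro DERIV_local_min[OF D, of 1]) auto
  then show "((\<lambda>e. act (\<lambda>t. x t + e * h t) a b) has_real_derivative 0) (at 0)" using D by simp
qed

lemma flow_of_minimizer:
  assumes "x \<in> M" shows "deriv x t = W u (x u) (deriv x u) t"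
proof (rule W_extremal[of "min t u - 1" "max t u"])
  show "x C1_differentiable_on {min t u - 1..max t u}" by (rule M_C1[OF assms])
qed (use first_variation_minimizer(1)[OF assms] in \<open>auto simp: act_def\<close>)

lemma unique_minimizer:
  assumes "\<gamma> \<in> M" "\<beta> \<in> M" "\<gamma> s = \<beta> s" "deriv \<gamma> s = deriv \<beta> s"
  shows "\<gamma> = \<beta>"
proof
  fix t
  have "deriv \<gamma> u = deriv \<beta> u" for u
    using flow_of_minimizer[OF assms(1), of u s] flow_of_minimizer[OF assms(2), of u s] assms(3,4) by simp
  then have "((\<lambda>t. \<gamma> t - \<beta> t) has_real_derivative 0) (at u)" for u
    using DERIV_diff[OF C1_has_deriv(1)[OF M_C1[OF assms(1), of UNIV]] C1_has_deriv(1)[OF M_C1[OF assms(2), of UNIV]], of u] by simp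
  then have "\<gamma> t - \<beta> t = \<gamma> s - \<beta> s" by (intro DERIV_const_ratio_const2 DERIV_isconst_all) auto
  then show "\<gamma> t = \<beta> t" using assms(3) by simp
qed

lemma W_int_periodic: "W (u + of_int n) (s + of_int m) v (t + of_int n) = W u s v t"
proof -
  have "W (u + (\<tau> + 1)) s v (t + (\<tau> + 1)) = W (u + \<tau>) s v (t + \<tau>)" for \<tau> s
    using W_periodic(1)[of "u + \<tau>" s v "t + \<tau>"] by (simp add: add.assoc)
  then have "W (u + of_int n) s v (t + of_int n) = W u s v t" for s
    using int_periodic[of "\<lambda>\<tau>. W (u + \<tau>) s v (t + \<tau>)" 0 n] by simp
  then show ?thesis
    using int_periodic[of "\<lambda>s. W (u + of_int n) s v (t + of_int n)" s m] W_periodic(2) by simp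
qed

text \<open>The action over a unit time interval is bounded by that of an affine curve, so within each such
interval the speed is moderate at some time. From there the flow bounds the speed on the whole
interval, because initial values of moderate speed form a compact set modulo translations.\<close>

lemma velocity_bound: "\<exists>V>0. \<forall>\<gamma>\<in>M. \<forall>t. \<bar>deriv \<gamma> t\<bar> \<le> V"
proof -
  obtain K where K: "\<And>a x y. cost a x (a + 1) y \<le> K" using cost_bounded[of 1] by auto
  obtain C where C: "\<And>s v t. \<bar>v\<bar> - C \<le> G s v t" using G_superlinear by blast
  define R where "R = K + C + 1"
  define S where "S = {0..1::real} \<times> {0..1::real} \<times> {-R..R} \<times> {-1..1::real}"
  have "compact S" unfolding S_def by (intro compact_Times compact_Icc)
  then have "compact ((\<lambda>(u, s, v, t). W u s v t) ` S)"
    by (intro compact_continuous_image continuous_on_subset[OF W_cont]) auto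
  then obtain V where V: "\<And>u s v t. (u, s, v, t) \<in> S \<Longrightarrow> \<bar>W u s v t\<bar> \<le> V"
    by (auto dest!: compact_imp_bounded simp: bounded_iff) fastforce
  have "\<bar>deriv \<gamma> t\<bar> \<le> max V 1" if \<gamma>: "\<gamma> \<in> M" for \<gamma> t
  proof -
    have "\<exists>u\<in>{t..t+1}. \<bar>deriv \<gamma> u\<bar> \<le> R"
    proof (rule ccontr)
      assume "\<not> ?thesis"
      then have "R - C \<le> G (\<gamma> u) (deriv \<gamma> u) u" if "u \<in> {t..t+1}" for u
        using C[of "deriv \<gamma> u" "\<gamma> u" u] that by force
      then have "(R - C) * ((t + 1) - t) \<le> act \<gamma> t (t + 1)"
        by (intro act_lower_bound M_C1[OF \<gamma>]) auto
      also have "\<dots> = cost t (\<gamma> t) (t + 1) (\<gamma> (t + 1))" using cost_minimizer[OF \<gamma>] by simp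
      also have "\<dots> \<le> K" by (rule K)
      finally show False by (simp add: R_def)
    qed
    then obtain u where u: "t \<le> u" "u \<le> t + 1" "\<bar>deriv \<gamma> u\<bar> \<le> R" by auto
    have "deriv \<gamma> t = W u (\<gamma> u) (deriv \<gamma> u) t" by (rule flow_of_minimizer[OF \<gamma>])
    also have "\<dots> = W (u + of_int (- \<lfloor>u\<rfloor>)) (\<gamma> u + of_int (- \<lfloor>\<gamma> u\<rfloor>)) (deriv \<gamma> u) (t + of_int (- \<lfloor>u\<rfloor>))"
      by (rule W_int_periodic[symmetric])
    also have "\<bar>\<dots>\<bar> \<le> V"
    proof (rule V)
      have "0 \<le> u - of_int \<lfloor>u\<rfloor>" "u - of_int \<lfloor>u\<rfloor> \<le> 1" "0 \<le> \<gamma> u - of_int \<lfloor>\<gamma> u\<rfloor>" "\<gamma> u - of_int \<lfloor>\<gamma> u\<rfloor> \<le> 1"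
        "- 1 \<le> t - of_int \<lfloor>u\<rfloor>" "t - of_int \<lfloor>u\<rfloor> \<le> 1"
        using u by linarith+
      then show "(u + of_int (- \<lfloor>u\<rfloor>), \<gamma> u + of_int (- \<lfloor>\<gamma> u\<rfloor>), deriv \<gamma> u, t + of_int (- \<lfloor>u\<rfloor>)) \<in> S"
        using u by (auto simp: S_def abs_le_iff)
    qed
    finally show ?thesis by simp
  qed
  then show ?thesis by (intro exI[of _ "max V 1"]) auto
qed


text \<open>The argument of du Bois-Reymond. The momentum \<open>p\<close> is only known to be continuous, so the
equation is obtained in integrated form: with a primitive \<open>P\<close> of \<open>Gs\<close> along \<open>x\<close>, the first
variation in the direction \<open>h\<close> is the integral of \<open>(p - P) h'\<close>. Choosing \<open>h'\<close> as \<open>p - P\<close> minus its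
mean \<open>m\<close> shows that \<open>p - P\<close> is constant.\<close>

lemma euler_lagrange:
  assumes x: "x \<in> M"
  shows "((\<lambda>t. Gv (x t) (deriv x t) t) has_real_derivative Gs (x t) (deriv x t) t) (at t)"
proof -
  define p where "p t = Gv (x t) (deriv x t) t" for t
  define s where "s t = Gs (x t) (deriv x t) t" for t
  have cont: "continuous_on S p" "continuous_on S s" for S
    unfolding p_def s_def by (intro G_comp_cont continuous_intros C1_has_deriv[OF M_C1[OF x]])+
  obtain P where P: "\<And>t. (P has_real_derivative s t) (at t)" using antiderivative_exists[OF cont(2)] by blast
  have contP: "continuous_on S P" for S
    using P by (metis DERIV_isCont continuous_at_imp_continuous_on)
  define a b where "a = t - 1" and "b = t + 1"
  have ab: "a < b" by (simp add: a_def b_def)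
  define m where "m = integral {a..b} (\<lambda>t. p t - P t) / (b - a)"
  define k where "k t = p t - P t - m" for t
  have contk: "continuous_on S k" for S unfolding k_def by (intro continuous_intros cont contP)
  obtain Q where Q: "\<And>t. (Q has_real_derivative k t) (at t)" using antiderivative_exists[OF contk] by blast
  define h where "h t = Q t - Q a" for t
  have hD: "(h has_real_derivative k t) (at t)" for t
    unfolding h_def using DERIV_diff[OF Q DERIV_const] by simp
  have h: "h C1_differentiable_on {a..b}" "\<And>t. t \<in> {a..b} \<Longrightarrow> deriv h t = k t"
    using C1_I[OF hD contk] by auto
  have int: "(\<lambda>t. p t - P t) integrable_on {a..b}"
    by (intro integrable_continuous_interval continuous_intros cont contP)
  have k0: "integral {a..b} k = 0"
  proof -
    have "integral {a..b} k = integral {a..b} (\<lambda>t. p t - P t) - integral {a..b} (\<lambda>t. m)"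
      unfolding k_def by (rule integral_diff[OF int integrable_const_ivl])
    also have "integral {a..b} (\<lambda>t. m) = m * (b - a)" using ab by simp
    also have "\<dots> = integral {a..b} (\<lambda>t. p t - P t)" using ab by (simp add: m_def)
    finally show ?thesis by simp
  qed
  have "integral {a..b} k = Q b - Q a" by (rule integral_deriv) (use ab Q in auto)
  then have h0: "h a = 0" "h b = 0" using k0 by (simp_all add: h_def)
  have conth: "continuous_on S h" for S using hD by (metis DERIV_isCont continuous_at_imp_continuous_on)
  have "integral {a..b} (\<lambda>t. s t * h t + p t * deriv h t) = 0"
    using first_variation_minimizer(2)[OF x ab h(1) h0] by (simp add: p_def s_def)
  also have "integral {a..b} (\<lambda>t. s t * h t + p t * deriv h t) = integral {a..b} (\<lambda>t. s t * h t + p t * k t)"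
    by (rule integral_cong) (simp add: h(2))
  finally have 1: "integral {a..b} (\<lambda>t. s t * h t + p t * k t) = 0" .
  have "integral {a..b} (\<lambda>t. s t * h t + P t * k t) = P b * h b - P a * h a"
    by (rule integral_deriv(1)) (use ab in \<open>auto intro!: derivative_eq_intros P hD\<close>)
  then have 2: "integral {a..b} (\<lambda>t. s t * h t + P t * k t) = 0" by (simp add: h0)
  have 3: "integral {a..b} (\<lambda>t. m * k t) = 0" using k0 by simp
  have "integral {a..b} (\<lambda>t. (s t * h t + p t * k t) - (s t * h t + P t * k t) - m * k t) = 0"
    using 1 2 3
    by (subst integral_diff, (intro integrable_continuous_interval continuous_intros cont contP conth contk)+,
      subst integral_diff, (intro integrable_continuous_interval continuous_intros cont contP conth contk)+) simp
  also have "(\<lambda>t. (s t * h t + p t * k t) - (s t * h t + P t * k t) - m * k t) = (\<lambda>t. (k t)\<^sup>2)"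
    by (simp add: k_def power2_eq_square algebra_simps)
  finally have "\<forall>t\<in>{a..b}. (k t)\<^sup>2 = 0"
    using integral_eq_0_iff[OF continuous_on_power[OF contk] ab] by simp
  then have eq: "p u = P u + m" if "u \<in> {a<..<b}" for u
  proof -
    have "(k u)\<^sup>2 = 0" using \<open>\<forall>t\<in>{a..b}. (k t)\<^sup>2 = 0\<close> that by auto
    then show ?thesis by (simp add: k_def)
  qed
  have "((\<lambda>t. P t + m) has_real_derivative s t) (at t)" using DERIV_add[OF P DERIV_const] by simp
  then have "(p has_real_derivative s t) (at t)"
    by (rule has_field_derivative_transform_within_open[of _ _ _ "{a<..<b}"]) (auto simp: eq a_def b_def)
  then show ?thesis by (simp add: p_def[abs_def] s_def)
qed

text \<open>By uniqueness the slopes \<open>v1\<close> and \<open>v2\<close> at the common point differ, so strict convexity gives a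
positive gain \<open>\<eta>\<close> per unit time when both are replaced by their mean. The chord over
\<open>[s - \<delta>, s + \<delta>]\<close> has nearly the mean slope, and all errors are small compared to \<open>\<delta>\<close>.\<close>

lemma cost_corner:
  assumes M: "\<gamma> \<in> M" "\<beta> \<in> M" and s: "\<gamma> s = \<beta> s" and ne: "\<gamma> \<noteq> \<beta>" and ab: "a < s" "s < b"
  shows "cost a (\<gamma> a) b (\<beta> b) < cost a (\<gamma> a) s (\<gamma> s) + cost s (\<beta> s) b (\<beta> b)"
proof -
  define x0 where "x0 = \<gamma> s"
  define v1 v2 where "v1 = deriv \<gamma> s" and "v2 = deriv \<beta> s"
  have "v1 \<noteq> v2" using unique_minimizer[OF M s] ne by (auto simp: v1_def v2_def)
  define \<eta> where "\<eta> = (G x0 v1 s + G x0 v2 s) / 2 - G x0 ((v1 + v2) / 2) s"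
  have \<eta>: "\<eta> > 0" using G_convex[OF \<open>v1 \<noteq> v2\<close>] by (simp add: \<eta>_def)
  obtain V where V: "V > 0" "\<And>\<gamma> t. \<gamma> \<in> M \<Longrightarrow> \<bar>deriv \<gamma> t\<bar> \<le> V" using velocity_bound by blast
  obtain K where K: "\<And>s v t s' v' t'. \<bar>v\<bar> \<le> V \<Longrightarrow> \<bar>v'\<bar> \<le> V \<Longrightarrow>
      \<bar>G s v t - G s' v' t'\<bar> \<le> K * (\<bar>s - s'\<bar> + \<bar>v - v'\<bar> + \<bar>t - t'\<bar>)" using G_lipschitz[of V] by blast
  have K0: "0 \<le> K" using K[of 0 0 0 1 0 0] V(1) by simp
  have der: "(\<gamma> has_real_derivative deriv \<gamma> t) (at t)" "(\<beta> has_real_derivative deriv \<beta> t) (at t)" for t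
    by (rule C1_has_deriv(1)[OF M_C1[of _ UNIV]]; use M in simp)+
  have lip: "\<bar>\<alpha> t - \<alpha> u\<bar> \<le> V * \<bar>t - u\<bar>" if "\<alpha> \<in> M" for \<alpha> t u
  proof -
    have "norm (\<alpha> t - \<alpha> u) \<le> V * norm (t - u)"
      by (rule field_differentiable_bound[of UNIV _ "deriv \<alpha>"])
        (use C1_has_deriv(1)[OF M_C1[OF that, of UNIV]] V(2)[OF that] in \<open>auto intro: has_field_derivative_at_within\<close>)
    then show ?thesis by simp
  qed
  have near: "\<forall>\<^sub>F \<delta> in at_right 0. \<forall>t. \<bar>t - s\<bar> \<le> \<delta> \<longrightarrow> \<bar>G (\<alpha> t) (deriv \<alpha> t) t - G x0 (deriv \<alpha> s) s\<bar> < \<eta> / 3"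
    if \<alpha>: "\<alpha> \<in> M" "\<alpha> s = x0" for \<alpha>
  proof -
    have "continuous_on UNIV (\<lambda>t. G (\<alpha> t) (deriv \<alpha> t) t)"
      by (intro G_comp_cont continuous_intros C1_has_deriv[OF M_C1[OF \<alpha>(1)]])
    then have "isCont (\<lambda>t. G (\<alpha> t) (deriv \<alpha> t) t) s" by (simp add: continuous_on_eq_continuous_at)
    then obtain d where "d > 0" "\<And>t. \<bar>t - s\<bar> < d \<Longrightarrow> \<bar>G (\<alpha> t) (deriv \<alpha> t) t - G x0 (deriv \<alpha> s) s\<bar> < \<eta> / 3"
      using \<eta> \<alpha>(2) unfolding continuous_at_eps_delta dist_real_def by (metis zero_less_divide_iff zero_less_numeral)
    then show ?thesis unfolding eventually_at_right_field by (intro exI[of _ d]) auto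
  qed
  define \<sigma> where "\<sigma> \<delta> = (\<beta> (s + \<delta>) - \<gamma> (s - \<delta>)) / (2 * \<delta>)" for \<delta>
  have \<sigma>_lim: "(\<sigma> \<longlongrightarrow> (v1 + v2) / 2) (at_right 0)"
  proof (rule Lim_transform_eventually)
    have "((\<lambda>\<delta>. (\<beta> (s + \<delta>) - \<beta> s) / \<delta>) \<longlongrightarrow> v2) (at_right 0)"
      using der(2)[of s] unfolding DERIV_def v2_def by (rule tendsto_within_subset) simp
    moreover have "((\<lambda>\<delta>. (\<gamma> (s + - \<delta>) - \<gamma> s) / - \<delta>) \<longlongrightarrow> v1) (at_right 0)"
    proof -
      have "((\<lambda>h. (\<gamma> (s + h) - \<gamma> s) / h) \<longlongrightarrow> v1) (at_left 0)"
        using der(1)[of s] unfolding DERIV_def v1_def by (rule tendsto_within_subset) simp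
      then show ?thesis using filterlim_at_left_to_right[of "\<lambda>h. (\<gamma> (s + h) - \<gamma> s) / h" "nhds v1" 0] by simp
    qed
    ultimately show "((\<lambda>\<delta>. ((\<gamma> (s + - \<delta>) - \<gamma> s) / - \<delta> + (\<beta> (s + \<delta>) - \<beta> s) / \<delta>) / 2) \<longlongrightarrow> (v1 + v2) / 2) (at_right 0)"
      by (intro tendsto_intros) simp_all
    show "\<forall>\<^sub>F \<delta> in at_right 0. ((\<gamma> (s + - \<delta>) - \<gamma> s) / - \<delta> + (\<beta> (s + \<delta>) - \<beta> s) / \<delta>) / 2 = \<sigma> \<delta>"
      unfolding eventually_at_filter by (rule always_eventually) (auto simp: \<sigma>_def s field_simps)
  qed
  have "((\<lambda>\<delta>. K * (3 * V * \<delta> + \<bar>\<sigma> \<delta> - (v1 + v2) / 2\<bar> + \<delta>)) \<longlongrightarrow> K * (3 * V * 0 + \<bar>(v1 + v2) / 2 - (v1 + v2) / 2\<bar> + 0)) (at_right 0)"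
    by (intro tendsto_intros \<sigma>_lim)
  then have e1: "\<forall>\<^sub>F \<delta> in at_right 0. K * (3 * V * \<delta> + \<bar>\<sigma> \<delta> - (v1 + v2) / 2\<bar> + \<delta>) < \<eta> / 3"
    using \<eta> by (intro order_tendstoD(2)) auto
  have e2: "\<forall>\<^sub>F \<delta> in at_right 0. \<delta> < min (s - a) (b - s)"
    using ab unfolding eventually_at_right_field by (intro exI[of _ "min (s - a) (b - s)"]) auto
  have e3: "\<forall>\<^sub>F \<delta> in at_right (0::real). 0 < \<delta>" by (simp add: eventually_at_filter)
  have e4: "\<forall>\<^sub>F \<delta> in at_right 0. \<forall>t. \<bar>t - s\<bar> \<le> \<delta> \<longrightarrow> \<bar>G (\<gamma> t) (deriv \<gamma> t) t - G x0 v1 s\<bar> < \<eta> / 3"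
    using near[OF M(1)] unfolding v1_def x0_def by blast
  have e5: "\<forall>\<^sub>F \<delta> in at_right 0. \<forall>t. \<bar>t - s\<bar> \<le> \<delta> \<longrightarrow> \<bar>G (\<beta> t) (deriv \<beta> t) t - G x0 v2 s\<bar> < \<eta> / 3"
    using near[OF M(2)] s unfolding v2_def x0_def by simp
  from e1 e2 e3 e4 e5 have "\<forall>\<^sub>F \<delta> in at_right 0. 0 < \<delta> \<and> \<delta> < min (s - a) (b - s) \<and>
      K * (3 * V * \<delta> + \<bar>\<sigma> \<delta> - (v1 + v2) / 2\<bar> + \<delta>) < \<eta> / 3 \<and>
      (\<forall>t. \<bar>t - s\<bar> \<le> \<delta> \<longrightarrow> \<bar>G (\<gamma> t) (deriv \<gamma> t) t - G x0 v1 s\<bar> < \<eta> / 3) \<and>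
      (\<forall>t. \<bar>t - s\<bar> \<le> \<delta> \<longrightarrow> \<bar>G (\<beta> t) (deriv \<beta> t) t - G x0 v2 s\<bar> < \<eta> / 3)"
    by eventually_elim auto
  from eventually_happens'[OF trivial_limit_at_right_real this]
  obtain \<delta> where \<delta>: "0 < \<delta>" "\<delta> < s - a" "\<delta> < b - s"
      "K * (3 * V * \<delta> + \<bar>\<sigma> \<delta> - (v1 + v2) / 2\<bar> + \<delta>) < \<eta> / 3"
      "\<And>t. \<bar>t - s\<bar> \<le> \<delta> \<Longrightarrow> \<bar>G (\<gamma> t) (deriv \<gamma> t) t - G x0 v1 s\<bar> < \<eta> / 3"
      "\<And>t. \<bar>t - s\<bar> \<le> \<delta> \<Longrightarrow> \<bar>G (\<beta> t) (deriv \<beta> t) t - G x0 v2 s\<bar> < \<eta> / 3"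
    unfolding min_less_iff_conj by blast
  define z where "z t = \<gamma> (s - \<delta>) + (\<beta> (s + \<delta>) - \<gamma> (s - \<delta>)) / ((s + \<delta>) - (s - \<delta>)) * (t - (s - \<delta>))" for t
  have z: "z \<in> competitors (s - \<delta>) (\<gamma> (s - \<delta>)) (s + \<delta>) (\<beta> (s + \<delta>))" "\<And>t. deriv z t = \<sigma> \<delta>"
    using affine_competitor[of "s - \<delta>" "s + \<delta>" "\<gamma> (s - \<delta>)" "\<beta> (s + \<delta>)"] \<delta>(1)
    unfolding z_def[abs_def] \<sigma>_def by (simp_all add: algebra_simps)
  have \<sigma>V: "\<bar>\<sigma> \<delta>\<bar> \<le> V"
  proof -
    have "\<bar>\<beta> (s + \<delta>) - \<gamma> (s - \<delta>)\<bar> \<le> V * \<delta> + V * \<delta>"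
      using lip[OF M(1), of "s - \<delta>" s] lip[OF M(2), of "s + \<delta>" s] s \<delta>(1) by (simp add: abs_le_iff)
    then show ?thesis using \<delta>(1) by (simp add: \<sigma>_def abs_of_pos divide_le_eq algebra_simps)
  qed
  have zG: "G (z t) (deriv z t) t \<le> G x0 ((v1 + v2) / 2) s + \<eta> / 3" if t: "t \<in> {s - \<delta>..s + \<delta>}" for t
  proof -
    have zt: "z t = \<gamma> (s - \<delta>) + \<sigma> \<delta> * (t - (s - \<delta>))" by (simp add: z_def \<sigma>_def)
    have "\<bar>\<sigma> \<delta> * (t - (s - \<delta>))\<bar> \<le> V * (2 * \<delta>)"
      unfolding abs_mult using \<sigma>V t by (intro mult_mono) auto
    moreover have "\<bar>\<gamma> (s - \<delta>) - x0\<bar> \<le> V * \<delta>" using lip[OF M(1), of "s - \<delta>" s] \<delta>(1) by (simp add: x0_def)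
    ultimately have "\<bar>z t - x0\<bar> \<le> 3 * V * \<delta>" unfolding zt by (simp add: abs_le_iff)
    moreover have "\<bar>(v1 + v2) / 2\<bar> \<le> V" using V(2)[OF M(1), of s] V(2)[OF M(2), of s] by (simp add: v1_def v2_def abs_le_iff)
    moreover have "\<bar>t - s\<bar> \<le> \<delta>" using t by auto
    ultimately have "K * (\<bar>z t - x0\<bar> + \<bar>\<sigma> \<delta> - (v1 + v2) / 2\<bar> + \<bar>t - s\<bar>) \<le> K * (3 * V * \<delta> + \<bar>\<sigma> \<delta> - (v1 + v2) / 2\<bar> + \<delta>)"
      using K0 by (intro mult_left_mono) auto
    then show ?thesis
      using K[OF \<sigma>V \<open>\<bar>(v1 + v2) / 2\<bar> \<le> V\<close>, of "z t" t x0 s] \<delta>(4) by (simp add: z(2) abs_le_iff)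
  qed
  have "cost (s - \<delta>) (\<gamma> (s - \<delta>)) (s + \<delta>) (\<beta> (s + \<delta>)) \<le> act z (s - \<delta>) (s + \<delta>)"
    using z(1) \<delta>(1) by (intro cost_le) auto
  also have "\<dots> \<le> (G x0 ((v1 + v2) / 2) s + \<eta> / 3) * ((s + \<delta>) - (s - \<delta>))"
    using z(1) \<delta>(1) zG by (intro act_upper) (auto simp: competitors_def)
  also have "\<dots> = \<delta> * (2 * G x0 ((v1 + v2) / 2) s + 2 * \<eta> / 3)" by (simp add: algebra_simps)
  also have "\<dots> < \<delta> * (G x0 v1 s - \<eta> / 3 + (G x0 v2 s - \<eta> / 3))"
    using \<delta>(1) \<eta> by (intro mult_strict_left_mono) (auto simp: \<eta>_def field_simps)
  also have "\<dots> = (G x0 v1 s - \<eta> / 3) * (s - (s - \<delta>)) + (G x0 v2 s - \<eta> / 3) * ((s + \<delta>) - s)"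
    by (simp add: algebra_simps)
  also have "\<dots> \<le> act \<gamma> (s - \<delta>) s + act \<beta> s (s + \<delta>)"
  proof (intro add_mono act_lower_bound M_C1 M)
    show "G x0 v1 s - \<eta> / 3 \<le> G (\<gamma> t) (deriv \<gamma> t) t" if "t \<in> {s - \<delta>..s}" for t
    proof -
      have "\<bar>t - s\<bar> \<le> \<delta>" using that by auto
      from \<delta>(5)[OF this] show ?thesis by linarith
    qed
    show "G x0 v2 s - \<eta> / 3 \<le> G (\<beta> t) (deriv \<beta> t) t" if "t \<in> {s..s + \<delta>}" for t
    proof -
      have "\<bar>t - s\<bar> \<le> \<delta>" using that by auto
      from \<delta>(6)[OF this] show ?thesis by linarith
    qed
  qed (use \<delta>(1) in auto)
  finally have gain: "cost (s - \<delta>) (\<gamma> (s - \<delta>)) (s + \<delta>) (\<beta> (s + \<delta>)) < act \<gamma> (s - \<delta>) s + act \<beta> s (s + \<delta>)" .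
  have "cost a (\<gamma> a) b (\<beta> b) \<le> cost a (\<gamma> a) (s - \<delta>) (\<gamma> (s - \<delta>)) + cost (s - \<delta>) (\<gamma> (s - \<delta>)) b (\<beta> b)"
    using \<delta> by (intro cost_triangle) auto
  also have "cost (s - \<delta>) (\<gamma> (s - \<delta>)) b (\<beta> b) \<le> cost (s - \<delta>) (\<gamma> (s - \<delta>)) (s + \<delta>) (\<beta> (s + \<delta>)) + cost (s + \<delta>) (\<beta> (s + \<delta>)) b (\<beta> b)"
    using \<delta> by (intro cost_triangle) auto
  also have "cost a (\<gamma> a) (s - \<delta>) (\<gamma> (s - \<delta>)) = act \<gamma> a (s - \<delta>)" using \<delta> by (intro cost_minimizer M) auto
  also have "cost (s + \<delta>) (\<beta> (s + \<delta>)) b (\<beta> b) = act \<beta> (s + \<delta>) b" using \<delta> by (intro cost_minimizer M) auto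
  finally have "cost a (\<gamma> a) b (\<beta> b) < (act \<gamma> a (s - \<delta>) + act \<gamma> (s - \<delta>) s) + (act \<beta> s (s + \<delta>) + act \<beta> (s + \<delta>) b)"
    using gain by simp
  also have "act \<gamma> a (s - \<delta>) + act \<gamma> (s - \<delta>) s = cost a (\<gamma> a) s (\<gamma> s)"
    using \<delta> cost_minimizer[OF M(1) ab(1)] act_additive[OF M_C1[OF M(1)], of a "s - \<delta>" s] by simp
  also have "act \<beta> s (s + \<delta>) + act \<beta> (s + \<delta>) b = cost s (\<beta> s) b (\<beta> b)"
    using \<delta> cost_minimizer[OF M(2) ab(2)] act_additive[OF M_C1[OF M(2)], of s "s + \<delta>" b] by simp
  finally show ?thesis .
qed

text \<open>Only the last unit of time is changed, by adding a linear function of slope \<open>x - \<gamma> b\<close>. Hence the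
bound does not depend on the length of the interval.\<close>

lemma cost_end:
  assumes e: "e > 0"
  shows "\<exists>\<delta>>0. \<forall>\<gamma>\<in>M. \<forall>a b x. a + 1 \<le> b \<and> \<bar>x - \<gamma> b\<bar> < \<delta>
      \<longrightarrow> cost a (\<gamma> a) b x \<le> cost a (\<gamma> a) b (\<gamma> b) + e"
proof -
  obtain V where V: "V > 0" "\<And>\<gamma> t. \<gamma> \<in> M \<Longrightarrow> \<bar>deriv \<gamma> t\<bar> \<le> V" using velocity_bound by blast
  obtain K where K: "\<And>s v t s' v' t'. \<bar>v\<bar> \<le> V + 1 \<Longrightarrow> \<bar>v'\<bar> \<le> V + 1 \<Longrightarrow>
      \<bar>G s v t - G s' v' t'\<bar> \<le> K * (\<bar>s - s'\<bar> + \<bar>v - v'\<bar> + \<bar>t - t'\<bar>)" using G_lipschitz[of "V + 1"] by blast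
  have K0: "0 \<le> K" using K[of 0 0 0 1 0 0] V(1) by simp
  define \<delta> where "\<delta> = min 1 (e / (2 * K + 1))"
  have \<delta>: "\<delta> > 0" "\<delta> \<le> 1" "2 * K * \<delta> \<le> e"
  proof -
    show "\<delta> > 0" "\<delta> \<le> 1" using e K0 by (auto simp: \<delta>_def)
    have "2 * K * \<delta> \<le> (2 * K + 1) * (e / (2 * K + 1))"
      using K0 e by (intro mult_mono) (auto simp: \<delta>_def)
    then show "2 * K * \<delta> \<le> e" using K0 by simp
  qed
  have last: "cost (b - 1) (\<gamma> (b - 1)) b x \<le> act \<gamma> (b - 1) b + e"
    if \<gamma>: "\<gamma> \<in> M" and x: "\<bar>x - \<gamma> b\<bar> < \<delta>" for \<gamma> b x
  proof -
    define d where "d = x - \<gamma> b"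
    define z where "z t = \<gamma> t + (0 + d * (t - (b - 1)))" for t
    have z: "z C1_differentiable_on S" "\<And>t. deriv z t = deriv \<gamma> t + d" for S
      unfolding z_def[abs_def]
      by (rule C1_affine_perturbation(1)[OF M_C1[OF \<gamma>]], rule C1_affine_perturbation(2)[OF M_C1[OF \<gamma>, of UNIV]]) simp
    have zc: "z \<in> competitors (b - 1) (\<gamma> (b - 1)) b x" using z(1) by (simp add: competitors_def z_def d_def)
    have "cost (b - 1) (\<gamma> (b - 1)) b x \<le> act z (b - 1) b" using zc by (intro cost_le) auto
    also have "\<dots> \<le> integral {b - 1..b} (\<lambda>t. G (\<gamma> t) (deriv \<gamma> t) t + 2 * K * \<delta>)" unfolding act_def
    proof (rule integral_le[OF act_integrand(2)[OF z(1)]])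
      show "(\<lambda>t. G (\<gamma> t) (deriv \<gamma> t) t + 2 * K * \<delta>) integrable_on {b - 1..b}"
        by (intro integrable_add act_integrand(2) M_C1 \<gamma> integrable_const_ivl)
      fix t assume t: "t \<in> {b - 1..b}"
      have "\<bar>d\<bar> * \<bar>t - (b - 1)\<bar> \<le> \<delta> * 1" using x t by (intro mult_mono) (auto simp: d_def)
      then have "\<bar>z t - \<gamma> t\<bar> \<le> \<delta>" by (simp add: z_def abs_mult)
      moreover have "\<bar>deriv z t - deriv \<gamma> t\<bar> \<le> \<delta>" using x by (simp add: z(2) d_def)
      ultimately have "K * (\<bar>z t - \<gamma> t\<bar> + \<bar>deriv z t - deriv \<gamma> t\<bar> + \<bar>t - t\<bar>) \<le> K * (2 * \<delta>)"
        using K0 by (intro mult_left_mono) auto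
      moreover have "\<bar>deriv z t\<bar> \<le> V + 1" "\<bar>deriv \<gamma> t\<bar> \<le> V + 1"
        using V(2)[OF \<gamma>, of t] x \<delta>(2) by (auto simp: z(2) d_def)
      ultimately show "G (z t) (deriv z t) t \<le> G (\<gamma> t) (deriv \<gamma> t) t + 2 * K * \<delta>"
        using K[of "deriv z t" "deriv \<gamma> t" "z t" t "\<gamma> t" t] by (simp add: abs_le_iff)
    qed
    also have "\<dots> = act \<gamma> (b - 1) b + 2 * K * \<delta>" unfolding act_def
      by (subst integral_add) (auto intro!: act_integrand(2) M_C1 \<gamma>)
    finally show ?thesis using \<delta>(3) by simp
  qed
  have "cost a (\<gamma> a) b x \<le> cost a (\<gamma> a) b (\<gamma> b) + e"
    if \<gamma>: "\<gamma> \<in> M" and ab: "a + 1 \<le> b" and x: "\<bar>x - \<gamma> b\<bar> < \<delta>" for \<gamma> a b x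
  proof (cases "a + 1 = b")
    case True
    then have "a = b - 1" by simp
    then show ?thesis using last[OF \<gamma> x] cost_minimizer[OF \<gamma>, of "b - 1" b] by simp
  next
    case False
    then have lt: "a < b - 1" using ab by simp
    have "cost a (\<gamma> a) b x \<le> cost a (\<gamma> a) (b - 1) (\<gamma> (b - 1)) + cost (b - 1) (\<gamma> (b - 1)) b x"
      using lt by (intro cost_triangle) auto
    also have "\<dots> \<le> act \<gamma> a (b - 1) + (act \<gamma> (b - 1) b + e)"
      using last[OF \<gamma> x] cost_minimizer[OF \<gamma> lt] by simp
    also have "\<dots> = cost a (\<gamma> a) b (\<gamma> b) + e"
      using lt cost_minimizer[OF \<gamma>, of a b] act_additive[OF M_C1[OF \<gamma>], of a "b - 1" b] by simp
    finally show ?thesis .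
  qed
  then show ?thesis using \<delta>(1) by blast
qed

end

section \<open>Compactness of the set of minimizers\<close>

context tonelli
begin

lemma minimizer_lipschitz:
  "\<exists>V. \<forall>\<gamma>\<in>M. \<forall>t u. \<bar>\<gamma> t - \<gamma> u\<bar> \<le> V * \<bar>t - u\<bar>"
proof -
  obtain V where V: "\<And>\<gamma> t. \<gamma> \<in> M \<Longrightarrow> \<bar>deriv \<gamma> t\<bar> \<le> V" using velocity_bound by blast
  have "\<bar>\<gamma> t - \<gamma> u\<bar> \<le> V * \<bar>t - u\<bar>" if "\<gamma> \<in> M" for \<gamma> t u
  proof -
    have "norm (\<gamma> t - \<gamma> u) \<le> V * norm (t - u)"
      by (rule field_differentiable_bound[of UNIV _ "deriv \<gamma>"])
        (use C1_has_deriv(1)[OF M_C1[OF that, of UNIV]] V[OF that] in \<open>auto intro: has_field_derivative_at_within\<close>)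
    then show ?thesis by simp
  qed
  then show ?thesis by blast
qed

text \<open>Along a subsequence the positions and velocities at \<open>t0\<close> converge, and then continuity of the flow
makes the velocities converge at all times. A competitor \<open>y\<close> of the limit, corrected by an affine
function tending to \<open>0\<close>, competes with the approximating minimizers, so minimality passes to the
limit.\<close>

lemma compactness:
  fixes u :: "nat \<Rightarrow> real \<Rightarrow> real"
  assumes u: "\<And>k. u k \<in> M" and bd: "bounded (range (\<lambda>k. u k t0))"
  shows "\<exists>r \<beta>. strict_mono (r :: nat \<Rightarrow> nat) \<and> \<beta> \<in> M \<and> (\<forall>s. (\<lambda>k. u (r k) s) \<longlonglongrightarrow> \<beta> s)"
proof -
  obtain V where V: "\<And>\<gamma> t. \<gamma> \<in> M \<Longrightarrow> \<bar>deriv \<gamma> t\<bar> \<le> V" using velocity_bound by blast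
  have "bounded (range (\<lambda>k. deriv (u k) t0))" using V u by (auto simp: bounded_iff)
  then have "bounded (range (\<lambda>k. u k t0) \<times> range (\<lambda>k. deriv (u k) t0))" using bd by (rule bounded_Times[rotated])
  then have "bounded (range (\<lambda>k. (u k t0, deriv (u k) t0)))" by (rule bounded_subset) auto
  then obtain l r where r: "strict_mono r" "((\<lambda>k. (u k t0, deriv (u k) t0)) \<circ> r) \<longlonglongrightarrow> l"
    using bounded_imp_convergent_subsequence by blast
  obtain x0 v0 where l: "l = (x0, v0)" by (cases l)
  have x0: "(\<lambda>k. u (r k) t0) \<longlonglongrightarrow> x0" and v0: "(\<lambda>k. deriv (u (r k)) t0) \<longlonglongrightarrow> v0"
    using tendsto_fst[OF r(2)] tendsto_snd[OF r(2)] by (simp_all add: l o_def)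
  define w where "w t = W t0 x0 v0 t" for t
  have contw: "continuous_on S w" for S
  proof -
    have "continuous_on S (\<lambda>t. (t0, x0, v0, t))" by (intro continuous_intros)
    from continuous_on_compose2[OF W_cont this] show ?thesis by (simp add: w_def[abs_def])
  qed
  have vlim: "(\<lambda>k. deriv (u (r k)) t) \<longlonglongrightarrow> w t" for t
  proof -
    have "(\<lambda>k. (t0, u (r k) t0, deriv (u (r k)) t0, t)) \<longlonglongrightarrow> (t0, x0, v0, t)"
      by (intro tendsto_Pair x0 v0 tendsto_const)
    from continuous_on_tendsto_compose[OF W_cont this]
    have "(\<lambda>k. W t0 (u (r k) t0) (deriv (u (r k)) t0) t) \<longlonglongrightarrow> w t" by (simp add: w_def)
    then show ?thesis using flow_of_minimizer[OF u, of _ t t0] by simp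
  qed
  obtain Z0 where Z0: "\<And>t. (Z0 has_real_derivative w t) (at t)" using antiderivative_exists[OF contw] by blast
  define Z where "Z t = Z0 t + (x0 - Z0 t0)" for t
  have Z: "(Z has_real_derivative w t) (at t)" for t
    unfolding Z_def using DERIV_add[OF Z0 DERIV_const] by simp
  have ZC1: "Z C1_differentiable_on S" "deriv Z t = w t" for S t
    using C1_I(1)[of S Z w, OF Z contw] DERIV_imp_deriv[OF Z] by auto
  have diff: "(\<lambda>k. u (r k) b - u (r k) a) \<longlonglongrightarrow> Z b - Z a" if ab: "a \<le> b" for a b
  proof -
    have 1: "integral {a..b} (deriv (u (r k))) = u (r k) b - u (r k) a" "deriv (u (r k)) integrable_on {a..b}" for k
      by (rule integral_deriv[OF ab C1_has_deriv(1)[OF M_C1[OF u]]], assumption)+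
    have "(\<lambda>k. integral {a..b} (deriv (u (r k)))) \<longlonglongrightarrow> integral {a..b} w"
      by (rule dominated_convergence(2)[OF 1(2) integrable_const_ivl[of V]]) (use V[OF u] vlim in auto)
    then show ?thesis using integral_deriv(1)[OF ab, of Z w] Z by (simp add: 1)
  qed
  have ulim: "(\<lambda>k. u (r k) t) \<longlonglongrightarrow> Z t" for t
  proof (cases "t0 \<le> t")
    case True
    from tendsto_add[OF x0 diff[OF True]] have "(\<lambda>k. u (r k) t) \<longlonglongrightarrow> x0 + (Z t - Z t0)" by simp
    also have "x0 + (Z t - Z t0) = Z t" by (simp add: Z_def)
    finally show ?thesis .
  next
    case False
    then have "t \<le> t0" by simp
    from tendsto_diff[OF x0 diff[OF this]] have "(\<lambda>k. u (r k) t) \<longlonglongrightarrow> x0 - (Z t0 - Z t)" by simp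
    also have "x0 - (Z t0 - Z t) = Z t" by (simp add: Z_def)
    finally show ?thesis .
  qed
  have "Z \<in> M" unfolding M_iff
  proof (intro conjI allI impI ballI)
    show "Z C1_differentiable_on UNIV" by (rule ZC1(1))
    fix a b y assume ab: "a < b" and y: "y \<in> competitors a (Z a) b (Z b)"
    have yC1: "y C1_differentiable_on {a..b}" using y by (simp add: competitors_def)
    define p where "p k = u (r k) a - Z a" for k
    define q where "q k = ((u (r k) b - Z b) - p k) / (b - a)" for k
    have p_lim: "p \<longlonglongrightarrow> 0" unfolding p_def[abs_def] using tendsto_diff[OF ulim[of a] tendsto_const[of "Z a"]] by simp
    have "q \<longlonglongrightarrow> ((Z b - Z b) - 0) / (b - a)"
      unfolding q_def[abs_def] by (intro tendsto_intros ulim p_lim) (use ab in simp)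
    then have q_lim: "q \<longlonglongrightarrow> 0" by simp
    define z where "z k t = y t + (p k + q k * (t - a))" for k t
    have zC1: "z k C1_differentiable_on {a..b}" "\<And>t. t \<in> {a..b} \<Longrightarrow> deriv (z k) t = deriv y t + q k" for k
      unfolding z_def[abs_def] by (rule C1_affine_perturbation[OF yC1], assumption?)+
    have "q k * (b - a) = (u (r k) b - Z b) - p k" for k using ab by (simp add: q_def)
    then have "z k b - u (r k) b = y b - Z b" for k by (simp add: z_def)
    moreover have "z k a - u (r k) a = y a - Z a" for k by (simp add: z_def p_def)
    ultimately have "z k \<in> competitors a (u (r k) a) b (u (r k) b)" for k
      using y zC1(1) by (simp add: competitors_def)
    then have le: "act (u (r k)) a b \<le> act (z k) a b" for k using u ab by (simp add: M_iff)
    have lim1: "(\<lambda>k. act (u (r k)) a b) \<longlonglongrightarrow> act Z a b"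
      unfolding act_def[of Z] ZC1(2)
      by (rule act_tendsto(2)[OF M_C1[OF u] V[OF u] ulim vlim])
    obtain E where "\<forall>t\<in>{a..b}. \<bar>deriv y t\<bar> \<le> E"
      using compact_imp_bounded[OF compact_continuous_image[OF C1_has_deriv(2)[OF yC1] compact_Icc]]
      by (auto simp: bounded_iff)
    moreover obtain E' where E': "\<And>n. \<bar>q n\<bar> \<le> E'"
      using Bseq_def[of q] convergent_imp_Bseq[OF convergentI[OF q_lim]] by auto
    ultimately have E: "\<bar>deriv (z k) t\<bar> \<le> E + E'" if "t \<in> {a..b}" for k t
    proof -
      have "\<bar>deriv y t\<bar> \<le> E" using \<open>\<forall>t\<in>{a..b}. \<bar>deriv y t\<bar> \<le> E\<close> that by blast
      then show ?thesis using E'[of k] zC1(2)[OF that, of k] by linarith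
    qed
    have lim2: "(\<lambda>k. act (z k) a b) \<longlonglongrightarrow> act y a b"
      unfolding act_def[of y]
    proof (rule act_tendsto(2)[OF zC1(1) E])
      have "(\<lambda>k. z k t) \<longlonglongrightarrow> y t + (0 + 0 * (t - a))" for t
        unfolding z_def by (intro tendsto_intros p_lim q_lim)
      then show "(\<lambda>k. z k t) \<longlonglongrightarrow> y t" for t by simp
      show "(\<lambda>k. deriv (z k) t) \<longlonglongrightarrow> deriv y t" if "t \<in> {a..b}" for t
        using tendsto_add[OF tendsto_const[of "deriv y t"] q_lim] zC1(2)[OF that] by simp
    qed
    show "act Z a b \<le> act y a b" by (rule LIMSEQ_le[OF lim1 lim2]) (use le in blast)
  qed
  then show ?thesis using r(1) ulim by blast
qed

lemma dense_cover:
  assumes "\<And>e. e > 0 \<Longrightarrow> \<exists>\<gamma>\<in>M. \<exists>s. \<bar>s - t\<bar> < e \<and> \<bar>\<gamma> s - x\<bar> < e"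
  shows "\<exists>\<gamma>\<in>M. \<gamma> t = x"
proof -
  obtain V where V: "\<And>\<gamma> t u. \<gamma> \<in> M \<Longrightarrow> \<bar>\<gamma> t - \<gamma> u\<bar> \<le> V * \<bar>t - u\<bar>" using minimizer_lipschitz by blast
  have "\<forall>n. \<exists>\<gamma> s. \<gamma> \<in> M \<and> \<bar>s - t\<bar> < inverse (real (Suc n)) \<and> \<bar>\<gamma> s - x\<bar> < inverse (real (Suc n))"
    using assms by (metis inverse_positive_iff_positive of_nat_0_less_iff zero_less_Suc)
  then obtain u s where us: "\<And>n. u n \<in> M" "\<And>n. \<bar>s n - t\<bar> < inverse (real (Suc n))"
    "\<And>n. \<bar>u n (s n) - x\<bar> < inverse (real (Suc n))" by metis
  have "V \<ge> 0" using V[OF us(1), of 0 1 0] by simp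
  have bound: "\<bar>u n t - x\<bar> \<le> (V + 1) * inverse (real (Suc n))" for n
  proof -
    have "\<bar>u n t - u n (s n)\<bar> \<le> V * inverse (real (Suc n))"
      using V[OF us(1), of n t "s n"] us(2)[of n] \<open>V \<ge> 0\<close>
      by (smt (verit) abs_minus_commute mult_left_mono)
    then show ?thesis using us(3)[of n] by (simp add: algebra_simps)
  qed
  have "(\<lambda>n. (V + 1) * inverse (real (Suc n))) \<longlonglongrightarrow> (V + 1) * 0"
    by (intro tendsto_mult tendsto_const LIMSEQ_inverse_real_of_nat)
  then have g: "(\<lambda>n. (V + 1) * inverse (real (Suc n))) \<longlonglongrightarrow> 0" by (simp only: mult_zero_right)
  have "(\<lambda>n. u n t - x) \<longlonglongrightarrow> 0"
    by (rule Lim_null_comparison[OF _ g], rule always_eventually, rule allI) (simp only: real_norm_def bound)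
  then have lim: "(\<lambda>n. u n t) \<longlonglongrightarrow> x" by (rule LIM_zero_cancel)
  obtain r \<beta> where r: "strict_mono r" "\<beta> \<in> M" "\<And>s. (\<lambda>k. u (r k) s) \<longlonglongrightarrow> \<beta> s"
    using compactness[of u t, OF us(1) convergent_imp_bounded[OF lim]] by blast
  have "(\<lambda>k. u (r k) t) \<longlonglongrightarrow> x" using LIMSEQ_subseq_LIMSEQ[OF lim r(1)] by (simp add: o_def)
  then have "\<beta> t = x" by (rule LIMSEQ_unique[OF r(3)])
  then show ?thesis using r(2) by blast
qed

lemma minimizing_curves:
  assumes "\<And>t x. \<exists>\<gamma>\<in>M. \<gamma> t = x"
  shows "minimizing_curves M cost"
proof
  show "(\<gamma> has_real_derivative deriv \<gamma> t) (at t)" if "\<gamma> \<in> M" for \<gamma> t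
    by (rule C1_has_deriv(1)[OF M_C1[OF that, of UNIV]]) simp
  show "cost a (\<gamma> a) c (\<gamma> c) = cost a (\<gamma> a) b (\<gamma> b) + cost b (\<gamma> b) c (\<gamma> c)"
    if "\<gamma> \<in> M" "a < b" "b < c" for \<gamma> a b c
    using that cost_minimizer[OF that(1)] act_additive[OF M_C1[OF that(1)], of a b c] by simp
qed (fact unique_minimizer shift_mem_M compactness assms cost_triangle cost_space_shift cost_time_shift
    cost_corner cost_end cost_bounded)+

end

section \<open>Lipschitz regularity of ordered minimizers\<close>

text \<open>A solution of \<open>r' \<le> - \<kappa> r\<^sup>2\<close> that exceeds \<open>B\<close> at time \<open>t\<close> has exceeded it at all earlier
times, and there \<open>1 / r\<close> increases at least at rate \<open>\<kappa>\<close>. Hence at time \<open>t - 2 / (\<kappa> r t)\<close> it would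
have been negative.\<close>

lemma riccati_bound_above:
  fixes r r' :: "real \<Rightarrow> real"
  assumes D: "\<And>t. (r has_real_derivative r' t) (at t)" and \<kappa>: "\<kappa> > 0" and B: "B > 0"
    and le: "\<And>t. r t \<ge> B \<Longrightarrow> r' t \<le> - \<kappa> * (r t)\<^sup>2"
  shows "r t \<le> B"
proof (rule ccontr)
  assume "\<not> r t \<le> B"
  then have t: "r t > B" by simp
  have cont: "continuous_on S r" for S using D by (metis DERIV_isCont continuous_at_imp_continuous_on)
  have past: "r u > B" if "u \<le> t" for u
  proof (rule ccontr)
    assume u: "\<not> r u > B"
    define S where "S = {u..t} \<inter> {s. r s \<le> B}"
    have "compact S" unfolding S_def
      by (intro compact_Int_closed compact_Icc closed_Collect_le cont continuous_on_const)
    moreover have "u \<in> S" using u that by (simp add: S_def)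
    ultimately obtain s where s: "s \<in> S" "\<And>s'. s' \<in> S \<Longrightarrow> s' \<le> s"
      using compact_attains_sup[of S] by blast
    have "s < t" using s(1) t by (auto simp: S_def less_le)
    then obtain \<xi> where \<xi>: "s < \<xi>" "\<xi> < t" "r t - r s = (t - s) * r' \<xi>"
      using MVT2[OF \<open>s < t\<close>, of r r'] D by auto
    have "r \<xi> > B" using s(2)[of \<xi>] s(1) \<xi> by (force simp: S_def)
    then have "r' \<xi> \<le> 0" using le[of \<xi>] \<kappa> by (smt (verit) mult_nonneg_nonneg mult_minus_left zero_le_power2)
    then have "r t \<le> r s" using \<xi> by (smt (verit) mult_nonneg_nonpos)
    then show False using s(1) t by (simp add: S_def)
  qed
  have pos: "r u > 0" if "u \<le> t" for u using past[OF that] B by simp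
  define u where "u = t - 2 / (\<kappa> * r t)"
  have ut: "u < t" using \<kappa> pos[of t] by (simp add: u_def)
  have "\<exists>\<xi>. u < \<xi> \<and> \<xi> < t \<and> inverse (r t) - inverse (r u) = (t - u) * (- (inverse (r \<xi>) * r' \<xi> * inverse (r \<xi>)))"
  proof (rule MVT2[OF ut])
    fix s assume "u \<le> s" "s \<le> t"
    then show "((\<lambda>t. inverse (r t)) has_real_derivative - (inverse (r s) * r' s * inverse (r s))) (at s)"
      using pos[of s] by (intro DERIV_inverse' D) simp
  qed
  then obtain \<xi> where \<xi>: "u < \<xi>" "\<xi> < t"
    "inverse (r t) - inverse (r u) = (t - u) * (- (inverse (r \<xi>) * r' \<xi> * inverse (r \<xi>)))" by blast
  have "r' \<xi> \<le> - \<kappa> * (r \<xi>)\<^sup>2" using le[of \<xi>] past[of \<xi>] \<xi> by simp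
  then have "\<kappa> \<le> - (inverse (r \<xi>) * r' \<xi> * inverse (r \<xi>))"
    using pos[of \<xi>] \<xi>(2) by (simp add: field_simps power2_eq_square)
  then have "(t - u) * \<kappa> \<le> inverse (r t) - inverse (r u)" using ut unfolding \<xi>(3) by (intro mult_left_mono) auto
  moreover have "(t - u) * \<kappa> = 2 * inverse (r t)" using \<kappa> pos[of t] by (simp add: u_def field_simps)
  moreover have "inverse (r u) > 0" "inverse (r t) > 0" using pos[of u] pos[of t] ut by simp_all
  ultimately show False by linarith
qed

lemma riccati_bound:
  fixes r r' :: "real \<Rightarrow> real"
  assumes D: "\<And>t. (r has_real_derivative r' t) (at t)" and \<kappa>: "\<kappa> > 0" and B: "B > 0"
    and le: "\<And>t. \<bar>r t\<bar> \<ge> B \<Longrightarrow> r' t \<le> - \<kappa> * (r t)\<^sup>2"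
  shows "\<bar>r t\<bar> \<le> B"
proof -
  have "r t \<le> B" by (rule riccati_bound_above[OF D \<kappa> B]) (use le in auto)
  moreover have "- r (- (- t)) \<le> B"
  proof (rule riccati_bound_above[of "\<lambda>t. - r (- t)" "\<lambda>t. r' (- t)", OF _ \<kappa> B])
    show "((\<lambda>t. - r (- t)) has_real_derivative r' (- t)) (at t)" for t
      using DERIV_minus[OF DERIV_chain2[OF D DERIV_minus[OF DERIV_ident]]] by simp
    show "r' (- t) \<le> - \<kappa> * (- r (- t))\<^sup>2" if "B \<le> - r (- t)" for t
      using le[of "- t"] that by simp
  qed
  ultimately show ?thesis by simp
qed

context tonelli
begin

text \<open>With the distance \<open>\<delta>\<close> of the two minimizers and the difference \<open>\<pi>\<close> of their momenta, the slope
\<open>r = \<pi> / \<delta>\<close> exists for all times. The Euler-Lagrange equation bounds \<open>\<pi>'\<close> by the distance \<open>\<delta>\<close> and the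
velocity difference \<open>\<Delta> = \<delta>'\<close>, while convexity makes \<open>\<Delta>\<close> comparable to \<open>\<pi>\<close> when \<open>r\<close> is large. So
\<open>r' = (\<pi>' - r \<Delta>) / \<delta>\<close> is dominated by \<open>- r\<^sup>2\<close>, the Riccati comparison bounds \<open>r\<close>, and with it
\<open>\<Delta> / \<delta>\<close>.\<close>

lemma graph_lipschitz_space:
  "\<exists>K. \<forall>\<gamma>\<in>M. \<forall>\<beta>\<in>M. (\<forall>t. \<gamma> t < \<beta> t) \<longrightarrow> (\<forall>t. \<bar>deriv \<beta> t - deriv \<gamma> t\<bar> \<le> K * (\<beta> t - \<gamma> t))"
proof -
  obtain V where V: "V > 0" "\<And>\<gamma> t. \<gamma> \<in> M \<Longrightarrow> \<bar>deriv \<gamma> t\<bar> \<le> V" using velocity_bound by blast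
  obtain K1 where K1: "\<And>s v t s' v' t'. \<bar>v\<bar> \<le> V \<Longrightarrow> \<bar>v'\<bar> \<le> V \<Longrightarrow>
      \<bar>Gs s v t - Gs s' v' t'\<bar> \<le> K1 * (\<bar>s - s'\<bar> + \<bar>v - v'\<bar> + \<bar>t - t'\<bar>)" using Gs_lipschitz[of V] by blast
  obtain K2 where K2: "\<And>s v t s' v' t'. \<bar>v\<bar> \<le> V \<Longrightarrow> \<bar>v'\<bar> \<le> V \<Longrightarrow>
      \<bar>Gv s v t - Gv s' v' t'\<bar> \<le> K2 * (\<bar>s - s'\<bar> + \<bar>v - v'\<bar> + \<bar>t - t'\<bar>)" using Gv_lipschitz[of V] by blast
  define K where "K = max 1 (max K1 K2)"
  have K: "K \<ge> 1" "K1 \<le> K" "K2 \<le> K" by (auto simp: K_def)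
  have KGs: "\<bar>Gs s v t - Gs s' v' t\<bar> \<le> K * (\<bar>s - s'\<bar> + \<bar>v - v'\<bar>)" if "\<bar>v\<bar> \<le> V" "\<bar>v'\<bar> \<le> V" for s v t s' v'
  proof -
    have "K1 * (\<bar>s - s'\<bar> + \<bar>v - v'\<bar>) \<le> K * (\<bar>s - s'\<bar> + \<bar>v - v'\<bar>)" using K by (intro mult_right_mono) auto
    then show ?thesis using K1[OF that, of s t s' t] by simp
  qed
  have KGv: "\<bar>Gv s v t - Gv s' v' t\<bar> \<le> K * (\<bar>s - s'\<bar> + \<bar>v - v'\<bar>)" if "\<bar>v\<bar> \<le> V" "\<bar>v'\<bar> \<le> V" for s v t s' v'
  proof -
    have "K2 * (\<bar>s - s'\<bar> + \<bar>v - v'\<bar>) \<le> K * (\<bar>s - s'\<bar> + \<bar>v - v'\<bar>)" using K by (intro mult_right_mono) auto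
    then show ?thesis using K2[OF that, of s t s' t] by simp
  qed
  obtain m where m: "m > 0" "\<And>s v v' t. \<bar>v\<bar> \<le> V \<Longrightarrow> \<bar>v'\<bar> \<le> V \<Longrightarrow>
      m * (v - v')\<^sup>2 \<le> (Gv s v t - Gv s v' t) * (v - v')" using Gv_monotone[of V] by blast
  define c where "c = K + K\<^sup>2 / m + K / m + 1"
  define B where "B = max 1 (2 * K * c)"
  have B: "B \<ge> 1" "B \<ge> 2 * K * c" by (auto simp: B_def)
  have c: "c \<ge> 1" using K m by (simp add: c_def)
  have KB: "K \<le> B"
  proof -
    have "K * 1 \<le> (2 * K) * c" using K c by (intro mult_mono) auto
    then show ?thesis using B(2) by simp
  qed
  have "\<bar>deriv \<beta> t - deriv \<gamma> t\<bar> \<le> (B + K) / m * (\<beta> t - \<gamma> t)"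
    if M: "\<gamma> \<in> M" "\<beta> \<in> M" and lt: "\<And>t. \<gamma> t < \<beta> t" for \<gamma> \<beta> t
  proof -
    define \<delta> where "\<delta> t = \<beta> t - \<gamma> t" for t
    define \<Delta> where "\<Delta> t = deriv \<beta> t - deriv \<gamma> t" for t
    define \<pi> where "\<pi> t = Gv (\<beta> t) (deriv \<beta> t) t - Gv (\<gamma> t) (deriv \<gamma> t) t" for t
    define \<pi>' where "\<pi>' t = Gs (\<beta> t) (deriv \<beta> t) t - Gs (\<gamma> t) (deriv \<gamma> t) t" for t
    define E where "E t = Gv (\<beta> t) (deriv \<beta> t) t - Gv (\<beta> t) (deriv \<gamma> t) t" for t
    have \<delta>: "\<delta> t > 0" for t using lt by (simp add: \<delta>_def)
    have \<delta>D: "(\<delta> has_real_derivative \<Delta> t) (at t)" for t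
      unfolding \<delta>_def \<Delta>_def by (intro DERIV_diff C1_has_deriv(1)[OF M_C1[OF M(1), of UNIV]] C1_has_deriv(1)[OF M_C1[OF M(2), of UNIV]]) auto
    have \<pi>D: "(\<pi> has_real_derivative \<pi>' t) (at t)" for t
      unfolding \<pi>_def \<pi>'_def by (intro DERIV_diff euler_lagrange M)
    have \<pi>E: "\<bar>\<pi> t - E t\<bar> \<le> K * \<delta> t" for t
      using KGv[OF V(2)[OF M(1)] V(2)[OF M(1)], of "\<beta> t" t t "\<gamma> t" t] \<delta>[of t]
      by (simp add: \<pi>_def E_def \<delta>_def)
    have E\<Delta>: "m * (\<Delta> t)\<^sup>2 \<le> E t * \<Delta> t" for t
      unfolding E_def \<Delta>_def by (rule m(2)[OF V(2)[OF M(2)] V(2)[OF M(1)]])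
    have EK: "\<bar>E t\<bar> \<le> K * \<bar>\<Delta> t\<bar>" for t
      using KGv[OF V(2)[OF M(2)] V(2)[OF M(1)], of "\<beta> t" t t "\<beta> t" t] by (simp add: E_def \<Delta>_def)
    have \<Delta>m: "m * \<bar>\<Delta> t\<bar> \<le> \<bar>\<pi> t\<bar> + K * \<delta> t" for t
    proof -
      have "m * \<bar>\<Delta> t\<bar> \<le> \<bar>E t\<bar>"
      proof (cases "\<Delta> t = 0")
        case False
        have "(m * \<bar>\<Delta> t\<bar>) * \<bar>\<Delta> t\<bar> = m * (\<Delta> t)\<^sup>2" by (simp add: power2_eq_square)
        also have "\<dots> \<le> \<bar>E t * \<Delta> t\<bar>" using E\<Delta>[of t] by linarith
        also have "\<dots> = \<bar>E t\<bar> * \<bar>\<Delta> t\<bar>" by (simp add: abs_mult)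
        finally show ?thesis using False by (simp add: mult_le_cancel_right)
      qed simp
      then show ?thesis using \<pi>E[of t] by linarith
    qed
    have \<pi>'K: "\<bar>\<pi>' t\<bar> \<le> K * (\<delta> t + \<bar>\<Delta> t\<bar>)" for t
      using KGs[OF V(2)[OF M(2)] V(2)[OF M(1)], of "\<beta> t" t t "\<gamma> t" t] \<delta>[of t]
      by (simp add: \<pi>'_def \<Delta>_def \<delta>_def)
    define r where "r t = \<pi> t / \<delta> t" for t
    define r' where "r' t = (\<pi>' t - r t * \<Delta> t) / \<delta> t" for t
    have rD: "(r has_real_derivative r' t) (at t)" for t
    proof -
      have "(r has_real_derivative (\<pi>' t * \<delta> t - \<pi> t * \<Delta> t) / (\<delta> t * \<delta> t)) (at t)"
        unfolding r_def by (rule DERIV_divide[OF \<pi>D \<delta>D]) (use \<delta>[of t] in simp)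
      moreover have "(\<pi>' t * \<delta> t - \<pi> t * \<Delta> t) / (\<delta> t * \<delta> t) = r' t"
        using \<delta>[of t] by (simp add: r'_def r_def field_simps)
      ultimately show ?thesis by simp
    qed
    have "r' t \<le> - (1 / (2 * K)) * (r t)\<^sup>2" if R: "\<bar>r t\<bar> \<ge> B" for t
    proof -
      define R where "R = \<bar>r t\<bar>"
      define y where "y = \<bar>\<Delta> t\<bar> / \<delta> t"
      have R: "R \<ge> B" using that by (simp add: R_def)
      have RK: "K \<le> R" using R KB by simp
      have \<pi>R: "\<bar>\<pi> t\<bar> = R * \<delta> t" using \<delta>[of t] by (simp add: R_def r_def)
      have y: "y \<le> (R + K) / m"
        using \<Delta>m[of t] \<delta>[of t] m(1) unfolding \<pi>R y_def by (simp add: field_simps)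
      \<comment> \<open>For large slopes the velocity difference has the sign of the slope.\<close>
      have sign: "r t * \<Delta> t = R * \<bar>\<Delta> t\<bar>"
      proof (cases "\<Delta> t = 0")
        case False
        then have "E t * \<Delta> t > 0" using E\<Delta>[of t] m(1) by (smt (verit) mult_pos_pos zero_less_power2)
        moreover have "E t * \<pi> t \<ge> 0"
        proof -
          have "K * \<delta> t \<le> \<bar>\<pi> t\<bar>" unfolding \<pi>R using RK \<delta>[of t] by (intro mult_right_mono) auto
          then have "(0 \<le> \<pi> t \<and> 0 \<le> E t) \<or> (\<pi> t \<le> 0 \<and> E t \<le> 0)" using \<pi>E[of t] by linarith
          then show ?thesis by (auto simp: zero_le_mult_iff)
        qed
        ultimately have "\<pi> t * \<Delta> t \<ge> 0" by (auto simp: zero_le_mult_iff zero_less_mult_iff)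
        then have "r t * \<Delta> t \<ge> 0" using \<delta>[of t] by (simp add: r_def)
        then show ?thesis by (simp add: R_def abs_mult[symmetric])
      qed simp
      have y': "R / K - 1 \<le> y"
      proof -
        have "R * \<delta> t - K * \<delta> t \<le> \<bar>E t\<bar>" using \<pi>E[of t] \<pi>R by linarith
        also have "\<dots> \<le> K * \<bar>\<Delta> t\<bar>" by (rule EK)
        finally have "(R - K) * \<delta> t \<le> K * \<bar>\<Delta> t\<bar>" by (simp add: algebra_simps)
        then show ?thesis using \<delta>[of t] K(1) unfolding y_def by (simp add: field_simps)
      qed
      have "r' t \<le> K * (1 + y) - R * y"
      proof -
        have "r' t = \<pi>' t / \<delta> t - R * y" unfolding r'_def sign y_def by (simp add: diff_divide_distrib)
        moreover have "\<pi>' t / \<delta> t \<le> K * (\<delta> t + \<bar>\<Delta> t\<bar>) / \<delta> t"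
          using \<pi>'K[of t] \<delta>[of t] by (intro divide_right_mono) auto
        moreover have "K * (\<delta> t + \<bar>\<Delta> t\<bar>) / \<delta> t = K * (1 + y)" using \<delta>[of t] by (simp add: y_def field_simps)
        ultimately show ?thesis by linarith
      qed
      also have "\<dots> \<le> K * (1 + (R + K) / m) - R * (R / K - 1)"
        using y y' K(1) R B(1) by (intro diff_mono mult_left_mono) auto
      also have "\<dots> = (K + K\<^sup>2 / m) + R * (K / m + 1) - R\<^sup>2 / K"
        by (simp add: field_simps power2_eq_square add_divide_distrib)
      also have "\<dots> \<le> R * c - R\<^sup>2 / K"
      proof -
        have "(K + K\<^sup>2 / m) * 1 \<le> (K + K\<^sup>2 / m) * R"
          using R B(1) K(1) m(1) by (intro mult_left_mono) auto
        then show ?thesis by (simp add: c_def algebra_simps)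
      qed
      also have "R * c \<le> R * (R / (2 * K))"
      proof -
        have "2 * K * c \<le> R" using B(2) R by linarith
        then have "c \<le> R / (2 * K)" using K(1) by (simp add: field_simps)
        then show ?thesis using R B(1) by (intro mult_left_mono) auto
      qed
      also have "R * (R / (2 * K)) - R\<^sup>2 / K = - (1 / (2 * K)) * (r t)\<^sup>2"
        using K(1) by (simp add: R_def power2_eq_square field_simps)
      finally show ?thesis by simp
    qed
    then have "\<bar>r t\<bar> \<le> B" using riccati_bound[OF rD, of "1 / (2 * K)" B t] K(1) B(1) by simp
    then have "\<bar>\<pi> t\<bar> \<le> B * \<delta> t" using \<delta>[of t] by (simp add: r_def divide_le_eq)
    then have "m * \<bar>\<Delta> t\<bar> \<le> (B + K) * \<delta> t" using \<Delta>m[of t] by (simp add: algebra_simps)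
    then show ?thesis using m(1) by (simp add: \<Delta>_def \<delta>_def field_simps)
  qed
  then show ?thesis by blast
qed

text \<open>By the Euler-Lagrange equation the momentum is Lipschitz in time, and convexity recovers the
velocity from the momentum.\<close>

lemma graph_lipschitz_time:
  "\<exists>K. \<forall>\<gamma>\<in>M. \<forall>t u. \<bar>deriv \<gamma> t - deriv \<gamma> u\<bar> \<le> K * \<bar>t - u\<bar>"
proof -
  obtain V where V: "V > 0" "\<And>\<gamma> t. \<gamma> \<in> M \<Longrightarrow> \<bar>deriv \<gamma> t\<bar> \<le> V" using velocity_bound by blast
  obtain V' where V': "\<And>\<gamma> t u. \<gamma> \<in> M \<Longrightarrow> \<bar>\<gamma> t - \<gamma> u\<bar> \<le> V' * \<bar>t - u\<bar>" using minimizer_lipschitz by blast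
  obtain B where B: "\<And>s v t. \<bar>v\<bar> \<le> V \<Longrightarrow> \<bar>Gs s v t\<bar> \<le> B" using Gs_bounded[of V] by blast
  obtain K where K: "\<And>s v t s' v' t'. \<bar>v\<bar> \<le> V \<Longrightarrow> \<bar>v'\<bar> \<le> V \<Longrightarrow>
      \<bar>Gv s v t - Gv s' v' t'\<bar> \<le> K * (\<bar>s - s'\<bar> + \<bar>v - v'\<bar> + \<bar>t - t'\<bar>)" using Gv_lipschitz[of V] by blast
  have K0: "K \<ge> 0" using K[of 0 0 0 1 0 0] V(1) by simp
  obtain m where m: "m > 0" "\<And>s v v' t. \<bar>v\<bar> \<le> V \<Longrightarrow> \<bar>v'\<bar> \<le> V \<Longrightarrow>
      m * (v - v')\<^sup>2 \<le> (Gv s v t - Gv s v' t) * (v - v')" using Gv_monotone[of V] by blast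
  have "\<bar>deriv \<gamma> t - deriv \<gamma> u\<bar> \<le> (B + K * (V' + 1)) / m * \<bar>t - u\<bar>" if \<gamma>: "\<gamma> \<in> M" for \<gamma> t u
  proof -
    define p where "p t = Gv (\<gamma> t) (deriv \<gamma> t) t" for t
    define \<Delta> where "\<Delta> = deriv \<gamma> t - deriv \<gamma> u"
    define E where "E = Gv (\<gamma> t) (deriv \<gamma> t) t - Gv (\<gamma> t) (deriv \<gamma> u) t"
    have "norm (p t - p u) \<le> B * norm (t - u)"
      by (rule field_differentiable_bound[of UNIV _ "\<lambda>t. Gs (\<gamma> t) (deriv \<gamma> t) t"])
        (use euler_lagrange[OF \<gamma>] B[OF V(2)[OF \<gamma>]] in \<open>auto simp: p_def[abs_def] intro: has_field_derivative_at_within\<close>)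
    moreover have "\<bar>Gv (\<gamma> u) (deriv \<gamma> u) u - Gv (\<gamma> t) (deriv \<gamma> u) t\<bar> \<le> K * (V' + 1) * \<bar>t - u\<bar>"
    proof -
      have "\<bar>Gv (\<gamma> u) (deriv \<gamma> u) u - Gv (\<gamma> t) (deriv \<gamma> u) t\<bar> \<le> K * (\<bar>\<gamma> u - \<gamma> t\<bar> + 0 + \<bar>u - t\<bar>)"
        using K[OF V(2)[OF \<gamma>] V(2)[OF \<gamma>], of "\<gamma> u" u u "\<gamma> t" u t] by simp
      also have "\<dots> \<le> K * (V' * \<bar>t - u\<bar> + 0 + \<bar>t - u\<bar>)"
        using V'[OF \<gamma>, of u t] K0 by (intro mult_left_mono) (auto simp: abs_minus_commute)
      finally show ?thesis by (simp add: algebra_simps)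
    qed
    ultimately have E: "\<bar>E\<bar> \<le> (B + K * (V' + 1)) * \<bar>t - u\<bar>"
      by (simp add: E_def p_def algebra_simps)
    have "m * \<bar>\<Delta>\<bar> \<le> \<bar>E\<bar>"
    proof (cases "\<Delta> = 0")
      case False
      have "(m * \<bar>\<Delta>\<bar>) * \<bar>\<Delta>\<bar> = m * \<Delta>\<^sup>2" by (simp add: power2_eq_square)
      also have "\<dots> \<le> \<bar>E * \<Delta>\<bar>" using m(2)[OF V(2)[OF \<gamma>] V(2)[OF \<gamma>], of t u "\<gamma> t" t] unfolding E_def \<Delta>_def by linarith
      also have "\<dots> = \<bar>E\<bar> * \<bar>\<Delta>\<bar>" by (simp add: abs_mult)
      finally show ?thesis using False by (simp add: mult_le_cancel_right)
    qed simp
    then have "m * \<bar>\<Delta>\<bar> \<le> (B + K * (V' + 1)) * \<bar>t - u\<bar>" using E by linarith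
    then show ?thesis using m(1) unfolding \<Delta>_def by (simp add: field_simps)
  qed
  then show ?thesis by blast
qed

text \<open>Leaves are disjoint, hence ordered, so the two preceding bounds combine: go from \<open>(t, \<gamma> t)\<close> to
\<open>\<beta>\<close> at the same time, and then along \<open>\<beta>\<close>.\<close>

theorem lipschitz_foliation:
  assumes dense: "\<And>t x e. e > 0 \<Longrightarrow> \<exists>\<gamma>\<in>M. \<exists>s. \<bar>s - t\<bar> < e \<and> \<bar>\<gamma> s - x\<bar> < e"
  shows "\<exists>F\<subseteq>M. (\<forall>\<gamma>\<in>F. \<forall>\<beta>\<in>F. \<forall>s. \<gamma> s = \<beta> s \<longrightarrow> \<gamma> = \<beta>) \<and> (\<forall>\<gamma>\<in>F. \<forall>m n. shift m n \<gamma> \<in> F)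
    \<and> (\<forall>x t. \<exists>\<gamma>\<in>F. \<gamma> t = x)
    \<and> (\<exists>K. \<forall>\<gamma>\<in>F. \<forall>\<beta>\<in>F. \<forall>t u. \<bar>deriv \<gamma> t - deriv \<beta> u\<bar> \<le> K * (\<bar>\<gamma> t - \<beta> u\<bar> + \<bar>t - u\<bar>))"
proof -
  have cover: "\<exists>\<gamma>\<in>M. \<gamma> t = x" for t x by (rule dense_cover, rule dense, assumption)
  interpret MC: minimizing_curves M cost by (rule minimizing_curves) (rule cover)
  obtain F where F: "F \<subseteq> M" "\<forall>\<gamma>\<in>F. \<forall>\<beta>\<in>F. \<forall>s. \<gamma> s = \<beta> s \<longrightarrow> \<gamma> = \<beta>" "\<forall>\<gamma>\<in>F. \<forall>m n. shift m n \<gamma> \<in> F"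
    "\<forall>x t. \<exists>\<gamma>\<in>F. \<gamma> t = x"
    using MC.foliation by (elim exE conjE)
  obtain K1 where K1: "\<And>\<gamma> \<beta> t. \<gamma> \<in> M \<Longrightarrow> \<beta> \<in> M \<Longrightarrow> (\<And>t. \<gamma> t < \<beta> t) \<Longrightarrow>
    \<bar>deriv \<beta> t - deriv \<gamma> t\<bar> \<le> K1 * (\<beta> t - \<gamma> t)" using graph_lipschitz_space by blast
  obtain K2 where K2: "\<And>\<gamma> t u. \<gamma> \<in> M \<Longrightarrow> \<bar>deriv \<gamma> t - deriv \<gamma> u\<bar> \<le> K2 * \<bar>t - u\<bar>"
    using graph_lipschitz_time by blast
  obtain V where V: "\<And>\<gamma> t u. \<gamma> \<in> M \<Longrightarrow> \<bar>\<gamma> t - \<gamma> u\<bar> \<le> V * \<bar>t - u\<bar>" using minimizer_lipschitz by blast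
  have K1': "\<bar>deriv \<beta> t - deriv \<gamma> t\<bar> \<le> \<bar>K1\<bar> * \<bar>\<beta> t - \<gamma> t\<bar>" if "\<gamma> \<in> F" "\<beta> \<in> F" for \<gamma> \<beta> t
  proof -
    have M: "\<gamma> \<in> M" "\<beta> \<in> M" using that F(1) by blast+
    have nt: "\<gamma> = \<beta> \<or> (\<forall>s. \<gamma> s \<noteq> \<beta> s)" using F(2) that by blast
    have le: "K1 * x \<le> \<bar>K1\<bar> * \<bar>x\<bar>" for x by (metis abs_ge_self abs_mult)
    consider "\<gamma> = \<beta>" | "\<And>s. \<gamma> s < \<beta> s" | "\<And>s. \<beta> s < \<gamma> s"
      using nt MC.no_touch_ordered[OF M, of t] MC.no_touch_ordered[OF M(2,1), of t] by (metis linorder_neqE_linordered_idom)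
    then show ?thesis
    proof cases
      case 2
      from K1[OF M 2, of t] le[of "\<beta> t - \<gamma> t"] show ?thesis by linarith
    next
      case 3
      from K1[OF M(2,1) 3, of t] le[of "\<gamma> t - \<beta> t"] show ?thesis by (simp add: abs_minus_commute)
    qed simp
  qed
  define K where "K = \<bar>K1\<bar> + \<bar>K1\<bar> * \<bar>V\<bar> + \<bar>K2\<bar>"
  have "\<bar>deriv \<gamma> t - deriv \<beta> u\<bar> \<le> K * (\<bar>\<gamma> t - \<beta> u\<bar> + \<bar>t - u\<bar>)" if "\<gamma> \<in> F" "\<beta> \<in> F" for \<gamma> \<beta> t u
  proof -
    have M: "\<beta> \<in> M" using that F(1) by blast
    have "\<bar>\<gamma> t - \<beta> t\<bar> \<le> \<bar>\<gamma> t - \<beta> u\<bar> + \<bar>V\<bar> * \<bar>t - u\<bar>"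
      using V[OF M, of u t] by (smt (verit) abs_minus_commute abs_mult abs_ge_self mult_right_mono abs_ge_zero)
    then have "\<bar>K1\<bar> * \<bar>\<gamma> t - \<beta> t\<bar> \<le> \<bar>K1\<bar> * (\<bar>\<gamma> t - \<beta> u\<bar> + \<bar>V\<bar> * \<bar>t - u\<bar>)" by (rule mult_left_mono) simp
    then have 1: "\<bar>deriv \<gamma> t - deriv \<beta> t\<bar> \<le> \<bar>K1\<bar> * (\<bar>\<gamma> t - \<beta> u\<bar> + \<bar>V\<bar> * \<bar>t - u\<bar>)" using K1'[OF that(2,1), of t] by linarith
    have 2: "\<bar>deriv \<beta> t - deriv \<beta> u\<bar> \<le> \<bar>K2\<bar> * \<bar>t - u\<bar>"
      using K2[OF M, of t u] by (smt (verit) abs_ge_self mult_right_mono abs_ge_zero)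
    have "0 \<le> \<bar>K1\<bar> * \<bar>t - u\<bar> + \<bar>K1\<bar> * \<bar>V\<bar> * \<bar>\<gamma> t - \<beta> u\<bar> + \<bar>K2\<bar> * \<bar>\<gamma> t - \<beta> u\<bar>" by simp
    moreover have "K * (\<bar>\<gamma> t - \<beta> u\<bar> + \<bar>t - u\<bar>)
      = (\<bar>K1\<bar> * (\<bar>\<gamma> t - \<beta> u\<bar> + \<bar>V\<bar> * \<bar>t - u\<bar>) + \<bar>K2\<bar> * \<bar>t - u\<bar>)
        + (\<bar>K1\<bar> * \<bar>t - u\<bar> + \<bar>K1\<bar> * \<bar>V\<bar> * \<bar>\<gamma> t - \<beta> u\<bar> + \<bar>K2\<bar> * \<bar>\<gamma> t - \<beta> u\<bar>)"
      by (simp add: K_def algebra_simps)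
    ultimately show ?thesis using 1 2 by linarith
  qed
  then have "\<exists>K. \<forall>\<gamma>\<in>F. \<forall>\<beta>\<in>F. \<forall>t u. \<bar>deriv \<gamma> t - deriv \<beta> u\<bar> \<le> K * (\<bar>\<gamma> t - \<beta> u\<bar> + \<bar>t - u\<bar>)"
    by blast
  note lip = this
  show ?thesis by (rule exI[of _ F], intro conjI F lip)
qed

end

section \<open>Smooth functions on the line and on the circle\<close>

lemma C_diff_Suc_I:
  assumes "\<And>x. (f has_derivative f' x) (at x)" "\<And>v. C_diff k (\<lambda>x. f' x v)"
  shows "C_diff (Suc k) f"
proof -
  have "frechet_derivative f (at x) = f' x" for x by (rule frechet_derivative_at[OF assms(1), symmetric])
  then show ?thesis using assms by (auto simp: differentiable_def)
qed

lemma C_diff_SucD: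
  assumes "C_diff (Suc k) f"
  shows "(f has_derivative frechet_derivative f (at x)) (at x)" "C_diff k (\<lambda>x. frechet_derivative f (at x) v)"
  using assms by (auto simp: frechet_derivative_works)

lemma C_diff_decrease: "C_diff (Suc k) f \<Longrightarrow> C_diff k f"
proof (induction k arbitrary: f)
  case 0
  then show ?case
    using C_diff_SucD(1)[OF 0] by (auto intro!: continuous_at_imp_continuous_on dest: has_derivative_continuous)
next
  case (Suc k)
  then show ?case by (metis C_diff.simps(2))
qed

lemma smooth_continuous: "smooth f \<Longrightarrow> continuous_on S f"
  using C_diff.simps(1)[of f] continuous_on_subset[of UNIV f S] unfolding smooth_def by blast

lemma C_diff_const: "C_diff k (\<lambda>x. c)"
proof (induction k arbitrary: c)
  case (Suc k)
  show ?case by (rule C_diff_Suc_I[where f' = "\<lambda>x v. 0"]) (use Suc in auto)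
qed simp

lemma C_diff_bounded_linear: "bounded_linear f \<Longrightarrow> C_diff k f"
proof (cases k)
  case (Suc n)
  assume f: "bounded_linear f"
  show ?thesis unfolding Suc
    by (rule C_diff_Suc_I[where f' = "\<lambda>x. f"]) (use f C_diff_const in \<open>auto intro: bounded_linear_imp_has_derivative\<close>)
qed (simp add: linear_continuous_on)

lemma C_diff_bounded_linear_comp:
  assumes T: "bounded_linear T"
  shows "C_diff k f \<Longrightarrow> C_diff k (\<lambda>x. T (f x))"
proof (induction k arbitrary: f)
  case 0
  then show ?case by (simp add: bounded_linear.continuous_on[OF T])
next
  case (Suc k)
  show ?case
    by (rule C_diff_Suc_I[where f' = "\<lambda>x v. T (frechet_derivative f (at x) v)"])
      (auto intro!: bounded_linear.has_derivative[OF T] C_diff_SucD[OF Suc.prems] Suc.IH)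
qed

lemma C_diff_add: "C_diff k f \<Longrightarrow> C_diff k g \<Longrightarrow> C_diff k (\<lambda>x. f x + g x)"
proof (induction k arbitrary: f g)
  case 0
  then show ?case by (simp add: continuous_on_add)
next
  case (Suc k)
  show ?case
    by (rule C_diff_Suc_I[where f' = "\<lambda>x v. frechet_derivative f (at x) v + frechet_derivative g (at x) v"])
      (intro has_derivative_add C_diff_SucD(1)[OF Suc.prems(1)] C_diff_SucD(1)[OF Suc.prems(2)],
       rule Suc.IH[OF C_diff_SucD(2)[OF Suc.prems(1)] C_diff_SucD(2)[OF Suc.prems(2)]])
qed

lemma C_diff_mult:
  fixes f g :: "'a::euclidean_space \<Rightarrow> real"
  shows "C_diff k f \<Longrightarrow> C_diff k g \<Longrightarrow> C_diff k (\<lambda>x. f x * g x)"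
proof (induction k arbitrary: f g)
  case 0
  then show ?case by (simp add: continuous_on_mult)
next
  case (Suc k)
  show ?case
  proof (rule C_diff_Suc_I[where f' = "\<lambda>x v. f x * frechet_derivative g (at x) v + frechet_derivative f (at x) v * g x"])
    show "((\<lambda>x. f x * g x) has_derivative (\<lambda>v. f x * frechet_derivative g (at x) v + frechet_derivative f (at x) v * g x)) (at x)" for x
      by (intro has_derivative_mult C_diff_SucD(1)[OF Suc.prems(1)] C_diff_SucD(1)[OF Suc.prems(2)])
    show "C_diff k (\<lambda>x. f x * frechet_derivative g (at x) v + frechet_derivative f (at x) v * g x)" for v
      by (rule C_diff_add[OF Suc.IH[OF C_diff_decrease[OF Suc.prems(1)] C_diff_SucD(2)[OF Suc.prems(2)]]
        Suc.IH[OF C_diff_SucD(2)[OF Suc.prems(1)] C_diff_decrease[OF Suc.prems(2)]]])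
  qed
qed

lemma C_diff_real_I:
  fixes g :: "real \<Rightarrow> real"
  assumes "\<And>y. (g has_real_derivative g' y) (at y)" "C_diff k g'"
  shows "C_diff (Suc k) g"
proof (rule C_diff_Suc_I)
  show "(g has_derivative (\<lambda>v. v * g' x)) (at x)" for x
    using assms(1)[of x] by (simp add: has_field_derivative_def mult_commute_abs)
  show "C_diff k (\<lambda>x. v * g' x)" for v by (intro C_diff_mult C_diff_const assms(2))
qed

lemma C_diff_real_D:
  fixes g :: "real \<Rightarrow> real"
  assumes "C_diff (Suc k) g"
  shows "(g has_real_derivative deriv g y) (at y)" "C_diff k (deriv g)"
proof -
  have D: "(g has_real_derivative frechet_derivative g (at y) 1) (at y)" for y
  proof -
    have "linear (frechet_derivative g (at y))"
      using C_diff_SucD(1)[OF assms] has_derivative_linear by blast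
    then have "frechet_derivative g (at y) = (*) (frechet_derivative g (at y) 1)"
      by (metis (no_types, opaque_lifting) ext linear_scale mult.commute mult.right_neutral real_scaleR_def)
    then show ?thesis using C_diff_SucD(1)[OF assms, of y] by (simp add: has_field_derivative_def)
  qed
  then have eq: "deriv g = (\<lambda>y. frechet_derivative g (at y) 1)" by (auto intro: DERIV_imp_deriv)
  show "(g has_real_derivative deriv g y) (at y)" "C_diff k (deriv g)"
    using D C_diff_SucD(2)[OF assms] by (simp_all add: eq)
qed

lemma C_diff_compose:
  fixes g :: "real \<Rightarrow> real" and f :: "'a::euclidean_space \<Rightarrow> real"
  shows "C_diff k g \<Longrightarrow> C_diff k f \<Longrightarrow> C_diff k (\<lambda>x. g (f x))"
proof (induction k arbitrary: f g)
  case 0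
  then show ?case using continuous_on_compose2[of UNIV g UNIV f] by simp
next
  case (Suc k)
  show ?case
  proof (rule C_diff_Suc_I)
    show "((\<lambda>x. g (f x)) has_derivative (\<lambda>v. deriv g (f x) * frechet_derivative f (at x) v)) (at x)" for x
      using has_derivative_compose[OF C_diff_SucD(1)[OF Suc.prems(2)], of g "(*) (deriv g (f x))" x]
        C_diff_real_D(1)[OF Suc.prems(1), of "f x"] by (simp add: has_field_derivative_def)
    show "C_diff k (\<lambda>x. deriv g (f x) * frechet_derivative f (at x) v)" for v
      by (rule C_diff_mult[OF Suc.IH[OF C_diff_real_D(2)[OF Suc.prems(1)] C_diff_decrease[OF Suc.prems(2)]]
        C_diff_SucD(2)[OF Suc.prems(2)]])
  qed
qed

lemma C_diff_sin_cos: "C_diff k (sin :: real \<Rightarrow> real) \<and> C_diff k (cos :: real \<Rightarrow> real)"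
proof (induction k)
  case (Suc k)
  have "C_diff k (\<lambda>x::real. - sin x)"
    using C_diff_mult[OF C_diff_const[of k "-1::real"], of sin] Suc by simp
  then show ?case using Suc by (auto simp del: C_diff.simps intro!: C_diff_real_I DERIV_sin DERIV_cos)
qed (auto intro!: continuous_intros)

lemma poly_exp_tendsto: "((\<lambda>y::real. poly p y * exp (- y)) \<longlongrightarrow> 0) at_top"
proof -
  have "((\<lambda>y::real. \<Sum>i\<le>degree p. coeff p i * (y ^ i / exp y)) \<longlongrightarrow> (\<Sum>i\<le>degree p. coeff p i * 0)) at_top"
    by (intro tendsto_sum tendsto_mult tendsto_const tendsto_power_div_exp_0)
  then show ?thesis by (simp add: poly_altdef sum_distrib_right exp_minus divide_inverse mult.assoc)
qed

text \<open>For \<open>p = 1\<close> this is the standard smooth function vanishing exactly on the half line \<open>x \<le> 0\<close>. The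
polynomial factor makes the family closed under differentiation.\<close>

definition flat :: "real poly \<Rightarrow> real \<Rightarrow> real" where
  "flat p x = (if x > 0 then poly p (1 / x) * exp (- (1 / x)) else 0)"

lemma flat_has_derivative:
  "(flat p has_real_derivative flat ([:0, 0, 1:] * (p - pderiv p)) x) (at x)"
proof -
  consider "x > 0" | "x < 0" | "x = 0" by linarith
  then show ?thesis
  proof cases
    case 1
    have "((\<lambda>x. poly p (1 / x) * exp (- (1 / x))) has_real_derivative flat ([:0, 0, 1:] * (p - pderiv p)) x) (at x)"
    proof -
      have u: "((\<lambda>x. 1 / x) has_real_derivative - ((1 / x) * (1 / x))) (at x)"
        using DERIV_inverse[of x UNIV] 1 by (simp add: inverse_eq_divide)
      note D = DERIV_mult[OF DERIV_chain2[OF poly_DERIV u] DERIV_chain2[OF DERIV_exp DERIV_minus[OF u]]]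
      have key: "poly (pderiv p) w * - (w * w) * e + e * (- (- (w * w))) * poly p w
        = poly ([:0, 0, 1:] * (p - pderiv p)) w * e" for w e :: real
        by (simp add: algebra_simps)
      have "flat ([:0, 0, 1:] * (p - pderiv p)) x
        = poly ([:0, 0, 1:] * (p - pderiv p)) (1 / x) * exp (- (1 / x))"
        using 1 by (simp only: flat_def if_True)
      then show ?thesis using D[of p] by (simp only: key)
    qed
    then show ?thesis
      by (rule has_field_derivative_transform_within_open[of _ _ _ "{0<..}"]) (use 1 in \<open>auto simp: flat_def\<close>)
  next
    case 2
    have "((\<lambda>x. 0) has_real_derivative flat ([:0, 0, 1:] * (p - pderiv p)) x) (at x)"
      using 2 by (simp add: flat_def)
    then show ?thesis
      by (rule has_field_derivative_transform_within_open[of _ _ _ "{..<0}"]) (use 2 in \<open>auto simp: flat_def\<close>)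
  next
    case 3
    have "((\<lambda>y. (flat p y - flat p 0) / (y - 0)) \<longlongrightarrow> 0) (at_left 0)"
      by (rule Lim_transform_eventually[OF tendsto_const]) (auto simp: eventually_at_filter flat_def)
    moreover have "((\<lambda>y. (flat p y - flat p 0) / (y - 0)) \<longlongrightarrow> 0) (at_right 0)"
    proof (rule Lim_transform_eventually)
      show "((\<lambda>y. poly (pCons 0 p) (inverse y) * exp (- inverse y)) \<longlongrightarrow> 0) (at_right (0::real))"
        by (rule filterlim_compose[OF poly_exp_tendsto filterlim_inverse_at_top_right])
      show "\<forall>\<^sub>F y in at_right 0. poly (pCons 0 p) (inverse y) * exp (- inverse y) = (flat p y - flat p 0) / (y - 0)"
        by (auto simp: eventually_at_filter flat_def inverse_eq_divide)
    qed
    ultimately show ?thesis unfolding 3 has_field_derivative_iff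
      by (simp add: flat_def filterlim_split_at)
  qed
qed

lemma C_diff_flat: "C_diff k (flat p)"
proof (induction k arbitrary: p)
  case 0
  then show ?case using flat_has_derivative by (auto intro: DERIV_continuous_on has_field_derivative_at_within)
next
  case (Suc k)
  show ?case by (rule C_diff_real_I[OF flat_has_derivative Suc])
qed

declare C_diff.simps [simp del]

lemma flat_1: "flat 1 x > 0 \<longleftrightarrow> x > 0" "flat 1 x \<ge> 0" "flat 1 x \<noteq> 0 \<longleftrightarrow> x > 0"
  by (auto simp: flat_def)

lemma bump_exists:
  fixes a b :: real assumes "a < b"
  shows "\<exists>f :: real \<Rightarrow> real. smooth f \<and> (\<forall>t. f t \<ge> 0) \<and> (\<forall>t. f t > 0 \<longleftrightarrow> a < t \<and> t < b)"
proof -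
  define f where "f t = flat 1 (t - a) * flat 1 (b - t)" for t
  have lin: "C_diff k (\<lambda>t. t - a)" "C_diff k (\<lambda>t. b - t)" for k
    using C_diff_add[OF C_diff_bounded_linear[OF bounded_linear_ident] C_diff_const[of k "- a"]]
      C_diff_add[OF C_diff_const[of k b] C_diff_bounded_linear[OF bounded_linear_minus[OF bounded_linear_ident]]]
    by simp_all
  have "smooth f" unfolding smooth_def f_def
    using C_diff_mult[OF C_diff_compose[OF C_diff_flat lin(1)] C_diff_compose[OF C_diff_flat lin(2)]] by blast
  moreover have "f t > 0 \<longleftrightarrow> a < t \<and> t < b" for t
    using flat_1(2)[of "t - a"] flat_1(2)[of "b - t"] flat_1(1)[of "t - a"] flat_1(1)[of "b - t"]
    by (auto simp: f_def zero_less_mult_iff)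
  moreover have "f t \<ge> 0" for t by (simp add: f_def flat_1(2))
  ultimately show ?thesis by blast
qed

lemma smooth_antiderivative:
  fixes f :: "real \<Rightarrow> real"
  assumes "smooth f" shows "\<exists>F. smooth F \<and> (\<forall>t. (F has_real_derivative f t) (at t))"
proof -
  obtain F where F: "\<forall>t. (F has_real_derivative f t) (at t)"
    using antiderivative_exists[OF smooth_continuous[OF assms]] by blast
  have "C_diff k F" for k
  proof -
    have "C_diff (Suc k) F" using F assms by (intro C_diff_real_I[where g' = f]) (simp_all add: smooth_def)
    then show ?thesis by (rule C_diff_decrease)
  qed
  then show ?thesis using F by (auto simp: smooth_def)
qed

lemma step_exists:
  fixes a b :: real assumes "a < b"
  shows "\<exists>\<theta> \<theta>' :: real \<Rightarrow> real. smooth \<theta> \<and> (\<forall>t. (\<theta> has_real_derivative \<theta>' t) (at t)) \<and> (\<forall>t. \<theta>' t \<noteq> 0 \<longrightarrow> a < t \<and> t < b) \<and>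
    (\<forall>t\<le>a. \<theta> t = 0) \<and> (\<forall>t\<ge>b. \<theta> t = 1)"
proof -
  obtain f :: "real \<Rightarrow> real" where f: "smooth f" "\<And>t. f t \<ge> 0" "\<And>t. f t > 0 \<longleftrightarrow> a < t \<and> t < b"
    using bump_exists[OF assms] by blast
  obtain F where F: "smooth F" "\<And>t. (F has_real_derivative f t) (at t)" using smooth_antiderivative[OF f(1)] by blast
  have zero: "f t = 0" if "t \<le> a \<or> b \<le> t" for t using f(2,3)[of t] that by force
  have left: "F t = F a" if t: "t \<le> a" for t
  proof (cases "t < a")
    case True
    then obtain z where "t < z" "z < a" "F a - F t = (a - t) * f z" using MVT2[OF True, of F f] F(2) by blast
    then show ?thesis using zero[of z] by simp
  qed (use t in simp)
  have right: "F t = F b" if t: "b \<le> t" for t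
  proof (cases "b < t")
    case True
    then obtain z where "b < z" "z < t" "F t - F b = (t - b) * f z" using MVT2[OF True, of F f] F(2) by blast
    then show ?thesis using zero[of z] by simp
  qed (use t in simp)
  obtain z where "a < z" "z < b" "F b - F a = (b - a) * f z" using MVT2[OF assms, of F f] F(2) by blast
  then have pos: "F b - F a > 0" using f(3)[of z] assms by simp
  define \<theta> where "\<theta> t = (1 / (F b - F a)) * (F t + - F a)" for t
  have "smooth \<theta>" unfolding smooth_def \<theta>_def
    by (intro allI C_diff_mult C_diff_add C_diff_const) (use F(1) in \<open>simp add: smooth_def\<close>)
  define \<theta>' where "\<theta>' t = (1 / (F b - F a)) * f t" for t
  have "\<forall>t. (\<theta> has_real_derivative \<theta>' t) (at t)"
  proof
    fix t
    have "((\<lambda>t. F t + - F a) has_real_derivative f t + 0) (at t)" by (rule DERIV_add[OF F(2) DERIV_const])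
    from DERIV_cmult[OF this, of "1 / (F b - F a)"] show "(\<theta> has_real_derivative \<theta>' t) (at t)"
      by (simp add: \<theta>_def[abs_def] \<theta>'_def)
  qed
  moreover have "\<forall>t\<le>a. \<theta> t = 0"
  proof (intro allI impI)
    fix t assume "t \<le> a"
    from left[OF this] show "\<theta> t = 0" by (simp add: \<theta>_def)
  qed
  moreover have "\<forall>t\<ge>b. \<theta> t = 1"
  proof (intro allI impI)
    fix t assume "b \<le> t"
    from right[OF this] pos show "\<theta> t = 1" by (simp add: \<theta>_def)
  qed
  moreover have "\<forall>t. \<theta>' t \<noteq> 0 \<longrightarrow> a < t \<and> t < b"
  proof (intro allI impI)
    fix t assume "\<theta>' t \<noteq> 0"
    then have "f t > 0" using f(2)[of t] by (auto simp: \<theta>'_def)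
    then show "a < t \<and> t < b" by (simp add: f(3))
  qed
  ultimately show ?thesis using \<open>smooth \<theta>\<close> by blast
qed

text \<open>The cosine of \<open>2 \<pi> x\<close> measures the distance of \<open>x\<close> from the integers; this turns flat functions
of the cosine into bumps on the circle.\<close>

lemma cos_near_zero:
  assumes e: "0 < e" "e < 1 / 2" and c: "cos (2 * pi * e) < cos (2 * pi * x)"
  shows "\<exists>n\<in>\<int>. \<bar>x - n\<bar> < e"
proof -
  define n :: int where "n = round x"
  define y where "y = \<bar>x - of_int n\<bar>"
  have y: "0 \<le> y" "y \<le> 1 / 2" using of_int_round_abs_le[of x] by (auto simp: y_def n_def abs_minus_commute)
  have "cos (2 * pi * x) = cos (2 * pi * (x - of_int n))"
  proof -
    have "2 * pi * (x - of_int n) = 2 * pi * x + of_int (- n) * (2 * pi)" by (simp add: algebra_simps)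
    then show ?thesis using cos.plus_of_int[of "2 * pi * x" "- n"] by simp
  qed
  also have "\<dots> = cos (2 * pi * y)" 
  proof (cases "x \<ge> of_int n")
    case False
    then have "2 * pi * y = - (2 * pi * (x - of_int n))" by (simp add: y_def algebra_simps)
    then show ?thesis by (simp only: cos_minus)
  qed (simp add: y_def)
  finally have "cos (2 * pi * e) < cos (2 * pi * y)" using c by simp
  note lt = this
  have "y < e"
  proof (rule ccontr)
    assume "\<not> y < e"
    then have "2 * pi * e \<le> 2 * pi * y" by (intro mult_left_mono) auto
    moreover have "2 * pi * y \<le> 2 * pi * (1 / 2)" using y by (intro mult_left_mono) auto
    ultimately have "cos (2 * pi * y) \<le> cos (2 * pi * e)" using e by (intro cos_monotone_0_pi_le) auto
    then show False using lt by simp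
  qed
  then show ?thesis unfolding y_def by (intro bexI[of _ "of_int n"]) auto
qed

lemma proj_int: "proj (s + of_int n) = proj s" by (simp add: proj_eq_iff)

text \<open>The function on the circle that is induced by a periodic function on the line.\<close>

definition descend :: "(real \<Rightarrow> 'a) \<Rightarrow> circle \<Rightarrow> 'a" where
  "descend f p = f (SOME s. proj s = p)"

lemma descend_proj:
  assumes "\<And>s n. f (s + of_int n) = f s"
  shows "descend f (proj s) = f s"
proof -
  have "proj (SOME u. proj u = proj s) = proj s" by (rule someI[of "\<lambda>u. proj u = proj s" s]) simp
  then obtain n :: int where "(SOME u. proj u = proj s) = s + of_int n"
    by (auto simp: proj_eq_iff elim!: Ints_cases) (metis add.commute diff_add_cancel)
  then show ?thesis by (simp add: descend_def assms)
qed

lemma circle_bump_exists: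
  fixes x0 e :: real assumes e: "0 < e"
  shows "\<exists>\<rho> :: circle \<Rightarrow> real. smooth (\<lambda>s. \<rho> (proj s)) \<and> (\<forall>p. \<rho> p \<ge> 0) \<and> \<rho> (proj x0) > 0 \<and>
    (\<forall>p. \<rho> p \<noteq> 0 \<longrightarrow> (\<exists>s. p = proj s \<and> \<bar>s - x0\<bar> < e))"
proof -
  define \<epsilon> where "\<epsilon> = min e (1 / 4)"
  have \<epsilon>: "0 < \<epsilon>" "\<epsilon> < 1 / 2" "\<epsilon> \<le> e" using e by (auto simp: \<epsilon>_def)
  define f where "f s = flat 1 (cos (2 * pi * (s + - x0)) + - cos (2 * pi * \<epsilon>))" for s
  have per: "f (s + of_int n) = f s" for s n
  proof -
    have "2 * pi * (s + of_int n + - x0) = 2 * pi * (s + - x0) + of_int n * (2 * pi)" by (simp add: algebra_simps)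
    then show ?thesis unfolding f_def using cos.plus_of_int[of "2 * pi * (s + - x0)" n] by simp
  qed
  have "smooth f" unfolding smooth_def f_def
    by (intro allI C_diff_compose[OF C_diff_flat] C_diff_add C_diff_const
        C_diff_compose[OF C_diff_sin_cos[THEN conjunct2]] C_diff_mult C_diff_bounded_linear[OF bounded_linear_ident])
  moreover have d: "descend f (proj s) = f s" for s by (rule descend_proj[OF per])
  ultimately have 1: "smooth (\<lambda>s. descend f (proj s))" by simp
  have 2: "descend f p \<ge> 0" for p by (simp add: descend_def f_def flat_1)
  have "cos (2 * pi * \<epsilon>) < cos 0" using \<epsilon> by (intro cos_monotone_0_pi) auto
  then have 3: "descend f (proj x0) > 0" unfolding d by (simp add: f_def flat_1)
  have 4: "\<exists>s. p = proj s \<and> \<bar>s - x0\<bar> < e" if p: "descend f p \<noteq> 0" for p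
  proof -
    obtain s where s: "p = proj s" by (rule proj_cases)
    then have "cos (2 * pi * \<epsilon>) < cos (2 * pi * (s - x0))" using p unfolding s d by (simp add: f_def flat_1)
    then obtain n where n: "n \<in> \<int>" "\<bar>s - x0 - n\<bar> < \<epsilon>" using cos_near_zero[OF \<epsilon>(1,2)] by blast
    have "p = proj (s - n)" using n by (simp add: s proj_eq_iff)
    moreover have "\<bar>(s - n) - x0\<bar> < e" using n \<epsilon>(3) by (simp add: algebra_simps)
    ultimately show ?thesis by blast
  qed
  show ?thesis by (intro exI[of _ "descend f"]) (use 1 2 3 4 in blast)
qed


lemma proj_continuous: "continuous_on S proj"
proof -
  have "continuous_on UNIV proj"
    unfolding continuous_on_open_vimage[OF open_UNIV] using open_circle_iff_open_vimage_proj by simp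
  then show ?thesis by (rule continuous_on_subset) simp
qed

lemma dist_proj_attained: "\<exists>y. proj y = p \<and> dist p (proj x) = \<bar>y - x\<bar>"
proof -
  obtain z where z: "p = proj z" by (rule proj_cases)
  obtain n where n: "n \<in> \<int>" "infdist (z - x) \<int> = \<bar>z - x - n\<bar>" using infdist_Ints_attained by blast
  have "proj (z - n) = p" using n(1) by (simp add: z proj_eq_iff)
  moreover have "dist p (proj x) = \<bar>z - n - x\<bar>" using n(2) by (simp add: z dist_proj algebra_simps)
  ultimately show ?thesis by blast
qed

section \<open>Cohomology of the circle\<close>

definition mean :: "(circle \<Rightarrow> real) \<Rightarrow> real" where
  "mean f = integral {0..1} (\<lambda>s. f (proj s))"

text \<open>A form on the circle is exact if and only if its integral vanishes: a primitive on the line is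
periodic precisely in that case. Cohomology classes are therefore classified by the mean.\<close>

lemma cohomologous_iff:
  "(f, h) \<in> cohomologous \<longleftrightarrow> f \<in> forms_S \<and> h \<in> forms_S \<and> mean f = mean h"
proof -
  have int: "(\<lambda>s. f (proj s)) integrable_on {0..1}" if "f \<in> forms_S" for f
    using that smooth_continuous by (auto simp: forms_S_def intro: integrable_continuous_interval)
  have "exact_form_S (\<lambda>x. f x - h x) \<longleftrightarrow> mean f = mean h" if f: "f \<in> forms_S" and h: "h \<in> forms_S"
  proof -
    have mean: "mean f - mean h = integral {0..1} (\<lambda>s. f (proj s) - h (proj s))"
      unfolding mean_def by (rule integral_diff[symmetric]) (intro int f h)+
    show ?thesis
    proof
      assume "exact_form_S (\<lambda>x. f x - h x)"
      then obtain F where F: "\<And>s. ((\<lambda>s. F (proj s)) has_real_derivative f (proj s) - h (proj s)) (at s)"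
        by (auto simp: exact_form_S_def)
      have "integral {0..1} (\<lambda>s. f (proj s) - h (proj s)) = F (proj 1) - F (proj 0)"
        by (rule integral_deriv(1)) (use F in auto)
      also have "proj 1 = proj 0" by (simp add: proj_eq_iff)
      finally show "mean f = mean h" using mean by simp
    next
      assume eq: "mean f = mean h"
      have sm: "smooth (\<lambda>s. f (proj s) - h (proj s))"
        using f h C_diff_add[OF _ C_diff_mult[OF C_diff_const[of _ "-1"]], of _ "\<lambda>s. f (proj s)" "\<lambda>s. h (proj s)"]
        by (simp add: forms_S_def smooth_def)
      obtain F where F: "smooth F" "\<And>t. (F has_real_derivative f (proj t) - h (proj t)) (at t)"
        using smooth_antiderivative[OF sm] by blast
      have per1: "F (s + 1) = F s" for s
      proof -
        have "((\<lambda>s. F (s + 1)) has_real_derivative f (proj (s + 1)) - h (proj (s + 1))) (at s)" for s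
          using F(2)[of "s + 1"] by (simp add: DERIV_shift)
        from this have "((\<lambda>s. F (s + 1)) has_real_derivative f (proj s) - h (proj s)) (at s)" for s
          using proj_int[of s 1] by (metis of_int_1)
        from DERIV_diff[OF this F(2)] have "((\<lambda>s. F (s + 1) - F s) has_real_derivative 0) (at s)" for s by simp
        then have "F (s + 1) - F s = F (0 + 1) - F 0" by (intro DERIV_isconst_all) auto
        also have "\<dots> = integral {0..1} (\<lambda>s. f (proj s) - h (proj s))"
          using integral_deriv(1)[of 0 1 F "\<lambda>s. f (proj s) - h (proj s)"] F(2) by simp
        finally show ?thesis using mean eq by simp
      qed
      have per: "F (s + of_int n) = F s" for s n using int_periodic[of F, OF per1] .
      have d: "(\<lambda>s. descend F (proj s)) = F" by (rule ext) (rule descend_proj[OF per])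
      show "exact_form_S (\<lambda>x. f x - h x)" unfolding exact_form_S_def
        by (rule exI[of _ "descend F"]) (use F in \<open>simp add: d\<close>)
    qed
  qed
  then show ?thesis by (auto simp: cohomologous_def)
qed

lemma equiv_cohomologous: "equiv forms_S cohomologous"
  by (intro equivI refl_onI symI transI) (auto simp: cohomologous_iff)

lemma class_eq_iff:
  "f \<in> forms_S \<Longrightarrow> h \<in> forms_S \<Longrightarrow> cohomologous `` {f} = cohomologous `` {h} \<longleftrightarrow> mean f = mean h"
  using eq_equiv_class_iff[OF equiv_cohomologous] by (simp add: cohomologous_iff)

section \<open>Step forms\<close>

lemma C_diff_pair_fst: "C_diff k f \<Longrightarrow> C_diff k (\<lambda>z. (f z :: real, 0 :: real))"
  by (rule C_diff_bounded_linear_comp[OF bounded_linear_Pair[OF bounded_linear_ident bounded_linear_zero]])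

text \<open>The step in \<open>\<mu> = \<theta>(t) \<kappa> \<rho>(x) dx\<close> takes place during the time interval of radius \<open>\<epsilon>\<close> around
\<open>t2\<close>, and \<open>\<rho>\<close> is supported within \<open>\<epsilon>\<close> of \<open>x1\<close>. Thus \<open>d\<mu>\<close> vanishes outside the rectangle \<open>K\<close> around
\<open>(x1, t2)\<close>, which lies off the closure of \<open>G(c)\<close>. The class of \<open>\<kappa> \<rho> dx\<close> is arbitrary, because \<open>\<rho>\<close> has
nonzero mean.\<close>

lemma R_set_eq_H1:
  assumes "closure (G_base L \<phi> c) \<noteq> UNIV"
  shows "R_set L \<phi> c = H1"
proof -
  define Wt where "Wt = (\<lambda>(s, t). (proj s, proj t)) -` (- closure (G_base L \<phi> c))"
  have cont2: "continuous_on S (\<lambda>(s, t). (proj s, proj t))" for S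
    unfolding split_beta
    by (intro continuous_on_Pair continuous_on_compose2[OF proj_continuous] continuous_intros) auto
  have op: "open Wt" unfolding Wt_def by (intro open_vimage cont2) auto
  obtain p where "p \<notin> closure (G_base L \<phi> c)" using assms by blast
  then obtain x' t' where xt': "(x', t') \<in> Wt" unfolding Wt_def
    by (metis (no_types, lifting) ComplI proj_cases surj_pair case_prod_conv vimageI)
  define x1 t1 where "x1 = frac x'" and "t1 = frac t'"
  have fr: "proj (frac s) = proj s" for s by (simp add: proj_eq_iff frac_def)
  have "(x1, t1) \<in> Wt" using xt' by (simp add: Wt_def x1_def t1_def fr)
  then obtain \<delta> where \<delta>: "\<delta> > 0" "\<And>z. dist z (x1, t1) < \<delta> \<Longrightarrow> z \<in> Wt"
    using op unfolding open_dist by blast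
  have t1: "0 \<le> t1" "t1 < 1" and x1: "0 \<le> x1" "x1 \<le> 1" by (auto simp: t1_def x1_def frac_lt_1 less_imp_le)
  define \<epsilon> where "\<epsilon> = min \<delta> (1 - t1) / 8"
  have \<epsilon>: "\<epsilon> > 0" "8 * \<epsilon> \<le> \<delta>" "8 * \<epsilon> \<le> 1 - t1" using \<delta>(1) t1 by (auto simp: \<epsilon>_def)
  \<comment> \<open>As \<open>t1\<close> may be \<open>0\<close>, the rectangle is moved forward in time to keep it inside \<open>(0, 1)\<close>.\<close>
  define t2 where "t2 = t1 + 2 * \<epsilon>"
  define K where "K = (\<lambda>(s, t). (proj s, proj t)) ` ({x1 - \<epsilon>..x1 + \<epsilon>} \<times> {t2 - \<epsilon>..t2 + \<epsilon>})"
  have "compact K" unfolding K_def by (intro compact_continuous_image cont2 compact_Times compact_Icc)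
  then have opU: "open (- K)" by (intro open_Compl compact_imp_closed)
  have KW: "K \<subseteq> - closure (G_base L \<phi> c)"
  proof
    fix q assume "q \<in> K"
    then obtain s t where st: "q = (proj s, proj t)" "\<bar>s - x1\<bar> \<le> \<epsilon>" "\<bar>t - t2\<bar> \<le> \<epsilon>"
      by (auto simp: K_def abs_le_iff)
    have "dist (s, t) (x1, t1) \<le> \<bar>s - x1\<bar> + \<bar>t - t1\<bar>"
      using sqrt_sum_squares_le_sum_abs[of "s - x1" "t - t1"] by (simp add: dist_Pair_Pair dist_real_def)
    also have "\<dots> < \<delta>" using st \<epsilon> by (auto simp: t2_def abs_le_iff)
    finally have "(s, t) \<in> Wt" by (rule \<delta>(2))
    then show "q \<in> - closure (G_base L \<phi> c)" by (simp add: Wt_def st(1))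
  qed
  have GU: "G_base L \<phi> c \<subseteq> - K" using KW closure_subset by blast
  obtain \<rho> where \<rho>': "smooth (\<lambda>s. \<rho> (proj s))" "\<forall>p. \<rho> p \<ge> (0::real)" "\<rho> (proj x1) > 0"
    "\<forall>p. \<rho> p \<noteq> 0 \<longrightarrow> (\<exists>s. p = proj s \<and> \<bar>s - x1\<bar> < \<epsilon>)"
    using circle_bump_exists[OF \<epsilon>(1), of x1] by (elim exE conjE)
  note \<rho> = \<rho>'(1) \<rho>'(2)[rule_format] \<rho>'(3) \<rho>'(4)[rule_format]
  have tt: "t2 - \<epsilon> < t2 + \<epsilon>" using \<epsilon> by simp
  obtain \<theta> \<theta>' :: "real \<Rightarrow> real" where \<theta>'': "smooth \<theta>" "\<forall>t. (\<theta> has_real_derivative \<theta>' t) (at t)"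
    "\<forall>t. \<theta>' t \<noteq> 0 \<longrightarrow> t2 - \<epsilon> < t \<and> t < t2 + \<epsilon>" "\<forall>t\<le>t2 - \<epsilon>. \<theta> t = 0" "\<forall>t\<ge>t2 + \<epsilon>. \<theta> t = 1"
    using step_exists[OF tt] by (elim exE conjE)
  note \<theta> = \<theta>''(1) \<theta>''(2-5)[rule_format]
  have \<rho>m: "mean \<rho> > 0"
  proof -
    have c: "continuous_on {0..1} (\<lambda>s. \<rho> (proj s))" by (rule smooth_continuous[OF \<rho>(1)])
    have "mean \<rho> \<noteq> 0" unfolding mean_def
      using integral_eq_0_iff[OF c] \<rho>(2,3) x1 by force
    moreover have "mean \<rho> \<ge> 0" unfolding mean_def
      by (rule integral_nonneg[OF integrable_continuous_interval[OF c]]) (use \<rho>(2) in auto)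
    ultimately show ?thesis by simp
  qed
  have "d \<in> R_set L \<phi> c" if d: "d \<in> H1" for d
  proof -
    obtain f where f: "f \<in> forms_S" "d = cohomologous `` {f}" using d unfolding H1_def by (rule quotientE)
    define \<kappa> where "\<kappa> = mean f / mean \<rho>"
    define \<mu>' :: form_SS where "\<mu>' = (\<lambda>(x, t). (\<kappa> * \<rho> x, 0))"
    define \<mu> :: form_SR where "\<mu> = (\<lambda>(x, t). (\<theta> t * (\<kappa> * \<rho> x), 0))"
    have sm: "C_diff k (\<lambda>s. \<kappa> * \<rho> (proj s))" for k
      using \<rho>(1) by (intro C_diff_mult C_diff_const) (simp add: smooth_def)
    have lin: "C_diff k (fst :: real \<times> real \<Rightarrow> real)" "C_diff k (snd :: real \<times> real \<Rightarrow> real)" for k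
      by (intro C_diff_bounded_linear bounded_linear_fst bounded_linear_snd)+
    have sm\<mu>: "smooth_form \<mu>"
    proof -
      have "C_diff k (\<lambda>z::real \<times> real. \<theta> (snd z))" for k
        using C_diff_compose[OF _ lin(2), of k \<theta>] \<theta>(1) by (simp add: smooth_def)
      then have "C_diff k (\<lambda>z::real \<times> real. (\<theta> (snd z) * (\<kappa> * \<rho> (proj (fst z))), 0 :: real))" for k
        by (intro C_diff_pair_fst C_diff_mult C_diff_compose[OF sm lin(1)])
      then show ?thesis by (simp add: smooth_form_def \<mu>_def smooth_def case_prod_unfold)
    qed
    have per: "periodic_form \<mu>' = (\<lambda>(x, t). (\<kappa> * \<rho> x, 0))" by (auto simp: periodic_form_def \<mu>'_def)
    have cl\<mu>': "closed_form_SS \<mu>'"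
    proof -
      have "C_diff k (\<lambda>z::real \<times> real. (\<kappa> * \<rho> (proj (fst z)), 0 :: real))" for k
        by (intro C_diff_pair_fst C_diff_compose[OF sm lin(1)])
      then have "smooth_form (periodic_form \<mu>')" by (simp add: per smooth_form_def smooth_def case_prod_unfold)
      then show ?thesis by (simp add: closed_form_SS_def closed_form_on_def d_form_def per)
    qed
    have dmu: "d_form \<mu> s t = - (\<theta>' t * (\<kappa> * \<rho> (proj s)))" for s t
    proof -
      have "deriv (\<lambda>t'. \<theta> t' * (\<kappa> * \<rho> (proj s))) t = \<theta>' t * (\<kappa> * \<rho> (proj s))"
        by (rule DERIV_imp_deriv) (rule DERIV_cmult_right[OF \<theta>(2)])
      then show ?thesis by (simp add: d_form_def \<mu>_def)
    qed
    have "closed_form_on {(x, t). (x, proj t) \<in> - K \<or> t \<le> 0 \<or> t \<ge> 1} \<mu>"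
      unfolding closed_form_on_def
    proof (intro allI impI)
      fix s t assume mem: "(proj s, t) \<in> {(x, t). (x, proj t) \<in> - K \<or> t \<le> 0 \<or> t \<ge> 1}"
      show "d_form \<mu> s t = 0"
      proof (rule ccontr)
        assume "d_form \<mu> s t \<noteq> 0"
        then have nz: "\<theta>' t \<noteq> 0" "\<rho> (proj s) \<noteq> 0" by (auto simp: dmu)
        obtain s' where s': "proj s = proj s'" "\<bar>s' - x1\<bar> < \<epsilon>" using \<rho>(4)[OF nz(2)] by blast
        have t: "t2 - \<epsilon> < t" "t < t2 + \<epsilon>" using \<theta>(3)[OF nz(1)] by auto
        have "(proj s', proj t) \<in> K" unfolding K_def using s' t by (intro image_eqI[of _ _ "(s', t)"]) auto
        moreover have "0 < t" "t < 1" using t \<epsilon> t1 by (auto simp: t2_def)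
        ultimately show False using mem s'(1) by auto
      qed
    qed
    moreover have "\<mu> (x, t) = 0" if "t \<le> 0" for x t using \<theta>(4)[of t] that \<epsilon> t1 by (simp add: \<mu>_def t2_def zero_prod_def)
    moreover have "\<mu> (x, t) = periodic_form \<mu>' (x, t)" if "t \<ge> 1" for x t
      using \<theta>(5)[of t] that \<epsilon> t1 by (simp add: \<mu>_def per t2_def)
    ultimately have step: "step_form (- K) \<mu> \<mu>'" using sm\<mu> cl\<mu>' by (simp add: step_form_def)
    have "(\<lambda>x. \<kappa> * \<rho> x) \<in> forms_S" using sm by (simp add: forms_S_def smooth_def)
    moreover have "mean (\<lambda>x. \<kappa> * \<rho> x) = mean f" using \<rho>m by (simp add: mean_def \<kappa>_def)
    ultimately have "form_class \<mu>' = d"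
      using f class_eq_iff[of "\<lambda>x. \<kappa> * \<rho> x" f] by (simp add: form_class_def \<mu>'_def)
    then show ?thesis unfolding R_set_def using d opU GU step by blast
  qed
  then show ?thesis unfolding R_set_def by blast
qed

section \<open>Dependence of minimizers on the cohomology class only\<close>

text \<open>A closed form \<open>\<alpha> ds + \<beta> dt\<close> with mean \<open>0\<close> in space has a primitive \<open>\<Phi>\<close> that is periodic in space:
integrate in space at one integer time \<open>T\<close> before \<open>a\<close>, and then in time.\<close>

lemma closed_form_integral:
  fixes \<alpha> \<beta> D :: "real \<Rightarrow> real \<Rightarrow> real"
  assumes \<beta>D: "\<And>s t. ((\<lambda>s. \<beta> s t) has_real_derivative D s t) (at s)"
    and \<alpha>D: "\<And>s t. ((\<lambda>t. \<alpha> s t) has_real_derivative D s t) (at t)"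
    and cont: "continuous_on UNIV (\<lambda>(s, t). \<alpha> s t)" "continuous_on UNIV (\<lambda>(s, t). \<beta> s t)" "continuous_on UNIV (\<lambda>(s, t). D s t)"
    and per: "\<And>s t n. \<alpha> (s + of_int n) t = \<alpha> s t" "\<And>s t n. \<alpha> s (t + of_int n) = \<alpha> s t"
      "\<And>s t n. \<beta> (s + of_int n) t = \<beta> s t"
    and mean0: "integral {0..1} (\<lambda>s. \<alpha> s 0) = 0"
    and ab: "a < b" and y: "y C1_differentiable_on {a..b}" and z: "z C1_differentiable_on {a..b}"
    and ends: "y a - z a \<in> \<int>" "y b - z b \<in> \<int>"
  shows "integral {a..b} (\<lambda>t. \<alpha> (y t) t * deriv y t + \<beta> (y t) t) = integral {a..b} (\<lambda>t. \<alpha> (z t) t * deriv z t + \<beta> (z t) t)"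
proof -
  have comp: "continuous_on S (\<lambda>w. \<alpha> (f w) (g w))" "continuous_on S (\<lambda>w. \<beta> (f w) (g w))" "continuous_on S (\<lambda>w. D (f w) (g w))"
    if "continuous_on S f" "continuous_on S g" for S :: "'z::topological_space set" and f g
    using continuous_on_compose2[OF cont(1) continuous_on_Pair[OF that]] continuous_on_compose2[OF cont(2) continuous_on_Pair[OF that]]
      continuous_on_compose2[OF cont(3) continuous_on_Pair[OF that]] by simp_all
  define T :: real where "T = of_int (\<lfloor>a\<rfloor> - 1)"
  have T: "T < a" unfolding T_def by linarith
  have contT: "continuous_on UNIV (\<lambda>s. \<alpha> s T)" by (intro comp continuous_intros)
  obtain A where A: "\<And>s. (A has_real_derivative \<alpha> s T) (at s)" using antiderivative_exists[OF contT] by blast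
  have A1: "A (s + 1) = A s" for s
  proof -
    have "((\<lambda>s. A (s + 1)) has_real_derivative \<alpha> s T) (at s)" for s
      using A[of "s + 1"] per(1)[of s 1 T] by (simp add: DERIV_shift)
    from DERIV_diff[OF this A] have "((\<lambda>s. A (s + 1) - A s) has_real_derivative 0) (at s)" for s by simp
    then have "A (s + 1) - A s = A (0 + 1) - A 0" by (intro DERIV_isconst_all) auto
    also have "\<dots> = integral {0..1} (\<lambda>s. \<alpha> s T)" using integral_deriv(1)[of 0 1 A "\<lambda>s. \<alpha> s T"] A by simp
    also have "\<dots> = 0" using mean0 per(2)[of _ 0 "\<lfloor>a\<rfloor> - 1"] by (simp add: T_def)
    finally show ?thesis by simp
  qed
  have Aper: "A (s + of_int n) = A s" for s n using int_periodic[of A, OF A1] .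
  define \<Phi> where "\<Phi> t s = A s + integral {T..t} (\<lambda>\<tau>. \<beta> s \<tau>)" for t s
  have \<Phi>per: "\<Phi> t (s + of_int n) = \<Phi> t s" for t s n by (simp add: \<Phi>_def Aper per(3))
  have \<Phi>s: "((\<lambda>s. \<Phi> t s) has_real_derivative \<alpha> s t) (at s)" if t: "T \<le> t" for s t
  proof -
    have "((\<lambda>s. integral (cbox T t) (\<beta> s)) has_real_derivative integral (cbox T t) (D s)) (at s within UNIV)"
      by (rule leibniz_rule_field_derivative)
        (auto simp: \<beta>D split_beta intro!: integrable_continuous_interval comp continuous_intros)
    moreover have "integral {T..t} (D s) = \<alpha> s t - \<alpha> s T"
      by (rule integral_deriv(1)[OF t \<alpha>D])
    ultimately have "((\<lambda>s. integral {T..t} (\<beta> s)) has_real_derivative \<alpha> s t - \<alpha> s T) (at s)" by simp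
    from DERIV_add[OF A this] show ?thesis by (simp add: \<Phi>_def)
  qed
  have \<Phi>t: "((\<lambda>t. \<Phi> t s) has_real_derivative \<beta> s t) (at t within {T..b})" if t: "t \<in> {T..b}" for s t
  proof -
    have "continuous_on {T..b} (\<lambda>\<tau>. \<beta> s \<tau>)" by (intro comp continuous_intros)
    from integral_has_real_derivative[OF this t] show ?thesis
      unfolding \<Phi>_def using DERIV_add[OF DERIV_const] by fastforce
  qed
  have main: "integral {a..b} (\<lambda>t. \<alpha> (y t) t * deriv y t + \<beta> (y t) t) = \<Phi> b (y b) - \<Phi> a (y a)"
    if y: "y C1_differentiable_on {a..b}" for y
  proof -
    have "((\<lambda>t. \<Phi> t (y t)) has_real_derivative \<alpha> (y t) t * deriv y t + \<beta> (y t) t) (at t within {a..b})"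
      if t: "t \<in> {a..b}" for t
    proof -
      have "((\<lambda>(t, s). \<Phi> t s) has_derivative (\<lambda>(tx, ty). \<beta> (y t) t * tx + blinfun_mult_right (\<alpha> (y t) t) ty)) (at (t, y t) within {T..b} \<times> UNIV)"
      proof (rule has_derivative_partialsI[where fy = "\<lambda>t s. blinfun_mult_right (\<alpha> s t)"])
        show "((\<lambda>u. \<Phi> u (y t)) has_derivative (*) (\<beta> (y t) t)) (at t within {T..b})"
          using \<Phi>t[of t "y t"] t T by (simp add: has_field_derivative_def) 
        show "((\<lambda>s. \<Phi> t s) has_derivative blinfun_apply (blinfun_mult_right (\<alpha> s t))) (at s within UNIV)"
          if "t \<in> {T..b}" for t s
          using \<Phi>s[of t s] that by (simp add: has_field_derivative_def blinfun_mult_right.rep_eq)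
        have "continuous_on UNIV (\<lambda>w::real \<times> real. blinfun_mult_right (\<alpha> (snd w) (fst w)))"
          by (intro bounded_linear.continuous_on[OF bounded_linear_blinfun_mult_right] comp continuous_intros)
        then have "continuous_on UNIV (\<lambda>(t, s). blinfun_mult_right (\<alpha> s t))" by (simp add: case_prod_unfold)
        then show "continuous (at (t, y t) within {T..b} \<times> UNIV) (\<lambda>(t, s). blinfun_mult_right (\<alpha> s t))"
          by (rule continuous_on_imp_continuous_within) auto
      qed auto
      then have "((\<lambda>(t, s). \<Phi> t s) has_derivative (\<lambda>(tx, ty). \<beta> (y t) t * tx + blinfun_mult_right (\<alpha> (y t) t) ty)) (at (t, y t) within (\<lambda>t. (t, y t)) ` {a..b})"
        by (rule has_derivative_subset) (use T in auto)
      moreover have "((\<lambda>t. (t, y t)) has_derivative (\<lambda>h. (h, h * deriv y t))) (at t within {a..b})"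
        using C1_has_deriv(1)[OF y t]
        by (intro has_derivative_Pair has_derivative_ident)
          (auto simp: has_field_derivative_def mult_commute_abs intro: has_derivative_at_withinI)
      ultimately have "((\<lambda>t. case (t, y t) of (t, s) \<Rightarrow> \<Phi> t s) has_derivative
        (\<lambda>h. case (h, h * deriv y t) of (tx, ty) \<Rightarrow> \<beta> (y t) t * tx + blinfun_mult_right (\<alpha> (y t) t) ty)) (at t within {a..b})"
        by (rule has_derivative_in_compose[rotated])
      moreover have "(\<lambda>h. case (h, h * deriv y t) of (tx, ty) \<Rightarrow> \<beta> (y t) t * tx + blinfun_mult_right (\<alpha> (y t) t) ty)
        = (*) (\<alpha> (y t) t * deriv y t + \<beta> (y t) t)"
        by (simp add: fun_eq_iff blinfun_mult_right.rep_eq algebra_simps)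
      ultimately show ?thesis by (simp add: has_field_derivative_def)
    qed
    then have "((\<lambda>t. \<alpha> (y t) t * deriv y t + \<beta> (y t) t) has_integral (\<Phi> b (y b) - \<Phi> a (y a))) {a..b}"
      using ab by (intro fundamental_theorem_of_calculus) (auto simp: has_real_derivative_iff_has_vector_derivative)
    then show ?thesis by (rule integral_unique)
  qed
  have eq: "\<Phi> t u = \<Phi> t w" if uw: "u - w \<in> \<int>" for t u w
  proof -
    obtain n where "u - w = of_int n" using uw by (rule Ints_cases)
    then have "u = w + of_int n" by simp
    then show ?thesis using \<Phi>per by simp
  qed
  show ?thesis using main[OF y] main[OF z] eq[OF ends(1)] eq[OF ends(2)] by simp
qed


definition const_form :: "real \<Rightarrow> form_SS" where "const_form c = (\<lambda>_. (c, 0))"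

lemma smooth_const: "smooth (\<lambda>x. c)" unfolding smooth_def using C_diff_const by blast

lemma closed_const_form: "closed_form_SS (const_form c)"
  by (simp add: closed_form_SS_def closed_form_on_def d_form_def periodic_form_def const_form_def
      smooth_form_def case_prod_unfold smooth_const)

lemma form_class_fiber:
  assumes "closed_form_SS \<eta>" shows "(\<lambda>x. fst (\<eta> (x, proj 0))) \<in> forms_S"
proof -
  have "C_diff k (\<lambda>s. fst (\<eta> (proj s, proj 0)))" for k
  proof -
    have sm: "C_diff k (\<lambda>z. fst (\<eta> (proj (fst z), proj (snd z))))" for k
      using assms C_diff_bounded_linear_comp[OF bounded_linear_fst, of k "\<lambda>z. \<eta> (proj (fst z), proj (snd z))"]
      by (simp add: closed_form_SS_def smooth_form_def smooth_def periodic_form_def case_prod_unfold)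
    have res: "C_diff k f \<Longrightarrow> C_diff k (\<lambda>s. f (s, 0))" for k and f :: "real \<times> real \<Rightarrow> real"
    proof (induction k arbitrary: f)
      case 0
      then have "continuous_on UNIV f" by (simp add: C_diff.simps)
      then have "continuous_on UNIV (\<lambda>s. f (s, 0))"
        by (rule continuous_on_compose2) (auto intro!: continuous_intros)
      then show ?case by (simp add: C_diff.simps)
    next
      case (Suc k)
      show ?case
      proof (rule C_diff_Suc_I)
        have "((\<lambda>s::real. (s, 0::real)) has_derivative (\<lambda>v. (v, 0))) (at s)" for s
          by (intro has_derivative_Pair has_derivative_ident has_derivative_const)
        then show "((\<lambda>s. f (s, 0)) has_derivative (\<lambda>v. frechet_derivative f (at (s, 0)) (v, 0))) (at s)" for s
          using has_derivative_compose[OF _ C_diff_SucD(1)[OF Suc.prems]] by blast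
        show "C_diff k (\<lambda>s. frechet_derivative f (at (s, 0)) (v, 0))" for v
          by (rule Suc.IH[OF C_diff_SucD(2)[OF Suc.prems]])
      qed
    qed
    show ?thesis using res[OF sm] by simp
  qed
  then show ?thesis by (simp add: forms_S_def smooth_def)
qed

lemma form_class_eq_iff:
  assumes "closed_form_SS \<eta>" "closed_form_SS \<eta>'"
  shows "form_class \<eta> = form_class \<eta>' \<longleftrightarrow> mean (\<lambda>x. fst (\<eta> (x, proj 0))) = mean (\<lambda>x. fst (\<eta>' (x, proj 0)))"
  unfolding form_class_def by (rule class_eq_iff[OF form_class_fiber[OF assms(1)] form_class_fiber[OF assms(2)]])

lemma class_of_const_form:
  assumes "c \<in> H1" shows "\<exists>r. form_class (const_form r) = c"
proof -
  obtain f where f: "f \<in> forms_S" "c = cohomologous `` {f}" using assms unfolding H1_def by (rule quotientE)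
  have "(\<lambda>x. mean f) \<in> forms_S" by (simp add: forms_S_def smooth_const)
  moreover have "mean (\<lambda>x. mean f) = mean f" by (simp add: mean_def)
  ultimately have "form_class (const_form (mean f)) = c"
    using class_eq_iff[of "\<lambda>x. mean f" f] f by (simp add: form_class_def const_form_def)
  then show ?thesis by blast
qed

lemma closed_form_components:
  assumes "closed_form_SS \<eta>"
  shows "\<exists>D. (\<forall>s t. ((\<lambda>s. snd (\<eta> (proj s, proj t))) has_real_derivative D s t) (at s)) \<and>
    (\<forall>s t. ((\<lambda>t. fst (\<eta> (proj s, proj t))) has_real_derivative D s t) (at t)) \<and>
    continuous_on UNIV (\<lambda>(s, t). fst (\<eta> (proj s, proj t))) \<and>
    continuous_on UNIV (\<lambda>(s, t). snd (\<eta> (proj s, proj t))) \<and> continuous_on UNIV (\<lambda>(s, t). D s t)"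
proof -
  define f where "f z = \<eta> (proj (fst z), proj (snd z))" for z
  have sm: "smooth f" and cl: "\<And>s t. d_form (periodic_form \<eta>) s t = 0"
    using assms by (simp_all add: closed_form_SS_def smooth_form_def periodic_form_def case_prod_unfold f_def[abs_def] closed_form_on_def)
  have C1: "C_diff (Suc 0) f" using sm by (simp add: smooth_def)
  define D where "D s t = snd (frechet_derivative f (at (s, t)) (1, 0))" for s t
  have "((\<lambda>s. (s, t)) has_derivative (\<lambda>v. (v, 0))) (at s)" for s t :: real
    by (intro has_derivative_Pair has_derivative_ident has_derivative_const)
  from has_derivative_compose[OF this C_diff_SucD(1)[OF C1]]
  have ds: "((\<lambda>s. f (s, t)) has_derivative (\<lambda>v. frechet_derivative f (at (s, t)) (v, 0))) (at s)" for s t .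
  have "((\<lambda>t. (s, t)) has_derivative (\<lambda>v. (0, v))) (at t)" for s t :: real
    by (intro has_derivative_Pair has_derivative_ident has_derivative_const)
  from has_derivative_compose[OF this C_diff_SucD(1)[OF C1]]
  have dt: "((\<lambda>t. f (s, t)) has_derivative (\<lambda>v. frechet_derivative f (at (s, t)) (0, v))) (at t)" for s t .
  have lin: "linear (frechet_derivative f (at z))" for z
    using C_diff_SucD(1)[OF C1] has_derivative_linear by blast
  have 1: "((\<lambda>s. snd (f (s, t))) has_real_derivative D s t) (at s)" for s t
  proof -
    have "snd (frechet_derivative f (at (s, t)) (v, 0)) = D s t * v" for v
      using linear_scale[OF lin, of "(s, t)" v "(1, 0)"] by (simp add: D_def)
    then show ?thesis using has_derivative_snd[OF ds[of t s]] by (simp add: has_field_derivative_def)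
  qed
  have 2: "((\<lambda>t. fst (f (s, t))) has_real_derivative fst (frechet_derivative f (at (s, t)) (0, 1))) (at t)" for s t
  proof -
    have "(\<lambda>v. fst (frechet_derivative f (at (s, t)) (0, v))) = (*) (fst (frechet_derivative f (at (s, t)) (0, 1)))"
    proof
      fix v
      show "fst (frechet_derivative f (at (s, t)) (0, v)) = fst (frechet_derivative f (at (s, t)) (0, 1)) * v"
        using linear_scale[OF lin, of "(s, t)" v "(0, 1)"] by simp
    qed
    then show ?thesis using has_derivative_fst[OF dt[of s t]] by (simp only: has_field_derivative_def)
  qed
  have 3: "fst (frechet_derivative f (at (s, t)) (0, 1)) = D s t" for s t
  proof -
    have "deriv (\<lambda>s. snd (f (s, t))) s = D s t" by (rule DERIV_imp_deriv[OF 1])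
    moreover have "deriv (\<lambda>t. fst (f (s, t))) t = fst (frechet_derivative f (at (s, t)) (0, 1))"
      by (rule DERIV_imp_deriv[OF 2])
    moreover have "deriv (\<lambda>s. snd (f (s, t))) s = deriv (\<lambda>t. fst (f (s, t))) t"
      using cl[of s t] by (simp add: d_form_def periodic_form_def f_def)
    ultimately show ?thesis by simp
  qed
  have cf: "continuous_on UNIV f" using smooth_continuous[OF sm] .
  have cD: "continuous_on UNIV (\<lambda>z. snd (frechet_derivative f (at z) (1, 0)))"
    using C_diff_SucD(2)[OF C1, of "(1, 0)"] by (intro continuous_on_snd) (simp add: C_diff.simps)
  have "continuous_on UNIV (\<lambda>(s, t). D s t)" using cD by (simp add: D_def split_beta)
  moreover have "continuous_on UNIV (\<lambda>(s, t). fst (\<eta> (proj s, proj t)))" "continuous_on UNIV (\<lambda>(s, t). snd (\<eta> (proj s, proj t)))"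
    using continuous_on_fst[OF cf] continuous_on_snd[OF cf] by (simp_all add: f_def split_beta)
  ultimately show ?thesis
    using 1 2 unfolding 3 by (intro exI[of _ D]) (simp add: f_def)
qed

text \<open>Passing from \<open>\<eta>\<close> to \<open>\<eta>'\<close> changes the action by the integral of a closed form of class \<open>0\<close>, which
takes the same value on all curves whose endpoints agree on the circle.\<close>

lemma minimizer_depends_on_class:
  assumes Lc: "continuous_on UNIV (\<lambda>(s, v, t). L (proj s, v) t)"
    and cl: "closed_form_SS \<eta>" "closed_form_SS \<eta>'" and eq: "form_class \<eta> = form_class \<eta>'"
    and x: "minimizer (minus_form L \<eta>) x"
  shows "minimizer (minus_form L \<eta>') x"
  unfolding minimizer_def
proof (intro conjI allI impI)
  show xC: "x C1_differentiable_on UNIV" using x by (simp add: minimizer_def)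
  fix a b y assume *: "a < b \<and> y C1_differentiable_on {a..b} \<and> proj (y a) = proj (x a) \<and> proj (y b) = proj (x b)"
  obtain D where D: "\<And>s t. ((\<lambda>s. snd (\<eta> (proj s, proj t))) has_real_derivative D s t) (at s)"
    "\<And>s t. ((\<lambda>t. fst (\<eta> (proj s, proj t))) has_real_derivative D s t) (at t)"
    "continuous_on UNIV (\<lambda>(s, t). fst (\<eta> (proj s, proj t)))"
    "continuous_on UNIV (\<lambda>(s, t). snd (\<eta> (proj s, proj t)))" "continuous_on UNIV (\<lambda>(s, t). D s t)"
    using closed_form_components[OF cl(1)] by blast
  obtain D' where D': "\<And>s t. ((\<lambda>s. snd (\<eta>' (proj s, proj t))) has_real_derivative D' s t) (at s)"
    "\<And>s t. ((\<lambda>t. fst (\<eta>' (proj s, proj t))) has_real_derivative D' s t) (at t)"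
    "continuous_on UNIV (\<lambda>(s, t). fst (\<eta>' (proj s, proj t)))"
    "continuous_on UNIV (\<lambda>(s, t). snd (\<eta>' (proj s, proj t)))" "continuous_on UNIV (\<lambda>(s, t). D' s t)"
    using closed_form_components[OF cl(2)] by blast
  define \<alpha> where "\<alpha> s t = fst (\<eta> (proj s, proj t)) - fst (\<eta>' (proj s, proj t))" for s t
  define \<beta> where "\<beta> s t = snd (\<eta> (proj s, proj t)) - snd (\<eta>' (proj s, proj t))" for s t
  have cont: "continuous_on UNIV (\<lambda>(s, t). \<alpha> s t)" "continuous_on UNIV (\<lambda>(s, t). \<beta> s t)"
    "continuous_on UNIV (\<lambda>(s, t). D s t - D' s t)"
    using D(3-5) D'(3-5) unfolding \<alpha>_def \<beta>_def split_beta by (intro continuous_on_diff; simp)+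
  have int: "(\<lambda>s. fst (\<eta> (proj s, proj 0))) integrable_on {0..1}" if "closed_form_SS \<eta>" for \<eta>
    using form_class_fiber[OF that] smooth_continuous
    by (auto simp: forms_S_def intro: integrable_continuous_interval)
  have mean0: "integral {0..1} (\<lambda>s. \<alpha> s 0) = 0"
    using eq integral_diff[OF int[OF cl(1)] int[OF cl(2)]]
    unfolding form_class_eq_iff[OF cl] by (simp add: \<alpha>_def mean_def)
  have act: "action (minus_form L \<eta>') z a b = action (minus_form L \<eta>) z a b
      + integral {a..b} (\<lambda>t. \<alpha> (z t) t * deriv z t + \<beta> (z t) t)"
    and C: "z C1_differentiable_on {a..b}" if z: "z C1_differentiable_on {a..b}" for z
  proof -
    note zc = C1_has_deriv(2,3)[OF z]
    have c1: "continuous_on {a..b} (\<lambda>t. f (z t) t)" if "continuous_on UNIV (\<lambda>(s, t). f s t)" for f :: "real \<Rightarrow> real \<Rightarrow> real"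
      using continuous_on_compose2[OF that continuous_on_Pair[OF zc(2) continuous_on_id]] by simp
    have "continuous_on {a..b} (\<lambda>t. (z t, deriv z t, t))" by (intro continuous_on_Pair zc continuous_on_id)
    from continuous_on_compose2[OF Lc this] have cL: "continuous_on {a..b} (\<lambda>t. L (proj (z t), deriv z t) t)" by simp
    have "(\<lambda>t. minus_form L \<eta> (velocity z t) t) integrable_on {a..b}"
      unfolding minus_form_def velocity_def case_prod_conv
      by (intro integrable_continuous_interval continuous_intros cL c1[OF D(3)] c1[OF D(4)] zc)
    moreover have "(\<lambda>t. \<alpha> (z t) t * deriv z t + \<beta> (z t) t) integrable_on {a..b}"
      by (intro integrable_continuous_interval continuous_intros c1[OF cont(1)] c1[OF cont(2)] zc)
    ultimately show "action (minus_form L \<eta>') z a b = action (minus_form L \<eta>) z a b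
      + integral {a..b} (\<lambda>t. \<alpha> (z t) t * deriv z t + \<beta> (z t) t)"
      unfolding action_def
      by (subst integral_add[symmetric]) (auto intro!: integral_cong simp: minus_form_def velocity_def \<alpha>_def \<beta>_def algebra_simps)
  qed (rule z)
  have pi: "proj (s + of_int n) = proj s" for s n by (rule proj_int)
  have xC': "x C1_differentiable_on {a..b}" by (rule C1_differentiable_on_subset[OF xC]) simp
  have "integral {a..b} (\<lambda>t. \<alpha> (x t) t * deriv x t + \<beta> (x t) t) = integral {a..b} (\<lambda>t. \<alpha> (y t) t * deriv y t + \<beta> (y t) t)"
  proof (rule closed_form_integral[where D = "\<lambda>s t. D s t - D' s t"])
    show "((\<lambda>s. \<beta> s t) has_real_derivative D s t - D' s t) (at s)" for s t
      unfolding \<beta>_def by (rule DERIV_diff[OF D(1) D'(1)])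
    show "((\<lambda>t. \<alpha> s t) has_real_derivative D s t - D' s t) (at t)" for s t
      unfolding \<alpha>_def by (rule DERIV_diff[OF D(2) D'(2)])
    show "x a - y a \<in> \<int>" "x b - y b \<in> \<int>" using * proj_eq_iff by metis+
  qed (use * xC' mean0 cont in \<open>auto simp: \<alpha>_def \<beta>_def pi\<close>)
  moreover have "action (minus_form L \<eta>) x a b \<le> action (minus_form L \<eta>) y a b"
    using x * unfolding minimizer_def by blast
  ultimately show "action (minus_form L \<eta>') x a b \<le> action (minus_form L \<eta>') y a b"
    using act[OF xC'] act[of y] * by simp
qed

section \<open>Periodic functions of position, velocity and time\<close>

lemma periodic_bounded:
  fixes f :: "real \<times> real \<times> real \<Rightarrow> real"
  assumes cont: "continuous_on UNIV f"
    and per: "\<And>s v t. f (s + 1, v, t) = f (s, v, t)" "\<And>s v t. f (s, v, t + 1) = f (s, v, t)"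
  shows "\<exists>B. \<forall>s v t. \<bar>v\<bar> \<le> V \<longrightarrow> \<bar>f (s, v, t)\<bar> \<le> B"
proof -
  have "compact ({0..1::real} \<times> {-V..V} \<times> {0..1::real})" by (intro compact_Times compact_Icc)
  then have "compact (f ` ({0..1} \<times> {-V..V} \<times> {0..1}))"
    by (intro compact_continuous_image continuous_on_subset[OF cont]) auto
  then obtain B where B: "\<forall>z\<in>{0..1} \<times> {-V..V} \<times> {0..1}. \<bar>f z\<bar> \<le> B"
    by (auto dest!: compact_imp_bounded simp: bounded_iff)
  have "\<bar>f (s, v, t)\<bar> \<le> B" if v: "\<bar>v\<bar> \<le> V" for s v t
  proof -
    have "f (s, v, t) = f (frac s, v, t)"
      using int_periodic[of "\<lambda>s. f (s, v, t)" "frac s" "\<lfloor>s\<rfloor>"] per(1) by (simp add: frac_def)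
    also have "\<dots> = f (frac s, v, frac t)"
      using int_periodic[of "\<lambda>t. f (frac s, v, t)" "frac t" "\<lfloor>t\<rfloor>"] per(2) by (simp add: frac_def)
    finally have eq: "f (s, v, t) = f (frac s, v, frac t)" .
    have "(frac s, v, frac t) \<in> {0..1} \<times> {-V..V} \<times> {0..1}"
      using v frac_lt_1[of s] frac_lt_1[of t] by (auto simp: abs_le_iff less_imp_le)
    with B show ?thesis unfolding eq by blast
  qed
  then show ?thesis by blast
qed

lemma frechet_derivative_periodic:
  fixes f :: "'a::real_normed_vector \<Rightarrow> 'b::real_normed_vector"
  assumes "\<And>z. f differentiable (at z)" "\<And>z. f (z + p) = f z"
  shows "frechet_derivative f (at (z + p)) = frechet_derivative f (at z)"
proof -
  have "(f has_derivative frechet_derivative f (at (z + p))) (at (z + p))"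
    using assms(1) by (simp add: frechet_derivative_works)
  moreover have "((\<lambda>x. x + p) has_derivative (\<lambda>h. h)) (at z)"
    by (rule has_derivative_add_const[OF has_derivative_ident])
  ultimately have "((\<lambda>x. f (x + p)) has_derivative (\<lambda>h. frechet_derivative f (at (z + p)) h)) (at z)"
    by (rule has_derivative_compose[rotated])
  then have "(f has_derivative frechet_derivative f (at (z + p))) (at z)" by (simp add: assms(2))
  then show ?thesis by (rule frechet_derivative_at)
qed

text \<open>The directional derivatives are periodic and continuous, hence bounded for bounded velocities, and
the mean value theorem applies along segments.\<close>

lemma periodic_lipschitz:
  fixes f :: "real \<times> real \<times> real \<Rightarrow> real"
  assumes C1: "C_diff (Suc 0) f"
    and per: "\<And>s v t. f (s + 1, v, t) = f (s, v, t)" "\<And>s v t. f (s, v, t + 1) = f (s, v, t)"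
  shows "\<exists>K\<ge>0. \<forall>s v t s' v' t'. \<bar>v\<bar> \<le> V \<and> \<bar>v'\<bar> \<le> V \<longrightarrow>
      \<bar>f (s, v, t) - f (s', v', t')\<bar> \<le> K * (\<bar>s - s'\<bar> + \<bar>v - v'\<bar> + \<bar>t - t'\<bar>)"
proof -
  define D where "D z = frechet_derivative f (at z)" for z
  have D: "(f has_derivative D z) (at z)" and cD: "continuous_on UNIV (\<lambda>z. D z w)" for z w
    using C_diff_SucD[OF C1] by (simp_all add: D_def C_diff.simps)
  have diff: "f differentiable (at z)" for z by (rule differentiableI[OF D])
  have perD: "D (s + 1, v, t) w = D (s, v, t) w" "D (s, v, t + 1) w = D (s, v, t) w" for s v t w
    using frechet_derivative_periodic[of f "(1, 0, 0)" "(s, v, t)"] frechet_derivative_periodic[of f "(0, 0, 1)" "(s, v, t)"]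
      diff per by (auto simp: D_def)
  have "\<exists>B. \<forall>s v t. \<bar>v\<bar> \<le> V \<longrightarrow> \<bar>D (s, v, t) w\<bar> \<le> B" for w
    by (rule periodic_bounded[OF cD]) (rule perD)+
  then obtain B where B: "\<And>w s v t. \<bar>v\<bar> \<le> V \<Longrightarrow> \<bar>D (s, v, t) w\<bar> \<le> B w" by metis
  define K where "K = \<bar>B (1, 0, 0)\<bar> + \<bar>B (0, 1, 0)\<bar> + \<bar>B (0, 0, 1)\<bar>"
  have "\<bar>f (s, v, t) - f (s', v', t')\<bar> \<le> K * (\<bar>s - s'\<bar> + \<bar>v - v'\<bar> + \<bar>t - t'\<bar>)"
    if v: "\<bar>v\<bar> \<le> V" "\<bar>v'\<bar> \<le> V" for s v t s' v' t'
  proof -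
    define w where "w = (s - s', v - v', t - t')"
    define c where "c \<tau> = (s', v', t') + \<tau> *\<^sub>R w" for \<tau>
    have "((\<lambda>\<tau>. f (c \<tau>)) has_real_derivative D (c \<tau>) w) (at \<tau>)" for \<tau>
    proof -
      have "(c has_derivative (\<lambda>h. h *\<^sub>R w)) (at \<tau>)" unfolding c_def[abs_def]
        by (auto intro!: derivative_eq_intros)
      from has_derivative_compose[OF this D]
      have "((\<lambda>\<tau>. f (c \<tau>)) has_derivative (\<lambda>h. D (c \<tau>) (h *\<^sub>R w))) (at \<tau>)" .
      moreover have "(\<lambda>h. D (c \<tau>) (h *\<^sub>R w)) = (*) (D (c \<tau>) w)"
        using linear_scale[OF has_derivative_linear[OF D]] by (auto simp: fun_eq_iff)
      ultimately show ?thesis by (simp add: has_field_derivative_def)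
    qed
    then obtain \<xi> where \<xi>: "0 < \<xi>" "\<xi> < 1" "f (c 1) - f (c 0) = (1 - 0) * D (c \<xi>) w"
      using MVT2[of 0 1 "\<lambda>\<tau>. f (c \<tau>)" "\<lambda>\<tau>. D (c \<tau>) w"] by auto
    have c01: "c 1 = (s, v, t)" "c 0 = (s', v', t')" by (auto simp: c_def w_def)
    obtain s2 v2 t2 where c\<xi>: "c \<xi> = (s2, v2, t2)" by (cases "c \<xi>") auto
    have "v2 = (1 - \<xi>) * v' + \<xi> * v" using c\<xi> by (auto simp: c_def w_def algebra_simps)
    also have "\<bar>\<dots>\<bar> \<le> (1 - \<xi>) * \<bar>v'\<bar> + \<xi> * \<bar>v\<bar>" using \<xi> by (intro order_trans[OF abs_triangle_ineq]) (simp add: abs_mult)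
    also have "\<dots> \<le> (1 - \<xi>) * V + \<xi> * V" using \<xi> v by (intro add_mono mult_left_mono) auto
    finally have v2: "\<bar>v2\<bar> \<le> V" by (simp add: algebra_simps)
    have "w = (s - s') *\<^sub>R (1, 0, 0) + (v - v') *\<^sub>R (0, 1, 0) + (t - t') *\<^sub>R (0, 0, 1)" by (simp add: w_def)
    then have "D (c \<xi>) w = (s - s') * D (c \<xi>) (1, 0, 0) + (v - v') * D (c \<xi>) (0, 1, 0) + (t - t') * D (c \<xi>) (0, 0, 1)"
      using has_derivative_linear[OF D, of "c \<xi>"] by (simp only: linear_add linear_scale real_scaleR_def)
    also have "\<bar>\<dots>\<bar> \<le> \<bar>s - s'\<bar> * K + \<bar>v - v'\<bar> * K + \<bar>t - t'\<bar> * K"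
    proof -
      have "\<bar>D (c \<xi>) (1, 0, 0)\<bar> \<le> K" "\<bar>D (c \<xi>) (0, 1, 0)\<bar> \<le> K" "\<bar>D (c \<xi>) (0, 0, 1)\<bar> \<le> K"
        unfolding c\<xi> using B[OF v2, of s2 t2 "(1, 0, 0)"] B[OF v2, of s2 t2 "(0, 1, 0)"] B[OF v2, of s2 t2 "(0, 0, 1)"]
        by (simp_all add: K_def)
      then have "\<bar>(s - s') * D (c \<xi>) (1, 0, 0)\<bar> \<le> \<bar>s - s'\<bar> * K" "\<bar>(v - v') * D (c \<xi>) (0, 1, 0)\<bar> \<le> \<bar>v - v'\<bar> * K"
        "\<bar>(t - t') * D (c \<xi>) (0, 0, 1)\<bar> \<le> \<bar>t - t'\<bar> * K"
        unfolding abs_mult by (auto intro!: mult_left_mono)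
      then show ?thesis by linarith
    qed
    finally show ?thesis using \<xi>(3) by (simp add: c01 algebra_simps)
  qed
  moreover have "K \<ge> 0" by (simp add: K_def)
  ultimately show ?thesis by blast
qed

section \<open>The Lagrangian on the universal cover\<close>

locale lagrangian_system =
  fixes g :: "circle \<Rightarrow> real" and L :: lagrangian and \<phi> :: "real \<Rightarrow> phase \<Rightarrow> phase" and r :: real
  assumes g: "riemannian_metric g" and L: "admissible_lagrangian g L" and \<phi>: "euler_lagrange_flow L \<phi>"
begin

definition F :: "real \<times> real \<times> real \<Rightarrow> real" where "F = (\<lambda>(s, v, t). L (proj s, v) t)"
definition DF :: "real \<times> real \<times> real \<Rightarrow> real \<times> real \<times> real \<Rightarrow> real" where
  "DF w z = frechet_derivative F (at z) w"
text \<open>\<open>L - \<eta>\<close> for the constant form \<open>\<eta> = r dx\<close>, lifted to the universal cover.\<close>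

definition G :: "real \<Rightarrow> real \<Rightarrow> real \<Rightarrow> real" where "G s v t = F (s, v, t) - r * v"
definition Gs :: "real \<Rightarrow> real \<Rightarrow> real \<Rightarrow> real" where "Gs s v t = DF (1, 0, 0) (s, v, t)"
definition Gv :: "real \<Rightarrow> real \<Rightarrow> real \<Rightarrow> real" where "Gv s v t = DF (0, 1, 0) (s, v, t) - r"
definition W :: "real \<Rightarrow> real \<Rightarrow> real \<Rightarrow> real \<Rightarrow> real" where
  "W u s v t = snd (fst (\<phi> (t - u) ((proj s, v), proj u)))"

lemma F_C2: "C_diff (Suc (Suc 0)) F"
  using L by (simp add: admissible_lagrangian_def F_def numeral_2_eq_2)

lemma F_deriv: "(F has_derivative (\<lambda>w. DF w z)) (at z)"
  unfolding DF_def by (rule C_diff_SucD(1)[OF F_C2])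

lemma DF_C1: "C_diff (Suc 0) (DF w)"
  using C_diff_SucD(2)[OF F_C2, of w] by (simp add: DF_def[abs_def])

lemma F_periodic: "F (s + 1, v, t) = F (s, v, t)" "F (s, v, t + 1) = F (s, v, t)"
  using L proj_int[of s 1] by (simp_all add: F_def admissible_lagrangian_def)

lemma DF_periodic: "DF w (s + 1, v, t) = DF w (s, v, t)" "DF w (s, v, t + 1) = DF w (s, v, t)"
proof -
  have diff: "F differentiable (at z)" for z by (rule differentiableI[OF F_deriv])
  show "DF w (s + 1, v, t) = DF w (s, v, t)" "DF w (s, v, t + 1) = DF w (s, v, t)"
    using frechet_derivative_periodic[of F "(1, 0, 0)" "(s, v, t)"] frechet_derivative_periodic[of F "(0, 0, 1)" "(s, v, t)"]
      diff F_periodic by (auto simp: DF_def)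
qed

lemma F_cont: "continuous_on S F"
  by (intro continuous_at_imp_continuous_on ballI has_derivative_continuous[OF F_deriv])

lemma DF_cont: "continuous_on S (DF w)"
  by (intro continuous_at_imp_continuous_on ballI has_derivative_continuous[OF C_diff_SucD(1)[OF DF_C1]])

lemma DF_linear: "linear (\<lambda>w. DF w z)" by (rule has_derivative_linear[OF F_deriv])

lemma F_v_deriv: "((\<lambda>v. F (s, v, t)) has_real_derivative DF (0, 1, 0) (s, v, t)) (at v)"
proof -
  have "((\<lambda>v. (s, v, t)) has_derivative (\<lambda>h. (0, h, 0))) (at v)"
    by (intro has_derivative_Pair has_derivative_ident has_derivative_const)
  from has_derivative_compose[OF this F_deriv]
  have "((\<lambda>v. F (s, v, t)) has_derivative (\<lambda>h. DF (0, h, 0) (s, v, t))) (at v)" .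
  moreover have "(\<lambda>h. DF (0, h, 0) (s, v, t)) = (*) (DF (0, 1, 0) (s, v, t))"
  proof
    fix h show "DF (0, h, 0) (s, v, t) = DF (0, 1, 0) (s, v, t) * h"
      using linear_scale[OF DF_linear, of h "(0, 1, 0)" "(s, v, t)"] by simp
  qed
  ultimately show ?thesis by (simp only: has_field_derivative_def)
qed

definition Fvv :: "real \<times> real \<times> real \<Rightarrow> real" where
  "Fvv z = frechet_derivative (DF (0, 1, 0)) (at z) (0, 1, 0)"

lemma Fv_v_deriv: "((\<lambda>v. DF (0, 1, 0) (s, v, t)) has_real_derivative Fvv (s, v, t)) (at v)"
proof -
  let ?D = "frechet_derivative (DF (0, 1, 0)) (at (s, v, t))"
  have "((\<lambda>v. (s, v, t)) has_derivative (\<lambda>h. (0, h, 0))) (at v)"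
    by (intro has_derivative_Pair has_derivative_ident has_derivative_const)
  from has_derivative_compose[OF this C_diff_SucD(1)[OF DF_C1]]
  have "((\<lambda>v. DF (0, 1, 0) (s, v, t)) has_derivative (\<lambda>h::real. ?D (0, h, 0))) (at v)" .
  moreover have "(\<lambda>h::real. ?D (0, h, 0)) = (*) (Fvv (s, v, t))"
  proof
    fix h :: real show "?D (0, h, 0) = Fvv (s, v, t) * h"
      using linear_scale[OF has_derivative_linear[OF C_diff_SucD(1)[OF DF_C1[of "(0, 1, 0)"], of "(s, v, t)"]], of h "(0, 1, 0)"]
      by (simp add: Fvv_def)
  qed
  ultimately show ?thesis by (simp only: has_field_derivative_def)
qed

lemma Fvv_nonzero: "Fvv (s, v, t) \<noteq> 0"
proof -
  have "deriv (\<lambda>w. F (s, w, t)) = (\<lambda>w. DF (0, 1, 0) (s, w, t))" using DERIV_imp_deriv[OF F_v_deriv] by blast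
  then have "deriv (deriv (\<lambda>w. F (s, w, t))) v = Fvv (s, v, t)" using DERIV_imp_deriv[OF Fv_v_deriv] by simp
  then show ?thesis using L by (simp add: admissible_lagrangian_def F_def) metis
qed

lemma F_strictly_convex:
  assumes "v \<noteq> w" "0 < u" "u < 1"
  shows "F (s, (1 - u) * v + u * w, t) < (1 - u) * F (s, v, t) + u * F (s, w, t)"
  using L assms by (simp add: admissible_lagrangian_def F_def)

lemma Fvv_cont: "continuous_on S Fvv"
  using C_diff_SucD(2)[OF DF_C1, of "(0, 1, 0)" "(0, 1, 0)"] continuous_on_subset[of UNIV _ S]
  by (simp add: C_diff.simps Fvv_def[abs_def])

text \<open>The second derivative in the velocity vanishes nowhere, so it has constant sign on the connected
phase space, and a negative sign would contradict convexity.\<close>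

lemma Fvv_pos: "Fvv z > 0"
proof (rule ccontr)
  assume "\<not> Fvv z > 0"
  then have neg: "Fvv z < 0" using Fvv_nonzero by (cases z) (metis linorder_neqE_linordered_idom)
  have "Fvv z' < 0" for z'
  proof (rule ccontr)
    assume "\<not> Fvv z' < 0"
    have "connected (range Fvv)" by (intro connected_continuous_image Fvv_cont connected_UNIV)
    then have "0 \<in> range Fvv" using connectedD_interval[of "range Fvv" "Fvv z" "Fvv z'" 0] neg \<open>\<not> Fvv z' < 0\<close> by auto
    then show False using Fvv_nonzero by (metis (no_types, lifting) imageE prod_cases3)
  qed
  note neg = this
  obtain \<xi>1 where 1: "0 < \<xi>1" "\<xi>1 < 1 / 2" "F (0, 1 / 2, 0) - F (0, 0, 0) = (1 / 2 - 0) * DF (0, 1, 0) (0, \<xi>1, 0)"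
    using MVT2[of 0 "1/2" "\<lambda>v. F (0, v, 0)" "\<lambda>v. DF (0, 1, 0) (0, v, 0)"] F_v_deriv by auto
  obtain \<xi>2 where 2: "1 / 2 < \<xi>2" "\<xi>2 < 1" "F (0, 1, 0) - F (0, 1 / 2, 0) = (1 - 1 / 2) * DF (0, 1, 0) (0, \<xi>2, 0)"
    using MVT2[of "1/2" 1 "\<lambda>v. F (0, v, 0)" "\<lambda>v. DF (0, 1, 0) (0, v, 0)"] F_v_deriv by auto
  have "\<xi>1 < \<xi>2" using 1 2 by linarith
  then obtain \<xi> where \<xi>: "DF (0, 1, 0) (0, \<xi>2, 0) - DF (0, 1, 0) (0, \<xi>1, 0) = (\<xi>2 - \<xi>1) * Fvv (0, \<xi>, 0)"
    using MVT2[of \<xi>1 \<xi>2 "\<lambda>v. DF (0, 1, 0) (0, v, 0)" "\<lambda>v. Fvv (0, v, 0)"] Fv_v_deriv by blast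
  have "(\<xi>2 - \<xi>1) * Fvv (0, \<xi>, 0) < 0" using \<open>\<xi>1 < \<xi>2\<close> neg by (simp add: mult_pos_neg)
  then have "F (0, 0, 0) + F (0, 1, 0) < 2 * F (0, 1 / 2, 0)" using 1(3) 2(3) \<xi> by (simp add: algebra_simps)
  then show False using F_strictly_convex[of 0 1 "1/2" 0 0] by simp
qed

lemma Gv_monotone: "\<exists>m>0. \<forall>s v v' t. \<bar>v\<bar> \<le> V \<and> \<bar>v'\<bar> \<le> V \<longrightarrow>
      m * (v - v')\<^sup>2 \<le> (Gv s v t - Gv s v' t) * (v - v')"
proof -
  have per: "Fvv (s + 1, v, t) = Fvv (s, v, t)" "Fvv (s, v, t + 1) = Fvv (s, v, t)" for s v t
  proof -
    have diff: "DF (0, 1, 0) differentiable (at z)" for z by (rule differentiableI[OF C_diff_SucD(1)[OF DF_C1]])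
    show "Fvv (s + 1, v, t) = Fvv (s, v, t)" "Fvv (s, v, t + 1) = Fvv (s, v, t)"
      using frechet_derivative_periodic[of "DF (0, 1, 0)" "(1, 0, 0)" "(s, v, t)"]
        frechet_derivative_periodic[of "DF (0, 1, 0)" "(0, 0, 1)" "(s, v, t)"]
        diff DF_periodic by (auto simp: Fvv_def)
  qed
  have "continuous_on UNIV (\<lambda>z. 1 / Fvv z)" using Fvv_pos by (intro continuous_intros Fvv_cont) (metis less_irrefl)
  then obtain B where B: "\<forall>s v t. \<bar>v\<bar> \<le> V \<longrightarrow> \<bar>1 / Fvv (s, v, t)\<bar> \<le> B"
    using periodic_bounded[of "\<lambda>z. 1 / Fvv z" V] per by auto
  define m where "m = 1 / max B 1"
  have m: "m > 0" by (simp add: m_def)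
  have low: "m \<le> Fvv (s, v, t)" if "\<bar>v\<bar> \<le> V" for s v t
  proof -
    have "1 / Fvv (s, v, t) \<le> max B 1" using B that by (smt (verit) max.cobounded1)
    then show ?thesis using Fvv_pos[of "(s, v, t)"] by (simp add: m_def field_simps)
  qed
  have le: "m * (v - v')\<^sup>2 \<le> (Gv s v t - Gv s v' t) * (v - v')"
    if h: "\<bar>v\<bar> \<le> V" "\<bar>v'\<bar> \<le> V" "v' < v" for s v v' t
  proof -
    obtain \<xi> where \<xi>: "v' < \<xi>" "\<xi> < v" "DF (0, 1, 0) (s, v, t) - DF (0, 1, 0) (s, v', t) = (v - v') * Fvv (s, \<xi>, t)"
      using MVT2[OF h(3), of "\<lambda>v. DF (0, 1, 0) (s, v, t)" "\<lambda>v. Fvv (s, v, t)"] Fv_v_deriv by blast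
    have "\<bar>\<xi>\<bar> \<le> V" using \<xi> h by (simp add: abs_le_iff)
    then have "m * (v - v')\<^sup>2 \<le> Fvv (s, \<xi>, t) * (v - v')\<^sup>2" using low by (intro mult_right_mono) auto
    also have "\<dots> = (Gv s v t - Gv s v' t) * (v - v')" using \<xi>(3) by (simp add: Gv_def power2_eq_square)
    finally show ?thesis .
  qed
  have "m * (v - v')\<^sup>2 \<le> (Gv s v t - Gv s v' t) * (v - v')" if "\<bar>v\<bar> \<le> V" "\<bar>v'\<bar> \<le> V" for s v v' t
  proof -
    consider "v' < v" | "v = v'" | "v < v'" by linarith
    then show ?thesis
    proof cases
      case 3
      from le[OF that(2,1) this, of s t] show ?thesis by (simp add: power2_commute algebra_simps)
    qed (use le that in auto)
  qed
  then show ?thesis using m by blast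
qed

lemma metric_lower_bound: "\<exists>c>0. \<forall>x v. c * \<bar>v\<bar> \<le> tangent_norm g (x, v)"
proof -
  have cont: "continuous_on UNIV (\<lambda>s. g (proj s))" using g smooth_continuous by (auto simp: riemannian_metric_def)
  have pos: "g x > 0" for x using g by (simp add: riemannian_metric_def)
  have "continuous_on UNIV (\<lambda>z::real \<times> real \<times> real. 1 / g (proj (fst z)))"
    using pos by (intro continuous_intros continuous_on_compose2[OF cont]) (auto simp: less_imp_neq[OF pos, symmetric])
  then obtain B where B: "\<forall>s (v::real) (t::real). \<bar>v\<bar> \<le> 0 \<longrightarrow> \<bar>1 / g (proj s)\<bar> \<le> B"
    using periodic_bounded[of "\<lambda>z::real \<times> real \<times> real. 1 / g (proj (fst z))" 0] proj_int[of _ 1] by auto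
  define c where "c = sqrt (1 / max B 1)"
  have "c * \<bar>v\<bar> \<le> tangent_norm g (x, v)" for x v
  proof -
    obtain s where s: "x = proj s" by (rule proj_cases)
    have "1 / g x \<le> max B 1" using B[rule_format, of 0 s] pos[of x] s by (auto simp: le_max_iff_disj)
    then have "1 / max B 1 \<le> g x" using pos[of x] by (simp add: field_simps)
    then have "sqrt (1 / max B 1 * v\<^sup>2) \<le> sqrt (g x * v\<^sup>2)" by (intro real_sqrt_le_mono mult_right_mono) auto
    then show ?thesis by (simp only: c_def tangent_norm_def real_sqrt_mult real_sqrt_abs prod.case)
  qed
  moreover have "c > 0" by (simp add: c_def)
  ultimately show ?thesis by blast
qed

text \<open>Superlinear growth is known at each time separately. At time \<open>t0\<close> it makes \<open>F\<close> large on the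
spheres \<open>\<bar>v\<bar> = R\<close>; the estimate persists on these spheres at nearby times by Lipschitz continuity,
and convexity along the ray from \<open>0\<close> extends it to all larger velocities.\<close>

lemma superlinear_locally:
  assumes k: "k \<ge> 0"
  shows "\<exists>C \<epsilon>. \<epsilon> > 0 \<and> (\<forall>t s v. \<bar>t - t0\<bar> < \<epsilon> \<longrightarrow> k * \<bar>v\<bar> - C \<le> F (s, v, t))"
proof -
  obtain B0 where B0: "\<And>s t. \<bar>F (s, 0, t)\<bar> \<le> B0"
    using periodic_bounded[OF F_cont F_periodic, of 0] by auto
  have B0': "B0 \<ge> 0" using B0[of 0 0] by simp
  obtain c where c: "c > 0" "\<And>x v. c * \<bar>v\<bar> \<le> tangent_norm g (x, v)" using metric_lower_bound by blast
  have "filterlim (\<lambda>z. L z t0 / tangent_norm g z) at_top (filtercomap (tangent_norm g) at_top)"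
    using L by (simp add: admissible_lagrangian_def)
  then have "\<forall>\<^sub>F z in filtercomap (tangent_norm g) at_top. (k + 1) / c \<le> L z t0 / tangent_norm g z"
    by (simp add: filterlim_at_top)
  then obtain N where N: "\<And>z. tangent_norm g z \<ge> N \<Longrightarrow> (k + 1) / c \<le> L z t0 / tangent_norm g z"
    unfolding eventually_filtercomap eventually_at_top_linorder by blast
  define R where "R = max (max 1 (N / c)) (B0 + 1)"
  have R: "R \<ge> 1" "R \<ge> N / c" "R \<ge> B0 + 1" by (auto simp: R_def)
  have big: "k * R + B0 + 1 \<le> F (s, v, t0)" if v: "\<bar>v\<bar> = R" for s v
  proof -
    have n: "c * R \<le> tangent_norm g (proj s, v)" using c(2)[of v "proj s"] v by simp
    have cR: "c * R > 0" using c(1) R(1) by simp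
    have "N \<le> c * R" using R(2) c(1) by (simp add: field_simps)
    then have "(k + 1) / c \<le> L (proj s, v) t0 / tangent_norm g (proj s, v)" using N n by simp
    then have "(k + 1) / c * tangent_norm g (proj s, v) \<le> L (proj s, v) t0" using n cR by (simp add: pos_le_divide_eq)
    moreover have "(k + 1) / c * (c * R) \<le> (k + 1) / c * tangent_norm g (proj s, v)"
      using n k c(1) by (intro mult_left_mono) auto
    moreover have "(k + 1) / c * (c * R) = k * R + R" using c(1) by (simp add: field_simps)
    ultimately show ?thesis using R(3) by (simp add: F_def)
  qed
  obtain K where K: "K \<ge> 0" "\<And>s v t s' v' t'. \<bar>v\<bar> \<le> R \<Longrightarrow> \<bar>v'\<bar> \<le> R \<Longrightarrow>
      \<bar>F (s, v, t) - F (s', v', t')\<bar> \<le> K * (\<bar>s - s'\<bar> + \<bar>v - v'\<bar> + \<bar>t - t'\<bar>)"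
    using periodic_lipschitz[OF C_diff_decrease[OF F_C2] F_periodic, of R] by blast
  obtain BR where BR: "\<And>s v t. \<bar>v\<bar> \<le> R \<Longrightarrow> \<bar>F (s, v, t)\<bar> \<le> BR"
    using periodic_bounded[OF F_cont F_periodic, of R] by blast
  define \<epsilon> where "\<epsilon> = 1 / (K + 1)"
  have \<epsilon>: "\<epsilon> > 0" "K * \<epsilon> \<le> 1" using K(1) by (auto simp: \<epsilon>_def)
  define C where "C = B0 + \<bar>BR\<bar> + k * R"
  have "k * \<bar>v\<bar> - C \<le> F (s, v, t)" if t: "\<bar>t - t0\<bar> < \<epsilon>" for t s v
  proof (cases "\<bar>v\<bar> \<le> R")
    case True
    then have "k * \<bar>v\<bar> \<le> k * R" using k by (intro mult_left_mono) auto
    then show ?thesis using BR[OF True, of s t] B0' by (simp add: C_def)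
  next
    case False
    define v1 where "v1 = R / \<bar>v\<bar> * v"
    have v0: "\<bar>v\<bar> > 0" "\<bar>v\<bar> > R" using False R(1) by auto
    have v1: "\<bar>v1\<bar> = R" using v0 R(1) by (simp add: v1_def abs_mult)
    have "\<bar>F (s, v1, t) - F (s, v1, t0)\<bar> \<le> K * \<bar>t - t0\<bar>" using K(2)[of v1 v1 s t s t0] v1 by simp
    also have "\<dots> \<le> K * \<epsilon>" using t K(1) by (intro mult_left_mono) auto
    finally have "k * R + B0 \<le> F (s, v1, t)" using big[OF v1, of s] \<epsilon>(2) by linarith
    then have le: "k * R + F (s, 0, t) \<le> F (s, v1, t)" using B0[of s t] by (simp add: abs_le_iff)
    define u where "u = R / \<bar>v\<bar>"
    have u: "0 < u" "u < 1" using v0 R(1) by (auto simp: u_def)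
    have "F (s, v1, t) < (1 - u) * F (s, 0, t) + u * F (s, v, t)"
      using F_strictly_convex[of 0 v u s t] u v0 by (simp add: v1_def u_def)
    then have "k * R < u * (F (s, v, t) - F (s, 0, t))" using le by (simp add: algebra_simps)
    also have "k * R = u * (k * \<bar>v\<bar>)" using v0 by (simp add: u_def)
    finally have "k * \<bar>v\<bar> < F (s, v, t) - F (s, 0, t)" using u(1) by (simp add: mult_less_cancel_left_pos)
    moreover have "k * R \<ge> 0" using k R(1) by simp
    ultimately show ?thesis using B0[of s t] abs_ge_zero[of BR] unfolding C_def abs_le_iff by linarith
  qed
  then show ?thesis using \<epsilon>(1) by blast
qed

text \<open>Finitely many of the time intervals above cover a period.\<close>

lemma superlinear: 
  assumes k: "k \<ge> 0" shows "\<exists>C. \<forall>s v t. k * \<bar>v\<bar> - C \<le> F (s, v, t)"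
proof -
  obtain C \<epsilon> where C: "\<And>t0. \<epsilon> t0 > (0::real)" "\<And>t0 t s v. \<bar>t - t0\<bar> < \<epsilon> t0 \<Longrightarrow> k * \<bar>v\<bar> - C t0 \<le> F (s, v, t)"
    using superlinear_locally[OF k] by metis
  have "{0..1} \<subseteq> (\<Union>t0\<in>{0..1::real}. ball t0 (\<epsilon> t0))" using C(1) by auto
  then obtain T where T: "T \<subseteq> {0..1}" "finite T" "{0..1} \<subseteq> (\<Union>t0\<in>T. ball t0 (\<epsilon> t0))"
    using compactE_image[OF compact_Icc, of "{0..1}" "\<lambda>t0. ball t0 (\<epsilon> t0)" 0 1] by (metis open_ball)
  define B where "B = Max (C ` T)"
  have "k * \<bar>v\<bar> - B \<le> F (s, v, t)" for s v t
  proof -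
    have "frac t \<in> {0..1}" by (auto simp: frac_lt_1 less_imp_le)
    then have "frac t \<in> (\<Union>t0\<in>T. ball t0 (\<epsilon> t0))" using T(3) by (rule subsetD[rotated])
    then obtain t0 where t0: "t0 \<in> T" "dist (frac t) t0 < \<epsilon> t0" by (elim UN_E) (simp add: dist_commute)
    have "C t0 \<le> B" unfolding B_def using T(2) t0(1) by (intro Max_ge) auto
    moreover have "k * \<bar>v\<bar> - C t0 \<le> F (s, v, frac t)" by (rule C(2)) (use t0(2) in \<open>simp add: dist_real_def\<close>)
    moreover have "F (s, v, frac t) = F (s, v, t)"
      using int_periodic[of "\<lambda>t. F (s, v, t)" "frac t" "\<lfloor>t\<rfloor>"] F_periodic(2) by (simp add: frac_def)
    ultimately show ?thesis by linarith
  qed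
  then show ?thesis by blast
qed


lemma action_eq:
  assumes "x C1_differentiable_on {a..b}" "a \<le> b"
  shows "action L x a b = integral {a..b} (\<lambda>t. G (x t) (deriv x t) t) + r * (x b - x a)"
proof -
  note x = C1_has_deriv[OF assms(1)]
  have "continuous_on {a..b} (\<lambda>t. F (x t, deriv x t, t) - r * deriv x t)"
    by (intro continuous_intros continuous_on_compose2[OF F_cont[of UNIV]] x) auto
  then have "(\<lambda>t. G (x t) (deriv x t) t) integrable_on {a..b}"
    unfolding G_def by (rule integrable_continuous_interval)
  moreover have "((\<lambda>t. r * deriv x t) has_integral r * (x b - x a)) {a..b}"
    using has_integral_mult_right[OF integrable_integral[OF integrable_continuous_interval], of a b "deriv x" r]
      integral_deriv[OF assms(2) x(1)] x by simp
  ultimately have "((\<lambda>t. G (x t) (deriv x t) t + r * deriv x t) has_integral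
      integral {a..b} (\<lambda>t. G (x t) (deriv x t) t) + r * (x b - x a)) {a..b}"
    by (intro has_integral_add integrable_integral)
  then show ?thesis unfolding action_def by (intro integral_unique) (simp add: G_def F_def velocity_def)
qed

text \<open>For fixed endpoints the actions of \<open>L\<close> and of \<open>G\<close> differ by a constant, so both have the same
critical points.\<close>

lemma extremal_of_critical:
  assumes ab: "a < b" and x: "x C1_differentiable_on {a..b}"
    and ext: "\<And>h. \<lbrakk>h C1_differentiable_on {a..b}; h a = 0; h b = 0\<rbrakk> \<Longrightarrow>
        ((\<lambda>e. integral {a..b} (\<lambda>t. G (x t + e * h t) (deriv (\<lambda>t. x t + e * h t) t) t))
          has_real_derivative 0) (at 0)"
  shows "extremal_on L x a b"
  unfolding extremal_on_def
proof (intro conjI x allI impI)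
    fix h :: "real \<Rightarrow> real" assume h: "h C1_differentiable_on {a..b} \<and> h a = 0 \<and> h b = 0"
    have "action L (\<lambda>t. x t + e * h t) a b =
        integral {a..b} (\<lambda>t. G (x t + e * h t) (deriv (\<lambda>t. x t + e * h t) t) t) + r * (x b - x a)" for e
    proof -
      have C1: "(\<lambda>t. x t + e * h t) C1_differentiable_on {a..b}"
        using x h by (intro C1_differentiable_on_add C1_differentiable_on_mult) auto
      show ?thesis using action_eq[OF C1] ab h by simp
    qed
    then have eq: "(\<lambda>e. action L (\<lambda>t. x t + e * h t) a b) =
        (\<lambda>e. integral {a..b} (\<lambda>t. G (x t + e * h t) (deriv (\<lambda>t. x t + e * h t) t) t) + r * (x b - x a))" by blast
    have "((\<lambda>e. integral {a..b} (\<lambda>t. G (x t + e * h t) (deriv (\<lambda>t. x t + e * h t) t) t) + r * (x b - x a))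
        has_real_derivative 0 + 0) (at 0)"
      by (rule DERIV_add[OF ext DERIV_const]) (use h in auto)
    then show "((\<lambda>\<epsilon>. action L (\<lambda>t. x t + \<epsilon> * h t) a b) has_real_derivative 0) (at 0)" unfolding eq by simp
  qed

lemma G_tonelli: "tonelli G Gs Gv W"
proof
  fix s v t V :: real
  show "G (s + 1) v t = G s v t" "G s v (t + 1) = G s v t" by (simp_all add: G_def F_periodic)
  show "continuous_on UNIV (\<lambda>(s, v, t). G s v t)" "continuous_on UNIV (\<lambda>(s, v, t). Gs s v t)"
    "continuous_on UNIV (\<lambda>(s, v, t). Gv s v t)"
    unfolding G_def Gs_def Gv_def case_prod_unfold prod.collapse
    by (intro continuous_intros F_cont DF_cont)+
  obtain B where B: "\<And>s v t. \<bar>v\<bar> \<le> V \<Longrightarrow> \<bar>F (s, v, t)\<bar> \<le> B"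
    using periodic_bounded[OF F_cont F_periodic, of V] by blast
  have "\<bar>G s v t\<bar> \<le> B + \<bar>r\<bar> * V" if "\<bar>v\<bar> \<le> V" for s v t
  proof -
    have "\<bar>r * v\<bar> \<le> \<bar>r\<bar> * V" unfolding abs_mult using that by (intro mult_left_mono) auto
    then show ?thesis using B[OF that, of s t] unfolding G_def by linarith
  qed
  then show "\<exists>B. \<forall>s v t. \<bar>v\<bar> \<le> V \<longrightarrow> \<bar>G s v t\<bar> \<le> B" by blast
  show "\<exists>B. \<forall>s v t. \<bar>v\<bar> \<le> V \<longrightarrow> \<bar>Gs s v t\<bar> \<le> B"
    unfolding Gs_def by (rule periodic_bounded[OF DF_cont DF_periodic])
  obtain K where K: "\<And>s v t s' v' t'. \<bar>v\<bar> \<le> V \<Longrightarrow> \<bar>v'\<bar> \<le> V \<Longrightarrow>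
      \<bar>F (s, v, t) - F (s', v', t')\<bar> \<le> K * (\<bar>s - s'\<bar> + \<bar>v - v'\<bar> + \<bar>t - t'\<bar>)"
    using periodic_lipschitz[OF C_diff_decrease[OF F_C2] F_periodic, of V] by blast
  have "\<bar>G s v t - G s' v' t'\<bar> \<le> (K + \<bar>r\<bar>) * (\<bar>s - s'\<bar> + \<bar>v - v'\<bar> + \<bar>t - t'\<bar>)"
    if "\<bar>v\<bar> \<le> V" "\<bar>v'\<bar> \<le> V" for s v t s' v' t'
  proof -
    have "\<bar>r * (v - v')\<bar> \<le> \<bar>r\<bar> * (\<bar>s - s'\<bar> + \<bar>v - v'\<bar> + \<bar>t - t'\<bar>)" unfolding abs_mult by (intro mult_left_mono) auto
    then show ?thesis using K[OF that, of s t s' t'] unfolding G_def by (simp add: distrib_right right_diff_distrib abs_le_iff)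
  qed
  then show "\<exists>K. \<forall>s v t s' v' t'. \<bar>v\<bar> \<le> V \<and> \<bar>v'\<bar> \<le> V \<longrightarrow>
      \<bar>G s v t - G s' v' t'\<bar> \<le> K * (\<bar>s - s'\<bar> + \<bar>v - v'\<bar> + \<bar>t - t'\<bar>)" by blast
  show "\<exists>K. \<forall>s v t s' v' t'. \<bar>v\<bar> \<le> V \<and> \<bar>v'\<bar> \<le> V \<longrightarrow>
      \<bar>Gs s v t - Gs s' v' t'\<bar> \<le> K * (\<bar>s - s'\<bar> + \<bar>v - v'\<bar> + \<bar>t - t'\<bar>)"
    using periodic_lipschitz[OF DF_C1 DF_periodic, of V "(1, 0, 0)"] unfolding Gs_def by blast
  show "\<exists>K. \<forall>s v t s' v' t'. \<bar>v\<bar> \<le> V \<and> \<bar>v'\<bar> \<le> V \<longrightarrow>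
      \<bar>Gv s v t - Gv s' v' t'\<bar> \<le> K * (\<bar>s - s'\<bar> + \<bar>v - v'\<bar> + \<bar>t - t'\<bar>)"
    using periodic_lipschitz[OF DF_C1 DF_periodic, of V "(0, 1, 0)"] unfolding Gv_def by auto
  show "\<exists>m>0. \<forall>s v v' t. \<bar>v\<bar> \<le> V \<and> \<bar>v'\<bar> \<le> V \<longrightarrow> m * (v - v')\<^sup>2 \<le> (Gv s v t - Gv s v' t) * (v - v')"
    by (rule Gv_monotone)
  show "G s ((v + w) / 2) t < (G s v t + G s w t) / 2" if "v \<noteq> w" for w
    using F_strictly_convex[OF that, of "1 / 2" s t] by (simp add: G_def field_simps)
  obtain C where C: "\<And>s v t. (1 + \<bar>r\<bar>) * \<bar>v\<bar> - C \<le> F (s, v, t)" using superlinear[of "1 + \<bar>r\<bar>"] by auto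
  have "\<bar>v\<bar> - C \<le> G s v t" for s v t
    using C[of v s t] abs_ge_self[of "r * v"] by (simp add: G_def abs_mult distrib_right)
  then show "\<exists>C. \<forall>s v t. \<bar>v\<bar> - C \<le> G s v t" by blast
next
  fix s v t a b e :: real
  have "((\<lambda>e. (s + e * a, v + e * b, t)) has_derivative (\<lambda>h. (h * a, h * b, 0))) (at e)"
    by (intro has_derivative_Pair has_derivative_const has_derivative_add_const has_derivative_mult_left has_derivative_ident
        has_derivative_add[OF has_derivative_const, simplified])
  from has_derivative_compose[OF this F_deriv]
  have d: "((\<lambda>e. F (s + e * a, v + e * b, t)) has_derivative (\<lambda>h. DF (h * a, h * b, 0) (s + e * a, v + e * b, t))) (at e)" .
  have "DF (h * a, h * b, 0) z = (DF (1, 0, 0) z * a + DF (0, 1, 0) z * b) * h" for h z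
  proof -
    have "(h * a, h * b, 0) = (h * a) *\<^sub>R (1, 0, 0) + (h * b) *\<^sub>R (0, 1, 0 :: real)" by simp
    then have "DF (h * a, h * b, 0) z = (h * a) * DF (1, 0, 0) z + (h * b) * DF (0, 1, 0) z"
      using linear_add[OF DF_linear, of "(h * a) *\<^sub>R (1, 0, 0)" "(h * b) *\<^sub>R (0, 1, 0)" z]
        linear_scale[OF DF_linear, of "h * a" "(1, 0, 0)" z] linear_scale[OF DF_linear, of "h * b" "(0, 1, 0)" z] by simp
    then show ?thesis by (simp add: algebra_simps)
  qed
  then have "(\<lambda>h. DF (h * a, h * b, 0) z) = (*) (DF (1, 0, 0) z * a + DF (0, 1, 0) z * b)" for z by blast
  then have "((\<lambda>e. F (s + e * a, v + e * b, t)) has_real_derivative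
      DF (1, 0, 0) (s + e * a, v + e * b, t) * a + DF (0, 1, 0) (s + e * a, v + e * b, t) * b) (at e)"
    using d by (simp only: has_field_derivative_def)
  moreover have "((\<lambda>e. r * (v + e * b)) has_real_derivative r * b) (at e)" by (auto intro!: derivative_eq_intros)
  ultimately have "((\<lambda>e. F (s + e * a, v + e * b, t) - r * (v + e * b)) has_real_derivative
      DF (1, 0, 0) (s + e * a, v + e * b, t) * a + DF (0, 1, 0) (s + e * a, v + e * b, t) * b - r * b) (at e)"
    by (rule DERIV_diff)
  then show "((\<lambda>e. G (s + e * a) (v + e * b) t) has_real_derivative
      Gs (s + e * a) (v + e * b) t * a + Gv (s + e * a) (v + e * b) t * b) (at e)"
    by (simp add: G_def Gs_def Gv_def algebra_simps)
next
  have c: "continuous_on UNIV (\<lambda>(t, p). \<phi> t p)" using \<phi> by (simp add: euler_lagrange_flow_def)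
  have "continuous_on UNIV (\<lambda>z::real \<times> real \<times> real \<times> real.
      (\<lambda>(t, p). \<phi> t p) (snd (snd (snd z)) - fst z, ((proj (fst (snd z)), fst (snd (snd z))), proj (fst z))))"
    by (intro continuous_on_compose2[OF c] continuous_intros continuous_on_compose2[OF proj_continuous[of UNIV]]) auto
  then show "continuous_on UNIV (\<lambda>(u, s, v, t). W u s v t)"
    unfolding W_def case_prod_unfold by (auto intro!: continuous_intros)
next
  fix u s v t :: real
  show "W (u + 1) s v (t + 1) = W u s v t" "W u (s + 1) v t = W u s v t"
    using proj_int[of u 1] proj_int[of s 1] by (simp_all add: W_def)
next
  fix x :: "real \<Rightarrow> real" and a b u t :: real
  assume ab: "a < b" and x: "x C1_differentiable_on {a..b}" and ut: "u \<in> {a..b}" "t \<in> {a..b}"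
    and ext: "\<And>h. \<lbrakk>h C1_differentiable_on {a..b}; h a = 0; h b = 0\<rbrakk> \<Longrightarrow>
        ((\<lambda>e. integral {a..b} (\<lambda>t. G (x t + e * h t) (deriv (\<lambda>t. x t + e * h t) t) t))
          has_real_derivative 0) (at 0)"
  have "extremal_on L x a b" by (rule extremal_of_critical[OF ab x ext])
  then have "\<phi> (t - u) (velocity x u, proj u) = (velocity x t, proj t)"
    using \<phi> ab x ut unfolding euler_lagrange_flow_def by blast
  then show "deriv x t = W u (x u) (deriv x u) t" by (simp add: W_def velocity_def)
qed

sublocale T: tonelli G Gs Gv W by (rule G_tonelli)

section \<open>The invariant torus\<close>

lemma minimizer_iff: "minimizer (minus_form L (const_form r)) x \<longleftrightarrow> x \<in> T.M"
proof -
  have "action (minus_form L (const_form r)) x a b = T.act x a b" for x a b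
    by (simp add: action_def T.act_def minus_form_def const_form_def velocity_def G_def F_def)
  then show ?thesis by (simp add: minimizer_def T.M_def proj_eq_iff)
qed

lemma orbit_of_minimizer:
  assumes x: "x \<in> T.M"
  shows "\<phi> s (velocity x t, proj t) = (velocity x (t + s), proj (t + s))"
proof -
  define a b where "a = min t (t + s) - 1" and "b = max t (t + s)"
  have ab: "a < b" "t \<in> {a..b}" "t + s \<in> {a..b}" by (auto simp: a_def b_def)
  have C1: "x C1_differentiable_on {a..b}" by (rule T.M_C1[OF x])
  have "extremal_on L x a b"
    by (rule extremal_of_critical[OF ab(1) C1]) (rule T.first_variation_minimizer(1)[OF x ab(1), unfolded T.act_def])
  then have "\<phi> (t + s - t) (velocity x t, proj t) = (velocity x (t + s), proj (t + s))"
    using \<phi> ab C1 unfolding euler_lagrange_flow_def by blast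
  then show ?thesis by simp
qed

text \<open>Points of \<open>G(c)\<close> lie on minimizers for various forms of the class of \<open>r dx\<close>; they all minimize for
\<open>r dx\<close> itself. Closeness on the torus becomes closeness in the plane after an integer
translation.\<close>

lemma minimizers_dense:
  assumes dense: "closure (G_base L \<phi> (form_class (const_form r))) = UNIV" and "e > 0"
  shows "\<exists>\<gamma>\<in>T.M. \<exists>s. \<bar>s - t\<bar> < e \<and> \<bar>\<gamma> s - x\<bar> < e"
proof -
  have "(proj x, proj t) \<in> closure (G_base L \<phi> (form_class (const_form r)))" using dense by simp
  then obtain q where q: "q \<in> G_base L \<phi> (form_class (const_form r))" "dist q (proj x, proj t) < e"
    using \<open>e > 0\<close> unfolding closure_approachable by blast
  obtain p where p: "p \<in> G_tilde L \<phi> (form_class (const_form r))" "q = base_point p" using q(1) by (auto simp: G_base_def)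
  obtain \<eta> y \<tau> where y: "closed_form_SS \<eta>" "form_class \<eta> = form_class (const_form r)" "minimizer (minus_form L \<eta>) y"
    "\<forall>t. \<phi> t p = (velocity y (t + \<tau>), proj (t + \<tau>))"
    using p(1) unfolding G_tilde_def by blast
  have "continuous_on UNIV (\<lambda>(s, v, t). L (proj s, v) t)" using F_cont[of UNIV] by (simp add: F_def)
  then have yM: "y \<in> T.M"
    using minimizer_depends_on_class[OF _ y(1) closed_const_form y(2,3)] minimizer_iff by simp
  have "\<phi> 0 p = p" using \<phi> unfolding euler_lagrange_flow_def by blast
  then have p_eq: "p = (velocity y \<tau>, proj \<tau>)" using y(4)[rule_format, of 0] by simp
  have "q = (proj (y \<tau>), proj \<tau>)" unfolding p(2) p_eq by (simp add: base_point_def velocity_def)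
  then have d: "dist (proj (y \<tau>)) (proj x) < e" "dist (proj \<tau>) (proj t) < e"
    using q(2) dist_fst_le[of q "(proj x, proj t)"] dist_snd_le[of q "(proj x, proj t)"] by auto
  obtain m where m: "m \<in> \<int>" "infdist (y \<tau> - x) \<int> = \<bar>y \<tau> - x - m\<bar>" using infdist_Ints_attained by blast
  obtain n where n: "n \<in> \<int>" "infdist (\<tau> - t) \<int> = \<bar>\<tau> - t - n\<bar>" using infdist_Ints_attained by blast
  obtain i j where ij: "m = of_int i" "n = of_int j" using m(1) n(1) by (elim Ints_cases)
  have "\<bar>(\<tau> - n) - t\<bar> < e" using d(2) n(2) by (simp add: dist_proj algebra_simps)
  moreover have "\<bar>shift (- i) j y (\<tau> - n) - x\<bar> < e" using d(1) m(2) ij by (simp add: dist_proj shift_def algebra_simps)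
  moreover have "shift (- i) j y \<in> T.M" by (rule T.shift_mem_M[OF yM])
  ultimately show ?thesis by blast
qed

text \<open>The velocity of the leaf through a point of the plane is periodic, since the foliation is invariant
under integer translations, and so defines the section \<open>\<sigma>\<close>. Orbits of the flow starting on its
image follow the leaves.\<close>

theorem invariant_torus:
  assumes dense: "closure (G_base L \<phi> (form_class (const_form r))) = UNIV"
  shows "\<exists>T\<subseteq>G_tilde L \<phi> (form_class (const_form r)). invariant_lipschitz_torus \<phi> T"
proof -
  obtain \<Phi> where \<Phi>: "\<Phi> \<subseteq> T.M" "\<forall>\<gamma>\<in>\<Phi>. \<forall>\<beta>\<in>\<Phi>. \<forall>s. \<gamma> s = \<beta> s \<longrightarrow> \<gamma> = \<beta>" "\<forall>\<gamma>\<in>\<Phi>. \<forall>m n. shift m n \<gamma> \<in> \<Phi>"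
      "\<forall>x t. \<exists>\<gamma>\<in>\<Phi>. \<gamma> t = x"
      "\<exists>K. \<forall>\<gamma>\<in>\<Phi>. \<forall>\<beta>\<in>\<Phi>. \<forall>t u. \<bar>deriv \<gamma> t - deriv \<beta> u\<bar> \<le> K * (\<bar>\<gamma> t - \<beta> u\<bar> + \<bar>t - u\<bar>)"
    by (rule exE[OF T.lipschitz_foliation[OF minimizers_dense[OF dense]]], assumption) (elim conjE)
  obtain K where K: "\<forall>\<gamma>\<in>\<Phi>. \<forall>\<beta>\<in>\<Phi>. \<forall>t u. \<bar>deriv \<gamma> t - deriv \<beta> u\<bar> \<le> K * (\<bar>\<gamma> t - \<beta> u\<bar> + \<bar>t - u\<bar>)"
    using \<Phi>(5) by (elim exE)
  define V where "V = (\<lambda>x t. deriv (SOME \<gamma>. \<gamma> \<in> \<Phi> \<and> \<gamma> t = x) t)"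
  have V: "V (\<gamma> t) t = deriv \<gamma> t" if "\<gamma> \<in> \<Phi>" for \<gamma> t
  proof -
    have "(SOME \<beta>. \<beta> \<in> \<Phi> \<and> \<beta> t = \<gamma> t) = \<gamma>" using that \<Phi>(2) by (intro some_equality) auto
    then show ?thesis by (simp add: V_def)
  qed
  define \<sigma> :: "circle \<times> circle \<Rightarrow> phase" where
    "\<sigma> = (\<lambda>(p, \<theta>). ((p, V (rep_circle p) (rep_circle \<theta>)), \<theta>))"
  have proj_rep: "proj (rep_circle p) = p" for p by (rule Quotient3_abs_rep[OF Quotient3_circle])
  have \<sigma>: "\<sigma> (proj (\<gamma> t), proj t) = (velocity \<gamma> t, proj t)" if \<gamma>: "\<gamma> \<in> \<Phi>" for \<gamma> t
  proof -
    have "rep_circle (proj (\<gamma> t)) - \<gamma> t \<in> \<int>" "rep_circle (proj t) - t \<in> \<int>"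
      using proj_rep[of "proj (\<gamma> t)"] proj_rep[of "proj t"] by (simp_all only: proj_eq_iff)
    then obtain i j where ij: "rep_circle (proj (\<gamma> t)) = \<gamma> t + of_int i" "rep_circle (proj t) = t + of_int j"
      by (elim Ints_cases) (metis add.commute diff_add_cancel)
    define \<beta> where "\<beta> = shift i (- j) \<gamma>"
    have \<beta>: "\<beta> \<in> \<Phi>" "\<beta> (t + of_int j) = \<gamma> t + of_int i" using \<gamma> \<Phi>(3) by (auto simp: \<beta>_def shift_def)
    have "deriv \<beta> (t + of_int j) = deriv \<gamma> t" unfolding \<beta>_def
      using T.shift_C1(2)[of \<gamma> "t + of_int j" "- j" "t + of_int j" "t + of_int j" i] T.M_C1 \<gamma> \<Phi>(1) by auto
    then have "V (\<gamma> t + of_int i) (t + of_int j) = deriv \<gamma> t" using V[OF \<beta>(1), of "t + of_int j"] \<beta>(2) by simp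
    then show ?thesis by (simp add: \<sigma>_def ij velocity_def)
  qed
  have lift: "\<exists>\<gamma>\<in>\<Phi>. \<gamma> t = x" for x t using \<Phi>(4) by blast
  have range\<sigma>: "\<exists>\<gamma>\<in>\<Phi>. \<exists>t. p = (velocity \<gamma> t, proj t)" if p: "p \<in> range \<sigma>" for p
  proof -
    obtain a b where ab: "p = \<sigma> (a, b)" using p by auto
    obtain x where x: "a = proj x" by (rule proj_cases)
    obtain t where t: "b = proj t" by (rule proj_cases)
    obtain \<gamma> where \<gamma>: "\<gamma> \<in> \<Phi>" "\<gamma> t = x" using lift by blast
    show ?thesis using \<sigma>[OF \<gamma>(1), of t] \<gamma> ab x t by auto
  qed
  have orbit: "\<phi> s (velocity \<gamma> t, proj t) = (velocity \<gamma> (t + s), proj (t + s))" if "\<gamma> \<in> \<Phi>" for \<gamma> s t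
    using that \<Phi>(1) by (intro orbit_of_minimizer) auto
  have "range \<sigma> \<subseteq> G_tilde L \<phi> (form_class (const_form r))"
  proof
    fix p assume "p \<in> range \<sigma>"
    then obtain \<gamma> t where \<gamma>: "\<gamma> \<in> \<Phi>" "p = (velocity \<gamma> t, proj t)" using range\<sigma> by blast
    have "minimizer (minus_form L (const_form r)) \<gamma>" using \<gamma>(1) \<Phi>(1) minimizer_iff by blast
    moreover have "\<forall>s. \<phi> s p = (velocity \<gamma> (s + t), proj (s + t))" using orbit[OF \<gamma>(1)] \<gamma>(2) by (simp add: add.commute)
    ultimately show "p \<in> G_tilde L \<phi> (form_class (const_form r))"
      unfolding G_tilde_def using closed_const_form by blast
  qed
  moreover have "invariant_lipschitz_torus \<phi> (range \<sigma>)"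
    unfolding invariant_lipschitz_torus_def
  proof (intro conjI allI exI[of _ \<sigma>] exI[of _ "2 * (1 + \<bar>K\<bar>)"] refl)
    have sub: "\<phi> s ` range \<sigma> \<subseteq> range \<sigma>" for s
    proof
      fix q assume "q \<in> \<phi> s ` range \<sigma>"
      then obtain p where p: "p \<in> range \<sigma>" "q = \<phi> s p" by blast
      obtain \<gamma> t where \<gamma>: "\<gamma> \<in> \<Phi>" "p = (velocity \<gamma> t, proj t)" using range\<sigma>[OF p(1)] by blast
      have "q = \<sigma> (proj (\<gamma> (t + s)), proj (t + s))" using orbit[OF \<gamma>(1)] \<sigma>[OF \<gamma>(1)] p(2) \<gamma>(2) by simp
      then show "q \<in> range \<sigma>" by blast
    qed
    show "\<phi> s ` range \<sigma> = range \<sigma>" for s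
    proof (rule equalityI[OF sub subsetI])
      fix p assume "p \<in> range \<sigma>"
      then have "\<phi> (- s) p \<in> range \<sigma>" using sub[of "- s"] by blast
      moreover have "\<phi> s (\<phi> (- s) p) = p"
      proof -
        have "\<phi> (s + - s) p = \<phi> s (\<phi> (- s) p)" "\<phi> 0 p = p"
          using \<phi> unfolding euler_lagrange_flow_def by blast+
        then show ?thesis by simp
      qed
      ultimately show "p \<in> \<phi> s ` range \<sigma>" by (intro image_eqI[of p "\<phi> s" "\<phi> (- s) p"]) simp_all
    qed
    show "base_point (\<sigma> q) = q" for q by (cases q) (simp add: \<sigma>_def base_point_def)
    show "(2 * (1 + \<bar>K\<bar>))-lipschitz_on UNIV \<sigma>"
    proof (rule lipschitz_onI)
      fix q q' :: "circle \<times> circle"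
      obtain p' \<theta>' p \<theta> where q: "q = (p, \<theta>)" "q' = (p', \<theta>')" by (cases q, cases q') blast
      obtain x' where x': "p' = proj x'" by (rule proj_cases)
      obtain t' where t': "\<theta>' = proj t'" by (rule proj_cases)
      obtain x where x: "proj x = p" "dist p p' = \<bar>x - x'\<bar>" using dist_proj_attained[of p x'] x' by blast
      obtain t where t: "proj t = \<theta>" "dist \<theta> \<theta>' = \<bar>t - t'\<bar>" using dist_proj_attained[of \<theta> t'] t' by blast
      obtain \<gamma> where \<gamma>: "\<gamma> \<in> \<Phi>" "\<gamma> t = x" using lift by blast
      obtain \<beta> where \<beta>: "\<beta> \<in> \<Phi>" "\<beta> t' = x'" using lift by blast
      let ?D = "\<bar>x - x'\<bar> + \<bar>t - t'\<bar>"
      have "\<bar>deriv \<gamma> t - deriv \<beta> t'\<bar> \<le> K * ?D" using K \<gamma> \<beta> by blast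
      also have "\<dots> \<le> \<bar>K\<bar> * ?D" by (intro mult_right_mono) auto
      finally have v: "\<bar>deriv \<gamma> t - deriv \<beta> t'\<bar> \<le> \<bar>K\<bar> * ?D" .
      have "\<sigma> q = ((p, deriv \<gamma> t), \<theta>)" "\<sigma> q' = ((p', deriv \<beta> t'), \<theta>')"
        using \<sigma>[OF \<gamma>(1), of t] \<sigma>[OF \<beta>(1), of t'] \<gamma>(2) \<beta>(2) x t x' t' by (simp_all add: q velocity_def)
      then have "dist (\<sigma> q) (\<sigma> q') \<le> dist (p, deriv \<gamma> t) (p', deriv \<beta> t') + dist \<theta> \<theta>'"
        by (simp add: dist_Pair_Pair[of "(p, deriv \<gamma> t)"] sqrt_sum_squares_le_sum)
      also have "dist (p, deriv \<gamma> t) (p', deriv \<beta> t') \<le> dist p p' + dist (deriv \<gamma> t) (deriv \<beta> t')"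
        by (simp add: dist_Pair_Pair sqrt_sum_squares_le_sum)
      finally have "dist (\<sigma> q) (\<sigma> q') \<le> (1 + \<bar>K\<bar>) * ?D"
        using v x(2) t(2) by (simp add: dist_real_def distrib_right)
      also have "?D \<le> 2 * dist q q'"
        using dist_fst_le[of q q'] dist_snd_le[of q q'] x(2) t(2) by (simp add: q)
      then have "(1 + \<bar>K\<bar>) * ?D \<le> (1 + \<bar>K\<bar>) * (2 * dist q q')" by (intro mult_left_mono) auto
      finally show "dist (\<sigma> q) (\<sigma> q') \<le> 2 * (1 + \<bar>K\<bar>) * dist q q'" by (simp add: algebra_simps)
    qed simp
  qed
  ultimately show ?thesis by blast
qed

end

theorem theorem5p2:
  fixes g :: "circle \<Rightarrow> real"
    and L :: lagrangian
    and \<phi> :: "real \<Rightarrow> phase \<Rightarrow> phase"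
    and c :: "(circle \<Rightarrow> real) set"
  assumes "riemannian_metric g"
    and "admissible_lagrangian g L"
    and "euler_lagrange_flow L \<phi>"
    and "c \<in> H1"
  shows "(\<exists>T. T \<subseteq> G_tilde L \<phi> c \<and> invariant_lipschitz_torus \<phi> T) \<or> R_set L \<phi> c = H1"
proof (cases "closure (G_base L \<phi> c) = UNIV")
  case True
  obtain r where r: "form_class (const_form r) = c" using class_of_const_form[OF assms(4)] by blast
  interpret lagrangian_system g L \<phi> r by (rule lagrangian_system.intro[OF assms(1-3)])
  show ?thesis using invariant_torus True unfolding r by blast
next
  case False
  then show ?thesis using R_set_eq_H1 by blast
qed

end
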